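(* Let $\mathcal M,\mathcal N\subset\mathbb R^2$ be closures of bounded connected open sets with Lipschitz boundaries, and suppose that $1/4<V_{\mathcal N}/V_{\mathcal M}\le1$. Let $\phi_n\in\operatorname{Lip}_+^{\mathrm{inj}}(\mathcal M,\mathcal N)$ be a sequence with $E_2(\phi_n)\to F(V_{\mathcal N}/V_{\mathcal M})$. Then $\phi_n$ has a subsequence converging strongly in $W^{1,2}(\mathcal M,\mathcal N)$ to a smooth surjective homothety $\phi\in\operatorname{Lip}_+^{\mathrm{inj}}(\mathcal M,\mathcal N)$ with Jacobian $J\phi=V_{\mathcal N}/V_{\mathcal M}$, which is injective on the interior $\mathcal M^\circ$ and satisfies $\phi(\mathcal M^\circ)\subseteq\mathcal N^\circ$. If moreover $\phi_n(\partial\mathcal M)\subset\partial\mathcal N$ for all $n$, then $\phi$ is injective on $\mathcal M$, and if in addition $\partial\mathcal M,\partial\mathcal N$ are smooth, then $\phi$ is smooth up to the boundary and is a bijective diffeomorphic homothety.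
   Context: Both domains carry the Euclidean metric and standard orientation; $V_X$ is the area of $X$; $X^\circ$ its interior. $\operatorname{Lip}_+^{\mathrm{inj}}(\mathcal M,\mathcal N)$ is the set of Lipschitz maps $\phi:\mathcal M\to\mathcal N$ with Jacobian $J\phi=\det d\phi\ge0$ a.e. and $|\phi^{-1}(q)|\le1$ for a.e. $q\in\mathcal N$. With $\operatorname{dist}$ the Frobenius distance on $2\times2$ matrices, $E_2(\phi)=\frac1{V_{\mathcal M}}\int_{\mathcal M}\operatorname{dist}^2(d\phi,\operatorname{SO}_2)\,dx$. $F:[0,\infty)\to\mathbb R$ is $F(s)=1-2s$ for $0\le s\le\frac14$, $F(s)=2(\sqrt s-1)^2$ for $s\ge\frac14$. A map $\phi$ is a homothety if $\langle d\phi_x(v),d\phi_x(w)\rangle=\lambda^2\langle v,w\rangle$ for all $x,v,w$, for some constant $\lambda>0$. *)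

theory Defs
  imports "HOL-Analysis.Analysis"
begin

subsection \<open>Smooth maps\<close>

text \<open>Meaningful for open \<open>S\<close>: all iterated directional derivatives of order at most \<open>k\<close> exist,
  with those of order less than \<open>k\<close> Frechet differentiable and those of order \<open>k\<close> continuous.\<close>

primrec Ck_on_open ::
  "nat \<Rightarrow> 'a::euclidean_space set \<Rightarrow> ('a \<Rightarrow> 'b::real_normed_vector) \<Rightarrow> bool" where
  "Ck_on_open 0 S f \<longleftrightarrow> continuous_on S f"
| "Ck_on_open (Suc k) S f \<longleftrightarrow>
     (\<forall>x\<in>S. f differentiable (at x)) \<and>
     (\<forall>v. Ck_on_open k S (\<lambda>x. frechet_derivative f (at x) v))"

text \<open>Smoothness on an arbitrary subset of Euclidean space is existence of local smooth extensions.
  On an open set this is ordinary smoothness; on a closed domain it is smoothness up to the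
  boundary.\<close>

definition smooth_on ::
  "'a::euclidean_space set \<Rightarrow> ('a \<Rightarrow> 'b::real_normed_vector) \<Rightarrow> bool" where
  "smooth_on S f \<longleftrightarrow>
     (\<forall>x\<in>S. \<exists>W g. open W \<and> x \<in> W \<and> (\<forall>k. Ck_on_open k W g) \<and> (\<forall>y\<in>W \<inter> S. g y = f y))"

definition diffeomorphism_betw ::
  "('a::euclidean_space \<Rightarrow> 'b::euclidean_space) \<Rightarrow> 'a set \<Rightarrow> 'b set \<Rightarrow> bool" where
  "diffeomorphism_betw f S T \<longleftrightarrow>
     bij_betw f S T \<and> smooth_on S f \<and> smooth_on T (inv_into S f)"


subsection \<open>Regularity of the boundary of a planar open set\<close>

text \<open>Near each boundary point, in suitable Cartesian coordinates, \<open>U\<close> is the region strictly above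
  the graph of a function in the class \<open>P\<close>; in particular \<open>U\<close> lies locally on one side of its
  boundary.\<close>

definition boundary_of_class :: "((real \<Rightarrow> real) \<Rightarrow> bool) \<Rightarrow> (real^2) set \<Rightarrow> bool" where
  "boundary_of_class P U \<longleftrightarrow>
     (\<forall>p\<in>frontier U. \<exists>(T :: real^2 \<Rightarrow> real^2) g W. orthogonal_transformation T \<and> P g \<and> open W \<and> p \<in> W \<and>
        U \<inter> W = {x \<in> W. g (T x $ 1) < T x $ 2})"

definition lipschitz_boundary :: "(real^2) set \<Rightarrow> bool" where
  "lipschitz_boundary U \<longleftrightarrow> boundary_of_class (\<lambda>g. \<exists>L. L-lipschitz_on UNIV g) U"

definition smooth_boundary :: "(real^2) set \<Rightarrow> bool" where
  "smooth_boundary U \<longleftrightarrow> boundary_of_class (smooth_on UNIV) U"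

definition lipschitz_domain :: "(real^2) set \<Rightarrow> bool" where
  "lipschitz_domain U \<longleftrightarrow> open U \<and> bounded U \<and> connected U \<and> lipschitz_boundary U"

abbreviation area :: "(real^2) set \<Rightarrow> real" where
  "area S \<equiv> measure lebesgue S"


subsection \<open>Differential, Jacobian, elastic energy\<close>

text \<open>The matrix of \<open>d\<phi>\<^sub>x\<close>. The value is unspecified where \<open>\<phi>\<close> is not differentiable, which for a
  Lipschitz map is a null set by Rademacher's theorem. At interior points of \<open>M\<close> the derivative is
  the full one; at boundary points it is taken within \<open>M\<close>.\<close>

definition differential ::
  "(real^2) set \<Rightarrow> (real^2 \<Rightarrow> real^2) \<Rightarrow> real^2 \<Rightarrow> real^2^2" where
  "differential M \<phi> x = matrix (frechet_derivative \<phi> (at x within M))"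

definition jacobian_det :: "(real^2) set \<Rightarrow> (real^2 \<Rightarrow> real^2) \<Rightarrow> real^2 \<Rightarrow> real" where
  "jacobian_det M \<phi> x = det (differential M \<phi> x)"

definition Lip_plus_inj ::
  "(real^2) set \<Rightarrow> (real^2) set \<Rightarrow> (real^2 \<Rightarrow> real^2) set" where
  "Lip_plus_inj M N = {\<phi>. \<phi> ` M \<subseteq> N \<and> (\<exists>L. L-lipschitz_on M \<phi>) \<and>
     (AE x in lebesgue_on M. 0 \<le> jacobian_det M \<phi> x) \<and>
     (AE q in lebesgue_on N. \<exists>\<^sub>\<le>\<^sub>1x. x \<in> M \<and> \<phi> x = q)}"

text \<open>The norm of \<^typ>\<open>real^2^2\<close> is the Frobenius norm, so \<^const>\<open>infdist\<close> is the Frobenius distance.\<close>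

definition E2 :: "(real^2) set \<Rightarrow> (real^2 \<Rightarrow> real^2) \<Rightarrow> real" where
  "E2 M \<phi> = 1 / area M *
     (LINT x|lebesgue_on M. (infdist (differential M \<phi> x) {A. rotation_matrix A})\<^sup>2)"

text \<open>Only arguments \<open>s \<ge> 0\<close> are relevant.\<close>

definition F :: "real \<Rightarrow> real" where
  "F s = (if s \<le> 1 / 4 then 1 - 2 * s else 2 * (sqrt s - 1)\<^sup>2)"

definition homothety_on :: "(real^2) set \<Rightarrow> (real^2 \<Rightarrow> real^2) \<Rightarrow> bool" where
  "homothety_on M \<phi> \<longleftrightarrow>
     (\<exists>c>0. \<forall>x\<in>M. \<phi> differentiable (at x within M) \<and>
        (\<forall>v w. (differential M \<phi> x *v v) \<bullet> (differential M \<phi> x *v w) = c\<^sup>2 * (v \<bullet> w)))"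


subsection \<open>The Sobolev space \<open>W\<^sup>1\<^sup>,\<^sup>2\<close>\<close>

definition test_function :: "(real^2) set \<Rightarrow> (real^2 \<Rightarrow> real) \<Rightarrow> bool" where
  "test_function U \<eta> \<longleftrightarrow>
     smooth_on UNIV \<eta> \<and> compact (closure {x. \<eta> x \<noteq> 0}) \<and> closure {x. \<eta> x \<noteq> 0} \<subseteq> U"

definition square_integrable_on ::
  "(real^2) set \<Rightarrow> (real^2 \<Rightarrow> 'b::euclidean_space) \<Rightarrow> bool" where
  "square_integrable_on U f \<longleftrightarrow>
     f \<in> borel_measurable (lebesgue_on U) \<and> integrable (lebesgue_on U) (\<lambda>x. (norm (f x))\<^sup>2)"

text \<open>\<open>G\<close> is a square integrable weak derivative of \<open>f\<close> on the open set \<open>U\<close>; the entry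
  \<open>G x $ i $ j\<close> is the weak partial derivative of the component \<open>i\<close> in the direction \<open>j\<close>.\<close>

definition L2_weak_derivative ::
  "(real^2) set \<Rightarrow> (real^2 \<Rightarrow> real^2) \<Rightarrow> (real^2 \<Rightarrow> real^2^2) \<Rightarrow> bool" where
  "L2_weak_derivative U f G \<longleftrightarrow> square_integrable_on U G \<and>
     (\<forall>\<eta> i j. test_function U \<eta> \<longrightarrow>
        (LINT x|lebesgue_on U. f x $ i * frechet_derivative \<eta> (at x) (axis j 1)) =
        - (LINT x|lebesgue_on U. G x $ i $ j * \<eta> x))"

definition W12 :: "(real^2) set \<Rightarrow> (real^2 \<Rightarrow> real^2) set" where
  "W12 U = {f. square_integrable_on U f \<and> (\<exists>G. L2_weak_derivative U f G)}"

text \<open>The choice of \<open>G\<close> is immaterial, as weak derivatives are unique almost everywhere.\<close>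

definition W12_norm :: "(real^2) set \<Rightarrow> (real^2 \<Rightarrow> real^2) \<Rightarrow> real" where
  "W12_norm U f = (let G = (SOME G. L2_weak_derivative U f G) in
     sqrt ((LINT x|lebesgue_on U. (norm (f x))\<^sup>2) + (LINT x|lebesgue_on U. (norm (G x))\<^sup>2)))"

text \<open>Maps between closed domains: the Sobolev space is that of the interior of the source.\<close>

definition W12_maps :: "(real^2) set \<Rightarrow> (real^2) set \<Rightarrow> (real^2 \<Rightarrow> real^2) set" where
  "W12_maps M N = {f \<in> W12 (interior M). AE x in lebesgue_on M. f x \<in> N}"

definition converges_strongly_W12 ::
  "(real^2) set \<Rightarrow> (real^2) set \<Rightarrow> (nat \<Rightarrow> real^2 \<Rightarrow> real^2) \<Rightarrow> (real^2 \<Rightarrow> real^2) \<Rightarrow> bool" where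
  "converges_strongly_W12 M N f g \<longleftrightarrow>
     (\<forall>n. f n \<in> W12_maps M N) \<and> g \<in> W12_maps M N \<and>
     (\<lambda>n. W12_norm (interior M) (\<lambda>x. f n x - g x)) \<longlonglongrightarrow> 0"

end

theory Submission
  imports Defs "HOL-Computational_Algebra.Polynomial"
begin

text \<open>For a planar map \<open>\<phi>\<close> the energy density and the Jacobian are expressed by the Wirtinger
  derivatives: \<open>dist\<^sup>2(d\<phi>, SO(2)) = 2 (\<bar>dz\<bar> - 1)\<^sup>2 + 2 \<bar>dzbar\<bar>\<^sup>2\<close> and \<open>J\<phi> = \<bar>dz\<bar>\<^sup>2 - \<bar>dzbar\<bar>\<^sup>2\<close>. Almost injectivity
  bounds \<open>\<integral>J\<phi>\<close> by the area of \<open>N\<close>, so with \<open>c\<^sup>2 = area N / area M\<close> the difference of the energy and its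
  infimum controls the integrals of \<open>\<bar>dzbar\<bar>\<^sup>2\<close> and \<open>(\<bar>dz\<bar> - c)\<^sup>2\<close>; this uses \<open>c > 1 / 2\<close>. Along a minimizing sequence
  both tend to \<open>0\<close>.

  A map with small \<open>dzbar\<close> is close to its averages over small discs by the Cauchy-Pompeiu formula, and by
  the Caccioppoli inequality the same holds for its derivative \<open>dz\<close>. As the modulus of \<open>dz\<close> is almost constant,
  its local variance tends to \<open>0\<close>, so \<open>dz\<close> is locally almost constant. Since the domain is
  connected, a subsequence converges strongly in \<open>W\<^sup>1\<^sup>,\<^sup>2\<close> to an affine similarity of ratio \<open>c\<close>.

  The similarity maps \<open>M\<close> into \<open>N\<close> because \<open>N\<close> is closed, and onto \<open>N\<close> because the image of
  \<open>M\<close> has the area of \<open>N\<close>. Being the restriction of a similarity of the plane, the limit is injective on \<open>M\<close> and smooth up to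
  the boundary.\<close>

subsection \<open>Smooth bump functions\<close>

text \<open>The Lipschitz constants may blow up along the sequence, so no estimate may contain them:
  Lipschitz continuity acts only qualitatively, giving derivatives almost everywhere and justifying
  integration by parts for each fixed map. Convergence comes from \<open>L^2\<close> bounds whose
  constants depend on a radius alone. The admissible ratios come from the tangent line to
  \<open>2 (sqrt s - 1)^2\<close> at \<open>s = c\<^sup>2\<close>, of slope
  \<open>2 - 2 / c\<close>. For \<open>c \<le> 1\<close> the slope is nonpositive, so an upper bound
  on the Jacobian integral bounds the energy from below; for \<open>c > 1 / 2\<close> the
  coefficient \<open>4 - 2 / c\<close> of the squared \<open>dzbar\<close> in the remaining excess
  is positive. No local estimate is uniform up to the boundary. Limits are matched on overlapping
  balls, and the boundary layer is absorbed because the integrands are dominated by a constant plus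
  a sequence tending to 0 in \<open>L^1\<close>. The Lipschitz boundary contributes two facts: it is
  a null set, and it determines derivatives within the closed domain at frontier points.\<close>

lemma Ck_on_open_const: "Ck_on_open k S (\<lambda>x. c)"
  by (induction k arbitrary: c) (auto simp: frechet_derivative_const)

lemma Ck_on_open_Suc_imp: "Ck_on_open (Suc k) S f \<Longrightarrow> Ck_on_open k S f"
proof (induction k arbitrary: f)
  case 0
  then show ?case
    by (auto intro!: continuous_at_imp_continuous_on differentiable_imp_continuous_within)
next
  case (Suc k)
  then show ?case by (metis Ck_on_open.simps(2))
qed

lemma Ck_on_open_add:
  "Ck_on_open k UNIV f \<Longrightarrow> Ck_on_open k UNIV g \<Longrightarrow> Ck_on_open k UNIV (\<lambda>x. f x + g x)"
proof (induction k arbitrary: f g)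
  case (Suc k)
  then have d: "f differentiable (at x)" "g differentiable (at x)" for x by auto
  have "frechet_derivative (\<lambda>x. f x + g x) (at x) v
      = frechet_derivative f (at x) v + frechet_derivative g (at x) v" for x v
    using frechet_derivative_at[OF has_derivative_add[OF
          frechet_derivative_works[THEN iffD1, OF d(1)] frechet_derivative_works[THEN iffD1, OF
            d(2)]]] by metis
  then show ?case using Suc d by (auto intro!: differentiable_add)
qed (auto intro: continuous_on_add)

lemma Ck_on_open_mult:
  fixes f g :: "'a::euclidean_space \<Rightarrow> real"
  shows "Ck_on_open k UNIV f \<Longrightarrow> Ck_on_open k UNIV g \<Longrightarrow> Ck_on_open k UNIV (\<lambda>x. f x * g x)"
proof (induction k arbitrary: f g)
  case (Suc k)
  then have d: "f differentiable (at x)" "g differentiable (at x)" for x by auto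
  have eq: "frechet_derivative (\<lambda>x. f x * g x) (at x) v
      = f x * frechet_derivative g (at x) v + frechet_derivative f (at x) v * g x" for x v
    using frechet_derivative_at[OF has_derivative_mult[OF
          frechet_derivative_works[THEN iffD1, OF d(1)] frechet_derivative_works[THEN iffD1, OF
            d(2)]]] by metis
  show ?case
    unfolding Ck_on_open.simps(2) eq
  proof (intro conjI ballI allI differentiable_mult d Ck_on_open_add)
    show "Ck_on_open k UNIV (\<lambda>x. f x * frechet_derivative g (at x) v)" for v
      using Suc.prems by (intro Suc.IH Ck_on_open_Suc_imp[of k _ f]) simp_all
    show "Ck_on_open k UNIV (\<lambda>x. frechet_derivative f (at x) v * g x)" for v
      using Suc.prems by (intro Suc.IH Ck_on_open_Suc_imp[of k _ g]) simp_all
  qed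
qed (auto intro: continuous_on_mult)

lemma Ck_on_open_prod:
  fixes f :: "'i \<Rightarrow> 'a::euclidean_space \<Rightarrow> real"
  assumes "finite I" "\<And>i. i \<in> I \<Longrightarrow> Ck_on_open k UNIV (f i)"
  shows "Ck_on_open k UNIV (\<lambda>x. \<Prod>i\<in>I. f i x)"
  using assms by (induction I rule: finite_induct) (auto intro!: Ck_on_open_const Ck_on_open_mult)

text \<open>With \<open>p = 1\<close> this is the classical flat function exp(-1/t), extended by 0.
  The polynomial factor makes the family closed under differentiation, so one induction over the
  order, for all \<open>p\<close> at once, gives smoothness.\<close>

definition exp_inv :: "real poly \<Rightarrow> real \<Rightarrow> real" where
  "exp_inv p t = (if t > 0 then poly p (1 / t) * exp (- (1 / t)) else 0)"

text \<open>The factor \<open>y ^ k\<close> strengthens the induction over the coefficients of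
  \<open>p\<close>: splitting off the constant coefficient leaves the shorter polynomial times
  \<open>y\<close>, hence the same claim with \<open>Suc k\<close>.\<close>

lemma poly_exp_tendsto_0: "((\<lambda>y::real. y ^ k * poly p y * exp (- y)) \<longlongrightarrow> 0) at_top"
proof (induction p arbitrary: k)
  case (pCons a p)
  have "((\<lambda>y::real. a * (y ^ k / exp y) + y ^ Suc k * poly p y * exp (- y)) \<longlongrightarrow> a * 0 + 0) at_top"
    by (intro tendsto_intros tendsto_power_div_exp_0 pCons.IH)
  then show ?case by (simp add: algebra_simps exp_minus divide_inverse)
qed simp

text \<open>The chain rule produces the factor 1/t^2, which \<open>[:0, 0, 1:]\<close> encodes as
  the square of 1/t. At 0 the left quotient vanishes, and the right one becomes, with y = 1/h, a
  polynomial in y times exp(-y).\<close>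

lemma exp_inv_deriv: "(exp_inv p has_real_derivative exp_inv ([:0, 0, 1:] * (p
  - pderiv p)) t) (at t)"
proof -
  let ?q = "[:0, 0, 1:] * (p - pderiv p)"
  consider "t < 0" | "t = 0" | "t > 0" by linarith
  then show ?thesis
  proof cases
    case 1
    have "((\<lambda>x. 0) has_real_derivative exp_inv ?q t) (at t)" using 1 by (simp add: exp_inv_def)
    then show ?thesis
      by (rule has_field_derivative_transform_within_open[of _ _ _ "{..<0}"]) (use 1 in \<open>auto
        simp: exp_inv_def\<close>)
  next
    case 3
    have "((\<lambda>x. poly p (1/x) * exp (-(1/x))) has_real_derivative exp_inv ?q t) (at t)"
      using 3 by (auto intro!: derivative_eq_intros poly_DERIV[THEN DERIV_chain2]
          simp: exp_inv_def field_simps power2_eq_square)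
    then show ?thesis
      by (rule has_field_derivative_transform_within_open[of _ _ _ "{0<..}"]) (use 3 in \<open>auto
        simp: exp_inv_def\<close>)
  next
    case 2
    have r: "((\<lambda>h. (exp_inv p (0 + h) - exp_inv p 0) / h) \<longlongrightarrow> 0) (at_right 0)"
    proof -
      have "((\<lambda>h. inverse h ^ 1 * poly p (inverse h) * exp (- inverse h)) \<longlongrightarrow> 0) (at_right (0::real))"
        by (rule filterlim_compose[OF poly_exp_tendsto_0 filterlim_inverse_at_top_right])
      moreover have "eventually (\<lambda>h. inverse h ^ 1 * poly p (inverse h) * exp (- inverse h)
           = (exp_inv p (0 + h) - exp_inv p 0) / h) (at_right (0::real))"
        by (rule eventually_mono[OF eventually_at_right_less[of 0]])
          (auto simp: exp_inv_def divide_inverse ac_simps)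
      ultimately show ?thesis by (rule Lim_transform_eventually)
    qed
    have l: "((\<lambda>h. (exp_inv p (0 + h) - exp_inv p 0) / h) \<longlongrightarrow> 0) (at_left 0)"
      by (rule tendsto_eventually) (auto simp: eventually_at_filter exp_inv_def)
    show ?thesis using filterlim_split_at[OF l r] 2 by (simp add: DERIV_def exp_inv_def)
  qed
qed

lemma Ck_on_open_exp_inv:
  fixes l :: "'a::euclidean_space \<Rightarrow> real"
  assumes l: "bounded_linear l"
  shows "Ck_on_open k UNIV (\<lambda>x. exp_inv p (l x + c))"
proof (induction k arbitrary: p)
  case 0
  have "continuous_on UNIV (exp_inv p)"
    using exp_inv_deriv by (meson DERIV_isCont continuous_at_imp_continuous_on)
  then have "continuous_on UNIV (exp_inv p \<circ> (\<lambda>x. l x + c))"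
    by (intro continuous_on_compose continuous_intros linear_continuous_on[OF l])
      (auto intro: continuous_on_subset)
  then show ?case by (simp add: o_def)
next
  case (Suc k)
  let ?q = "[:0, 0, 1:] * (p - pderiv p)"
  have D: "((\<lambda>x. exp_inv p (l x + c)) has_derivative (\<lambda>v. l v * exp_inv ?q (l x + c))) (at x)" for x
  proof -
    have "((\<lambda>x. l x + c) has_derivative l) (at x)"
      using has_derivative_add[OF bounded_linear_imp_has_derivative[OF l] has_derivative_const[of
        c]] by simp
    from DERIV_compose_FDERIV[OF exp_inv_deriv this] show ?thesis by (simp add: mult.commute)
  qed
  have eq: "frechet_derivative (\<lambda>x. exp_inv p (l x + c)) (at x) v = l v * exp_inv ?q (l x + c)"
    for x v
    using frechet_derivative_at[OF D, of x] by metis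
  show ?case
    using D by (auto simp: eq differentiable_def simp
      del: mult_pCons_left intro!: Ck_on_open_mult Ck_on_open_const Suc.IH)
qed

text \<open>The parameter \<open>r\<close> is a steepness: for \<open>r > 0\<close> the set of
  nonzero values stays \<open>box a b\<close>, while the values there tend to 1 as \<open>r\<close>
  grows. Smooth test functions thus approximate the indicator of an open box.\<close>

definition box_bump :: "'a::euclidean_space \<Rightarrow> 'a \<Rightarrow> real \<Rightarrow> 'a \<Rightarrow> real" where
  "box_bump a b r x = (\<Prod>i\<in>Basis. exp_inv 1 (r * ((x - a) \<bullet> i)) * exp_inv 1 (r * ((b - x) \<bullet> i)))"

lemma exp_inv_1_bounds: "0 \<le> exp_inv 1 t" "exp_inv 1 t \<le> 1" "exp_inv 1 t \<noteq> 0 \<longleftrightarrow> t > 0"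
  by (auto simp: exp_inv_def)

lemma box_bump_bounds: "0 \<le> box_bump a b r x" "box_bump a b r x \<le> 1"
  by (auto simp: box_bump_def intro!: prod_nonneg prod_le_1 mult_le_one exp_inv_1_bounds
    mult_nonneg_nonneg)

lemma box_bump_nonzero: "r > 0 \<Longrightarrow> box_bump a b r x \<noteq> 0 \<longleftrightarrow> x \<in> box a b"
  by (auto simp: box_bump_def exp_inv_1_bounds(3) mem_box zero_less_mult_iff inner_diff_left)

lemma box_bump_Ck: "Ck_on_open k UNIV (box_bump a b r)"
proof -
  have 1: "Ck_on_open k UNIV (\<lambda>x. exp_inv 1 (r * ((x - a) \<bullet> i)))" for i
    using Ck_on_open_exp_inv[of "\<lambda>x. r * (x \<bullet> i)" k 1 "- r * (a \<bullet> i)"]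
      bounded_linear_const_mult[OF bounded_linear_inner_left, of r i]
    by (simp add: inner_diff_left algebra_simps)
  have 2: "Ck_on_open k UNIV (\<lambda>x. exp_inv 1 (r * ((b - x) \<bullet> i)))" for i
    using Ck_on_open_exp_inv[of "\<lambda>x. - r * (x \<bullet> i)" k 1 "r * (b \<bullet> i)"]
      bounded_linear_const_mult[OF bounded_linear_inner_left, of "- r" i]
    by (simp add: inner_diff_left algebra_simps)
  show ?thesis unfolding box_bump_def
    by (intro Ck_on_open_prod Ck_on_open_mult 1 2) auto
qed

lemma box_bump_tendsto:
  "(\<lambda>n. box_bump a b (real (Suc n)) x) \<longlonglongrightarrow> indicator (box a b) x"
proof (cases "x \<in> box a b")
  case False
  then show ?thesis using box_bump_nonzero[of "real (Suc n)" a b x for n] by simp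
next
  case True
  have e: "(\<lambda>n. exp_inv 1 (real (Suc n) * c)) \<longlonglongrightarrow> 1" if "c > 0" for c
  proof -
    have "(\<lambda>n. exp (- ((1 / c) * inverse (real (Suc n))))) \<longlonglongrightarrow> exp (- ((1 / c) * 0))"
      by (intro tendsto_intros LIMSEQ_inverse_real_of_nat)
    then show ?thesis using that by (simp add: exp_inv_def divide_inverse mult.commute)
  qed
  have "(\<lambda>n. \<Prod>i\<in>Basis. exp_inv 1 (real (Suc n) * ((x - a) \<bullet> i)) * exp_inv 1 (real (Suc n) * ((b
    - x) \<bullet> i)))
     \<longlonglongrightarrow> (\<Prod>i\<in>(Basis::'a set). 1 * 1)"
    using True by (intro tendsto_prod tendsto_mult e) (auto simp: mem_box inner_diff_left)
  then show ?thesis using True by (simp add: box_bump_def)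
qed

text \<open>The derivative is continuous on the compact closure of the support and zero outside,
  hence bounded. This qualifies smooth test functions as partners in integration by parts, which is
  set up for Lipschitz functions.\<close>

lemma C1_compact_support_lipschitz:
  fixes f :: "'a::euclidean_space \<Rightarrow> real"
  assumes C1: "Ck_on_open 1 UNIV f" and bd: "bounded {x. f x \<noteq> 0}"
  shows "\<exists>L. L-lipschitz_on UNIV f"
proof -
  define K where "K = closure {x. f x \<noteq> 0}"
  have K: "compact K" using bd by (simp add: K_def)
  let ?D = "\<lambda>x. frechet_derivative f (at x)"
  have d: "(f has_derivative ?D x) (at x)" for x
    using C1 by (auto simp: frechet_derivative_works[symmetric])
  have c: "continuous_on UNIV (\<lambda>x. ?D x v)" for v using C1 by auto
  have z: "?D x = (\<lambda>v. 0)" if "x \<notin> K" for x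
  proof -
    have "open (- K)" using K by (simp add: compact_imp_closed open_Compl)
    then have "(f has_derivative (\<lambda>v. 0)) (at x)"
      using that by (intro has_derivative_transform_within_open[of "\<lambda>x. 0" _ x UNIV "-K" f])
        (auto simp: K_def intro: closure_subset[THEN subsetD])
    then show ?thesis using d has_derivative_unique by blast
  qed
  have "\<exists>B. \<forall>x. \<bar>?D x v\<bar> \<le> B" for v
  proof -
    have "bounded ((\<lambda>x. ?D x v) ` K)"
      using K c by (meson compact_continuous_image compact_imp_bounded continuous_on_subset
        subset_UNIV)
    then obtain B where "\<And>x. x \<in> K \<Longrightarrow> \<bar>?D x v\<bar> \<le> B" by (auto simp: bounded_iff)
    then have "\<bar>?D x v\<bar> \<le> max B 0" for x using z[of x]
      by (cases "x \<in> K") (auto simp: le_max_iff_disj)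
    then show ?thesis by blast
  qed
  then obtain B where B: "\<And>v x. \<bar>?D x v\<bar> \<le> B v" by metis
  define L where "L = (\<Sum>i\<in>Basis. B i)"
  have B0: "0 \<le> B v" for v using B[of undefined v] by linarith
  have "onorm (?D x) \<le> L" for x
  proof (rule onorm_le)
    fix v
    interpret linear "?D x" using d has_derivative_linear by blast
    have "?D x v = ?D x (\<Sum>i\<in>Basis. (v \<bullet> i) *\<^sub>R i)" by (simp add: euclidean_representation)
    also have "\<dots> = (\<Sum>i\<in>Basis. (v \<bullet> i) * ?D x i)" by (simp add: sum scale)
    also have "norm \<dots> \<le> (\<Sum>i\<in>Basis. norm v * B i)"
      using B by (intro sum_norm_le) (auto simp: abs_mult intro!: mult_mono Basis_le_norm)
    finally show "norm (?D x v) \<le> L * norm v" by (simp add: L_def sum_distrib_left mult.commute)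
  qed
  then have "norm (f x - f y) \<le> L * norm (x - y)" for x y
    using differentiable_bound[of UNIV f ?D L x y] d by auto
  moreover have "0 \<le> L" unfolding L_def using B0 by (intro sum_nonneg) auto
  ultimately show ?thesis by (auto intro!: exI[of _ L] lipschitz_onI simp: dist_norm)
qed

text \<open>Lebesgue's differentiation theorem for boxes: almost every value is a limit of means
  over boxes having that point as lower corner. Open boxes occur in the vanishing condition because
  bump functions converge to their indicators; the faces are null.\<close>

lemma AE_zero_if_box_integrals_zero:
  fixes g :: "'a::euclidean_space \<Rightarrow> real"
  assumes "open U" and int: "\<And>a b. integrable lborel (\<lambda>x. indicator (cbox a b) x * (indicator U x *
    g x))"
    and zero: "\<And>a b. cbox a b \<subseteq> U \<Longrightarrow> (LINT x|lborel. indicator (box a b) x * g x) = 0"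
  shows "AE x in lborel. x \<in> U \<longrightarrow> g x = 0"
proof -
  let ?g = "\<lambda>x. indicator U x * g x"
  have ii: "set_integrable lborel (cbox a b) ?g" for a b
    using int[of a b] by (simp add: set_integrable_def)
  then have hk: "?g integrable_on cbox a b" for a b
    by (rule set_borel_integral_eq_integral)
  obtain N where N: "negligible N" and R: "\<And>x e. x \<notin> N \<Longrightarrow> 0 < e \<Longrightarrow>
     \<exists>d>0. \<forall>h. 0 < h \<and> h < d \<longrightarrow> norm (integral (cbox x
       (x + h *\<^sub>R One)) ?g /\<^sub>R h ^ DIM('a) - ?g x) < e"
    by (rule integrable_ccontinuous_explicit[OF hk]) blast
  have "g x = 0" if x: "x \<notin> N" "x \<in> U" for x
  proof (rule ccontr)
    assume "g x \<noteq> 0"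
    then obtain d where d: "d > 0" "\<And>h. 0 < h \<Longrightarrow> h < d \<Longrightarrow>
       norm (integral (cbox x (x + h *\<^sub>R One)) ?g /\<^sub>R h ^ DIM('a) - ?g x) < \<bar>g x\<bar>"
      using R[OF x(1), of "\<bar>g x\<bar>"] by auto
    obtain e where e: "e > 0" "ball x e \<subseteq> U" using \<open>open U\<close> x openE by blast
    \<comment> \<open>The first entry forces \<open>h < d\<close>; the second keeps the box of side
      \<open>h\<close> within distance \<open>e\<close> of \<open>x\<close>.\<close>
    define h where "h = min (d / 2) (e / (2 * (1 + norm (One::'a))))"
    have h: "0 < h" "h < d" using d e by (auto simp: h_def add_pos_nonneg)
    have "h * norm (One::'a) < e"
    proof -
      have "h * norm (One::'a) \<le> e / (2 * (1 + norm (One::'a))) * (1 + norm (One::'a))"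
        using h by (intro mult_mono) (auto simp: h_def)
      also have "\<dots> = e / 2" by (simp add: field_simps add_nonneg_eq_0_iff)
      finally show ?thesis using e by linarith
    qed
    have sub: "cbox x (x + h *\<^sub>R One) \<subseteq> U"
    proof
      fix y assume y: "y \<in> cbox x (x + h *\<^sub>R One)"
      have "norm (y - x) \<le> norm (h *\<^sub>R One :: 'a)"
        using y h by (intro norm_le_componentwise) (auto
          simp: mem_box inner_diff_left inner_add_left)
      then have "dist x y < e" using \<open>h * norm One < e\<close> h
        by (simp add: dist_norm norm_minus_commute)
      then show "y \<in> U" using e by auto
    qed
    have "integral (cbox x (x + h *\<^sub>R One)) ?g = (LINT y:cbox x (x + h *\<^sub>R One)|lborel. ?g y)"
      using set_borel_integral_eq_integral(2)[OF ii] by simp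
    also have "\<dots> = (LINT y|lborel. indicator (box x (x + h *\<^sub>R One)) y * g y)"
    proof -
      have n: "AE y in lborel. y \<notin> cbox x (x + h *\<^sub>R One) - box x (x + h *\<^sub>R One)"
        using negligible_frontier_interval[of x "x + h *\<^sub>R One"]
        by (intro AE_not_in) (simp add: negligible_iff_null_sets null_sets_completion_iff)
      let ?c = "cbox x (x + h *\<^sub>R One)" and ?b = "box x (x + h *\<^sub>R One)"
      have eq: "(\<lambda>y. indicator ?b y * g y) = (\<lambda>y. indicator ?b y * (indicator ?c y * ?g y))"
        using sub box_subset_cbox[of x "x + h *\<^sub>R One"] by (auto simp: fun_eq_iff indicator_def)
      define G where "G y = indicator ?c y * ?g y" for y
      have [measurable]: "G \<in> borel_measurable lborel"
        using int[of x "x + h *\<^sub>R One"] unfolding G_def by blast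
      have "(LINT y|lborel. G y) = (LINT y|lborel. indicator ?b y * G y)"
      proof (rule integral_cong_AE)
        show "AE y in lborel. G y = indicator ?b y * G y"
          using n by eventually_elim (auto simp: indicator_def G_def)
      qed measurable
      then show ?thesis unfolding eq by (simp add: set_lebesgue_integral_def G_def)
    qed
    also have "\<dots> = 0" using zero[OF sub] .
    finally show False using d(2)[OF h] x by simp
  qed
  then have "AE x in lebesgue. x \<in> U \<longrightarrow> g x = 0"
    using N by (intro AE_I'[of N]) (auto simp: negligible_iff_null_sets)
  then show ?thesis by (simp add: AE_completion_iff)
qed

subsection \<open>Rademacher's theorem\<close>

text \<open>Adding \<open>(L + 1) * x\<close> makes the function an increasing Lipschitz bijection
  \<open>F\<close>. The measure assigning to a set the length of its image under \<open>F\<close> is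
  absolutely continuous, since Lipschitz maps preserve null sets. So \<open>F\<close> is an
  indefinite integral of its Radon-Nikodym density, and the differentiation theorem applies.\<close>

lemma lipschitz_real_differentiable_AE:
  fixes f :: "real \<Rightarrow> real"
  assumes L: "L-lipschitz_on UNIV f"
  shows "AE x in lborel. \<exists>D. (f has_real_derivative D) (at x)"
proof -
  define F where "F x = f x + (L + 1) * x" for x
  have L0: "0 \<le> L" using L lipschitz_on_nonneg by blast
  have fL: "\<bar>f x - f y\<bar> \<le> L * \<bar>x - y\<bar>" for x y
    using lipschitz_onD[OF L, of x y] by (auto simp: dist_real_def)
  have Fincr: "F y - F x \<ge> y - x" if "x \<le> y" for x y
    using fL[of x y] that by (auto simp: F_def algebra_simps)
  have FL: "\<bar>F x - F y\<bar> \<le> (2 * L + 1) * \<bar>x - y\<bar>" for x y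
  proof -
    have "F x - F y = (f x - f y) + (L + 1) * (x - y)" by (simp add: F_def algebra_simps)
    then have "\<bar>F x - F y\<bar> \<le> \<bar>f x - f y\<bar> + \<bar>(L + 1) * (x - y)\<bar>" by linarith
    also have "\<dots> \<le> L * \<bar>x - y\<bar> + (L+1) * \<bar>x - y\<bar>" using fL[of x y] L0 by (simp add: abs_mult)
    finally show ?thesis by (simp add: algebra_simps)
  qed
  have Fcont: "continuous_on UNIV F"
    unfolding F_def using lipschitz_on_continuous_on[OF L] by (intro continuous_intros) auto
  have mono: "F x < F y \<longleftrightarrow> x < y" for x y
    using Fincr[of x y] Fincr[of y x] by linarith
  then have Fle: "F x \<le> F y \<longleftrightarrow> x \<le> y" for x y
    by (meson not_less)
  have injF: "inj F" by (metis Fle antisym injI order_refl)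
  have surjF: "surj F"
  proof -
    have "\<exists>x. F x = y" for y
    proof -
      define K where "K = \<bar>y - F 0\<bar>"
      have K0: "0 \<le> K" by (simp add: K_def)
      have 1: "F K \<ge> y" using Fincr[of 0 K] unfolding K_def by linarith
      have 2: "F (-K) \<le> y" using Fincr[of "-K" 0] unfolding K_def by linarith
      show ?thesis
        using IVT'[of F "-K" y K] 1 2 K0 Fcont continuous_on_subset
          by (metis neg_le_0_iff_le order_trans subset_UNIV)
    qed
    then show ?thesis by (metis surjI)
  qed
  define h where "h = inv F"
  have hF: "h (F x) = x" and Fh: "F (h x) = x" for x
    using injF surjF by (auto simp: h_def surj_f_inv_f)
  have "mono h" by (rule monoI) (metis Fh Fle)
  then have hmeas: "h \<in> borel_measurable borel" by (rule borel_measurable_mono)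
  define \<mu> where "\<mu> = distr lborel borel h"
  have vim: "h -` A = F ` A" for A
    using hF Fh by (auto simp: image_iff) (metis)
  have em: "emeasure \<mu> A = emeasure lborel (F ` A)" if "A \<in> sets borel" for A
    using that hmeas by (simp add: \<mu>_def emeasure_distr vim)
  have "absolutely_continuous lborel \<mu>"
    unfolding absolutely_continuous_def
  proof
    fix A :: "real set" assume A: "A \<in> null_sets lborel"
    then have Ab: "A \<in> sets borel" by auto
    have "negligible A" using A by (simp add: negligible_iff_null_sets null_sets_completionI)
    then have "negligible (F ` A)"
    proof (rule negligible_locally_Lipschitz_image[rotated])
      fix x assume "x \<in> A"
      show "\<exists>T B. open T \<and> x \<in> T \<and> (\<forall>y\<in>A \<inter> T. norm (F y - F x) \<le> B * norm (y - x))"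
        using FL by (intro exI[of _ UNIV] exI[of _ "2*L+1"]) auto
    qed simp
    moreover have "F ` A \<in> sets borel"
      using measurable_sets_borel[OF hmeas, of A] Ab vim by simp
    ultimately have "emeasure lborel (F ` A) = 0"
      by (simp add: negligible_iff_emeasure0)
    then show "A \<in> null_sets \<mu>" using em[OF Ab] Ab by (auto simp: \<mu>_def)
  qed
  then obtain g0 where g0: "g0 \<in> borel_measurable lborel" and dens: "density lborel g0 = \<mu>"
    using sigma_finite_measure.Radon_Nikodym[OF sigma_finite_lborel, of \<mu>] by (auto simp: \<mu>_def)
  have img: "F ` {a..b} = {F a..F b}" for a b
  proof -
    have "F ` {a..b} = {y. h y \<in> {a..b}}" using vim[of "{a..b}"] by auto
    also have "\<dots> = {F a..F b}"
      using Fle[of a "h y" for y] Fle[of "h y" b for y] by (auto simp: Fh)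
    finally show ?thesis .
  qed
  have g0int: "(\<integral>\<^sup>+ x. g0 x * indicator {a..b} x \<partial>lborel) = ennreal (F b - F a)" if "a \<le> b" for a b
  proof -
    have "(\<integral>\<^sup>+ x. g0 x * indicator {a..b} x \<partial>lborel) = emeasure (density lborel g0) {a..b}"
      using g0 by (subst emeasure_density) auto
    also have "\<dots> = emeasure lborel {F a..F b}" using dens em[of "{a..b}"] img by simp
    also have "\<dots> = ennreal (F b - F a)" using that Fle by (simp add: emeasure_lborel_Icc)
    finally show ?thesis .
  qed
  define g where "g x = enn2real (g0 x)" for x
  have gmeas: "g \<in> borel_measurable borel" using g0 unfolding g_def by measurable
  have gnn: "0 \<le> g x" for x by (simp add: g_def)
  have fin: "AE x in lborel. g0 x * indicator {a..b} x \<noteq> \<infinity>" for a b :: real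
    by (cases "a \<le> b", intro nn_integral_PInf_AE) (use g0 g0int in auto)
  have gint: "(g has_integral (F b - F a)) {a..b}" if "a \<le> b" for a b
  proof -
    have "(\<integral>\<^sup>+ x. ennreal (g x * indicator {a..b} x) \<partial>lborel)
      = (\<integral>\<^sup>+ x. g0 x * indicator {a..b} x \<partial>lborel)"
      by (rule nn_integral_cong_AE, rule AE_mp[OF fin[of a b]])
        (auto simp: g_def indicator_def top.not_eq_extremum)
    then have "((\<lambda>x. g x * indicator {a..b} x) has_integral (F b - F a)) UNIV"
      using g0int[OF that] gmeas that Fle[of a b]
      by (intro nn_integral_has_integral) (auto simp: gnn)
    then have "((\<lambda>x. if x \<in> {a..b} then g x else 0) has_integral (F b - F a)) UNIV"
      by (rule has_integral_eq[rotated]) auto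
    then show ?thesis by (simp only: has_integral_restrict_UNIV)
  qed
  have gi: "g integrable_on cbox a b" for a b
    using gint[of a b] by (cases "a \<le> b") auto
  \<comment> \<open>The differentiation theorem supplies only intervals to the right of a point; the
    reflected density supplies those to the left.\<close>
  have gir: "(\<lambda>x. g (-x)) integrable_on cbox a b" for a b
    using gi[of "-b" "-a"] Henstock_Kurzweil_Integration.integrable_reflect_real[where f=g
      and a="-b" and b="-a"] by simp
  obtain N1 where N1: "negligible N1" and R: "\<And>x e. x \<notin> N1 \<Longrightarrow> 0 < e \<Longrightarrow>
     \<exists>d>0. \<forall>h. 0 < h \<and> h < d \<longrightarrow> norm (integral (cbox x
       (x + h *\<^sub>R One)) g /\<^sub>R h ^ DIM(real) - g x) < e"
    using integrable_ccontinuous_explicit[OF gi] by metis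
  obtain N2 where N2: "negligible N2" and Rr: "\<And>x e. x \<notin> N2 \<Longrightarrow> 0 < e \<Longrightarrow>
     \<exists>d>0. \<forall>h. 0 < h \<and> h < d \<longrightarrow> norm (integral (cbox x (x + h *\<^sub>R One)) (\<lambda>x. g
       (-x)) /\<^sub>R h ^ DIM(real) - g (-x)) < e"
    using integrable_ccontinuous_explicit[OF gir] by metis
  have N2': "negligible (uminus ` N2)" using N2
    by (intro negligible_differentiable_image_negligible) (auto intro!: derivative_intros)
  have der: "(F has_real_derivative g x) (at x)" if x: "x \<notin> N1" "-x \<notin> N2" for x
    unfolding DERIV_def LIM_def
  proof (intro allI impI)
    fix e :: real assume e: "0 < e"
    obtain d1 where d1: "d1 > 0" "\<And>h. 0 < h \<Longrightarrow> h < d1 \<Longrightarrow> norm (integral {x..x + h} g / h - g x) < e"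
      using R[OF x(1) e] by (auto simp: divide_inverse mult.commute)
    obtain d2 where d2: "d2 > 0" "\<And>h. 0 < h \<Longrightarrow> h < d2 \<Longrightarrow> norm (integral {-x..-x + h} (\<lambda>x. g (-x)) / h
      - g x) < e"
      using Rr[OF x(2) e] by (auto simp: divide_inverse mult.commute)
    show "\<exists>s>0. \<forall>xa. xa \<noteq> 0 \<and> dist xa 0 < s \<longrightarrow> dist ((F (x + xa) - F x) / xa) (g x) < e"
    proof (intro exI[of _ "min d1 d2"] conjI allI impI)
      fix k :: real assume k: "k \<noteq> 0 \<and> dist k 0 < min d1 d2"
      show "dist ((F (x + k) - F x) / k) (g x) < e"
      proof (cases "k > 0")
        case True
        then show ?thesis using d1(2)[of k] k integral_unique[OF gint[of x "x+k"]]
          by (simp add: dist_real_def)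
      next
        case False
        then have k': "k < 0" using k by auto
        have "integral {-x..-x + (-k)} (\<lambda>x. g (-x)) = integral {x+k..x} g"
          using Henstock_Kurzweil_Integration.integral_reflect_real[where f=g and a="x+k" and b=x]
            by (simp add: algebra_simps)
        also have "\<dots> = F x - F (x + k)" using integral_unique[OF gint[of "x+k" x]] k' by simp
        finally have "norm ((F x - F (x+k)) / (-k) - g x) < e" using d2(2)[of "-k"] k k' by simp
        then show ?thesis by (simp add: dist_real_def divide_simps split: if_splits)
      qed
    qed (use d1 d2 in auto)
  qed
  have "negligible (N1 \<union> uminus ` N2)" using N1 N2' by (rule negligible_Un)
  moreover have "\<exists>D. (f has_real_derivative D) (at x)" if "x \<notin> N1 \<union> uminus ` N2" for x
  proof -
    have "-x \<notin> N2" using that by (metis UnI2 image_eqI minus_minus)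
    then have "(F has_real_derivative g x) (at x)" using that by (intro der) auto
    then have "((\<lambda>x. F x - (L + 1) * x) has_real_derivative (g x - (L + 1) * 1)) (at x)"
      by (auto intro!: derivative_eq_intros)
    moreover have "(\<lambda>x. F x - (L + 1) * x) = f" by (auto simp: F_def)
    ultimately show ?thesis by auto
  qed
  ultimately have "AE x in lebesgue. \<exists>D. (f has_real_derivative D) (at x)"
    by (intro AE_I'[of "N1 \<union> uminus ` N2"]) (auto simp: negligible_iff_null_sets)
  then show ?thesis by (simp add: AE_completion_iff)
qed

section \<open>Translation invariance and directional derivatives\<close>

lemma nn_integral_lborel_shift:
  fixes g :: "'a::euclidean_space \<Rightarrow> ennreal"
  assumes [measurable]: "g \<in> borel_measurable borel"
  shows "(\<integral>\<^sup>+x. g (x + c) \<partial>lborel) = (\<integral>\<^sup>+x. g x \<partial>lborel)"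
proof -
  have "(\<integral>\<^sup>+x. g x \<partial>lborel) = (\<integral>\<^sup>+x. g x \<partial>distr lborel borel ((+) c))"
    by (simp add: lborel_distr_plus)
  also have "\<dots> = (\<integral>\<^sup>+x. g (c + x) \<partial>lborel)" by (subst nn_integral_distr) auto
  finally show ?thesis by (simp add: add.commute)
qed

lemma integrable_lborel_shift:
  fixes g :: "'a::euclidean_space \<Rightarrow> 'b::{banach,second_countable_topology}"
  assumes [measurable]: "g \<in> borel_measurable borel"
  shows "integrable lborel (\<lambda>x. g (x + c)) \<longleftrightarrow> integrable lborel g"
proof -
  have "integrable lborel g \<longleftrightarrow> integrable (distr lborel borel ((+) c)) g"
    by (simp add: lborel_distr_plus)
  also have "\<dots> \<longleftrightarrow> integrable lborel (\<lambda>x. g (c + x))" by (subst integrable_distr_eq) auto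
  finally show ?thesis by (simp add: add.commute)
qed

lemma integral_lborel_shift:
  fixes g :: "'a::euclidean_space \<Rightarrow> 'b::{banach,second_countable_topology}"
  assumes [measurable]: "g \<in> borel_measurable borel"
  shows "(LINT x|lborel. g (x + c)) = (LINT x|lborel. g x)"
proof -
  have "(LINT x|lborel. g x) = (LINT x|distr lborel borel ((+) c). g x)"
    by (simp add: lborel_distr_plus)
  also have "\<dots> = (LINT x|lborel. g (c + x))" by (subst integral_distr) auto
  finally show ?thesis by (simp add: add.commute)
qed

lemma integrable_continuous_bounded_support:
  fixes f :: "'a::euclidean_space \<Rightarrow> real"
  assumes "continuous_on UNIV f" "bounded {x. f x \<noteq> 0}"
  shows "integrable lborel f"
proof -
  let ?S = "closure {x. f x \<noteq> 0}"
  have "integrable lborel (\<lambda>x. indicator ?S x *\<^sub>R f x)"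
    using assms by (intro borel_integrable_compact) (auto intro: continuous_on_subset)
  moreover have "(\<lambda>x. indicator ?S x *\<^sub>R f x) = f"
    using closure_subset[of "{x. f x \<noteq> 0}"] by (auto simp: indicator_def fun_eq_iff)
  ultimately show ?thesis by simp
qed

text \<open>Fubini: on each line parallel to \<open>v\<close> the one-dimensional result makes the
  exceptional set null. This requires a measurable set, hence the Borel set \<open>C\<close> of
  points whose difference quotients are Cauchy along rational steps; continuity of \<open>f\<close>
  extends the Cauchy property to real steps.\<close>

lemma lipschitz_directional_derivative_AE:
  fixes f :: "'a::euclidean_space \<Rightarrow> real"
  assumes L: "L-lipschitz_on UNIV f"
  shows "AE x in lborel. \<exists>D. ((\<lambda>t. f (x + t *\<^sub>R v)) has_real_derivative D) (at 0)"
proof -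
  have fc: "continuous_on UNIV f" using L by (rule lipschitz_on_continuous_on)
  have fcx: "isCont f x" for x using fc by (simp add: continuous_on_eq_continuous_at)
  have [measurable]: "f \<in> borel_measurable borel" using fc by (rule borel_measurable_continuous_onI)
  define Q where "Q s x = (f (x + s *\<^sub>R v) - f x) / s" for s x
  have [measurable]: "Q s \<in> borel_measurable borel" for s unfolding Q_def by measurable
  define C where "C = {x. \<forall>k::nat. \<exists>m::nat. \<forall>(p::rat) (q::rat).
      0 < \<bar>real_of_rat p\<bar> \<and> \<bar>real_of_rat p\<bar> < 1 / Suc m \<and> 0 < \<bar>real_of_rat q\<bar> \<and> \<bar>real_of_rat q\<bar> < 1
        / Suc m \<longrightarrow>
      \<bar>Q (of_rat p) x - Q (of_rat q) x\<bar> \<le> 1 / Suc k}"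
  have C[measurable]: "C \<in> sets borel" unfolding C_def by measurable
  have DC: "x \<in> C" if D: "((\<lambda>t. f (x + t *\<^sub>R v)) has_real_derivative D) (at 0)" for x D
  proof -
    have lim: "(\<lambda>s. Q s x) \<midarrow>0\<rightarrow> D" using D by (simp add: DERIV_def Q_def)
    show ?thesis unfolding C_def
    proof (rule CollectI, rule allI)
      fix k :: nat
      obtain d where d: "d > 0" "\<And>s. s \<noteq> 0 \<Longrightarrow> \<bar>s\<bar> < d \<Longrightarrow> \<bar>Q s x - D\<bar> < 1 / (2 * real (Suc k))"
        using lim[unfolded LIM_def, rule_format, of "1 / (2 * real (Suc k))"]
          by (auto simp: dist_real_def)
      obtain m where m: "inverse (real (Suc m)) < d" using reals_Archimedean[OF d(1)] by blast
      show "\<exists>m::nat. \<forall>(p::rat) (q::rat).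
      0 < \<bar>real_of_rat p\<bar> \<and> \<bar>real_of_rat p\<bar> < 1 / Suc m \<and> 0 < \<bar>real_of_rat q\<bar> \<and> \<bar>real_of_rat q\<bar> < 1
        / Suc m \<longrightarrow>
      \<bar>Q (of_rat p) x - Q (of_rat q) x\<bar> \<le> 1 / Suc k"
      proof (intro exI[of _ m] allI impI)
        fix p q :: rat
        assume a: "0 < \<bar>real_of_rat p\<bar> \<and> \<bar>real_of_rat p\<bar> < 1 / Suc m \<and> 0 < \<bar>real_of_rat q\<bar>
          \<and> \<bar>real_of_rat q\<bar> < 1 / Suc m"
        have "\<bar>real_of_rat p\<bar> < d" "\<bar>real_of_rat q\<bar> < d"
          using a m unfolding inverse_eq_divide by linarith+
        then have "\<bar>Q (of_rat p) x - D\<bar> < 1 / (2 * real (Suc k))" "\<bar>Q (of_rat q) x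
          - D\<bar> < 1 / (2 * real (Suc k))"
          using a d(2)[of "of_rat p"] d(2)[of "of_rat q"] by auto
        then have "\<bar>Q (of_rat p) x - D\<bar> + \<bar>Q (of_rat q) x - D\<bar>
          \<le> 1 / (2 * real (Suc k)) + 1 / (2 * real (Suc k))"
          by (intro add_mono less_imp_le)
        also have "\<dots> = 1 / real (Suc k)" by (simp add: field_simps)
        finally have "\<bar>Q (of_rat p) x - D\<bar> + \<bar>Q (of_rat q) x - D\<bar> \<le> 1 / real (Suc k)" .
        moreover have "\<bar>Q (of_rat p) x - Q (of_rat q) x\<bar>
          \<le> \<bar>Q (of_rat p) x - D\<bar> + \<bar>Q (of_rat q) x - D\<bar>"
          by linarith
        ultimately show "\<bar>Q (of_rat p) x - Q (of_rat q) x\<bar> \<le> 1 / Suc k"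
          by (rule order_trans[rotated])
      qed
    qed
  qed
  have CD: "\<exists>D. ((\<lambda>t. f (x + t *\<^sub>R v)) has_real_derivative D) (at 0)" if "x \<in> C" for x
  proof -
    have cont: "isCont (\<lambda>s. Q s x) s" if "s \<noteq> 0" for s
      unfolding Q_def using that by (intro continuous_intros isCont_o2[OF _ fcx]) auto
    \<comment> \<open>The radius \<open>r'\<close> below keeps the rational approximant close to
      \<open>s\<close>, nonzero, and of modulus less than \<open>d\<close>.\<close>
    have app: "\<exists>p::rat. 0 < \<bar>real_of_rat p\<bar> \<and> \<bar>real_of_rat p\<bar> < d \<and> \<bar>Q (of_rat p) x - Q s x\<bar> < e"
      if s: "0 < \<bar>s\<bar>" "\<bar>s\<bar> < d" "0 < e" for s d e
    proof -
      obtain r where r: "r > 0" "\<And>y. \<bar>y - s\<bar> < r \<Longrightarrow> \<bar>Q y x - Q s x\<bar> < e"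
        using cont[of s] s unfolding continuous_at_eps_delta by (auto simp: dist_real_def)
      define r' where "r' = min r (min \<bar>s\<bar> (d - \<bar>s\<bar>))"
      obtain p where p: "s - r' < real_of_rat p" "real_of_rat p < s"
        using of_rat_dense[of "s - r'" s] r s by (auto simp: r'_def)
      have "\<bar>real_of_rat p - s\<bar> < r'" using p by linarith
      then have "\<bar>real_of_rat p - s\<bar> < r" "0 < \<bar>real_of_rat p\<bar>" "\<bar>real_of_rat p\<bar> < d"
        unfolding r'_def by linarith+
      then show ?thesis using r by blast
    qed
    have ext: "\<exists>d>0. \<forall>s t. 0 < \<bar>s\<bar> \<and> \<bar>s\<bar> < d \<and> 0 < \<bar>t\<bar> \<and> \<bar>t\<bar> < d \<longrightarrow> \<bar>Q s x - Q t x\<bar> \<le> 1 / Suc k"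
      for k :: nat
    proof -
      obtain m :: nat where m: "\<And>(p::rat) (q::rat).
      0 < \<bar>real_of_rat p\<bar> \<and> \<bar>real_of_rat p\<bar> < 1 / Suc m \<and> 0 < \<bar>real_of_rat q\<bar> \<and> \<bar>real_of_rat q\<bar> < 1
        / Suc m \<Longrightarrow>
      \<bar>Q (of_rat p) x - Q (of_rat q) x\<bar> \<le> 1 / Suc k" using \<open>x \<in> C\<close> unfolding C_def by blast
      show ?thesis
      proof (intro exI[of _ "1 / Suc m"] conjI allI impI)
        fix s t assume a: "0 < \<bar>s\<bar> \<and> \<bar>s\<bar> < 1 / Suc m \<and> 0 < \<bar>t\<bar> \<and> \<bar>t\<bar> < 1 / Suc m"
        show "\<bar>Q s x - Q t x\<bar> \<le> 1 / Suc k"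
        proof (rule field_le_epsilon)
          fix e :: real assume "0 < e"
          obtain p where p: "0 < \<bar>real_of_rat p\<bar>" "\<bar>real_of_rat p\<bar> < 1 / Suc m" "\<bar>Q (of_rat p) x
            - Q s x\<bar> < e/2"
            using app[of s "1 / Suc m" "e/2"] a \<open>0 < e\<close> by auto
          obtain q where q: "0 < \<bar>real_of_rat q\<bar>" "\<bar>real_of_rat q\<bar> < 1 / Suc m" "\<bar>Q (of_rat q) x
            - Q t x\<bar> < e/2"
            using app[of t "1 / Suc m" "e/2"] a \<open>0 < e\<close> by auto
          show "\<bar>Q s x - Q t x\<bar> \<le> 1 / Suc k + e"
            using m[of p q] p q by linarith
        qed
      qed simp
    qed
    define X where "X n = Q (1 / real (Suc n)) x" for n
    have small: "\<exists>N. \<forall>n\<ge>N. 1 / real (Suc n) < d" if "d > 0" for d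
    proof -
      obtain N where N: "inverse (real (Suc N)) < d" using reals_Archimedean[OF \<open>d > 0\<close>] by blast
      have "1 / real (Suc n) < d" if "n \<ge> N" for n
      proof -
        have "1 / real (Suc n) \<le> 1 / real (Suc N)" using that by (intro divide_left_mono) auto
        then show ?thesis using N unfolding inverse_eq_divide by (rule le_less_trans)
      qed
      then show ?thesis by blast
    qed
    have "Cauchy X"
    proof (rule metric_CauchyI)
      fix e :: real assume "0 < e"
      obtain k where k: "inverse (real (Suc k)) < e" using reals_Archimedean[OF \<open>0 < e\<close>] by blast
      obtain d where d: "d > 0" "\<And>s t. 0 < \<bar>s\<bar> \<and> \<bar>s\<bar> < d \<and> 0 < \<bar>t\<bar> \<and> \<bar>t\<bar> < d \<Longrightarrow> \<bar>Q s x - Q t x\<bar>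
        \<le> 1 / Suc k"
        using ext[of k] by blast
      obtain N where "\<forall>n\<ge>N. 1 / real (Suc n) < d" using small[OF d(1)] by blast
      then have "\<bar>X m - X n\<bar> \<le> 1 / Suc k" if "m \<ge> N" "n \<ge> N" for m n
        unfolding X_def using that by (intro d) auto
      then show "\<exists>M. \<forall>m\<ge>M. \<forall>n\<ge>M. dist (X m) (X n) < e"
        using k by (force simp: dist_real_def inverse_eq_divide)
    qed
    then obtain D where D: "X \<longlonglongrightarrow> D" using real_Cauchy_convergent convergent_def by blast
    have "(\<lambda>s. Q s x) \<midarrow>0\<rightarrow> D"
      unfolding LIM_def
    proof (intro allI impI)
      fix e :: real assume "0 < e"
      obtain k where k: "inverse (real (Suc k)) < e" using reals_Archimedean[OF \<open>0 < e\<close>] by blast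
      obtain d where d: "d > 0" "\<And>s t. 0 < \<bar>s\<bar> \<and> \<bar>s\<bar> < d \<and> 0 < \<bar>t\<bar> \<and> \<bar>t\<bar> < d \<Longrightarrow> \<bar>Q s x - Q t x\<bar>
        \<le> 1 / Suc k"
        using ext[of k] by blast
      obtain N where N: "\<forall>n\<ge>N. 1 / real (Suc n) < d" using small[OF d(1)] by blast
      have "dist (Q s x) D < e" if "s \<noteq> 0" "\<bar>s\<bar> < d" for s
      proof -
        have "(\<lambda>n. \<bar>Q s x - X n\<bar>) \<longlonglongrightarrow> \<bar>Q s x - D\<bar>" by (intro tendsto_intros D)
        moreover have "\<forall>n\<ge>N. \<bar>Q s x - X n\<bar> \<le> 1 / Suc k"
          unfolding X_def using that N by (intro allI impI d) auto
        ultimately have "\<bar>Q s x - D\<bar> \<le> 1 / Suc k" by (meson LIMSEQ_le_const2)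
        then show ?thesis using k by (simp add: dist_real_def inverse_eq_divide)
      qed
      then show "\<exists>s>0. \<forall>xa. xa \<noteq> 0 \<and> dist xa 0 < s \<longrightarrow> dist (Q xa x) D < e"
        using d(1) by (intro exI[of _ d]) auto
    qed
    then show ?thesis by (auto simp: DERIV_def Q_def)
  qed
  \<comment> \<open>A unit interval along the line suffices: after exchanging the integrals,
    translation invariance turns the inner one into the measure of the complement of
    \<open>C\<close>, and the outer one contributes the length 1.\<close>
  have nul: "(\<integral>\<^sup>+t. indicator (- C) (x + t *\<^sub>R v) * indicator {0..1::real} t \<partial>lborel)
    = (0::ennreal)" for x
  proof -
    have lip: "(L * norm v)-lipschitz_on UNIV (\<lambda>t. f (x + t *\<^sub>R v))"
    proof (rule lipschitz_onI)
      fix s t :: real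
      have "dist (f (x + s *\<^sub>R v)) (f (x + t *\<^sub>R v)) \<le> L * dist (x + s *\<^sub>R v) (x + t *\<^sub>R v)"
        using L lipschitz_onD by blast
      also have "dist (x + s *\<^sub>R v) (x + t *\<^sub>R v) = dist s t * norm v"
        by (simp add: dist_norm flip: scaleR_diff_left)
      finally show "dist (f (x + s *\<^sub>R v)) (f (x + t *\<^sub>R v)) \<le> L * norm v * dist s t"
        by (simp add: ac_simps)
    qed (simp add: lipschitz_on_nonneg[OF L])
    have "AE t in lborel. \<exists>D. ((\<lambda>t. f (x + t *\<^sub>R v)) has_real_derivative D) (at t)"
      by (rule lipschitz_real_differentiable_AE[OF lip])
    then have "AE t in lborel. x + t *\<^sub>R v \<in> C"
    proof eventually_elim
      case (elim t)
      then obtain D where "((\<lambda>t. f (x + t *\<^sub>R v)) has_real_derivative D) (at (0 + t))" by auto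
      then have "((\<lambda>s. f (x + (s + t) *\<^sub>R v)) has_real_derivative D) (at 0)"
        by (subst (asm) DERIV_shift)
      then show ?case by (intro DC[of _ D]) (simp add: algebra_simps)
    qed
    then have "AE t in lborel. indicator (- C) (x + t *\<^sub>R v) * indicator {0..1::real} t
      = (0::ennreal)"
      by eventually_elim auto
    then show ?thesis by (subst nn_integral_0_iff_AE) auto
  qed
  have "0 = (\<integral>\<^sup>+x. \<integral>\<^sup>+t. indicator (- C) (x
    + t *\<^sub>R v) * indicator {0..1::real} t \<partial>lborel \<partial>(lborel :: 'a measure))"
    by (simp add: nul)
  also have "\<dots> = (\<integral>\<^sup>+t. \<integral>\<^sup>+x. indicator (- C) (x
    + t *\<^sub>R v) * indicator {0..1::real} t \<partial>(lborel :: 'a measure) \<partial>lborel)"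
    by (rule lborel_pair.Fubini'[symmetric]) measurable
  also have "\<dots> = (\<integral>\<^sup>+t. emeasure lborel (- C) * indicator {0..1::real} t \<partial>lborel)"
  proof (rule nn_integral_cong)
    fix t :: real
    have "(\<integral>\<^sup>+x. indicator (- C) (x + t *\<^sub>R v) * indicator {0..1::real} t \<partial>lborel)
        = (\<integral>\<^sup>+x. indicator (- C) (x + t *\<^sub>R v) \<partial>lborel) * indicator {0..1::real} t"
      by (rule nn_integral_multc) measurable
    also have "(\<integral>\<^sup>+x. indicator (- C) (x + t *\<^sub>R v) \<partial>lborel) = (\<integral>\<^sup>+x. indicator (- C) x \<partial>lborel)"
      by (rule nn_integral_lborel_shift) measurable
    also have "\<dots> = emeasure lborel (- C)" by (rule nn_integral_indicator) (simp add: borel_comp)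
    finally show "(\<integral>\<^sup>+x. indicator (- C) (x + t *\<^sub>R v) * indicator {0..1::real} t \<partial>lborel)
       = emeasure lborel (- C) * indicator {0..1::real} t" .
  qed
  also have "\<dots> = emeasure lborel (- C)" by (subst nn_integral_cmult_indicator) auto
  finally have "AE x in lborel. x \<in> C" by (intro AE_I[of _ _ "- C"]) (auto simp: borel_comp)
  then show ?thesis by eventually_elim (rule CD)
qed

section \<open>Integration by parts for Lipschitz functions\<close>

definition has_dir_deriv_AE :: "'a::euclidean_space \<Rightarrow> ('a \<Rightarrow> real) \<Rightarrow> ('a \<Rightarrow> real) \<Rightarrow> bool" where
  "has_dir_deriv_AE v f f' \<longleftrightarrow> f' \<in> borel_measurable borel \<and>
     (AE x in lborel. ((\<lambda>t. f (x + t *\<^sub>R v)) has_real_derivative f' x) (at 0))"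

lemma inverse_Suc_at_0: "filterlim (\<lambda>n. 1 / real (Suc n)) (at 0) sequentially"
proof (rule filterlim_atI)
  show "(\<lambda>n. 1 / real (Suc n)) \<longlonglongrightarrow> 0"
    using LIMSEQ_inverse_real_of_nat by (simp add: inverse_eq_divide)
qed auto

lemma neg_inverse_Suc_at_0: "filterlim (\<lambda>n. - (1 / real (Suc n))) (at 0) sequentially"
proof (rule filterlim_atI)
  show "(\<lambda>n. - (1 / real (Suc n))) \<longlonglongrightarrow> 0"
    using tendsto_minus[OF LIMSEQ_inverse_real_of_nat] by (simp add: inverse_eq_divide)
qed auto

lemma dir_deriv_seq:
  fixes f :: "'a::euclidean_space \<Rightarrow> real"
  assumes "((\<lambda>t. f (x + t *\<^sub>R v)) has_real_derivative D) (at 0)"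
  shows "(\<lambda>n. (f (x + (1 / real (Suc n)) *\<^sub>R v) - f x) / (1 / real (Suc n))) \<longlonglongrightarrow> D"
    and "(\<lambda>n. (f (x - (1 / real (Suc n)) *\<^sub>R v) - f x) / (1 / real (Suc n))) \<longlonglongrightarrow> - D"
proof -
  have D: "((\<lambda>h. (f (x + h *\<^sub>R v) - f x) / h) \<longlongrightarrow> D) (at 0)"
    using assms by (simp add: DERIV_def)
  show "(\<lambda>n. (f (x + (1 / real (Suc n)) *\<^sub>R v) - f x) / (1 / real (Suc n))) \<longlonglongrightarrow> D"
    by (rule filterlim_compose[OF D inverse_Suc_at_0])
  have "(\<lambda>n. - ((f (x + (- (1 / real (Suc n))) *\<^sub>R v) - f x) / (- (1 / real (Suc n))))) \<longlonglongrightarrow> - D"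
    by (intro tendsto_minus filterlim_compose[OF D neg_inverse_Suc_at_0])
  then show "(\<lambda>n. (f (x - (1 / real (Suc n)) *\<^sub>R v) - f x) / (1 / real (Suc n))) \<longlonglongrightarrow> - D"
    by simp
qed

lemma lipschitz_quotient_bound:
  fixes f :: "'a::euclidean_space \<Rightarrow> real"
  assumes "L-lipschitz_on UNIV f"
  shows "\<bar>(f (x + (1 / real (Suc n)) *\<^sub>R v) - f x) / (1 / real (Suc n))\<bar> \<le> L * norm v"
    and "\<bar>(f (x - (1 / real (Suc n)) *\<^sub>R v) - f x) / (1 / real (Suc n))\<bar> \<le> L * norm v"
proof -
  define h where "h = 1 / real (Suc n)"
  have h: "h > 0" by (simp add: h_def)
  have "\<bar>f (x + h *\<^sub>R v) - f x\<bar> \<le> L * (h * norm v)" "\<bar>f (x - h *\<^sub>R v) - f x\<bar> \<le> L * (h * norm v)"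
    using lipschitz_onD[OF assms, of "x + h *\<^sub>R v" x] lipschitz_onD[OF assms, of "x - h *\<^sub>R v" x] h
    by (simp_all add: dist_norm)
  then have "\<bar>(f (x + h *\<^sub>R v) - f x) / h\<bar> \<le> L * norm v" "\<bar>(f (x - h *\<^sub>R v) - f x) / h\<bar>
    \<le> L * norm v"
    using h by (simp_all add: pos_divide_le_eq ac_simps)
  then show "\<bar>(f (x + (1 / real (Suc n)) *\<^sub>R v) - f x) / (1 / real (Suc n))\<bar> \<le> L * norm v"
    and "\<bar>(f (x - (1 / real (Suc n)) *\<^sub>R v) - f x) / (1 / real (Suc n))\<bar> \<le> L * norm v"
    unfolding h_def .
qed

lemma dir_deriv_bound:
  fixes f :: "'a::euclidean_space \<Rightarrow> real"
  assumes "L-lipschitz_on UNIV f" "((\<lambda>t. f (x + t *\<^sub>R v)) has_real_derivative D) (at 0)"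
  shows "\<bar>D\<bar> \<le> L * norm v"
  using LIMSEQ_le_const2[OF tendsto_rabs[OF dir_deriv_seq(1)[OF assms(2)]]]
    lipschitz_quotient_bound(1)[OF assms(1)]
  by blast

lemma lipschitz_has_dir_deriv_AE:
  fixes f :: "'a::euclidean_space \<Rightarrow> real"
  assumes L: "L-lipschitz_on UNIV f"
  shows "\<exists>f'. has_dir_deriv_AE v f f'"
proof -
  have [measurable]: "f \<in> borel_measurable borel"
    using L lipschitz_on_continuous_on borel_measurable_continuous_onI by blast
  define f' where "f' x = lim (\<lambda>n. (f (x + (1 / real (Suc n)) *\<^sub>R v) - f x) / (1 / real (Suc n)))"
    for x
  have "f' \<in> borel_measurable borel" unfolding f'_def by measurable
  moreover have "AE x in lborel. ((\<lambda>t. f (x + t *\<^sub>R v)) has_real_derivative f' x) (at 0)"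
    using lipschitz_directional_derivative_AE[OF L, of v]
  proof eventually_elim
    case (elim x)
    then obtain D where D: "((\<lambda>t. f (x + t *\<^sub>R v)) has_real_derivative D) (at 0)" by blast
    have "f' x = D" unfolding f'_def by (rule limI[OF dir_deriv_seq(1)[OF D]])
    then show ?case using D by simp
  qed
  ultimately show ?thesis unfolding has_dir_deriv_AE_def by blast
qed

text \<open>For difference quotients this is a translation of the integral, which moves a forward
  quotient of \<open>u\<close> to a backward quotient of \<open>k\<close>. The quotients are bounded
  by the Lipschitz constants and the integrands vanish outside a fixed ball, so dominated
  convergence applies.\<close>

lemma lipschitz_integration_by_parts:
  fixes u k :: "'a::euclidean_space \<Rightarrow> real"
  assumes u: "L-lipschitz_on UNIV u" and k: "K-lipschitz_on UNIV k" and bd: "bounded {x. k x \<noteq> 0}"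
    and du: "has_dir_deriv_AE v u u'" and dk: "has_dir_deriv_AE v k k'"
  shows "integrable lborel (\<lambda>x. u' x * k x)" "integrable lborel (\<lambda>x. u x * k' x)"
    "(LINT x|lborel. u' x * k x) = - (LINT x|lborel. u x * k' x)"
proof -
  have [measurable]: "u' \<in> borel_measurable borel" "k' \<in> borel_measurable borel"
    using du dk by (auto simp: has_dir_deriv_AE_def)
  have uc: "continuous_on UNIV u" and kc: "continuous_on UNIV k"
    using u k by (auto intro: lipschitz_on_continuous_on)
  have [measurable]: "u \<in> borel_measurable borel" "k \<in> borel_measurable borel"
    using uc kc by (auto intro: borel_measurable_continuous_onI)
  have K0: "0 \<le> K" using k lipschitz_on_nonneg by blast
  define h where "h n = 1 / real (Suc n)" for n
  define a where "a n x = (u (x + h n *\<^sub>R v) - u x) / h n * k x" for n x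
  define b where "b n x = u x * ((k (x - h n *\<^sub>R v) - k x) / h n)" for n x
  obtain R where R: "\<And>x. k x \<noteq> 0 \<Longrightarrow> norm x \<le> R" using bd by (auto simp: bounded_iff)
  have ki: "integrable lborel k" by (rule integrable_continuous_bounded_support[OF kc bd])
  have bd1: "bounded {x. u (x + c) * k x \<noteq> 0}" for c
    using bd by (rule bounded_subset) auto
  have i1: "integrable lborel (\<lambda>x. u (x + c) * k x)" for c
    by (intro integrable_continuous_bounded_support bd1 continuous_intros kc
        continuous_on_compose2[OF uc]) auto
  have i2: "integrable lborel (\<lambda>x. u x * k (x - c))" for c
    using integrable_lborel_shift[of "\<lambda>x. u x * k (x - c)" c] i1[of c] by simp
  have e1: "(LINT x|lborel. u (x + c) * k x) = (LINT x|lborel. u x * k (x - c))" for c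
    using integral_lborel_shift[of "\<lambda>x. u x * k (x - c)" c] by simp
  have eq: "integral\<^sup>L lborel (a n) = integral\<^sup>L lborel (b n)" for n
  proof -
    have "integral\<^sup>L lborel (a n) = (LINT x|lborel. (u (x + h n *\<^sub>R v) * k x - u (x
      + 0) * k x) / h n)"
      by (simp add: a_def[abs_def] left_diff_distrib diff_divide_distrib)
    also have "\<dots> = (LINT x|lborel. (u x * k (x - h n *\<^sub>R v) - u x * k (x - 0)) / h n)"
      using i1 i2 e1 by (simp only: integral_divide_zero Bochner_Integration.integral_diff)
    also have "\<dots> = integral\<^sup>L lborel (b n)"
      by (simp add: b_def[abs_def] right_diff_distrib diff_divide_distrib)
    finally show ?thesis .
  qed
  have A: "integrable lborel (\<lambda>x. u' x * k x)" "(\<lambda>n. integral\<^sup>L lborel (a n))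
    \<longlonglongrightarrow> (LINT x|lborel. u' x * k x)"
  proof -
    have ptw: "AE x in lborel. (\<lambda>n. a n x) \<longlonglongrightarrow> u' x * k x"
      using du[unfolded has_dir_deriv_AE_def, THEN conjunct2]
    proof eventually_elim
      case (elim x)
      show ?case unfolding a_def h_def by (intro tendsto_intros dir_deriv_seq(1)[OF elim])
    qed
    have bnd: "norm (a n x) \<le> L * norm v * \<bar>k x\<bar>" for n x
      unfolding a_def h_def real_norm_def abs_mult[of _ "k x"]
      by (intro mult_right_mono lipschitz_quotient_bound(1)[OF u]) auto
    have ma: "a n \<in> borel_measurable lborel" for n unfolding a_def by measurable
    have w: "integrable lborel (\<lambda>x. L * norm v * \<bar>k x\<bar>)" using ki by auto
    show "integrable lborel (\<lambda>x. u' x * k x)"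
      by (rule integrable_dominated_convergence[OF _ ma w ptw]) (use bnd in auto)
    show "(\<lambda>n. integral\<^sup>L lborel (a n)) \<longlonglongrightarrow> (LINT x|lborel. u' x * k x)"
      by (rule integral_dominated_convergence[OF _ ma w ptw]) (use bnd in auto)
  qed
  have B: "integrable lborel (\<lambda>x. u x * - k' x)" "(\<lambda>n. integral\<^sup>L lborel (b n))
    \<longlonglongrightarrow> (LINT x|lborel. u x * - k' x)"
  proof -
    define T where "T = cball (0::'a) (R + norm v)"
    have ptw: "AE x in lborel. (\<lambda>n. b n x) \<longlonglongrightarrow> u x * - k' x"
      using dk[unfolded has_dir_deriv_AE_def, THEN conjunct2]
    proof eventually_elim
      case (elim x)
      show ?case unfolding b_def h_def by (intro tendsto_intros dir_deriv_seq(2)[OF elim])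
    qed
    have bnd: "norm (b n x) \<le> K * norm v * (indicator T x *\<^sub>R \<bar>u x\<bar>)" for n x
    proof (cases "x \<in> T")
      case True
      have "\<bar>u x\<bar> * \<bar>(k (x - h n *\<^sub>R v) - k x) / h n\<bar> \<le> \<bar>u x\<bar> * (K * norm v)"
        unfolding h_def by (intro mult_left_mono lipschitz_quotient_bound(2)[OF k]) auto
      then show ?thesis using True by (simp add: b_def abs_mult ac_simps)
    next
      case False
      then have n: "norm x > R + norm v" by (simp add: T_def)
      have "norm x \<le> norm (x - h n *\<^sub>R v) + norm (h n *\<^sub>R v)"
        by (metis diff_add_cancel norm_triangle_ineq)
      moreover have "norm (h n *\<^sub>R v) \<le> norm v" by (simp add: h_def mult_left_le_one_le field_simps)
      ultimately have "norm (x - h n *\<^sub>R v) > R" using n by linarith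
      moreover have "norm x > R" using n norm_ge_zero[of v] by linarith
      ultimately have "k (x - h n *\<^sub>R v) = 0" "k x = 0" using R by force+
      then show ?thesis using K0 by (simp add: b_def)
    qed
    have mb: "b n \<in> borel_measurable lborel" for n unfolding b_def by measurable
    have "integrable lborel (\<lambda>x. indicator T x *\<^sub>R \<bar>u x\<bar>)" unfolding T_def
      by (intro borel_integrable_compact continuous_intros continuous_on_subset[OF uc]) auto
    then have w: "integrable lborel (\<lambda>x. K * norm v * (indicator T x *\<^sub>R \<bar>u x\<bar>))" by simp
    show "integrable lborel (\<lambda>x. u x * - k' x)"
      by (rule integrable_dominated_convergence[OF _ mb w ptw]) (use bnd in auto)
    show "(\<lambda>n. integral\<^sup>L lborel (b n)) \<longlonglongrightarrow> (LINT x|lborel. u x * - k' x)"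
      by (rule integral_dominated_convergence[OF _ mb w ptw]) (use bnd in auto)
  qed
  show "integrable lborel (\<lambda>x. u' x * k x)" by (rule A)
  show "integrable lborel (\<lambda>x. u x * k' x)" using B(1) by simp
  show "(LINT x|lborel. u' x * k x) = - (LINT x|lborel. u x * k' x)"
    using LIMSEQ_unique[OF A(2)] B(2) eq by simp
qed

text \<open>Integrating by parts twice would need second derivatives. Difference quotients avoid
  them: expanding the product and translating each term exchanges the two directions and turns both
  forward quotients into backward ones, whose signs cancel in the limit.\<close>

lemma lipschitz_null_lagrangian:
  fixes u w :: "'a::euclidean_space \<Rightarrow> real"
  assumes u: "L-lipschitz_on UNIV u" and w: "K-lipschitz_on UNIV w" and bd: "bounded {x. u x \<noteq> 0}"
    and ua: "has_dir_deriv_AE a u ua" and ub: "has_dir_deriv_AE b u ub"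
    and wa: "has_dir_deriv_AE a w wa" and wb: "has_dir_deriv_AE b w wb"
  shows "integrable lborel (\<lambda>x. ua x * wb x)" "integrable lborel (\<lambda>x. ub x * wa x)"
    "(LINT x|lborel. ua x * wb x) = (LINT x|lborel. ub x * wa x)"
proof -
  have [measurable]: "ua \<in> borel_measurable borel" "ub \<in> borel_measurable borel"
     "wa \<in> borel_measurable borel" "wb \<in> borel_measurable borel"
    using ua ub wa wb by (auto simp: has_dir_deriv_AE_def)
  have uc: "continuous_on UNIV u" and wc: "continuous_on UNIV w"
    using u w by (auto intro: lipschitz_on_continuous_on)
  have [measurable]: "u \<in> borel_measurable borel" "w \<in> borel_measurable borel"
    using uc wc by (auto intro: borel_measurable_continuous_onI)
  have K0: "0 \<le> K" "0 \<le> L" using u w lipschitz_on_nonneg by blast+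
  define h where "h n = 1 / real (Suc n)" for n
  define P where "P n x = (u (x + h n *\<^sub>R a) - u x) / h n * ((w (x + h n *\<^sub>R b) - w x) / h n)"
    for n x
  define Q where "Q n x = (u (x - h n *\<^sub>R b) - u x) / h n * ((w (x - h n *\<^sub>R a) - w x) / h n)"
    for n x
  obtain R where R: "\<And>x. u x \<noteq> 0 \<Longrightarrow> norm x \<le> R" using bd by (auto simp: bounded_iff)
  have bd1: "bounded {x. u x * w (x + c) \<noteq> 0}" for c
    using bd by (rule bounded_subset) auto
  have i0: "integrable lborel (\<lambda>x. u x * w (x + c))" for c
    by (intro integrable_continuous_bounded_support bd1 continuous_intros uc
        continuous_on_compose2[OF wc]) auto
  have i1: "integrable lborel (\<lambda>x. u (x + c) * w (x + d))" for c d
    using integrable_lborel_shift[of "\<lambda>x. u (x + c) * w (x + d)" "-c"] i0[of "d - c"]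
      by (simp add: algebra_simps)
  have e1: "(LINT x|lborel. u (x + c) * w (x + d)) = (LINT x|lborel. u (x - d) * w (x - c))" for c d
    using integral_lborel_shift[of "\<lambda>x. u (x - d) * w (x - c)" "c + d"] by (simp add: algebra_simps)
  have eq: "integral\<^sup>L lborel (P n) = integral\<^sup>L lborel (Q n)" for n
  proof -
    let ?h = "h n"
    have F: "(a - b) / h * ((c - d) / h) = (((a * c - a * d) - b * c) + b * d) / (h * h)"
      for a b c d h :: real
    proof -
      have "(a - b) * (c - d) = ((a * c - a * d) - b * c) + b * d" by algebra
      then show ?thesis by (simp only: times_divide_times_eq)
    qed
    have "integral\<^sup>L lborel (P n) = (LINT x|lborel. (((u (x + ?h *\<^sub>R a) * w (x + ?h *\<^sub>R b)
        - u (x + ?h *\<^sub>R a) * w (x + 0)) - u (x + 0) * w (x + ?h *\<^sub>R b)) + u (x + 0) * w (x + 0)) /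
          (?h * ?h))"
      unfolding P_def[abs_def] F by simp
    also have "\<dots> = (((LINT x|lborel. u (x + ?h *\<^sub>R a) * w (x + ?h *\<^sub>R b))
        - (LINT x|lborel. u (x + ?h *\<^sub>R a) * w (x + 0))) - (LINT x|lborel. u (x + 0) * w
          (x + ?h *\<^sub>R b))
        + (LINT x|lborel. u (x + 0) * w (x + 0))) / (?h * ?h)"
      using i1 by (simp only: integral_divide_zero Bochner_Integration.integral_diff
        Bochner_Integration.integral_add
          Bochner_Integration.integrable_diff Bochner_Integration.integrable_add)
    also have "\<dots> = (((LINT x|lborel. u (x + - (?h *\<^sub>R b)) * w (x + - (?h *\<^sub>R a)))
        - (LINT x|lborel. u (x + 0) * w (x + - (?h *\<^sub>R a)))) - (LINT x|lborel. u (x + -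
          (?h *\<^sub>R b)) * w (x + 0))
        + (LINT x|lborel. u (x + 0) * w (x + 0))) / (?h * ?h)"
      using e1[of "?h *\<^sub>R a" "?h *\<^sub>R b"] e1[of "?h *\<^sub>R a" 0] e1[of 0 "?h *\<^sub>R b"] by simp
    also have "\<dots> = (LINT x|lborel. (((u (x + - (?h *\<^sub>R b)) * w (x + - (?h *\<^sub>R a))
        - u (x + 0) * w (x + - (?h *\<^sub>R a))) - u (x + - (?h *\<^sub>R b)) * w (x + 0)) + u (x + 0) * w
          (x + 0)) / (?h * ?h))"
      using i1 by (simp only: integral_divide_zero Bochner_Integration.integral_diff
        Bochner_Integration.integral_add
          Bochner_Integration.integrable_diff Bochner_Integration.integrable_add)
    also have "\<dots> = integral\<^sup>L lborel (Q n)"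
      unfolding Q_def[abs_def] F by (simp add: algebra_simps)
    finally show ?thesis .
  qed
  define T where "T = cball (0::'a) (R + norm a + norm b)"
  have uz: "u (x + c) = 0" if "x \<notin> T" "norm c \<le> max (norm a) (norm b)" for x c
  proof -
    have "norm x > R + norm a + norm b" using that(1) by (simp add: T_def)
    moreover have "norm x \<le> norm (x + c) + norm c"
      by (metis add_diff_cancel_right' norm_triangle_ineq4)
    ultimately have "norm (x + c) > R" using that(2) norm_ge_zero[of a] norm_ge_zero[of b]
      by linarith
    then show ?thesis using R by force
  qed
  have hn: "norm (h n *\<^sub>R c) \<le> norm c" for n and c :: 'a
    by (simp add: h_def mult_left_le_one_le field_simps)
  define W where "W x = indicator T x *\<^sub>R (L * (norm a + norm b) * (K * (norm a + norm b)))"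
    for x :: 'a
  have Wi: "integrable lborel W" unfolding T_def W_def
    by (intro borel_integrable_compact continuous_intros) auto
  have Pb: "norm (P n x) \<le> W x" for n x
  proof (cases "x \<in> T")
    case True
    have "\<bar>(u (x + h n *\<^sub>R a) - u x) / h n\<bar> * \<bar>(w (x + h n *\<^sub>R b) - w x) / h n\<bar>
      \<le> (L * norm a) * (K * norm b)"
      unfolding h_def using K0 by (intro mult_mono lipschitz_quotient_bound(1)[OF u]
        lipschitz_quotient_bound(1)[OF w]) auto
    also have "\<dots> \<le> (L * (norm a + norm b)) * (K * (norm a + norm b))"
      using K0 by (intro mult_mono) auto
    finally show ?thesis using True by (simp add: P_def W_def abs_mult)
  next
    case False
    then show ?thesis using uz[OF False, of "h n *\<^sub>R a"] uz[OF False, of 0] hn[of n a]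
      by (simp add: P_def W_def le_max_iff_disj)
  qed
  have Qb: "norm (Q n x) \<le> W x" for n x
  proof (cases "x \<in> T")
    case True
    have "\<bar>(u (x - h n *\<^sub>R b) - u x) / h n\<bar> * \<bar>(w (x - h n *\<^sub>R a) - w x) / h n\<bar>
      \<le> (L * norm b) * (K * norm a)"
      unfolding h_def using K0 by (intro mult_mono lipschitz_quotient_bound(2)[OF u]
        lipschitz_quotient_bound(2)[OF w]) auto
    also have "\<dots> \<le> (L * (norm a + norm b)) * (K * (norm a + norm b))"
      using K0 by (intro mult_mono) auto
    finally show ?thesis using True by (simp add: Q_def W_def abs_mult)
  next
    case False
    then show ?thesis using uz[OF False, of "- (h n *\<^sub>R b)"] uz[OF False, of 0] hn[of n b]
      by (simp add: Q_def W_def le_max_iff_disj)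
  qed
  have mP: "P n \<in> borel_measurable lborel" "Q n \<in> borel_measurable lborel" for n
    unfolding P_def Q_def by measurable
  have pP: "AE x in lborel. (\<lambda>n. P n x) \<longlonglongrightarrow> ua x * wb x"
    using ua[unfolded has_dir_deriv_AE_def, THEN conjunct2] wb[unfolded has_dir_deriv_AE_def, THEN
      conjunct2]
  proof eventually_elim
    case (elim x)
    show ?case unfolding P_def h_def
      by (intro tendsto_mult dir_deriv_seq(1)[OF elim(1)] dir_deriv_seq(1)[OF elim(2)])
  qed
  have pQ: "AE x in lborel. (\<lambda>n. Q n x) \<longlonglongrightarrow> - ub x * - wa x"
    using ub[unfolded has_dir_deriv_AE_def, THEN conjunct2] wa[unfolded has_dir_deriv_AE_def, THEN
      conjunct2]
  proof eventually_elim
    case (elim x)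
    show ?case unfolding Q_def h_def
      by (intro tendsto_mult dir_deriv_seq(2)[OF elim(1)] dir_deriv_seq(2)[OF elim(2)])
  qed
  show "integrable lborel (\<lambda>x. ua x * wb x)"
    by (rule integrable_dominated_convergence[OF _ mP(1) Wi pP]) (use Pb in auto)
  have "integrable lborel (\<lambda>x. - ub x * - wa x)"
    by (rule integrable_dominated_convergence[OF _ mP(2) Wi pQ]) (use Qb in auto)
  then show "integrable lborel (\<lambda>x. ub x * wa x)" by simp
  have 1: "(\<lambda>n. integral\<^sup>L lborel (P n)) \<longlonglongrightarrow> (LINT x|lborel. ua x * wb x)"
    by (rule integral_dominated_convergence[OF _ mP(1) Wi pP]) (use Pb in auto)
  have "(\<lambda>n. integral\<^sup>L lborel (Q n)) \<longlonglongrightarrow> (LINT x|lborel. - ub x * - wa x)"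
    by (rule integral_dominated_convergence[OF _ mP(2) Wi pQ]) (use Qb in auto)
  then show "(LINT x|lborel. ua x * wb x) = (LINT x|lborel. ub x * wa x)"
    using LIMSEQ_unique[OF 1] eq by simp
qed

lemma has_derivative_dir_deriv:
  fixes f :: "'a::real_normed_vector \<Rightarrow> real"
  assumes "(f has_derivative f') (at x)"
  shows "((\<lambda>t. f (x + t *\<^sub>R v)) has_real_derivative f' v) (at 0)"
proof -
  interpret linear f' using assms has_derivative_linear by blast
  have 1: "((\<lambda>t. x + t *\<^sub>R v) has_derivative (\<lambda>t. t *\<^sub>R v)) (at 0)"
    by (auto intro!: derivative_eq_intros)
  have "(f has_derivative f') (at (x + 0 *\<^sub>R v))" using assms by simp
  from has_derivative_compose[OF 1 this] show ?thesis
    by (simp add: has_field_derivative_def scale mult.commute[of _ "f' v"])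
qed

text \<open>The directional derivatives depend linearly on the direction because, tested against
  bump functions, they equal integrals with the derivatives of the bumps, which are linear.
  Countably many dense directions share one null set, and the Lipschitz bound carries
  differentiability from them to all directions uniformly.\<close>

theorem rademacher:
  fixes f :: "'a::euclidean_space \<Rightarrow> real"
  assumes L: "L-lipschitz_on UNIV f"
  shows "\<exists>g. g \<in> borel_measurable borel \<and> (\<forall>x. norm (g x) \<le> L) \<and>
    (AE x in lborel. (f has_derivative (\<lambda>h. g x \<bullet> h)) (at x))"
proof -
  have fc: "continuous_on UNIV f" using L by (rule lipschitz_on_continuous_on)
  have [measurable]: "f \<in> borel_measurable borel" using fc by (rule borel_measurable_continuous_onI)
  have L0: "0 \<le> L" using L lipschitz_on_nonneg by blast
  obtain D where D: "\<And>v. has_dir_deriv_AE v f (D v)" using lipschitz_has_dir_deriv_AE[OF L] by metis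
  have [measurable]: "D v \<in> borel_measurable borel" for v using D
    by (auto simp: has_dir_deriv_AE_def)
  have Dx: "AE x in lborel. ((\<lambda>t. f (x + t *\<^sub>R v)) has_real_derivative D v x) (at 0)" for v
    using D by (auto simp: has_dir_deriv_AE_def)
  have Db: "AE x in lborel. \<bar>D v x\<bar> \<le> L * norm v" for v
    using Dx[of v] by eventually_elim (rule dir_deriv_bound[OF L])
  define g0 where "g0 x = (\<Sum>i\<in>Basis. D i x *\<^sub>R i)" for x
  have [measurable]: "g0 \<in> borel_measurable borel" unfolding g0_def by measurable
  have lin: "AE x in lborel. D v x = g0 x \<bullet> v" for v
  proof -
    let ?G = "\<lambda>x. D v x - (\<Sum>i\<in>Basis. (v \<bullet> i) * D i x)"
    have g0v: "g0 x \<bullet> v = (\<Sum>i\<in>Basis. (v \<bullet> i) * D i x)" for x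
      unfolding g0_def inner_sum_left by (intro sum.cong) (auto simp: inner_commute)
    define M where "M = L * norm v + (\<Sum>i\<in>Basis. \<bar>v \<bullet> i\<bar> * (L * norm (i::'a)))"
    have Gb: "AE x in lborel. \<bar>?G x\<bar> \<le> M"
    proof -
      have "AE x in lborel. \<forall>i\<in>Basis. \<bar>D i x\<bar> \<le> L * norm i"
        by (rule AE_finite_allI) (simp, rule Db)
      with Db[of v] show ?thesis
      proof eventually_elim
        case (elim x)
        have "\<bar>\<Sum>i\<in>Basis. (v \<bullet> i) * D i x\<bar> \<le> (\<Sum>i\<in>Basis. \<bar>v \<bullet> i\<bar> * (L * norm (i::'a)))"
          using elim by (intro order.trans[OF sum_abs] sum_mono) (auto
            simp: abs_mult intro!: mult_left_mono)
        then show ?case using elim unfolding M_def by linarith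
      qed
    qed
    have gi: "integrable lborel (\<lambda>x. indicator S x * ?G x)" if "S \<in> sets borel" "bounded S" for S
    proof -
      have "integrable lborel (\<lambda>x. indicator S x *\<^sub>R ?G x)"
      proof (rule integrableI_bounded_set_indicator[where B=M])
        show "emeasure lborel S < \<infinity>" using emeasure_bounded_finite[OF that(2)] by simp
      qed (use that Gb in auto)
      then show ?thesis by simp
    qed
    have "AE x in lborel. x \<in> UNIV \<longrightarrow> ?G x = 0"
    proof (rule AE_zero_if_box_integrals_zero)
      show "integrable lborel (\<lambda>x. indicator (cbox a b) x * (indicator UNIV x * ?G x))" for a b
        using gi[of "cbox a b"] by simp
      fix a b :: 'a
      define k where "k n = box_bump a b (real (Suc n))" for n
      have kz: "{x. k n x \<noteq> 0} = box a b" for n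
        using box_bump_nonzero[of "real (Suc n)"] by (auto simp: k_def)
      have kd: "(k n has_derivative frechet_derivative (k n) (at x)) (at x)" for n x
        using box_bump_Ck[of 1 a b "real (Suc n)"] by (auto simp: k_def frechet_derivative_works)
      have kC: "continuous_on UNIV (\<lambda>x. frechet_derivative (k n) (at x) w)" for n w
        using box_bump_Ck[of 1 a b "real (Suc n)"] by (auto simp: k_def)
      have kdd: "has_dir_deriv_AE w (k n) (\<lambda>x. frechet_derivative (k n) (at x) w)" for n w
        unfolding has_dir_deriv_AE_def
        using borel_measurable_continuous_onI[OF kC] has_derivative_dir_deriv[OF kd] by auto
      have "\<exists>K. K-lipschitz_on UNIV (k n)" for n
      proof (rule C1_compact_support_lipschitz)
        show "Ck_on_open 1 UNIV (k n)" unfolding k_def by (rule box_bump_Ck)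
        show "bounded {x. k n x \<noteq> 0}" by (simp add: kz)
      qed
      then obtain K where K: "\<And>n. (K n)-lipschitz_on UNIV (k n)" by metis
      have [measurable]: "k n \<in> borel_measurable borel" for n
        using K lipschitz_on_continuous_on borel_measurable_continuous_onI by blast
      have bdk: "bounded {x. k n x \<noteq> 0}" for n by (simp add: kz bounded_box)
      note ibp = lipschitz_integration_by_parts[OF L K bdk D kdd]
      have zero: "(LINT x|lborel. ?G x * k n x) = 0" for n
      proof -
        have lin: "linear (frechet_derivative (k n) (at x))" for x using kd has_derivative_linear
          by blast
        have s: "frechet_derivative (k n) (at x) v
          = (\<Sum>i\<in>Basis. (v \<bullet> i) * frechet_derivative (k n) (at x) i)" for x
        proof -
          have "frechet_derivative (k n) (at x) v
            = frechet_derivative (k n) (at x) (\<Sum>i\<in>Basis. (v \<bullet> i) *\<^sub>R i)"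
            by (simp add: euclidean_representation)
          then show ?thesis by (simp add: linear_sum[OF lin] linear_scale[OF lin])
        qed
        have "(LINT x|lborel. D v x * k n x)
          = - (LINT x|lborel. f x * frechet_derivative (k n) (at x) v)"
          by (rule ibp)
        also have "\<dots> = - (LINT x|lborel. (\<Sum>i\<in>Basis. (v \<bullet> i) * (f x * frechet_derivative (k n) (at x)
          i)))"
          by (simp add: s sum_distrib_left ac_simps)
        also have "\<dots> = - (\<Sum>i\<in>Basis. (v \<bullet> i) * (LINT x|lborel. f x * frechet_derivative (k n) (at x)
          i))"
          using ibp(2) by (subst Bochner_Integration.integral_sum) auto
        also have "\<dots> = (\<Sum>i\<in>Basis. (v \<bullet> i) * (LINT x|lborel. D i x * k n x))"
          by (simp add: ibp(3) sum_negf)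
        also have "\<dots> = (LINT x|lborel. (\<Sum>i\<in>Basis. (v \<bullet> i) * (D i x * k n x)))"
          using ibp(1) by (subst Bochner_Integration.integral_sum) auto
        finally have "(LINT x|lborel. D v x * k n x)
          - (LINT x|lborel. (\<Sum>i\<in>Basis. (v \<bullet> i) * (D i x * k n x))) = 0"
          by simp
        moreover have "integrable lborel (\<lambda>x. \<Sum>i\<in>Basis. (v \<bullet> i) * (D i x * k n x))"
          by (intro Bochner_Integration.integrable_sum integrable_mult_right ibp(1))
        ultimately have "(LINT x|lborel. D v x * k n x - (\<Sum>i\<in>Basis. (v \<bullet> i) * (D i x * k n x))) = 0"
          using ibp(1) by (subst Bochner_Integration.integral_diff) auto
        then show ?thesis by (simp only: left_diff_distrib sum_distrib_right mult.assoc)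
      qed
      have "(\<lambda>n. LINT x|lborel. ?G x * k n x) \<longlonglongrightarrow> (LINT x|lborel. ?G x * indicator (box a b) x)"
      proof (rule integral_dominated_convergence[where w="\<lambda>x. \<bar>indicator (box a b) x * ?G x\<bar>"])
        show "integrable lborel (\<lambda>x. \<bar>indicator (box a b) x * ?G x\<bar>)"
          using gi[of "box a b"] by (intro integrable_abs) auto
        show "AE x in lborel. (\<lambda>n. ?G x * k n x) \<longlonglongrightarrow> ?G x * indicator (box a b) x"
          unfolding k_def by (intro AE_I2 tendsto_intros box_bump_tendsto)
        show "AE x in lborel. norm (?G x * k n x) \<le> \<bar>indicator (box a b) x * ?G x\<bar>" for n
        proof (rule AE_I2)
          fix x
          have "k n x = 0" if "x \<notin> box a b" using kz[of n] that by blast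
          then show "norm (?G x * k n x) \<le> \<bar>indicator (box a b) x * ?G x\<bar>"
            using box_bump_bounds[of a b "real (Suc n)" x]
            by (cases "x \<in> box a b") (auto simp: k_def abs_mult intro!: mult_left_le)
        qed
      qed measurable
      then show "(LINT x|lborel. indicator (box a b) x * ?G x) = 0"
        unfolding zero LIMSEQ_const_iff by (simp only: mult.commute)
    qed simp
    then show ?thesis by eventually_elim (simp add: g0v)
  qed
  obtain S :: "'a set" where S: "countable S" "\<And>X. open X \<Longrightarrow> X \<noteq> {} \<Longrightarrow> \<exists>d\<in>S. d \<in> X"
    using countable_dense_exists by metis
  have all: "AE x in lborel. \<forall>v\<in>S. ((\<lambda>t. f (x + t *\<^sub>R v)) has_real_derivative g0 x \<bullet> v) (at 0)"
    unfolding AE_ball_countable[OF S(1)]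
  proof
    fix v assume "v \<in> S"
    show "AE x in lborel. ((\<lambda>t. f (x + t *\<^sub>R v)) has_real_derivative g0 x \<bullet> v) (at 0)"
      using Dx[of v] lin[of v] by eventually_elim simp
  qed
  have der: "(f has_derivative (\<lambda>h. g0 x \<bullet> h)) (at x)"
    if x: "\<forall>v\<in>S. ((\<lambda>t. f (x + t *\<^sub>R v)) has_real_derivative g0 x \<bullet> v) (at 0)" for x
    unfolding has_derivative_at_alt
  proof (intro conjI allI impI)
    show "bounded_linear ((\<bullet>) (g0 x))" by (rule bounded_linear_inner_right)
    fix e :: real assume e: "0 < e"
    define M where "M = L + norm (g0 x) + 1"
    have M: "M > 0" using L0 by (simp add: M_def add_nonneg_pos)
    \<comment> \<open>Exchanging a direction for a net direction within \<open>e'\<close> costs at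
      most \<open>(L + norm (g0 x)) * e'\<close> per unit length, which is at most half of
      \<open>e\<close>; the net directions themselves use the other half.\<close>
    define e' where "e' = e / (2 * M)"
    have e': "e' > 0" using e M by (simp add: e'_def)
    have e'2: "(L + norm (g0 x)) * e' \<le> e / 2"
    proof -
      have "(L + norm (g0 x)) * e' \<le> M * e'" using e' by (simp add: M_def)
      also have "\<dots> = e / 2" using M by (simp add: e'_def)
      finally show ?thesis .
    qed
    have "sphere 0 1 \<subseteq> (\<Union>s\<in>S. ball s e')"
    proof
      fix w :: 'a
      obtain s where "s \<in> S" "s \<in> ball w e'" using S(2)[of "ball w e'"] e' by auto
      then show "w \<in> (\<Union>s\<in>S. ball s e')" by (auto simp: dist_commute)
    qed
    then obtain F where F: "F \<subseteq> S" "finite F" "sphere 0 1 \<subseteq> (\<Union>s\<in>F. ball s e')"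
      using compactE_image[of "sphere 0 1" S "\<lambda>s. ball s e'"] by auto
    have "eventually (\<lambda>t. \<forall>s\<in>F. \<bar>f (x + t *\<^sub>R s) - f x - t * (g0 x \<bullet> s)\<bar> \<le> (e / 2) * \<bar>t\<bar>) (at 0)"
    proof (rule eventually_ball_finite[OF F(2)], rule ballI)
      fix s assume "s \<in> F"
      then have "((\<lambda>t. f (x + t *\<^sub>R s)) has_real_derivative g0 x \<bullet> s) (at 0)" using x F by auto
      then have "((\<lambda>h. (f (x + h *\<^sub>R s) - f x) / h) \<longlongrightarrow> g0 x \<bullet> s) (at 0)" by (simp add: DERIV_def)
      then have "eventually (\<lambda>t. dist ((f (x + t *\<^sub>R s) - f x) / t) (g0 x \<bullet> s) < e / 2) (at 0)"
        using e by (auto dest: tendstoD[of _ _ _ "e/2"])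
      then show "eventually (\<lambda>t. \<bar>f (x + t *\<^sub>R s) - f x - t * (g0 x \<bullet> s)\<bar> \<le> (e / 2) * \<bar>t\<bar>) (at 0)"
        using eventually_at_ball'[of 1 0 UNIV, simplified]
      proof eventually_elim
        case (elim t)
        have "f (x + t *\<^sub>R s) - f x - t * (g0 x \<bullet> s) = ((f (x + t *\<^sub>R s) - f x) / t - g0 x \<bullet> s) * t"
          using elim by (simp add: field_simps)
        then show ?case using elim by (simp add: abs_mult dist_real_def mult_right_mono)
      qed
    qed
    then obtain d where d: "d > 0" "\<And>t s. t \<noteq> 0 \<Longrightarrow> \<bar>t\<bar> < d \<Longrightarrow> s \<in> F
      \<Longrightarrow> \<bar>f (x + t *\<^sub>R s) - f x - t * (g0 x \<bullet> s)\<bar> \<le> (e / 2) * \<bar>t\<bar>"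
      unfolding eventually_at by (auto simp: dist_real_def)
    show "\<exists>d>0. \<forall>y. norm (y - x) < d \<longrightarrow> norm (f y - f x - g0 x \<bullet> (y - x)) \<le> e * norm (y - x)"
    proof (intro exI[of _ d] conjI allI impI)
      fix y assume y: "norm (y - x) < d"
      show "norm (f y - f x - g0 x \<bullet> (y - x)) \<le> e * norm (y - x)"
      proof (cases "y = x")
        case False
        define t where "t = norm (y - x)"
        define w where "w = (y - x) /\<^sub>R t"
        have t: "t > 0" "t < d" using False y by (auto simp: t_def)
        have yx: "y = x + t *\<^sub>R w" using t by (simp add: w_def)
        have "w \<in> sphere 0 1" using t by (simp add: w_def t_def)
        then obtain s where s: "s \<in> F" "dist s w < e'" using F(3) by auto
        have 1: "\<bar>f y - f (x + t *\<^sub>R s)\<bar> \<le> L * (t * e')"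
        proof -
          have "\<bar>f y - f (x + t *\<^sub>R s)\<bar> \<le> L * dist y (x + t *\<^sub>R s)"
            using lipschitz_onD[OF L, of y "x + t *\<^sub>R s"] by (simp add: dist_real_def)
          also have "dist y (x + t *\<^sub>R s) = t * dist s w" using t
            by (simp add: yx dist_norm norm_minus_commute flip: scaleR_diff_right)
          also have "L * (t * dist s w) \<le> L * (t * e')" using s t L0 by (intro mult_left_mono) auto
          finally show ?thesis .
        qed
        have 2: "\<bar>f (x + t *\<^sub>R s) - f x - t * (g0 x \<bullet> s)\<bar> \<le> (e / 2) * t" using d(2)[of t s] t s
          by simp
        have 3: "\<bar>t * (g0 x \<bullet> s) - g0 x \<bullet> (y - x)\<bar> \<le> norm (g0 x) * (t * e')"
        proof -
          have "t * (g0 x \<bullet> s) - g0 x \<bullet> (y - x) = g0 x \<bullet> (t *\<^sub>R (s - w))"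
            by (simp add: yx inner_diff_right algebra_simps)
          also have "\<bar>\<dots>\<bar> \<le> norm (g0 x) * norm (t *\<^sub>R (s - w))" by (rule Cauchy_Schwarz_ineq2)
          also have "\<dots> \<le> norm (g0 x) * (t * e')" using s t
            by (intro mult_left_mono) (auto simp: dist_norm)
          finally show ?thesis .
        qed
        have "\<bar>f y - f x - g0 x \<bullet> (y - x)\<bar> \<le> L * (t * e') + (e / 2) * t + norm (g0 x) * (t * e')"
          using 1 2 3 by linarith
        also have "\<dots> = ((L + norm (g0 x)) * e' + e / 2) * t" by (simp add: algebra_simps)
        also have "\<dots> \<le> e * t" using e'2 t by (intro mult_right_mono) auto
        finally show ?thesis by (simp add: t_def)
      qed simp
    qed (rule d)
  qed
  have gb: "norm (g0 x) \<le> L" if "(f has_derivative (\<lambda>h. g0 x \<bullet> h)) (at x)" for x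
  proof -
    have "\<bar>g0 x \<bullet> g0 x\<bar> \<le> L * norm (g0 x)"
      using dir_deriv_bound[OF L has_derivative_dir_deriv[OF that]] .
    then have "norm (g0 x) * norm (g0 x) \<le> L * norm (g0 x)"
      by (simp add: dot_square_norm power2_eq_square)
    then show ?thesis using L0 mult_right_le_imp_le[of "norm (g0 x)" "norm (g0 x)" L]
      by (cases "norm (g0 x) > 0") auto
  qed
  \<comment> \<open>Resetting \<open>g0\<close> where its norm exceeds \<open>L\<close>, which
    happens only on a null set, makes the bound hold everywhere.\<close>
  define g where "g x = (if norm (g0 x) \<le> L then g0 x else 0)" for x
  have "g \<in> borel_measurable borel" unfolding g_def by measurable
  moreover have "\<forall>x. norm (g x) \<le> L" using L0 by (auto simp: g_def)
  moreover have "AE x in lborel. (f has_derivative (\<lambda>h. g x \<bullet> h)) (at x)"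
    using all
  proof eventually_elim
    case (elim x)
    from der[OF elim] gb[OF der[OF elim]] show ?case by (simp add: g_def)
  qed
  ultimately show ?thesis by blast
qed

subsection \<open>Averages over balls\<close>

lemma AE_lborel_shift:
  fixes c :: "'a::euclidean_space"
  assumes "AE x in lborel. P x"
  shows "AE x in lborel. P (c + x)"
proof -
  obtain N where N: "{x. \<not> P x} \<subseteq> N" "emeasure lborel N = 0" "N \<in> sets borel"
    using assms by (auto elim: AE_E)
  let ?N = "(+) c -` N"
  have m: "?N \<in> sets borel" using N(3) by (intro measurable_sets_borel[of _ borel]) auto
  have "emeasure lborel ?N = emeasure (distr lborel borel ((+) c)) N"
    using N(3) by (subst emeasure_distr) auto
  then have "emeasure lborel ?N = 0" using N by (simp add: lborel_distr_plus)
  then show ?thesis using N m by (intro AE_I[of _ _ ?N]) auto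
qed

text \<open>Wide enough for Lipschitz functions and bounded Borel gradients, closed under the
  algebra used below, and strong enough that an average over a ball is a genuine integral at every
  point, not just at almost every one.\<close>

definition loc_bdd_borel :: "('a::euclidean_space \<Rightarrow> 'b::euclidean_space) \<Rightarrow> bool" where
  "loc_bdd_borel f \<longleftrightarrow> f \<in> borel_measurable borel \<and> (\<forall>S. bounded S \<longrightarrow> bounded (f ` S))"

lemma loc_bdd_borel_measurable: "loc_bdd_borel f \<Longrightarrow> f \<in> borel_measurable borel"
  by (simp add: loc_bdd_borel_def)

lemma loc_bdd_borelE:
  assumes "loc_bdd_borel f" "bounded S"
  obtains B where "0 \<le> B" "\<And>x. x \<in> S \<Longrightarrow> norm (f x) \<le> B"
proof -
  have "bounded (f ` S)" using assms by (simp add: loc_bdd_borel_def)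
  then obtain B where "\<forall>x\<in>S. norm (f x) \<le> B" by (auto simp: bounded_iff)
  then show ?thesis using that[of "max B 0"] by (auto simp: le_max_iff_disj)
qed

lemma loc_bdd_borelI:
  assumes "f \<in> borel_measurable borel" "\<And>S. bounded S \<Longrightarrow> \<exists>B. \<forall>x\<in>S. norm (f x) \<le> B"
  shows "loc_bdd_borel f"
  using assms by (auto simp: loc_bdd_borel_def bounded_iff)

lemma loc_bdd_borel_continuous: "continuous_on UNIV f \<Longrightarrow> loc_bdd_borel f"
proof (rule loc_bdd_borelI)
  assume c: "continuous_on UNIV f"
  show "f \<in> borel_measurable borel" using c by (rule borel_measurable_continuous_onI)
  fix S :: "'a set" assume "bounded S"
  then have "compact (f ` closure S)"
    using c by (intro compact_continuous_image continuous_on_subset[OF c]) auto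
  then obtain B where "\<forall>x\<in>closure S. norm (f x) \<le> B"
    using compact_imp_bounded by (fastforce simp: bounded_iff)
  then show "\<exists>B. \<forall>x\<in>S. norm (f x) \<le> B" using closure_subset by blast
qed

lemma loc_bdd_borel_bounded: "f \<in> borel_measurable borel \<Longrightarrow> (\<And>x. norm (f x) \<le> B) \<Longrightarrow> loc_bdd_borel f"
  by (rule loc_bdd_borelI) auto

lemma loc_bdd_borel_lipschitz: "L-lipschitz_on UNIV f \<Longrightarrow> loc_bdd_borel f"
  by (intro loc_bdd_borel_continuous lipschitz_on_continuous_on)

lemma loc_bdd_borel_const: "loc_bdd_borel (\<lambda>x. c)"
  by (rule loc_bdd_borel_continuous) auto

lemma loc_bdd_borel_add: "loc_bdd_borel f \<Longrightarrow> loc_bdd_borel g \<Longrightarrow> loc_bdd_borel (\<lambda>x. f x + g x)"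
  by (auto simp: loc_bdd_borel_def intro!: borel_measurable_add bounded_plus_comp)

lemma loc_bdd_borel_diff: "loc_bdd_borel f \<Longrightarrow> loc_bdd_borel g \<Longrightarrow> loc_bdd_borel (\<lambda>x. f x - g x)"
  by (auto simp: loc_bdd_borel_def intro!: borel_measurable_diff bounded_minus_comp)

lemma loc_bdd_borel_linear:
  fixes T :: "'b::euclidean_space \<Rightarrow> 'c::euclidean_space" and f :: "'a::euclidean_space \<Rightarrow> 'b"
  assumes "bounded_linear T" "loc_bdd_borel f"
  shows "loc_bdd_borel (\<lambda>x. T (f x))"
proof (rule loc_bdd_borelI)
  have "T \<in> borel_measurable borel"
    using assms(1) by (intro borel_measurable_continuous_onI linear_continuous_on)
  then show "(\<lambda>x. T (f x)) \<in> borel_measurable borel"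
    using measurable_compose loc_bdd_borel_measurable[OF assms(2)] by blast
  fix S :: "'a set" assume "bounded S"
  then obtain B where B: "0 \<le> B" "\<And>x. x \<in> S \<Longrightarrow> norm (f x) \<le> B" using loc_bdd_borelE[OF assms(2)]
    by metis
  have "norm (T (f x)) \<le> onorm T * B" if "x \<in> S" for x
    using onorm[OF assms(1), of "f x"] mult_left_mono[OF B(2)[OF that] onorm_pos_le[OF assms(1)]]
      by linarith
  then show "\<exists>B. \<forall>x\<in>S. norm (T (f x)) \<le> B" by blast
qed

lemma loc_bdd_borel_norm: "loc_bdd_borel f \<Longrightarrow> loc_bdd_borel (\<lambda>x. norm (f x))"
  by (auto simp: loc_bdd_borel_def bounded_iff)

lemma loc_bdd_borel_scaleR:
  assumes "loc_bdd_borel f" "loc_bdd_borel g"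
  shows "loc_bdd_borel (\<lambda>x. f x *\<^sub>R g x)"
proof (rule loc_bdd_borelI)
  show "(\<lambda>x. f x *\<^sub>R g x) \<in> borel_measurable borel"
    using assms by (auto simp: loc_bdd_borel_def)
  fix S :: "'a set" assume S: "bounded S"
  obtain A where "0 \<le> A" "\<And>x. x \<in> S \<Longrightarrow> norm (f x) \<le> A" using loc_bdd_borelE[OF assms(1) S] by metis
  moreover obtain B where "0 \<le> B" "\<And>x. x \<in> S \<Longrightarrow> norm (g x) \<le> B" using loc_bdd_borelE[OF assms(2) S]
    by metis
  ultimately show "\<exists>B. \<forall>x\<in>S. norm (f x *\<^sub>R g x) \<le> B"
    by (intro exI[of _ "A * B"]) (auto intro!: mult_mono)
qed

lemma loc_bdd_borel_mult:
  fixes f g :: "'a::euclidean_space \<Rightarrow> real"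
  shows "loc_bdd_borel f \<Longrightarrow> loc_bdd_borel g \<Longrightarrow> loc_bdd_borel (\<lambda>x. f x * g x)"
  using loc_bdd_borel_scaleR[of f g] by simp

lemma loc_bdd_borel_power2:
  fixes f :: "'a::euclidean_space \<Rightarrow> real"
  shows "loc_bdd_borel f \<Longrightarrow> loc_bdd_borel (\<lambda>x. (f x)\<^sup>2)"
  using loc_bdd_borel_mult[of f f] by (simp add: power2_eq_square)

lemma loc_bdd_borel_inner: "loc_bdd_borel f \<Longrightarrow> loc_bdd_borel (\<lambda>x. f x \<bullet> c)"
  by (rule loc_bdd_borel_linear[OF bounded_linear_inner_left])

lemmas loc_bdd_borel_intros = loc_bdd_borel_const loc_bdd_borel_add loc_bdd_borel_diff
  loc_bdd_borel_norm loc_bdd_borel_scaleR loc_bdd_borel_mult loc_bdd_borel_power2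
    loc_bdd_borel_inner

text \<open>The uniform distribution on a ball around 0, written as a finite measure: averages
  become convolutions, so that one Tonelli estimate serves them and the Cauchy kernel alike.\<close>

definition disc_measure :: "real \<Rightarrow> 'a::euclidean_space measure" where
  "disc_measure e = density lborel (\<lambda>z. ennreal (indicator (ball 0 e) z / measure lborel (ball
    (0::'a) e)))"

definition avg :: "real \<Rightarrow> ('a::euclidean_space \<Rightarrow> 'b::euclidean_space) \<Rightarrow> 'a \<Rightarrow> 'b" where
  "avg e f x = (LINT z|disc_measure e. f (x + z))"

lemma sets_disc_measure [simp, measurable_cong]: "sets (disc_measure e) = sets borel"
  and space_disc_measure [simp]: "space (disc_measure e) = UNIV"
  by (auto simp: disc_measure_def)

lemma disc_density_measurable [measurable, simp]:
  "(\<lambda>z::'a::euclidean_space. indicator (ball 0 e) z / c :: real) \<in> borel_measurable borel"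
  by (intro borel_measurable_divide borel_measurable_indicator borel_measurable_const borel_open
    open_ball)

lemma measure_ball_pos: "0 < e \<Longrightarrow> 0 < measure lborel (ball (0::'a::euclidean_space) e)"
  by (simp add: content_ball)

lemma emeasure_disc_measure: "0 < e \<Longrightarrow> emeasure (disc_measure e :: 'a::euclidean_space measure) UNIV
  = 1"
proof -
  assume e: "0 < e"
  let ?m = "measure lborel (ball (0::'a) e)"
  have "emeasure (disc_measure e :: 'a measure) UNIV
    = (\<integral>\<^sup>+z. ennreal (1 / ?m) * indicator (ball (0::'a) e) z \<partial>lborel)"
    unfolding disc_measure_def
    by (subst emeasure_density) (auto intro!: nn_integral_cong simp: indicator_def)
  also have "\<dots> = ennreal (1 / ?m) * emeasure lborel (ball (0::'a) e)"
    by (subst nn_integral_cmult_indicator) auto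
  also have "\<dots> = ennreal (1 / ?m) * ennreal ?m"
    using emeasure_lborel_ball_finite[of "0::'a" e] by (subst emeasure_eq_ennreal_measure) auto
  also have "\<dots> = 1" using measure_ball_pos[OF e, where 'a='a] by (simp flip: ennreal_mult)
  finally show ?thesis .
qed

lemma finite_measure_disc: "0 < e \<Longrightarrow> finite_measure (disc_measure e :: 'a::euclidean_space measure)"
  by (rule finite_measureI) (simp add: emeasure_disc_measure)

lemma AE_disc_in_ball: "AE z in disc_measure e. z \<in> ball 0 e"
  unfolding disc_measure_def by (subst AE_density) (auto simp: indicator_def)

lemma AE_disc_shift:
  assumes "AE x in lborel. P x"
  shows "AE z in disc_measure e. P (x + z)"
  unfolding disc_measure_def using AE_lborel_shift[OF assms, of x]
  by (subst AE_density) auto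

lemma loc_bdd_borel_integrable_disc:
  fixes x :: "'a::euclidean_space"
  assumes f: "loc_bdd_borel f" and e: "0 < e"
  shows "integrable (disc_measure e) (\<lambda>z. f (x + z))"
proof -
  interpret finite_measure "disc_measure e :: 'a measure" by (rule finite_measure_disc[OF e])
  have [measurable]: "f \<in> borel_measurable borel" using f by (rule loc_bdd_borel_measurable)
  obtain B where B: "\<And>y. y \<in> ball x e \<Longrightarrow> norm (f y) \<le> B" using loc_bdd_borelE[OF f bounded_ball]
    by metis
  have "AE z in disc_measure e. norm (f (x + z)) \<le> B"
    using AE_disc_in_ball by eventually_elim (auto intro!: B simp: dist_norm)
  then show ?thesis by (rule integrable_const_bound) measurable
qed

lemma avg_add: "loc_bdd_borel f \<Longrightarrow> loc_bdd_borel g \<Longrightarrow> 0 < e \<Longrightarrow> avg e (\<lambda>x. f x + g x) x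
  = avg e f x + avg e g x"
  unfolding avg_def by (intro Bochner_Integration.integral_add loc_bdd_borel_integrable_disc)

lemma avg_diff: "loc_bdd_borel f \<Longrightarrow> loc_bdd_borel g \<Longrightarrow> 0 < e \<Longrightarrow> avg e (\<lambda>x. f x - g x) x
  = avg e f x - avg e g x"
  unfolding avg_def by (intro Bochner_Integration.integral_diff loc_bdd_borel_integrable_disc)

lemma avg_const: "0 < e \<Longrightarrow> avg e (\<lambda>x. c) (x::'a::euclidean_space) = c"
  using emeasure_disc_measure[of e, where 'a='a] by (simp add: avg_def measure_def)

lemma avg_linear:
  assumes "bounded_linear T" "loc_bdd_borel f" "0 < e"
  shows "avg e (\<lambda>x. T (f x)) x = T (avg e f x)"
  unfolding avg_def by (intro integral_bounded_linear assms loc_bdd_borel_integrable_disc)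

lemma norm_avg_le:
  fixes x :: "'a::euclidean_space"
  assumes "0 < e" "\<And>y. y \<in> ball x e \<Longrightarrow> norm (f y) \<le> B" "0 \<le> B"
  shows "norm (avg e f x) \<le> B"
proof -
  interpret finite_measure "disc_measure e :: 'a measure" by (rule finite_measure_disc[OF assms(1)])
  have "norm (avg e f x) \<le> (LINT z|disc_measure e. norm (f (x + z)))"
    unfolding avg_def by (rule integral_norm_bound)
  also have "\<dots> \<le> (LINT z|(disc_measure e :: 'a measure). B)"
  proof (rule integral_mono_AE')
    show "AE z in disc_measure e. norm (f (x + z)) \<le> B"
      using AE_disc_in_ball by eventually_elim (auto intro!: assms(2) simp: dist_norm)
    show "AE z in (disc_measure e :: 'a measure). 0 \<le> B" using assms(3) by simp
  qed simp
  also have "\<dots> = B" using avg_const[OF assms(1), of B x] by (simp add: avg_def)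
  finally show ?thesis .
qed

lemma avg_borel:
  fixes f :: "'a::euclidean_space \<Rightarrow> 'b::euclidean_space"
  assumes [measurable]: "f \<in> borel_measurable borel" and "0 < e"
  shows "avg e f \<in> borel_measurable borel"
proof -
  interpret finite_measure "disc_measure e :: 'a measure" by (rule finite_measure_disc[OF assms(2)])
  have "(\<lambda>x. LINT z|disc_measure e. f (x + z)) \<in> borel_measurable borel"
    by (rule borel_measurable_lebesgue_integral) measurable
  then show ?thesis by (simp add: avg_def[abs_def])
qed

text \<open>Used with two choices of \<open>a\<close>: the average itself, which yields Jensen's
  inequality, and the value at \<open>x\<close>, which yields the local variance.\<close>

lemma avg_norm_diff_sq:
  assumes f: "loc_bdd_borel f" and e: "0 < e"
  shows "avg e (\<lambda>y. (norm (f y - a))\<^sup>2) x = avg e (\<lambda>y. (norm (f y))\<^sup>2) x - 2 * (avg e f x \<bullet> a)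
    + (norm a)\<^sup>2"
proof -
  have "(\<lambda>y. (norm (f y - a))\<^sup>2) = (\<lambda>y. ((norm (f y))\<^sup>2 - (2 * (f y \<bullet> a))) + (norm a)\<^sup>2)"
    by (simp add: fun_eq_iff power2_norm_eq_inner inner_diff_left inner_diff_right inner_commute)
  moreover have l: "loc_bdd_borel (\<lambda>y. 2 * (f y \<bullet> a))" "loc_bdd_borel (\<lambda>y. (norm (f y))\<^sup>2)"
    using f by (auto intro!: loc_bdd_borel_intros)
  moreover have "avg e (\<lambda>y. 2 * (f y \<bullet> a)) x = 2 * (avg e f x \<bullet> a)"
    by (rule avg_linear[of "\<lambda>w. 2 * (w \<bullet> a)"])
      (use f e in \<open>auto intro!: bounded_linear_const_mult bounded_linear_inner_left\<close>)
  ultimately show ?thesis using e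
    by (simp add: avg_add avg_diff avg_const loc_bdd_borel_intros)
qed

lemma avg_jensen:
  assumes f: "loc_bdd_borel f" and e: "0 < e"
  shows "(norm (avg e f x))\<^sup>2 \<le> avg e (\<lambda>y. (norm (f y))\<^sup>2) x"
proof -
  have "0 \<le> avg e (\<lambda>y. (norm (f y - avg e f x))\<^sup>2) x"
    unfolding avg_def by (rule Bochner_Integration.integral_nonneg) simp
  then show ?thesis
    unfolding avg_norm_diff_sq[OF f e] by (simp add: power2_norm_eq_inner)
qed

lemma ennreal_avg:
  fixes f :: "'a::euclidean_space \<Rightarrow> real"
  assumes "loc_bdd_borel f" "0 < e" "\<And>x. 0 \<le> f x"
  shows "ennreal (avg e f x) = (\<integral>\<^sup>+z. ennreal (f (x + z)) \<partial>disc_measure e)"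
  unfolding avg_def using assms
  by (intro nn_integral_eq_integral[symmetric] loc_bdd_borel_integrable_disc) auto

text \<open>Tonelli and translation: for almost every \<open>z\<close> the shifted set stays inside
  \<open>K'\<close>, so the total mass of \<open>N\<close> is the only factor lost.\<close>

lemma nn_integral_convolution_le:
  fixes f :: "'a::euclidean_space \<Rightarrow> ennreal" and N :: "'a measure"
  assumes N: "finite_measure N" and [measurable_cong]: "sets N = sets borel"
    and r: "AE z in N. z \<in> ball 0 r"
    and [measurable]: "f \<in> borel_measurable borel" "K \<in> sets borel" "K' \<in> sets borel"
    and K: "\<And>x z. x \<in> K \<Longrightarrow> z \<in> ball 0 r \<Longrightarrow> x + z \<in> K'"
  shows "(\<integral>\<^sup>+x\<in>K. (\<integral>\<^sup>+z. f (x + z) \<partial>N) \<partial>lborel) \<le> emeasure N UNIV * (\<integral>\<^sup>+x\<in>K'. f x \<partial>lborel)"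
proof -
  interpret N: finite_measure N by fact
  interpret pair_sigma_finite N "lborel :: 'a measure" ..
  have sp: "space N = UNIV" using sets_eq_imp_space_eq[OF assms(2)] by simp
  have "(\<integral>\<^sup>+x\<in>K. (\<integral>\<^sup>+z. f (x + z) \<partial>N) \<partial>lborel)
    = (\<integral>\<^sup>+x. (\<integral>\<^sup>+z. f (x + z) * indicator K x \<partial>N) \<partial>lborel)"
    by (intro nn_integral_cong nn_integral_multc[symmetric]) measurable
  also have "\<dots> = (\<integral>\<^sup>+z. (\<integral>\<^sup>+x. f (x + z) * indicator K x \<partial>lborel) \<partial>N)"
    by (rule Fubini') measurable
  also have "\<dots> \<le> (\<integral>\<^sup>+z. (\<integral>\<^sup>+x\<in>K'. f x \<partial>lborel) \<partial>N)"
  proof (rule nn_integral_mono_AE)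
    show "AE z in N. (\<integral>\<^sup>+x. f (x + z) * indicator K x \<partial>lborel) \<le> (\<integral>\<^sup>+x\<in>K'. f x \<partial>lborel)"
      using r
    proof eventually_elim
      case (elim z)
      have "(\<integral>\<^sup>+x. f (x + z) * indicator K x \<partial>lborel)
        \<le> (\<integral>\<^sup>+x. f (x + z) * indicator K' (x + z) \<partial>lborel)"
        using K[OF _ elim] by (intro nn_integral_mono) (auto simp: indicator_def)
      also have "\<dots> = (\<integral>\<^sup>+x\<in>K'. f x \<partial>lborel)"
        by (rule nn_integral_lborel_shift[of "\<lambda>x. f x * indicator K' x"]) measurable
      finally show ?case .
    qed
  qed
  also have "\<dots> = emeasure N UNIV * (\<integral>\<^sup>+x\<in>K'. f x \<partial>lborel)"
    using sp by (simp add: mult.commute)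
  finally show ?thesis .
qed

section \<open>Gradients almost everywhere and averages of Lipschitz functions\<close>

definition has_gradient_AE :: "('a::euclidean_space \<Rightarrow> real) \<Rightarrow> ('a \<Rightarrow> 'a) \<Rightarrow> bool" where
  "has_gradient_AE f g \<longleftrightarrow> g \<in> borel_measurable borel \<and> (\<exists>B. \<forall>x. norm (g x) \<le> B) \<and>
     (AE x in lborel. (f has_derivative (\<lambda>h. g x \<bullet> h)) (at x))"

lemma lipschitz_has_gradient_AE: "L-lipschitz_on UNIV f \<Longrightarrow> \<exists>g. has_gradient_AE f g"
  using rademacher unfolding has_gradient_AE_def by metis

lemma has_gradient_AE_loc_bdd: "has_gradient_AE f g \<Longrightarrow> loc_bdd_borel g"
  unfolding has_gradient_AE_def using loc_bdd_borel_bounded by metis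

lemma has_gradient_AE_dir_deriv: "has_gradient_AE f g \<Longrightarrow> has_dir_deriv_AE v f (\<lambda>x. g x \<bullet> v)"
  unfolding has_gradient_AE_def has_dir_deriv_AE_def
  by (auto elim!: eventually_mono dest: has_derivative_dir_deriv[where v=v])

lemma has_gradient_AE_diff:
  assumes "has_gradient_AE f g" "has_gradient_AE u h"
  shows "has_gradient_AE (\<lambda>x. f x - u x) (\<lambda>x. g x - h x)"
proof -
  have [measurable]: "g \<in> borel_measurable borel" "h \<in> borel_measurable borel"
    using assms by (auto simp: has_gradient_AE_def)
  obtain A B where "\<And>x. norm (g x) \<le> A" "\<And>x. norm (h x) \<le> B" using assms
    unfolding has_gradient_AE_def by metis
  then have "norm (g x - h x) \<le> A + B" for x by (meson add_mono norm_triangle_le_diff)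
  moreover have "AE x in lborel. ((\<lambda>x. f x - u x) has_derivative (\<lambda>v. (g x - h x) \<bullet> v)) (at x)"
    using assms[unfolded has_gradient_AE_def, THEN conjunct2, THEN conjunct2]
    by eventually_elim (auto intro!: derivative_eq_intros simp: inner_diff_left)
  ultimately show ?thesis unfolding has_gradient_AE_def by (auto intro!: borel_measurable_diff)
qed

lemma has_gradient_AE_uminus:
  assumes "has_gradient_AE f g"
  shows "has_gradient_AE (\<lambda>x. - f x) (\<lambda>x. - g x)"
  using assms unfolding has_gradient_AE_def
  by (auto elim!: eventually_mono intro!: derivative_eq_intros)

lemma has_gradient_AE_shift:
  assumes "has_gradient_AE f g"
  shows "has_gradient_AE (\<lambda>z. f (x + z)) (\<lambda>z. g (x + z))"
proof -
  have [measurable]: "g \<in> borel_measurable borel" using assms by (auto simp: has_gradient_AE_def)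
  have "AE z in lborel. ((\<lambda>z. f (x + z)) has_derivative (\<lambda>h. g (x + z) \<bullet> h)) (at z)"
    using AE_lborel_shift[OF assms[unfolded has_gradient_AE_def, THEN conjunct2, THEN conjunct2], of
      x]
  proof eventually_elim
    case (elim z)
    have "((\<lambda>z. x + z) has_derivative (\<lambda>h. h)) (at z)" by (auto intro!: derivative_eq_intros)
    from has_derivative_compose[OF this elim] show ?case by simp
  qed
  then show ?thesis using assms unfolding has_gradient_AE_def by auto
qed

lemma avg_lipschitz:
  fixes u :: "'a::euclidean_space \<Rightarrow> real"
  assumes L: "L-lipschitz_on UNIV u" and e: "0 < e"
  shows "L-lipschitz_on UNIV (avg e u)"
proof (rule lipschitz_onI)
  fix x y :: 'a
  have lb: "loc_bdd_borel (\<lambda>z. u (z + (y - x)))"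
    by (intro loc_bdd_borel_continuous continuous_on_compose2[OF lipschitz_on_continuous_on[OF L]]
      continuous_intros) auto
  have "avg e u y = avg e (\<lambda>z. u (z + (y - x))) x" by (simp add: avg_def algebra_simps)
  then have "avg e u x - avg e u y = avg e (\<lambda>z. u z - u (z + (y - x))) x"
    using avg_diff[OF loc_bdd_borel_lipschitz[OF L] lb e, of x] by simp
  also have "norm \<dots> \<le> L * dist x y"
  proof (rule norm_avg_le[OF e])
    show "norm (u z - u (z + (y - x))) \<le> L * dist x y" for z
      using lipschitz_onD[OF L, of z "z + (y - x)"] by (simp add: dist_norm norm_minus_commute)
  qed (use lipschitz_on_nonneg[OF L] in auto)
  finally show "dist (avg e u x) (avg e u y) \<le> L * dist x y" by (simp add: dist_norm)
qed (rule lipschitz_on_nonneg[OF L])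

text \<open>Differentiation under the integral: the remainder quotients are bounded by
  \<open>L + B\<close> and tend to 0 for almost every \<open>z\<close>. So the average is
  differentiable at each point, although \<open>u\<close> is so only almost everywhere.\<close>

lemma avg_has_derivative:
  fixes u :: "'a::euclidean_space \<Rightarrow> real"
  assumes L: "L-lipschitz_on UNIV u" and g: "has_gradient_AE u g" and e: "0 < e"
  shows "(avg e u has_derivative (\<lambda>h. avg e g x \<bullet> h)) (at x)"
proof -
  interpret finite_measure "disc_measure e :: 'a measure" by (rule finite_measure_disc[OF e])
  have gl: "loc_bdd_borel g" using g by (rule has_gradient_AE_loc_bdd)
  have ul: "loc_bdd_borel u" using L by (rule loc_bdd_borel_lipschitz)
  have [measurable]: "g \<in> borel_measurable borel" "u \<in> borel_measurable borel"
    using gl ul loc_bdd_borel_measurable by auto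
  obtain B where B: "\<And>x. norm (g x) \<le> B" using g by (auto simp: has_gradient_AE_def)
  have der: "AE z in disc_measure e. (u has_derivative (\<lambda>h. g (x + z) \<bullet> h)) (at (x + z))"
    using g by (intro AE_disc_shift) (auto simp: has_gradient_AE_def)
  define R where "R h z = (u (x + z + h) - u (x + z) - g (x + z) \<bullet> h) / norm h" for h z
  have Rb: "norm (R h z) \<le> L + B" if "h \<noteq> 0" for h z
  proof -
    have "\<bar>u (x + z + h) - u (x + z)\<bar> \<le> L * norm h"
      using lipschitz_onD[OF L, of "x + z + h" "x + z"] by (simp add: dist_norm)
    moreover have "\<bar>g (x + z) \<bullet> h\<bar> \<le> B * norm h"
      using Cauchy_Schwarz_ineq2[of "g (x + z)" h] B[of "x + z"]
        by (meson mult_right_mono norm_ge_zero order_trans)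
    ultimately have "\<bar>u (x + z + h) - u (x + z) - g (x + z) \<bullet> h\<bar> \<le> (L + B) * norm h"
      by (simp add: algebra_simps)
    then show ?thesis using that by (simp add: R_def field_simps)
  qed
  have eq: "(avg e u (x + h) - avg e u x - avg e g x \<bullet> h) /\<^sub>R norm h
    = (LINT z|disc_measure e. R h z)" for h
  proof -
    have i: "integrable (disc_measure e) (\<lambda>z. u (x + z + h))" "integrable (disc_measure e) (\<lambda>z. u (x
      + z))"
        "integrable (disc_measure e) (\<lambda>z. g (x + z) \<bullet> h)"
      using loc_bdd_borel_integrable_disc[OF ul e, of "x
        + h"] loc_bdd_borel_integrable_disc[OF ul e, of x]
        loc_bdd_borel_integrable_disc[OF loc_bdd_borel_inner[OF gl] e, of x]
          by (auto simp: algebra_simps)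
    have "avg e g x \<bullet> h = (LINT z|disc_measure e. g (x + z) \<bullet> h)"
      using avg_linear[OF bounded_linear_inner_left gl e, of h x] by (simp add: avg_def)
    moreover have "avg e u (x + h) = (LINT z|disc_measure e. u (x + z + h))"
      by (simp add: avg_def algebra_simps)
    ultimately show ?thesis using i
      by (simp add: R_def avg_def divide_inverse mult.commute)
  qed
  have "((\<lambda>h. (avg e u (x + h) - avg e u x - avg e g x \<bullet> h) /\<^sub>R norm h) \<longlongrightarrow> 0) (at 0)"
    unfolding eq tendsto_at_iff_sequentially
  proof (intro allI impI)
    fix X :: "nat \<Rightarrow> 'a" assume X: "\<forall>i. X i \<in> UNIV - {0}" "X \<longlonglongrightarrow> 0"
    have "(\<lambda>n. LINT z|disc_measure e. R (X n) z) \<longlonglongrightarrow> (LINT z|(disc_measure e :: 'a measure). 0)"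
    proof (rule integral_dominated_convergence[where w="\<lambda>_. L + B"])
      show "R (X n) \<in> borel_measurable (disc_measure e)" for n unfolding R_def by measurable
      show "AE z in disc_measure e. (\<lambda>n. R (X n) z) \<longlonglongrightarrow> 0"
        using der
      proof eventually_elim
        case (elim z)
        have "((\<lambda>h. norm (u (x + z + h) - u (x + z) - g (x + z) \<bullet> h) / norm h) \<longlongrightarrow> 0) (at 0)"
          using elim by (simp add: has_derivative_at)
        moreover have "filterlim X (at 0) sequentially"
          using X by (auto intro!: filterlim_atI)
        ultimately have "(\<lambda>n. norm (u (x + z + X n) - u (x + z) - g (x + z) \<bullet> X n) / norm (X n))
          \<longlonglongrightarrow> 0"
          by (rule filterlim_compose)
        then have "(\<lambda>n. norm (R (X n) z)) \<longlonglongrightarrow> 0" by (simp add: R_def)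
        then show ?case by (rule tendsto_norm_zero_cancel)
      qed
      show "AE z in disc_measure e. norm (R (X n) z) \<le> L + B" for n
        using X by (intro AE_I2 Rb) auto
    qed simp_all
    then show "((\<lambda>h. LINT z|disc_measure e. R h z) \<circ> X) \<longlonglongrightarrow> 0" by (simp add: o_def)
  qed
  then have "((\<lambda>h. norm (avg e u (x + h) - avg e u x - avg e g x \<bullet> h) / norm h) \<longlongrightarrow> 0) (at 0)"
    using tendsto_norm_zero by (fastforce simp: divide_inverse mult.commute abs_mult)
  then show ?thesis by (simp add: has_derivative_at bounded_linear_inner_right)
qed

lemma has_gradient_AE_avg:
  assumes "L-lipschitz_on UNIV u" "has_gradient_AE u g" "0 < e"
  shows "has_gradient_AE (avg e u) (avg e g)"
proof -
  obtain B where B: "\<And>x. norm (g x) \<le> B" using assms(2) by (auto simp: has_gradient_AE_def)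
  have "0 \<le> B" using norm_ge_zero B order_trans by blast
  then have "norm (avg e g x) \<le> B" for x using B assms(3) by (intro norm_avg_le) auto
  moreover have "avg e g \<in> borel_measurable borel"
    using assms by (intro avg_borel) (auto simp: has_gradient_AE_def)
  ultimately show ?thesis unfolding has_gradient_AE_def
    using avg_has_derivative[OF assms] by auto
qed

subsection \<open>The Cauchy-Pompeiu formula for averages\<close>

lemma borel_measurable_vec_nth [measurable (raw)]:
  fixes f :: "'a \<Rightarrow> real^'n"
  assumes "f \<in> borel_measurable M"
  shows "(\<lambda>x. f x $ i) \<in> borel_measurable M"
proof -
  have "(\<lambda>y::real^'n. y $ i) \<in> borel_measurable borel"
    by (intro borel_measurable_continuous_onI continuous_intros)
  then show ?thesis using assms by (rule measurable_compose[rotated])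
qed

text \<open>The Cauchy kernel \<open>z / \<bar>z\<bar>\<^sup>2\<close>, truncated at radius \<open>d\<close>. Its divergence is \<open>2 / d\<^sup>2\<close> on the disc of
  radius \<open>d\<close> and \<open>0\<close> outside, so integration by parts against the difference of the truncations at
  two radii, which has compact support, compares the averages over the two discs.\<close>

definition trunc_kernel :: "real \<Rightarrow> real^2 \<Rightarrow> real^2" where
  "trunc_kernel d z = (1 / (max (norm z) d)\<^sup>2) *\<^sub>R z"

definition trunc_kernel' :: "real \<Rightarrow> real^2 \<Rightarrow> real^2 \<Rightarrow> real^2" where
  "trunc_kernel' d z v = (if norm z < d then (1 / d\<^sup>2) *\<^sub>R v
     else (1 / (norm z)\<^sup>2) *\<^sub>R v - (2 * (z \<bullet> v) / (norm z) ^ 4) *\<^sub>R z)"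

text \<open>Truncation removes the singularity at the origin, so the kernel becomes an admissible
  factor in integration by parts. In the constant, \<open>1 / m\<^sup>2\<close> is counted twice,
  from the difference of the points and from that of the scalar factors, and
  \<open>1 / (m * k)\<close> once.\<close>

lemma trunc_kernel_lipschitz:
  assumes d: "0 < d"
  shows "(3 / d\<^sup>2)-lipschitz_on UNIV (trunc_kernel d)"
proof (rule lipschitz_onI)
  fix z w :: "real^2"
  define m k n where "m = max (norm z) d" and "k = max (norm w) d" and "n = norm (z - w)"
  have m: "d \<le> m" "d \<le> k" "norm w \<le> k" "0 < m" "0 < k" using d by (auto simp: m_def k_def)
  have n: "\<bar>k - m\<bar> \<le> n" "0 \<le> n"
    using norm_triangle_ineq3[of z w] by (auto simp: m_def k_def n_def)
  have "trunc_kernel d z - trunc_kernel d w = (1 / m\<^sup>2) *\<^sub>R (z - w) + (1 / m\<^sup>2 - 1 / k\<^sup>2) *\<^sub>R w"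
    by (simp add: trunc_kernel_def m_def k_def algebra_simps)
  then have "norm (trunc_kernel d z - trunc_kernel d w)
    \<le> (1 / m\<^sup>2) * n + \<bar>1 / m\<^sup>2 - 1 / k\<^sup>2\<bar> * norm w"
    by (metis (no_types, opaque_lifting) abs_divide abs_one abs_power2 n_def norm_scaleR
      norm_triangle_ineq)
  also have "\<bar>1 / m\<^sup>2 - 1 / k\<^sup>2\<bar> * norm w \<le> \<bar>1 / m\<^sup>2 - 1 / k\<^sup>2\<bar> * k"
    using m by (intro mult_left_mono) auto
  also have "1 / m\<^sup>2 - 1 / k\<^sup>2 = (k - m) * ((k + m) / (m\<^sup>2 * k\<^sup>2))"
    using m by (simp add: field_simps power2_eq_square)
  also have "\<bar>(k - m) * ((k + m) / (m\<^sup>2 * k\<^sup>2))\<bar> * k \<le> n * ((k + m) / (m\<^sup>2 * k\<^sup>2)) * k"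
    using n m by (intro mult_right_mono) (auto
      simp: abs_mult intro!: divide_right_mono mult_right_mono)
  also have "n * ((k + m) / (m\<^sup>2 * k\<^sup>2)) * k = n * (1 / m\<^sup>2 + 1 / (m * k))"
    using m by (simp add: field_simps power2_eq_square)
  finally have 1: "norm (trunc_kernel d z - trunc_kernel d w) \<le> n * (2 * (1 / m\<^sup>2) + 1 / (m * k))"
    by (simp add: algebra_simps)
  have "1 / m\<^sup>2 \<le> 1 / d\<^sup>2" using m d by (intro divide_left_mono power_mono mult_pos_pos) auto
  moreover have "1 / (m * k) \<le> 1 / d\<^sup>2" using m d
    unfolding power2_eq_square by (intro divide_left_mono mult_mono mult_pos_pos) auto
  ultimately have "n * (2 * (1 / m\<^sup>2) + 1 / (m * k)) \<le> n * (2 * (1 / d\<^sup>2) + 1 / d\<^sup>2)"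
    using n by (intro mult_left_mono add_mono) auto
  with 1 have "norm (trunc_kernel d z - trunc_kernel d w) \<le> n * (2 * (1 / d\<^sup>2) + 1 / d\<^sup>2)"
    by linarith
  then show "dist (trunc_kernel d z) (trunc_kernel d w) \<le> 3 / d\<^sup>2 * dist z w"
    by (simp add: dist_norm n_def mult.commute)
qed simp

lemma trunc_kernel_has_derivative:
  assumes d: "0 < d" and z: "norm z \<noteq> d"
  shows "(trunc_kernel d has_derivative trunc_kernel' d z) (at z)"
proof (cases "norm z < d")
  case True
  have "((\<lambda>z. (1 / d\<^sup>2) *\<^sub>R z) has_derivative trunc_kernel' d z) (at z)"
    using True by (auto simp: trunc_kernel'_def[abs_def] intro!: derivative_eq_intros)
  then show ?thesis
    by (rule has_derivative_transform_within_open[of _ _ _ _ "ball 0 d"])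
      (use True in \<open>auto simp: trunc_kernel_def max_def\<close>)
next
  case False
  with z have zd: "norm z > d" "norm z > 0" using d by auto
  then have zz: "z \<bullet> z \<noteq> 0" by auto
  have n4: "norm z ^ 4 = (z \<bullet> z)\<^sup>2"
    by (simp add: power2_norm_eq_inner[symmetric] power_mult[symmetric])
  have "((\<lambda>z. (1 / (z \<bullet> z)) *\<^sub>R z) has_derivative trunc_kernel' d z) (at z)"
    using False zz unfolding trunc_kernel'_def[abs_def] n4 power2_norm_eq_inner
    by (auto intro!: derivative_eq_intros
      simp: fun_eq_iff inner_commute power2_eq_square divide_inverse algebra_simps)
  then show ?thesis
    by (rule has_derivative_transform_within_open[of _ _ _ _ "- cball 0 d"])
      (use zd in \<open>auto simp: trunc_kernel_def max_def open_Compl power2_norm_eq_inner\<close>)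
qed

lemma trunc_kernel_has_dir_deriv:
  assumes d: "0 < d"
  shows "has_dir_deriv_AE v (\<lambda>z. trunc_kernel d z $ i) (\<lambda>z. trunc_kernel' d z v $ i)"
proof -
  have "AE z in lborel. z \<notin> sphere (0::real^2) d"
    using negligible_sphere[of "0::real^2" d]
    by (intro AE_not_in) (simp add: negligible_iff_null_sets null_sets_completion_iff)
  then have "AE z in lborel. ((\<lambda>t. trunc_kernel d (z
    + t *\<^sub>R v) $ i) has_real_derivative trunc_kernel' d z v $ i) (at 0)"
  proof eventually_elim
    case (elim z)
    then have "(trunc_kernel d has_derivative trunc_kernel' d z) (at z)" using d
      by (intro trunc_kernel_has_derivative) auto
    then have "((\<lambda>z. trunc_kernel d z $ i) has_derivative (\<lambda>v. trunc_kernel' d z v $ i)) (at z)"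
      by (rule bounded_linear.has_derivative[OF bounded_linear_vec_nth])
    then show ?case by (rule has_derivative_dir_deriv)
  qed
  moreover have "(\<lambda>z. trunc_kernel' d z v $ i) \<in> borel_measurable borel"
  proof -
    have "trunc_kernel' d z v $ i = (if norm z < d then v $ i / d\<^sup>2
        else v $ i / (norm z)\<^sup>2 - 2 * (z \<bullet> v) / norm z ^ 4 * z $ i)" for z
      by (simp add: trunc_kernel'_def)
    then show ?thesis by simp
  qed
  ultimately show ?thesis by (simp add: has_dir_deriv_AE_def)
qed

lemma has_dir_deriv_AE_diff:
  assumes "has_dir_deriv_AE v f f'" "has_dir_deriv_AE v g g'"
  shows "has_dir_deriv_AE v (\<lambda>x. f x - g x) (\<lambda>x. f' x - g' x)"
  using assms[unfolded has_dir_deriv_AE_def] unfolding has_dir_deriv_AE_def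
  by (auto intro!: borel_measurable_diff) (eventually_elim, auto intro!: derivative_intros)

text \<open>The majorant does not depend on the inner radius \<open>d\<close>, so \<open>d\<close>
  can be sent to 0; \<open>1 / norm z\<close> is integrable on a planar disc.\<close>

lemma trunc_kernel_diff_bound:
  assumes "0 < d" "d \<le> e"
  shows "norm (trunc_kernel d z - trunc_kernel e z) \<le> indicator (ball 0 e) z / norm z"
proof (cases "norm z < e \<and> z \<noteq> 0")
  case False
  then show ?thesis using assms by (auto simp: trunc_kernel_def max_def indicator_def)
next
  case True
  define M where "M = max (norm z) d"
  have M: "norm z \<le> M" "0 < M" "M \<le> e" "0 < norm z" "0 < e" "0 \<le> M" using True assms
    by (auto simp: M_def less_max_iff_disj le_max_iff_disj)
  have "trunc_kernel d z - trunc_kernel e z = (1 / M\<^sup>2 - 1 / e\<^sup>2) *\<^sub>R z"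
    using True by (simp add: trunc_kernel_def M_def max_def scaleR_left_diff_distrib)
  moreover have "\<bar>1 / M\<^sup>2 - 1 / e\<^sup>2\<bar> \<le> 1 / (norm z)\<^sup>2"
  proof -
    have "1 / e\<^sup>2 \<le> 1 / M\<^sup>2" "1 / M\<^sup>2 \<le> 1 / (norm z)\<^sup>2"
      using M by (auto intro!: divide_left_mono power_mono mult_pos_pos simp del: divide_le_eq_1)
    moreover have "0 \<le> 1 / e\<^sup>2" by simp
    ultimately show ?thesis by linarith
  qed
  ultimately have "norm (trunc_kernel d z - trunc_kernel e z) \<le> 1 / (norm z)\<^sup>2 * norm z"
    by (simp only: norm_scaleR real_norm_def) (rule mult_right_mono, auto)
  then show ?thesis using True by (simp add: power2_eq_square)
qed

lemma avg_eq:
  fixes f :: "'a::euclidean_space \<Rightarrow> 'b::euclidean_space"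
  assumes "f \<in> borel_measurable borel"
  shows "avg e f x = (1 / measure lborel (ball (0::'a) e)) *\<^sub>R (LINT z|lborel. indicator (ball 0 e)
    z *\<^sub>R f (x + z))"
proof -
  have [measurable]: "f \<in> borel_measurable borel" by fact
  have "avg e f x = (LINT z|lborel. (indicator (ball 0 e) z / measure lborel (ball (0::'a) e)) *\<^sub>R f
    (x + z))"
    unfolding avg_def disc_measure_def
    by (rule integral_density[where f="\<lambda>z. f (x + z)"
      and g="\<lambda>z. indicator (ball 0 e) z / measure lborel (ball (0::'a) e)"])
      auto
  also have "\<dots> = (LINT z|lborel. (1 / measure lborel (ball (0::'a) e)) *\<^sub>R (indicator (ball 0 e) z
    *\<^sub>R f (x + z)))"
    by simp
  finally show ?thesis by (simp only: integral_scaleR_right)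
qed

definition disc_area :: real where "disc_area = measure lborel (ball (0::real^2) 1)"

lemma disc_area_pos: "0 < disc_area" by (simp add: disc_area_def measure_ball_pos)

lemma measure_ball_disc: "0 \<le> e \<Longrightarrow> measure lborel (ball (0::real^2) e) = disc_area * e\<^sup>2"
  by (simp add: disc_area_def content_ball)

lemma component_lipschitz:
  assumes "L-lipschitz_on UNIV (f :: 'a::metric_space \<Rightarrow> real^'n)"
  shows "L-lipschitz_on UNIV (\<lambda>x. f x $ i)"
proof (rule lipschitz_onI)
  fix x y
  have "dist (f x $ i) (f y $ i) \<le> dist (f x) (f y)" by (rule dist_vec_nth_le)
  also have "\<dots> \<le> L * dist x y" using assms lipschitz_onD by blast
  finally show "dist (f x $ i) (f y $ i) \<le> L * dist x y" .
qed (rule lipschitz_on_nonneg[OF assms])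

text \<open>Real part of the Cauchy-Pompeiu formula: the two combinations of gradient entries are
  twice the real and imaginary parts of the conjugate Wirtinger derivative. After integration by
  parts \<open>u\<close> meets the divergence of the kernel, whereas \<open>v\<close> meets its
  curl, which vanishes.\<close>

lemma cauchy_pompeiu_identity:
  fixes u v :: "real^2 \<Rightarrow> real"
  assumes u: "L-lipschitz_on UNIV u" and v: "K-lipschitz_on UNIV v"
    and g: "has_gradient_AE u g" and h: "has_gradient_AE v h" and d: "0 < d" "d < e"
  defines "k \<equiv> \<lambda>z. trunc_kernel d z - trunc_kernel e z"
  shows "(LINT z|lborel. (g z $ 1 - h z $ 2) * k z $ 1 + (g z $ 2 + h z $ 1) * k z $ 2)
     = - 2 * disc_area * (avg d u 0 - avg e u 0)"
proof -
  have e: "0 < e" using d by linarith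
  have kl: "(3 / d\<^sup>2 + 3 / e\<^sup>2)-lipschitz_on UNIV (\<lambda>z. k z $ i)" for i
    unfolding k_def by (intro component_lipschitz lipschitz_on_diff trunc_kernel_lipschitz d e)
  have kz: "k z = 0" if "z \<notin> ball 0 e" for z
    using trunc_kernel_diff_bound[of d e z] d that by (simp add: k_def)
  have kb: "bounded {z. k z $ i \<noteq> 0}" for i
    by (rule bounded_subset[OF bounded_ball[of 0 e]]) (use kz in force)
  define K where "K j i z = trunc_kernel' d z (axis j 1) $ i - trunc_kernel' e z (axis j 1) $ i"
    for j i z
  have kd: "has_dir_deriv_AE (axis j 1) (\<lambda>z. k z $ i) (K j i)" for i j
    unfolding K_def k_def vector_minus_component using d e
      by (intro has_dir_deriv_AE_diff trunc_kernel_has_dir_deriv) auto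
  have gd: "has_dir_deriv_AE (axis j 1) u (\<lambda>z. g z $ j)" for j
    using has_gradient_AE_dir_deriv[OF g, of "axis j 1"] by (simp add: inner_axis)
  have hd: "has_dir_deriv_AE (axis j 1) v (\<lambda>z. h z $ j)" for j
    using has_gradient_AE_dir_deriv[OF h, of "axis j 1"] by (simp add: inner_axis)
  note U = lipschitz_integration_by_parts[OF u kl kb gd kd]
  note V = lipschitz_integration_by_parts[OF v kl kb hd kd]
  have tr: "trunc_kernel' r z (axis 1 1) $ 1 + trunc_kernel' r z (axis 2 1) $ 2
    = (2 / r\<^sup>2) * indicator (ball 0 r) z"
    if "0 < r" for r z
  proof (cases "norm z < r")
    case False
    have n: "(norm z)\<^sup>2 = (z $ 1)\<^sup>2 + (z $ 2)\<^sup>2"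
      by (simp only: power2_norm_eq_inner inner_vec_def sum_2) (simp add: power2_eq_square)
    define a where "a = (z $ 1)\<^sup>2 + (z $ 2)\<^sup>2"
    have n4: "norm z ^ 4 = a\<^sup>2" using n unfolding a_def
      by (metis mult_2_right numeral_Bit0 power_even_eq)
    have a: "a \<noteq> 0"
      using False that n by (metis a_def norm_zero zero_eq_power2 norm_eq_zero)
    have "trunc_kernel' r z (axis 1 1) $ 1 = 1 / a - 2 * (z $ 1 * z $ 1) / a\<^sup>2"
      "trunc_kernel' r z (axis 2 1) $ 2 = 1 / a - 2 * (z $ 2 * z $ 2) / a\<^sup>2"
      using False by (simp_all add: trunc_kernel'_def inner_axis n n4 a_def)
    then have "trunc_kernel' r z (axis 1 1) $ 1 + trunc_kernel' r z (axis 2 1) $ 2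
      = 2 / a - 2 * (z $ 1 * z $ 1 + z $ 2 * z $ 2) / a\<^sup>2"
      by (simp add: add_divide_distrib distrib_left)
    also have "z $ 1 * z $ 1 + z $ 2 * z $ 2 = a" by (simp add: a_def power2_eq_square)
    finally show ?thesis using False a by (simp add: power2_eq_square)
  qed (simp add: trunc_kernel'_def)
  \<comment> \<open>The kernel is the gradient of a radial function, so its derivative is
    symmetric.\<close>
  have sy: "trunc_kernel' r z (axis 1 1) $ 2 = trunc_kernel' r z (axis 2 1) $ 1" for r z
    by (simp add: trunc_kernel'_def inner_axis) (simp add: axis_def)
  have av: "(LINT z|lborel. u z * ((2 / r\<^sup>2) * indicator (ball 0 r) z)) = 2 * disc_area * avg r u 0"
     "integrable lborel (\<lambda>z. u z * ((2 / r\<^sup>2) * indicator (ball 0 r) z))" if r: "0 < r" for r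
  proof -
    have [measurable]: "u \<in> borel_measurable borel"
      using u loc_bdd_borel_lipschitz loc_bdd_borel_measurable by blast
    have "avg r u 0 = 1 / (disc_area * r\<^sup>2) * (LINT z|lborel. u z * indicator (ball 0 r) z)"
      using avg_eq[of u r 0] r by (simp add: measure_ball_disc mult.commute)
    then show "(LINT z|lborel. u z * ((2 / r\<^sup>2) * indicator (ball 0 r) z))
      = 2 * disc_area * avg r u 0"
      using r disc_area_pos by (simp add: mult.left_commute[of "u _"] del: times_divide_eq_left)
    have "integrable (disc_measure r) (\<lambda>z. u (0 + z))"
      by (intro loc_bdd_borel_integrable_disc loc_bdd_borel_lipschitz[OF u] r)
    then have "integrable lborel (\<lambda>z. (indicator (ball 0 r) z / measure lborel (ball (0::real^2) r))
      *\<^sub>R u z)"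
      unfolding disc_measure_def by (subst (asm) integrable_density) auto
    then have "integrable lborel (\<lambda>z. (2 / r\<^sup>2 * measure lborel (ball (0::real^2) r)) * ((indicator
      (ball 0 r) z / measure lborel (ball (0::real^2) r)) *\<^sub>R u z))"
      by (rule integrable_mult_right)
    then show "integrable lborel (\<lambda>z. u z * ((2 / r\<^sup>2) * indicator (ball 0 r) z))"
      using measure_ball_pos[OF r, where 'a="real^2"] by (simp add: mult_ac)
  qed
  have "(LINT z|lborel. (g z $ 1 - h z $ 2) * k z $ 1 + (g z $ 2 + h z $ 1) * k z $ 2)
      = (LINT z|lborel. (g z $ 1 * k z $ 1 - h z $ 2 * k z $ 1) +
        (g z $ 2 * k z $ 2 + h z $ 1 * k z $ 2))"
    by (simp add: algebra_simps)
  also have "\<dots> = ((LINT z|lborel. g z $ 1 * k z $ 1) - (LINT z|lborel. h z $ 2 * k z $ 1))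
      + ((LINT z|lborel. g z $ 2 * k z $ 2) + (LINT z|lborel. h z $ 1 * k z $ 2))"
    using U(1) V(1) by simp
  also have "\<dots> = - ((LINT z|lborel. u z * K 1 1 z) + (LINT z|lborel. u z * K 2 2 z))
      + ((LINT z|lborel. v z * K 2 1 z) - (LINT z|lborel. v z * K 1 2 z))"
    by (simp add: U(3) V(3))
  also have "K 2 1 = K 1 2" by (simp add: K_def fun_eq_iff sy)
  also have "(LINT z|lborel. u z * K 1 1 z) + (LINT z|lborel. u z * K 2 2 z)
     = (LINT z|lborel. u z * K 1 1 z + u z * K 2 2 z)"
    using U(2) by simp
  also have "\<dots> = (LINT z|lborel. u z * ((2 / d\<^sup>2) * indicator (ball 0 d) z)
    - u z * ((2 / e\<^sup>2) * indicator (ball 0 e) z))"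
  proof (rule Bochner_Integration.integral_cong)
    fix z
    have "u z * K 1 1 z + u z * K 2 2 z = u z * ((trunc_kernel' d z (axis 1 1) $ 1
      + trunc_kernel' d z (axis 2 1) $ 2)
       - (trunc_kernel' e z (axis 1 1) $ 1 + trunc_kernel' e z
         (axis 2 1) $ 2))" by (simp add: K_def algebra_simps)
    then show "u z * K 1 1 z + u z * K 2 2 z = u z * ((2 / d\<^sup>2) * indicator (ball 0 d) z)
      - u z * ((2 / e\<^sup>2) * indicator (ball 0 e) z)"
      unfolding tr[OF d(1)] tr[OF e] by (simp only: right_diff_distrib)
  qed simp
  also have "\<dots> = 2 * disc_area * avg d u 0 - 2 * disc_area * avg e u 0"
    using av[OF d(1)] av[OF e] by simp
  finally show ?thesis by (simp add: algebra_simps)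
qed

text \<open>The modulus of the Cauchy kernel as a measure: its finiteness allows convolution with
  the kernel to be bounded in \<open>L^2\<close>.\<close>

definition cauchy_measure :: "real \<Rightarrow> (real^2) measure" where
  "cauchy_measure e = density lborel (\<lambda>z. ennreal (indicator (ball 0 e) z / norm z))"

lemma cauchy_density_measurable [measurable, simp]:
  "(\<lambda>z::real^2. indicator (ball 0 e) z / norm z :: real) \<in> borel_measurable borel"
  by (intro borel_measurable_divide borel_measurable_indicator borel_measurable_norm) auto

lemma sets_cauchy_measure [simp, measurable_cong]: "sets (cauchy_measure e) = sets borel"
  and space_cauchy_measure [simp]: "space (cauchy_measure e) = UNIV"
  by (auto simp: cauchy_measure_def)

lemma AE_cauchy_in_ball: "AE z in cauchy_measure e. z \<in> ball 0 e"
  unfolding cauchy_measure_def by (subst AE_density) (auto simp: indicator_def)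

text \<open>Layer-cake estimate: the disc \<open>{z. t < 1 / norm z}\<close> has area at most \<open>disc_area / t\<^sup>2\<close>.\<close>

lemma finite_measure_cauchy: "finite_measure (cauchy_measure e)"
proof (rule finite_measureI)
  define I :: "real^2 \<Rightarrow> real \<Rightarrow> ennreal" where
    "I z t = (if norm z < e \<and> 0 \<le> t \<and> t < 1 / norm z then 1 else 0)" for z t
  have [measurable]: "case_prod I \<in> borel_measurable (borel \<Otimes>\<^sub>M borel)"
    unfolding I_def by measurable
  have "emeasure (cauchy_measure e) UNIV
    = (\<integral>\<^sup>+z. ennreal (indicator (ball (0::real^2) e) z / norm z) \<partial>lborel)"
    unfolding cauchy_measure_def by (subst emeasure_density) auto
  also have "\<dots> = (\<integral>\<^sup>+z. (\<integral>\<^sup>+t. I z t \<partial>lborel) \<partial>lborel)"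
  proof (rule nn_integral_cong)
    fix z :: "real^2"
    have "(\<integral>\<^sup>+t. I z t \<partial>lborel) = (\<integral>\<^sup>+t. indicator (ball 0 e) z * indicator {0..<1 / norm z} t
      \<partial>lborel)"
      by (intro nn_integral_cong) (auto simp: I_def indicator_def)
    also have "\<dots> = indicator (ball 0 e) z * ennreal (1 / norm z)"
      by (subst nn_integral_cmult_indicator) (auto simp: emeasure_lborel_Ico)
    also have "\<dots> = ennreal (indicator (ball 0 e) z / norm z)" by (auto simp: indicator_def)
    finally show "ennreal (indicator (ball 0 e) z / norm z) = (\<integral>\<^sup>+t. I z t \<partial>lborel)" ..
  qed
  also have "\<dots> = (\<integral>\<^sup>+t. (\<integral>\<^sup>+z. I z t \<partial>lborel) \<partial>lborel)"
    by (rule lborel_pair.Fubini') measurable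
  also have "\<dots> \<le> (\<integral>\<^sup>+t. emeasure lborel (ball (0::real^2) e) * indicator {0..1} t
       + ennreal (disc_area / t\<^sup>2) * indicator {1..} t \<partial>lborel)"
  proof (rule nn_integral_mono)
    fix t :: real
    show "(\<integral>\<^sup>+z. I z t \<partial>lborel) \<le> emeasure lborel (ball (0::real^2) e) * indicator {0..1} t
       + ennreal (disc_area / t\<^sup>2) * indicator {1..} t"
    proof (cases "t \<ge> 1")
      case True
      have "(\<integral>\<^sup>+z. I z t \<partial>lborel) \<le> (\<integral>\<^sup>+z. indicator (ball (0::real^2) (1 / t)) z \<partial>lborel)"
      proof -
        have "norm z < 1 / t" if "t < 1 / norm z" for z :: "real^2"
          using that True by (cases "z = 0") (auto simp: field_simps)
        then show ?thesis by (intro nn_integral_mono) (auto simp: I_def indicator_def)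
      qed
      also have "\<dots> = ennreal (measure lborel (ball (0::real^2) (1 / t)))"
        using emeasure_lborel_ball_finite[of "0::real^2" "1 / t"]
          by (subst nn_integral_indicator) (auto intro!: emeasure_eq_ennreal_measure)
      also have "\<dots> = ennreal (disc_area / t\<^sup>2)"
        using True by (subst measure_ball_disc) (auto simp: power_divide)
      finally show ?thesis using True by (simp add: add_increasing)
    next
      case False
      show ?thesis
      proof (cases "t \<ge> 0")
        case True
        have "(\<integral>\<^sup>+z. I z t \<partial>lborel) \<le> (\<integral>\<^sup>+z. indicator (ball (0::real^2) e) z \<partial>lborel)"
          by (intro nn_integral_mono) (auto simp: I_def indicator_def)
        also have "\<dots> = emeasure lborel (ball (0::real^2) e)"
          by (rule nn_integral_indicator) simp
        finally show ?thesis using True False by simp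
      qed (simp add: I_def)
    qed
  qed
  also have "\<dots> = (\<integral>\<^sup>+t. emeasure lborel (ball (0::real^2) e) * indicator {0..1::real} t \<partial>lborel)
       + (\<integral>\<^sup>+t. ennreal (disc_area / t\<^sup>2) * indicator {1..} t \<partial>lborel)"
    by (rule nn_integral_add) measurable
  also have "\<dots> < \<infinity>"
  proof -
    have "(\<integral>\<^sup>+t. ennreal (disc_area / t\<^sup>2) * indicator {1..} t \<partial>lborel)
      = ennreal (0 - (- disc_area / 1))"
    proof (rule nn_integral_FTC_atLeast)
      show "DERIV (\<lambda>t. - disc_area / t) x :> disc_area / x\<^sup>2" if "1 \<le> x" for x
        using that by (auto intro!: derivative_eq_intros simp: power2_eq_square)
      show "((\<lambda>t. - disc_area / t) \<longlongrightarrow> 0) at_top"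
        by (intro tendsto_divide_0[OF tendsto_const] filterlim_at_top_imp_at_infinity
          filterlim_ident)
    qed (use disc_area_pos in auto)
    moreover have "emeasure lborel (ball (0::real^2) e) < \<infinity>" by (rule emeasure_lborel_ball_finite)
    ultimately show ?thesis
      by (subst nn_integral_cmult_indicator) (auto simp: ennreal_mult_less_top)
  qed
  finally show "emeasure (cauchy_measure e) (space (cauchy_measure e)) \<noteq> \<infinity>" by simp
qed

text \<open>Limit of the truncated identity as the inner radius tends to 0. The Lipschitz constant
  governs only how small that radius must be and leaves no trace in the bound, which is essential
  for sequences with unbounded constants.\<close>

lemma cauchy_pompeiu_bound:
  fixes u v :: "real^2 \<Rightarrow> real"
  assumes u: "L-lipschitz_on UNIV u" and v: "K-lipschitz_on UNIV v"
    and g: "has_gradient_AE u g" and h: "has_gradient_AE v h" and e: "0 < e"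
  shows "ennreal \<bar>u x - avg e u x\<bar> \<le> ennreal (1 / (2 * disc_area)) *
    (\<integral>\<^sup>+z. ennreal (\<bar>g (x + z) $ 1 - h (x + z) $ 2\<bar> + \<bar>g (x + z) $ 2 + h
      (x + z) $ 1\<bar>) \<partial>cauchy_measure e)"
    (is "_ \<le> ?A")
proof (rule ennreal_le_epsilon)
  fix r :: real assume r: "0 < r"
  have [measurable]: "g \<in> borel_measurable borel" "h \<in> borel_measurable borel"
    using g h by (auto simp: has_gradient_AE_def)
  have L0: "0 \<le> L" by (rule lipschitz_on_nonneg[OF u])
  \<comment> \<open>\<open>L * d \<le> r\<close> makes \<open>avg d u x\<close> differ from
    \<open>u x\<close> by at most the tolerance \<open>r\<close>; \<open>e / 2\<close> keeps the
    inner disc strictly inside the outer one.\<close>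
  define d where "d = min (e / 2) (r / (L + 1))"
  have d: "0 < d" "d < e" "L * d \<le> r"
  proof -
    show "0 < d" "d < e" using e r L0 by (auto simp: d_def)
    have "L * d \<le> (L + 1) * (r / (L + 1))" using L0 r \<open>0 < d\<close>
      by (intro mult_mono) (auto simp: d_def)
    then show "L * d \<le> r" using L0 by simp
  qed
  define k where "k z = trunc_kernel d z - trunc_kernel e z" for z
  have us: "L-lipschitz_on UNIV (\<lambda>z. u (x + z))" and vs: "K-lipschitz_on UNIV (\<lambda>z. v (x + z))"
    using u v unfolding lipschitz_on_def by (metis UNIV_I dist_add_cancel)+
  define a b where "a z = g (x + z) $ 1 - h (x + z) $ 2" and "b z = g (x + z) $ 2 + h (x + z) $ 1"
    for z
  have [measurable]: "a \<in> borel_measurable borel" "b \<in> borel_measurable borel"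
    unfolding a_def b_def by measurable
  have sh: "avg s (\<lambda>z. u (x + z)) 0 = avg s u x" for s by (simp add: avg_def)
  have "(LINT z|lborel. a z * k z $ 1 + b z * k z $ 2) = - 2 * disc_area * (avg d u x - avg e u x)"
    using cauchy_pompeiu_identity[OF us vs has_gradient_AE_shift[OF g] has_gradient_AE_shift[OF h]
      d(1,2)]
    by (simp add: a_def b_def k_def sh)
  then have "avg d u x - avg e u x = - (1 / (2 * disc_area)) * (LINT z|lborel. a z * k z $ 1
    + b z * k z $ 2)"
    using disc_area_pos by (simp add: field_simps)
  then have "ennreal \<bar>avg d u x - avg e u x\<bar>
    = ennreal (1 / (2 * disc_area)) * ennreal \<bar>LINT z|lborel. a z * k z $ 1 + b z * k z $ 2\<bar>"
    using disc_area_pos by (subst ennreal_mult[symmetric]) (auto simp: abs_mult)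
  also have "ennreal \<bar>LINT z|lborel. a z * k z $ 1 + b z * k z $ 2\<bar>
    \<le> (\<integral>\<^sup>+z. ennreal (norm (a z * k z $ 1 + b z * k z $ 2)) \<partial>lborel)"
    using integral_norm_bound_ennreal[of lborel "\<lambda>z. a z * k z $ 1 + b z * k z $ 2"]
    by (cases "integrable lborel (\<lambda>z. a z * k z $ 1 + b z * k z $ 2)") (auto
      simp: not_integrable_integral_eq)
  also have "\<dots> \<le> (\<integral>\<^sup>+z. ennreal (indicator (ball 0 e) z / norm z) * ennreal (\<bar>a z\<bar>
    + \<bar>b z\<bar>) \<partial>lborel)"
  proof (rule nn_integral_mono)
    fix z
    have "\<bar>a z * k z $ 1 + b z * k z $ 2\<bar> \<le> \<bar>a z\<bar> * \<bar>k z $ 1\<bar> + \<bar>b z\<bar> * \<bar>k z $ 2\<bar>"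
      by (metis abs_mult abs_triangle_ineq)
    also have "\<dots> \<le> \<bar>a z\<bar> * norm (k z) + \<bar>b z\<bar> * norm (k z)"
      by (intro add_mono mult_left_mono component_le_norm_cart) auto
    also have "\<dots> = norm (k z) * (\<bar>a z\<bar> + \<bar>b z\<bar>)" by (simp add: algebra_simps)
    also have "\<dots> \<le> (indicator (ball 0 e) z / norm z) * (\<bar>a z\<bar> + \<bar>b z\<bar>)"
      using trunc_kernel_diff_bound[of d e z] d by (intro mult_right_mono) (auto simp: k_def)
    finally show "ennreal (norm (a z * k z $ 1 + b z * k z $ 2))
      \<le> ennreal (indicator (ball 0 e) z / norm z) * ennreal (\<bar>a z\<bar> + \<bar>b z\<bar>)"
      by (subst ennreal_mult[symmetric]) (auto intro!: ennreal_leI)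
  qed
  also have "\<dots> = (\<integral>\<^sup>+z. ennreal (\<bar>a z\<bar> + \<bar>b z\<bar>) \<partial>cauchy_measure e)"
    unfolding cauchy_measure_def by (subst nn_integral_density) auto
  finally have 1: "ennreal \<bar>avg d u x - avg e u x\<bar> \<le> ?A" by (simp add: a_def b_def mult_left_mono)
  have "\<bar>u x - avg d u x\<bar> \<le> L * d"
  proof -
    have "u x - avg d u x = avg d (\<lambda>y. u x - u y) x"
      using d by (simp add: avg_diff loc_bdd_borel_const loc_bdd_borel_lipschitz[OF u] avg_const)
    moreover have "norm (avg d (\<lambda>y. u x - u y) x) \<le> L * d"
    proof (rule norm_avg_le)
      fix y assume "y \<in> ball x d"
      then show "norm (u x - u y) \<le> L * d"
        using lipschitz_onD[OF u, of x y] L0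
          by (auto simp: dist_norm intro!: order_trans[OF _ mult_left_mono[of "norm (x - y)" d L]])
    qed (use d L0 in auto)
    ultimately show ?thesis by simp
  qed
  then have "\<bar>u x - avg e u x\<bar> \<le> \<bar>avg d u x - avg e u x\<bar> + r" using d by linarith
  then have "ennreal \<bar>u x - avg e u x\<bar> \<le> ennreal (\<bar>avg d u x - avg e u x\<bar> + r)"
    by (rule ennreal_leI)
  also have "\<dots> = ennreal \<bar>avg d u x - avg e u x\<bar> + ennreal r"
    using r by (intro ennreal_plus) auto
  also have "\<dots> \<le> ?A + ennreal r" using 1 by (rule add_right_mono)
  finally show "ennreal \<bar>u x - avg e u x\<bar> \<le> ?A + ennreal r" .
qed

text \<open>The order of quantifiers is the point: the constant is chosen from the radius alone,
  before the functions, their Lipschitz constants and the sets. The margin between \<open>S\<close>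
  and \<open>S'\<close> accommodates the support of the kernel.\<close>

lemma cauchy_pompeiu_L2:
  assumes e: "0 < e"
  shows "\<exists>C::real. \<forall>(u :: real^2 \<Rightarrow> real) v L K g h (S :: (real^2) set) S'. L-lipschitz_on UNIV u
    \<longrightarrow> K-lipschitz_on UNIV v \<longrightarrow>
    has_gradient_AE u g \<longrightarrow> has_gradient_AE v h \<longrightarrow> S \<in> sets borel \<longrightarrow> S' \<in> sets borel \<longrightarrow>
    (\<forall>x\<in>S. \<forall>z\<in>ball 0 e. x + z \<in> S') \<longrightarrow>
    (\<integral>\<^sup>+x\<in>S. ennreal ((u x - avg e u x)\<^sup>2) \<partial>lborel) \<le>
      ennreal C * (\<integral>\<^sup>+x\<in>S'. ennreal ((g x $ 1 - h x $ 2)\<^sup>2 + (g x $ 2 + h x $ 1)\<^sup>2) \<partial>lborel)"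
proof -
  let ?N = "cauchy_measure e"
  interpret finite_measure ?N by (rule finite_measure_cauchy)
  define n where "n = measure ?N UNIV"
  have n: "emeasure ?N UNIV = ennreal n" unfolding n_def using emeasure_eq_measure by simp
  define c where "c = 1 / (2 * disc_area)"
  have c0: "0 \<le> c" using disc_area_pos by (simp add: c_def)
  show ?thesis
  \<comment> \<open>One mass \<open>n\<close> comes from Cauchy-Schwarz against the kernel measure,
    the other from the convolution estimate; the 2 comes from squaring a sum of two terms.\<close>
  proof (intro exI[of _ "c\<^sup>2 * n * (2 * n)"] allI impI)
    fix u v :: "real^2 \<Rightarrow> real" and L K :: real and g h and S S' :: "(real^2) set"
    assume u: "L-lipschitz_on UNIV u" and v: "K-lipschitz_on UNIV v"
      and g: "has_gradient_AE u g" and h: "has_gradient_AE v h"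
      and [measurable]: "S \<in> sets borel" "S' \<in> sets borel"
      and S: "\<forall>x\<in>S. \<forall>z\<in>ball 0 e. x + z \<in> S'"
    have [measurable]: "g \<in> borel_measurable borel" "h \<in> borel_measurable borel"
      using g h by (auto simp: has_gradient_AE_def)
    define a b where "a z = g z $ 1 - h z $ 2" and "b z = g z $ 2 + h z $ 1" for z
    have [measurable]: "a \<in> borel_measurable borel" "b \<in> borel_measurable borel"
      unfolding a_def b_def by measurable
    define f where "f z = ennreal ((a z)\<^sup>2 + (b z)\<^sup>2)" for z
    have [measurable]: "f \<in> borel_measurable borel" unfolding f_def by measurable
    have pt: "ennreal ((u x - avg e u x)\<^sup>2) \<le> ennreal (c\<^sup>2 * n * 2) * (\<integral>\<^sup>+z. f (x + z) \<partial>?N)" for x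
    proof -
      have "ennreal ((u x - avg e u x)\<^sup>2) = (ennreal \<bar>u x - avg e u x\<bar>)\<^sup>2"
        by (simp add: ennreal_power)
      also have "\<dots> \<le> (ennreal c * (\<integral>\<^sup>+z. ennreal (\<bar>a (x + z)\<bar> + \<bar>b (x + z)\<bar>) * 1 \<partial>?N))\<^sup>2"
        using cauchy_pompeiu_bound[OF u v g h e, of x]
        by (intro power_mono) (auto simp: a_def b_def c_def)
      also have "\<dots> = ennreal (c\<^sup>2) * (\<integral>\<^sup>+z. ennreal (\<bar>a (x + z)\<bar> + \<bar>b (x + z)\<bar>) * 1 \<partial>?N)\<^sup>2"
        using c0 by (simp add: power_mult_distrib ennreal_power)
      also have "(\<integral>\<^sup>+z. ennreal (\<bar>a (x + z)\<bar> + \<bar>b (x + z)\<bar>) * 1 \<partial>?N)\<^sup>2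
          \<le> (\<integral>\<^sup>+z. (ennreal (\<bar>a (x + z)\<bar> + \<bar>b (x + z)\<bar>))\<^sup>2 \<partial>?N) * (\<integral>\<^sup>+z. 1\<^sup>2 \<partial>?N)"
        by (rule Cauchy_Schwarz_nn_integral) measurable
      also have "(\<integral>\<^sup>+z. 1\<^sup>2 \<partial>?N) = ennreal n" by (simp add: n)
      also have "(\<integral>\<^sup>+z. (ennreal (\<bar>a (x + z)\<bar> + \<bar>b (x + z)\<bar>))\<^sup>2 \<partial>?N)
        \<le> (\<integral>\<^sup>+z. ennreal 2 * f (x + z) \<partial>?N)"
      proof (rule nn_integral_mono)
        fix z
        have "(ennreal (\<bar>a (x + z)\<bar> + \<bar>b (x + z)\<bar>))\<^sup>2 = ennreal ((\<bar>a (x + z)\<bar> + \<bar>b (x + z)\<bar>)\<^sup>2)"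
          by (rule ennreal_power) simp
        moreover have "(\<bar>a (x + z)\<bar> + \<bar>b (x + z)\<bar>)\<^sup>2 \<le> 2 * ((a (x + z))\<^sup>2 + (b (x + z))\<^sup>2)"
          using sum_squares_bound[of "\<bar>a (x + z)\<bar>" "\<bar>b (x + z)\<bar>"] by (simp add: power2_sum)
        moreover have "ennreal 2 * f (x + z) = ennreal (2 * ((a (x + z))\<^sup>2 + (b (x + z))\<^sup>2))"
          unfolding f_def by (rule ennreal_mult[symmetric]) auto
        ultimately show "(ennreal (\<bar>a (x + z)\<bar> + \<bar>b (x + z)\<bar>))\<^sup>2 \<le> ennreal 2 * f (x + z)"
          by (simp only: ennreal_leI)
      qed
      also have "\<dots> = ennreal 2 * (\<integral>\<^sup>+z. f (x + z) \<partial>?N)" by (rule nn_integral_cmult) measurable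
      also have "ennreal (c\<^sup>2) * (ennreal 2 * (\<integral>\<^sup>+z. f (x + z) \<partial>?N) * ennreal n)
          = ennreal (c\<^sup>2 * n * 2) * (\<integral>\<^sup>+z. f (x + z) \<partial>?N)"
        by (simp add: ennreal_mult n_def mult_ac)
      finally show ?thesis by (simp add: mult_left_mono mult_right_mono)
    qed
    have "(\<integral>\<^sup>+x\<in>S. ennreal ((u x - avg e u x)\<^sup>2) \<partial>lborel)
        \<le> (\<integral>\<^sup>+x. ennreal (c\<^sup>2 * n * 2) * ((\<integral>\<^sup>+z. f (x + z) \<partial>?N) * indicator S x) \<partial>lborel)"
      using pt by (intro nn_integral_mono) (auto simp: indicator_def)
    also have "\<dots> = ennreal (c\<^sup>2 * n * 2) * (\<integral>\<^sup>+x\<in>S. (\<integral>\<^sup>+z. f (x + z) \<partial>?N) \<partial>lborel)"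
      by (rule nn_integral_cmult) measurable
    also have "\<dots> \<le> ennreal (c\<^sup>2 * n * 2) * (emeasure ?N UNIV * (\<integral>\<^sup>+x\<in>S'. f x \<partial>lborel))"
      by (intro mult_left_mono nn_integral_convolution_le[where r=e] finite_measure_cauchy
        AE_cauchy_in_ball)
        (use S in auto)
    also have "\<dots> = ennreal (c\<^sup>2 * n * (2 * n)) * (\<integral>\<^sup>+x\<in>S'. f x \<partial>lborel)"
      by (simp add: n ennreal_mult n_def mult_ac)
    finally show "(\<integral>\<^sup>+x\<in>S. ennreal ((u x - avg e u x)\<^sup>2) \<partial>lborel) \<le>
      ennreal (c\<^sup>2 * n * (2 * n)) * (\<integral>\<^sup>+x\<in>S'. ennreal ((g x $ 1 - h x $ 2)\<^sup>2 +
        (g x $ 2 + h x $ 1)\<^sup>2) \<partial>lborel)"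
      by (simp add: f_def a_def b_def)
  qed
qed

subsection \<open>Wirtinger derivatives and the Caccioppoli inequality\<close>

text \<open>If \<open>g\<close> and \<open>h\<close> are the gradients of \<open>u\<close> and \<open>v\<close>, these are the derivatives of \<open>u + \<i> v\<close> with respect
  to \<open>z\<close> and its conjugate.\<close>

definition dz :: "real^2 \<Rightarrow> real^2 \<Rightarrow> complex" where
  "dz g h = Complex ((g $ 1 + h $ 2) / 2) ((h $ 1 - g $ 2) / 2)"

definition dzbar :: "real^2 \<Rightarrow> real^2 \<Rightarrow> complex" where
  "dzbar g h = Complex ((g $ 1 - h $ 2) / 2) ((g $ 2 + h $ 1) / 2)"

lemma norm_vec2_sq: "(norm (x::real^2))\<^sup>2 = (x $ 1)\<^sup>2 + (x $ 2)\<^sup>2"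
  by (simp only: power2_norm_eq_inner inner_vec_def sum_2) (simp add: power2_eq_square)

lemma norm_dz_sq: "(norm (dz g h))\<^sup>2 = ((g $ 1 + h $ 2) / 2)\<^sup>2 + ((h $ 1 - g $ 2) / 2)\<^sup>2"
  and norm_dzbar_sq: "(norm (dzbar g h))\<^sup>2 = ((g $ 1 - h $ 2) / 2)\<^sup>2 + ((g $ 2 + h $ 1) / 2)\<^sup>2"
  by (simp_all add: dz_def dzbar_def cmod_power2)

lemma norm_dz_add_dzbar: "(norm (dz g h))\<^sup>2 + (norm (dzbar g h))\<^sup>2 = ((norm g)\<^sup>2 + (norm h)\<^sup>2) / 2"
  unfolding norm_dz_sq norm_dzbar_sq norm_vec2_sq by (simp add: power2_eq_square field_simps)

lemma norm_dz_diff_dzbar: "(norm (dz g h))\<^sup>2 - (norm (dzbar g h))\<^sup>2 = g $ 1 * h $ 2 - g $ 2 * h $ 1"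
  unfolding norm_dz_sq norm_dzbar_sq by (simp add: power2_eq_square field_simps)

lemma dz_add: "dz (g + g') (h + h') = dz g h + dz g' h'"
  and dzbar_add: "dzbar (g + g') (h + h') = dzbar g h + dzbar g' h'"
  and dz_diff: "dz (g - g') (h - h') = dz g h - dz g' h'"
  and dzbar_diff: "dzbar (g - g') (h - h') = dzbar g h - dzbar g' h'"
  and dzbar_scaleR: "dzbar (c *\<^sub>R g) (c *\<^sub>R h) = c *\<^sub>R dzbar g h"
  by (simp_all add: dz_def dzbar_def complex_eq_iff algebra_simps add_divide_distrib
    diff_divide_distrib)

lemma norm_add_sq_le: "(norm (a + b))\<^sup>2 \<le> 2 * (norm a)\<^sup>2 + 2 * (norm (b::'a::real_inner))\<^sup>2"
proof -
  have "(norm (a + b))\<^sup>2 + (norm (a - b))\<^sup>2 = 2 * (norm a)\<^sup>2 + 2 * (norm b)\<^sup>2"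
    by (simp add: power2_norm_eq_inner inner_add_left inner_add_right inner_diff_left
      inner_diff_right inner_commute)
  then show ?thesis by (smt (verit) zero_le_power2)
qed

lemma norm_diff_sq_le: "(norm (a - b))\<^sup>2 \<le> 2 * (norm a)\<^sup>2 + 2 * (norm (b::'a::real_inner))\<^sup>2"
  using norm_add_sq_le[of a "- b"] by simp

section \<open>Measurability and averages of Wirtinger derivatives; squared norms\<close>

lemma borel_measurable_Complex [measurable (raw)]:
  assumes "f \<in> borel_measurable M" "g \<in> borel_measurable M"
  shows "(\<lambda>x. Complex (f x) (g x)) \<in> borel_measurable M"
proof -
  have "(\<lambda>x. of_real (f x) + \<i> * of_real (g x)) \<in> borel_measurable M"
    using assms by measurable
  then show ?thesis by (simp add: Complex_eq)
qed

lemma loc_bdd_borel_vec_nth: "loc_bdd_borel f \<Longrightarrow> loc_bdd_borel (\<lambda>x. f x $ i)"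
  by (rule loc_bdd_borel_linear[OF bounded_linear_vec_nth])

lemma loc_bdd_borel_Complex:
  assumes "loc_bdd_borel f" "loc_bdd_borel g"
  shows "loc_bdd_borel (\<lambda>x. Complex (f x) (g x))"
proof -
  have "loc_bdd_borel (\<lambda>x. complex_of_real (f x))" "loc_bdd_borel (\<lambda>x. \<i> * complex_of_real (g x))"
    by (rule loc_bdd_borel_linear[OF bounded_linear_of_real assms(1)],
        rule loc_bdd_borel_linear[OF bounded_linear_const_mult[OF bounded_linear_of_real] assms(2)])
  from loc_bdd_borel_add[OF this] show ?thesis by (simp add: Complex_eq)
qed

lemma loc_bdd_borel_dz:
  fixes g h :: "'a::euclidean_space \<Rightarrow> real^2"
  assumes "loc_bdd_borel g" "loc_bdd_borel h"
  shows "loc_bdd_borel (\<lambda>x. dz (g x) (h x))" "loc_bdd_borel (\<lambda>x. dzbar (g x) (h x))"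
proof -
  have *: "loc_bdd_borel (\<lambda>x. f x / 2)" if "loc_bdd_borel f" for f :: "'a \<Rightarrow> real"
    using loc_bdd_borel_linear[OF bounded_linear_divide that] by simp
  show "loc_bdd_borel (\<lambda>x. dz (g x) (h x))" "loc_bdd_borel (\<lambda>x. dzbar (g x) (h x))"
    unfolding dz_def dzbar_def using assms
    by (auto intro!: loc_bdd_borel_Complex * loc_bdd_borel_intros loc_bdd_borel_vec_nth)
qed

lemma avg_dz:
  fixes g h :: "'a::euclidean_space \<Rightarrow> real^2"
  assumes g: "loc_bdd_borel g" and h: "loc_bdd_borel h" and e: "0 < e"
  shows "avg e (\<lambda>x. dz (g x) (h x)) x = dz (avg e g x) (avg e h x)"
    and "avg e (\<lambda>x. dzbar (g x) (h x)) x = dzbar (avg e g x) (avg e h x)"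
proof -
  have n: "avg e (\<lambda>x. f x $ i) x = avg e f x $ i" if "loc_bdd_borel f" for f :: "'a \<Rightarrow> real^2" and i
    by (rule avg_linear[OF bounded_linear_vec_nth that e])
  have l: "loc_bdd_borel (\<lambda>x. g x $ i)" "loc_bdd_borel (\<lambda>x. h x $ i)" for i
    using g h by (auto intro: loc_bdd_borel_vec_nth)
  have d: "avg e (\<lambda>x. f x / 2) x = avg e f x / 2" if "loc_bdd_borel f" for f :: "'a \<Rightarrow> real"
    by (rule avg_linear[OF bounded_linear_divide that e])
  note R = avg_linear[OF bounded_linear_Re _ e] and I = avg_linear[OF bounded_linear_Im _ e]
  show "avg e (\<lambda>x. dz (g x) (h x)) x = dz (avg e g x) (avg e h x)"
    using R[OF loc_bdd_borel_dz(1)[OF g h], of x] I[OF loc_bdd_borel_dz(1)[OF g h], of x] e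
    by (simp add: complex_eq_iff dz_def d avg_add avg_diff loc_bdd_borel_add loc_bdd_borel_diff l
      n[OF g] n[OF h])
  show "avg e (\<lambda>x. dzbar (g x) (h x)) x = dzbar (avg e g x) (avg e h x)"
    using R[OF loc_bdd_borel_dz(2)[OF g h], of x] I[OF loc_bdd_borel_dz(2)[OF g h], of x] e
    by (simp add: complex_eq_iff dzbar_def d avg_add avg_diff loc_bdd_borel_add loc_bdd_borel_diff l
      n[OF g] n[OF h])
qed

text \<open>Extended nonnegative values let squared norms be compared, added and sent to 0 without
  integrability side conditions.\<close>

definition sq_norm_on :: "'a::euclidean_space set \<Rightarrow> ('a \<Rightarrow> 'b::euclidean_space) \<Rightarrow> ennreal" where
  "sq_norm_on S f = (\<integral>\<^sup>+x\<in>S. ennreal ((norm (f x))\<^sup>2) \<partial>lborel)"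

lemma pred_mem_ball [measurable]: "Measurable.pred borel (\<lambda>x::'a::euclidean_space. x \<in> ball a r)"
  by (simp add: pred_def)

lemma nn_integral_linear_combination:
  assumes "f \<in> borel_measurable M" "g \<in> borel_measurable M"
  shows "(\<integral>\<^sup>+x. c * f x + d * g x \<partial>M) = c * (\<integral>\<^sup>+x. f x \<partial>M) + d * (\<integral>\<^sup>+x. g x \<partial>M)"
  using assms by (simp add: nn_integral_add nn_integral_cmult)

lemma sq_norm_on_mono_AE:
  assumes "AE x in lborel. x \<in> S \<longrightarrow> norm (f x) \<le> norm (g x)"
  shows "sq_norm_on S f \<le> sq_norm_on S g"
  unfolding sq_norm_on_def
  by (rule nn_integral_mono_AE, rule AE_mp[OF assms])
    (auto simp: indicator_def intro!: ennreal_leI power_mono)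

lemma sq_norm_on_mono: "(\<And>x. x \<in> S \<Longrightarrow> norm (f x) \<le> norm (g x)) \<Longrightarrow> sq_norm_on S f \<le> sq_norm_on S g"
  by (rule sq_norm_on_mono_AE) auto

lemma sq_norm_on_subset: "S \<subseteq> T \<Longrightarrow> sq_norm_on S f \<le> sq_norm_on T f"
  unfolding sq_norm_on_def by (rule nn_integral_mono) (auto simp: indicator_def)

lemma sq_norm_on_add_le:
  assumes [measurable]: "f \<in> borel_measurable borel" "g \<in> borel_measurable borel" "S \<in> sets borel"
  shows "sq_norm_on S (\<lambda>x. f x + g x) \<le> 2 * sq_norm_on S f + 2 * sq_norm_on S g"
proof -
  have "sq_norm_on S (\<lambda>x. f x + g x) \<le>
      (\<integral>\<^sup>+x. 2 * (ennreal ((norm (f x))\<^sup>2) * indicator S x) + 2 * (ennreal ((norm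
        (g x))\<^sup>2) * indicator S x) \<partial>lborel)"
    unfolding sq_norm_on_def
  proof (rule nn_integral_mono)
    fix x
    have "ennreal ((norm (f x + g x))\<^sup>2) \<le> ennreal (2 * (norm (f x))\<^sup>2 + 2 * (norm (g x))\<^sup>2)"
      by (intro ennreal_leI norm_add_sq_le)
    also have "\<dots> = 2 * ennreal ((norm (f x))\<^sup>2) + 2 * ennreal ((norm (g x))\<^sup>2)"
      by (simp add: ennreal_mult)
    finally show "ennreal ((norm (f x + g x))\<^sup>2) * indicator S x
       \<le> 2 * (ennreal ((norm (f x))\<^sup>2) * indicator S x) + 2 * (ennreal ((norm
         (g x))\<^sup>2) * indicator S x)"
      by (auto simp: indicator_def)
  qed
  also have "\<dots> = 2 * sq_norm_on S f + 2 * sq_norm_on S g"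
    unfolding sq_norm_on_def by (rule nn_integral_linear_combination) measurable
  finally show ?thesis .
qed

lemma sq_norm_on_diff_le:
  assumes "f \<in> borel_measurable borel" "g \<in> borel_measurable borel" "S \<in> sets borel"
  shows "sq_norm_on S (\<lambda>x. f x - g x) \<le> 2 * sq_norm_on S f + 2 * sq_norm_on S g"
  using sq_norm_on_add_le[of f "\<lambda>x. - g x" S] assms by (simp add: sq_norm_on_def)

lemma sq_norm_on_const: "S \<in> sets borel \<Longrightarrow> sq_norm_on S (\<lambda>x. c)
  = ennreal ((norm c)\<^sup>2) * emeasure lborel S"
  unfolding sq_norm_on_def by (subst nn_integral_cmult_indicator) auto

lemma sq_norm_on_Un_le: 
  assumes [measurable]: "f \<in> borel_measurable borel" "S \<in> sets borel" "T \<in> sets borel"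
  shows "sq_norm_on (S \<union> T) f \<le> sq_norm_on S f + sq_norm_on T f"
proof -
  have "sq_norm_on (S \<union> T) f \<le> (\<integral>\<^sup>+x. ennreal ((norm (f x))\<^sup>2) * indicator S x
    + ennreal ((norm (f x))\<^sup>2) * indicator T x \<partial>lborel)"
    unfolding sq_norm_on_def by (rule nn_integral_mono) (auto simp: indicator_def)
  also have "\<dots> = sq_norm_on S f + sq_norm_on T f"
    unfolding sq_norm_on_def by (rule nn_integral_add) measurable
  finally show ?thesis .
qed

text \<open>Jensen, then Tonelli. The average of squares in the middle is kept as a separate bound
  because the variance estimate needs exactly that quantity.\<close>

lemma sq_norm_on_avg_le:
  fixes f :: "'a::euclidean_space \<Rightarrow> 'b::euclidean_space"
  assumes f: "loc_bdd_borel f" and e: "0 < e" and [measurable]: "S \<in> sets borel" "T \<in> sets borel"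
    and ST: "\<And>x z. x \<in> S \<Longrightarrow> z \<in> ball 0 e \<Longrightarrow> x + z \<in> T"
  shows "sq_norm_on S (avg e f) \<le> (\<integral>\<^sup>+x\<in>S. ennreal (avg e (\<lambda>y. (norm (f y))\<^sup>2) x) \<partial>lborel)"
    and "(\<integral>\<^sup>+x\<in>S. ennreal (avg e (\<lambda>y. (norm (f y))\<^sup>2) x) \<partial>lborel) \<le> sq_norm_on T f"
proof -
  have [measurable]: "f \<in> borel_measurable borel" using f by (rule loc_bdd_borel_measurable)
  show "sq_norm_on S (avg e f) \<le> (\<integral>\<^sup>+x\<in>S. ennreal (avg e (\<lambda>y. (norm (f y))\<^sup>2) x) \<partial>lborel)"
    unfolding sq_norm_on_def
    by (intro nn_integral_mono mult_right_mono ennreal_leI avg_jensen f e) auto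
  have "(\<integral>\<^sup>+x\<in>S. ennreal (avg e (\<lambda>y. (norm (f y))\<^sup>2) x) \<partial>lborel)
      = (\<integral>\<^sup>+x\<in>S. (\<integral>\<^sup>+z. ennreal ((norm (f (x + z)))\<^sup>2) \<partial>disc_measure e) \<partial>lborel)"
    using f e by (subst ennreal_avg) (auto intro!: loc_bdd_borel_intros)
  also have "\<dots> \<le> emeasure (disc_measure e :: 'a measure) UNIV * (\<integral>\<^sup>+x\<in>T. ennreal ((norm (f x))\<^sup>2)
    \<partial>lborel)"
    by (rule nn_integral_convolution_le[OF finite_measure_disc[OF e] _ AE_disc_in_ball])
      (use ST in auto)
  finally show "(\<integral>\<^sup>+x\<in>S. ennreal (avg e (\<lambda>y. (norm (f y))\<^sup>2) x) \<partial>lborel) \<le> sq_norm_on T f"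
    by (simp add: emeasure_disc_measure[OF e] sq_norm_on_def)
qed

text \<open>A radial piecewise linear profile, 1 on the ball of radius \<open>r\<close> and 0
  outside radius \<open>2 * r\<close> when \<open>r > 0\<close>. Lipschitz regularity matches the
  integration tools, and the slope \<open>1 / r\<close> is explicit.\<close>

definition cutoff :: "real^2 \<Rightarrow> real \<Rightarrow> real^2 \<Rightarrow> real" where
  "cutoff a r x = max 0 (min 1 (2 - dist x a / r))"

lemma cutoff_bounds: "0 \<le> cutoff a r x" "cutoff a r x \<le> 1"
  by (auto simp: cutoff_def)

lemma cutoff_eq_1: "0 < r \<Longrightarrow> x \<in> ball a r \<Longrightarrow> cutoff a r x = 1"
  by (auto simp: cutoff_def dist_commute field_simps)

lemma cutoff_eq_0: "0 < r \<Longrightarrow> x \<notin> ball a (2 * r) \<Longrightarrow> cutoff a r x = 0"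
  by (auto simp: cutoff_def dist_commute field_simps)

lemma cutoff_lipschitz:
  assumes r: "0 < r"
  shows "(1 / r)-lipschitz_on UNIV (cutoff a r)"
proof (rule lipschitz_onI)
  fix x y
  have "\<bar>cutoff a r x - cutoff a r y\<bar> \<le> \<bar>dist x a / r - dist y a / r\<bar>" by (auto simp: cutoff_def)
  also have "\<dots> = \<bar>dist x a - dist y a\<bar> / r" using r by (simp add: diff_divide_distrib[symmetric])
  also have "\<dots> \<le> dist x y / r" using r
    by (intro divide_right_mono abs_leI) (metis add.commute diff_le_eq dist_commute dist_triangle, 
        metis add.commute diff_le_eq dist_commute dist_triangle minus_diff_eq, simp)
  finally show "dist (cutoff a r x) (cutoff a r y) \<le> 1 / r * dist x y" by (simp add: dist_real_def)
qed (use r in simp)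

text \<open>\<open>w\<close> may be unbounded on the plane, but the product sees it only on the ball
  of radius \<open>2 * r\<close>. The difference at two points is split so that the bare value of
  \<open>w\<close> is taken at a point of that ball; if neither point lies there, both products
  vanish.\<close>

lemma cutoff_mult_lipschitz:
  fixes w :: "real^2 \<Rightarrow> real"
  assumes r: "0 < r" and w: "K-lipschitz_on UNIV w"
  shows "\<exists>M. M-lipschitz_on UNIV (\<lambda>x. cutoff a r x * w x)"
proof -
  obtain B where B: "0 \<le> B" "\<And>x. x \<in> ball a (2 * r) \<Longrightarrow> norm (w x) \<le> B"
    using loc_bdd_borelE[OF loc_bdd_borel_lipschitz[OF w] bounded_ball] by metis
  have K: "0 \<le> K" by (rule lipschitz_on_nonneg[OF w])
  have half: "\<bar>cutoff a r x * w x - cutoff a r y * w y\<bar> \<le> (B / r + K) * dist x y"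
    if "y \<in> ball a (2 * r)" for x y
  proof -
    have "cutoff a r x * w x - cutoff a r y * w y = cutoff a r x * (w x - w y) + (cutoff a r x
      - cutoff a r y) * w y"
      by (simp add: algebra_simps)
    then have "\<bar>cutoff a r x * w x - cutoff a r y * w y\<bar>
      \<le> \<bar>cutoff a r x\<bar> * \<bar>w x - w y\<bar> + \<bar>cutoff a r x - cutoff a r y\<bar> * \<bar>w y\<bar>"
      by (metis abs_mult abs_triangle_ineq)
    also have "\<dots> \<le> 1 * (K * dist x y) + (1 / r * dist x y) * B"
      using lipschitz_onD[OF w, of x y] lipschitz_onD[OF cutoff_lipschitz[OF r], of x y a] B(2)[OF
        that] cutoff_bounds r K
      by (intro add_mono mult_mono) (auto simp: dist_real_def)
    finally show ?thesis by (simp add: algebra_simps)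
  qed
  have "\<bar>cutoff a r x * w x - cutoff a r y * w y\<bar> \<le> (B / r + K) * dist x y" for x y
  proof (cases "y \<in> ball a (2 * r)")
    case False
    then have y: "cutoff a r y = 0" using r by (rule cutoff_eq_0[rotated])
    show ?thesis
    proof (cases "x \<in> ball a (2 * r)")
      case True
      then show ?thesis using half[OF True, of y] by (simp add: dist_commute abs_minus_commute)
    next
      case False
      then have "cutoff a r x = 0" using r by (rule cutoff_eq_0[rotated])
      then show ?thesis using y B K r by simp
    qed
  qed (rule half)
  then have "(B / r + K)-lipschitz_on UNIV (\<lambda>x. cutoff a r x * w x)"
    using B K r by (intro lipschitz_onI) (auto simp: dist_real_def)
  then show ?thesis by blast
qed

text \<open>Where the cutoff vanishes it attains its minimum, so a derivative there must be zero and
  the representative can be reset to 0 on that set. Products with the cutoff then have gradients of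
  bounded support.\<close>

lemma cutoff_gradient:
  assumes r: "0 < r"
  shows "\<exists>q. has_gradient_AE (cutoff a r) q \<and> (\<forall>x. norm (q x) \<le> 1 / r) \<and> (\<forall>x. cutoff a r x = 0 \<longrightarrow> q x
    = 0)"
proof -
  obtain q where q: "q \<in> borel_measurable borel" "\<And>x. norm (q x) \<le> 1 / r"
     "AE x in lborel. (cutoff a r has_derivative (\<lambda>h. q x \<bullet> h)) (at x)"
    using rademacher[OF cutoff_lipschitz[OF r, of a]] by blast
  have [measurable]: "cutoff a r \<in> borel_measurable borel"
    using cutoff_lipschitz[OF r] loc_bdd_borel_lipschitz loc_bdd_borel_measurable by blast
  have [measurable]: "q \<in> borel_measurable borel" by (rule q)
  define q' where "q' x = (if cutoff a r x = 0 then 0 else q x)" for x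
  have "q' \<in> borel_measurable borel" unfolding q'_def by measurable
  moreover have "norm (q' x) \<le> 1 / r" for x using q(2)[of x] r by (auto simp: q'_def)
  moreover have "AE x in lborel. (cutoff a r has_derivative (\<lambda>h. q' x \<bullet> h)) (at x)"
    using q(3)
  proof eventually_elim
    case (elim x)
    show ?case
    proof (cases "cutoff a r x = 0")
      case True
      have "(\<lambda>h. q x \<bullet> h) = (\<lambda>h. 0)"
        using differential_zero_maxmin[OF UNIV_I open_UNIV elim] cutoff_bounds(1) True by metis
      then show ?thesis using elim True by (simp add: q'_def)
    qed (use elim in \<open>simp add: q'_def\<close>)
  qed
  moreover have "\<forall>x. cutoff a r x = 0 \<longrightarrow> q' x = 0" by (simp add: q'_def)
  ultimately show ?thesis unfolding has_gradient_AE_def by blast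
qed

text \<open>The gradient is globally bounded even for unbounded \<open>w\<close>, because both the
  cutoff and \<open>q\<close> vanish outside the ball of radius \<open>2 * r\<close>.\<close>

lemma has_gradient_AE_cutoff_mult:
  assumes r: "0 < r" and q: "has_gradient_AE (cutoff a r) q" "\<And>x. cutoff a r x = 0 \<Longrightarrow> q x = 0"
    and w: "K-lipschitz_on UNIV w" and g: "has_gradient_AE w g"
  shows "has_gradient_AE (\<lambda>x. cutoff a r x * w x) (\<lambda>x. cutoff a r x *\<^sub>R g x + w x *\<^sub>R q x)"
proof -
  have cl: "loc_bdd_borel (cutoff a r)" using cutoff_lipschitz[OF r]
    by (rule loc_bdd_borel_lipschitz)
  have lb: "loc_bdd_borel (\<lambda>x. cutoff a r x *\<^sub>R g x + w x *\<^sub>R q x)"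
    by (intro loc_bdd_borel_add loc_bdd_borel_scaleR cl has_gradient_AE_loc_bdd[OF g]
        has_gradient_AE_loc_bdd[OF q(1)] loc_bdd_borel_lipschitz[OF w])
  obtain B where B: "0 \<le> B" "\<And>x. x \<in> ball a (2 * r) \<Longrightarrow> norm (cutoff a r x *\<^sub>R g x + w x *\<^sub>R q x) \<le> B"
    using loc_bdd_borelE[OF lb bounded_ball] by metis
  have "norm (cutoff a r x *\<^sub>R g x + w x *\<^sub>R q x) \<le> B" for x
    using B q(2)[of x] cutoff_eq_0[OF r, of x a] by (cases "x \<in> ball a (2 * r)") auto
  moreover have "AE x in lborel. ((\<lambda>x. cutoff a r x * w x) has_derivative (\<lambda>h. (cutoff a r x *\<^sub>R g x
    + w x *\<^sub>R q x) \<bullet> h)) (at x)"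
    using q(1)[unfolded has_gradient_AE_def, THEN conjunct2, THEN conjunct2]
      g[unfolded has_gradient_AE_def, THEN conjunct2, THEN conjunct2]
    by eventually_elim (auto intro!: derivative_eq_intros simp: inner_add_left algebra_simps)
  ultimately show ?thesis using loc_bdd_borel_measurable[OF lb] unfolding has_gradient_AE_def
    by blast
qed

text \<open>The Jacobian \<open>\<bar>dz\<bar>\<^sup>2 - \<bar>dzbar\<bar>\<^sup>2\<close> is a null Lagrangian.\<close>

lemma dz_dzbar_compact_support:
  assumes u: "L-lipschitz_on UNIV u" and v: "K-lipschitz_on UNIV v"
    and bu: "bounded {x. u x \<noteq> 0}"
    and g: "has_gradient_AE u g" and h: "has_gradient_AE v h"
    and S: "bounded S" "\<And>x. x \<notin> S \<Longrightarrow> g x = 0 \<and> h x = 0"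
  shows "(\<integral>\<^sup>+x. ennreal ((norm (dz (g x) (h x)))\<^sup>2) \<partial>lborel)
    = (\<integral>\<^sup>+x. ennreal ((norm (dzbar (g x) (h x)))\<^sup>2) \<partial>lborel)"
proof -
  obtain R where "\<And>x. x \<in> S \<Longrightarrow> norm x \<le> R" using S(1) by (auto simp: bounded_iff)
  then have R: "S \<subseteq> cball 0 R" by auto
  have gl: "loc_bdd_borel g" "loc_bdd_borel h" using g h by (auto intro: has_gradient_AE_loc_bdd)
  have i: "integrable lborel (\<lambda>x. (norm (f x))\<^sup>2)" if f: "loc_bdd_borel f" "\<And>x. x \<notin> S \<Longrightarrow> f x = 0"
    for f :: "real^2 \<Rightarrow> complex"
  proof -
    have [measurable]: "f \<in> borel_measurable borel" using f(1) by (rule loc_bdd_borel_measurable)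
    obtain B where B: "0 \<le> B" "\<And>x. x \<in> cball 0 R \<Longrightarrow> norm (f x) \<le> B"
      using loc_bdd_borelE[OF f(1) bounded_cball] by metis
    have "integrable lborel (\<lambda>x. indicator (cball 0 R) x *\<^sub>R (norm (f x))\<^sup>2)"
    proof (rule integrableI_bounded_set_indicator[where B="B\<^sup>2"])
      show "AE x in lborel. x \<in> cball 0 R \<longrightarrow> norm ((norm (f x))\<^sup>2) \<le> B\<^sup>2"
        using B by (auto intro!: AE_I2 power_mono)
    qed (use emeasure_bounded_finite[OF bounded_cball[of "0::real^2" R]] in auto)
    also have "(\<lambda>x. indicator (cball 0 R) x *\<^sub>R (norm (f x))\<^sup>2) = (\<lambda>x. (norm (f x))\<^sup>2)"
    proof (rule ext)
      fix x
      show "indicator (cball 0 R) x *\<^sub>R (norm (f x))\<^sup>2 = (norm (f x))\<^sup>2"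
        using f(2)[of x] subsetD[OF R, of x] by (cases "x \<in> cball 0 R") auto
    qed
    finally show ?thesis .
  qed
  have i1: "integrable lborel (\<lambda>x. (norm (dz (g x) (h x)))\<^sup>2)"
    by (rule i[OF loc_bdd_borel_dz(1)[OF gl]]) (use S in \<open>auto simp: dz_def complex_eq_iff\<close>)
  have i2: "integrable lborel (\<lambda>x. (norm (dzbar (g x) (h x)))\<^sup>2)"
    by (rule i[OF loc_bdd_borel_dz(2)[OF gl]]) (use S in \<open>auto simp: dzbar_def complex_eq_iff\<close>)
  note N = lipschitz_null_lagrangian[OF u v bu has_gradient_AE_dir_deriv[OF g, of "axis 1 1"]
      has_gradient_AE_dir_deriv[OF g, of "axis 2 1"] has_gradient_AE_dir_deriv[OF h, of "axis 1 1"]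
      has_gradient_AE_dir_deriv[OF h, of "axis 2 1"]]
  have "(LINT x|lborel. (norm (dz (g x) (h x)))\<^sup>2) - (LINT x|lborel. (norm (dzbar (g x) (h x)))\<^sup>2)
     = (LINT x|lborel. g x $ 1 * h x $ 2 - g x $ 2 * h x $ 1)"
    using i1 i2 by (simp add: norm_dz_diff_dzbar flip: Bochner_Integration.integral_diff)
  also have "\<dots> = 0" using N by (simp add: inner_axis)
  finally show ?thesis using i1 i2 by (simp add: nn_integral_eq_integral)
qed

text \<open>For the localized map, which has compact support, the null Lagrangian property equates
  the squared norms of \<open>dz\<close> and \<open>dzbar\<close>. Undoing the localization by the
  product rule costs only terms in which the cutoff gradient multiplies the map.\<close>

lemma caccioppoli:
  assumes r: "0 < r" and w1: "L-lipschitz_on UNIV w1" and w2: "K-lipschitz_on UNIV w2"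
    and g: "has_gradient_AE w1 g" and h: "has_gradient_AE w2 h"
  shows "sq_norm_on (ball a r) (\<lambda>x. dz (g x) (h x))
    \<le> 4 * sq_norm_on (ball a (2 * r)) (\<lambda>x. dzbar (g x) (h x))
    + ennreal (3 / r\<^sup>2) * (sq_norm_on (ball a (2 * r)) w1 + sq_norm_on (ball a (2 * r)) w2)"
proof -
  let ?B = "ball a (2 * r)" and ?c = "cutoff a r"
  obtain q where q: "has_gradient_AE ?c q" "\<And>x. norm (q x) \<le> 1 / r" "\<And>x. ?c x = 0 \<Longrightarrow> q x = 0"
    using cutoff_gradient[OF r, of a] by blast
  obtain M1 where M1: "M1-lipschitz_on UNIV (\<lambda>x. ?c x * w1 x)" using cutoff_mult_lipschitz[OF r w1]
    by blast
  obtain M2 where M2: "M2-lipschitz_on UNIV (\<lambda>x. ?c x * w2 x)" using cutoff_mult_lipschitz[OF r w2]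
    by blast
  define G where "G x = ?c x *\<^sub>R g x + w1 x *\<^sub>R q x" for x
  define H where "H x = ?c x *\<^sub>R h x + w2 x *\<^sub>R q x" for x
  have G: "has_gradient_AE (\<lambda>x. ?c x * w1 x) G" unfolding G_def
    by (rule has_gradient_AE_cutoff_mult[OF r q(1) q(3) w1 g])
  have H: "has_gradient_AE (\<lambda>x. ?c x * w2 x) H" unfolding H_def
    by (rule has_gradient_AE_cutoff_mult[OF r q(1) q(3) w2 h])
  have out: "?c x = 0 \<and> q x = 0" if "x \<notin> ?B" for x using cutoff_eq_0[OF r that] q(3) by blast
  have eq: "(\<integral>\<^sup>+x. ennreal ((norm (dz (G x) (H x)))\<^sup>2) \<partial>lborel)
    = (\<integral>\<^sup>+x. ennreal ((norm (dzbar (G x) (H x)))\<^sup>2) \<partial>lborel)"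
  proof (rule dz_dzbar_compact_support[OF M1 M2 _ G H bounded_ball[of a "2 * r"]])
    show "bounded {x. ?c x * w1 x \<noteq> 0}"
      by (rule bounded_subset[OF bounded_ball[of a "2 * r"]]) (use out in force)
    show "G x = 0 \<and> H x = 0" if "x \<notin> ?B" for x using out[OF that] by (simp add: G_def H_def)
  qed
  have [measurable]: "g \<in> borel_measurable borel" "h \<in> borel_measurable borel"
    "q \<in> borel_measurable borel"
    using g h q by (auto simp: has_gradient_AE_def)
  have [measurable]: "w1 \<in> borel_measurable borel" "w2 \<in> borel_measurable borel"
    "?c \<in> borel_measurable borel"
    using w1 w2 cutoff_lipschitz[OF r] loc_bdd_borel_lipschitz loc_bdd_borel_measurable by blast+
  have [measurable]: "G \<in> borel_measurable borel" "H \<in> borel_measurable borel"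
    unfolding G_def H_def by measurable
  have dm [measurable]: "(\<lambda>x. dz (f x) (k x)) \<in> borel_measurable borel"
    "(\<lambda>x. dzbar (f x) (k x)) \<in> borel_measurable borel"
    if "f \<in> borel_measurable borel" "k \<in> borel_measurable borel" for f k :: "real^2 \<Rightarrow> real^2"
    using that unfolding dz_def dzbar_def by measurable
  define E where "E x = (w1 x)\<^sup>2 + (w2 x)\<^sup>2" for x
  have [measurable]: "E \<in> borel_measurable borel" unfolding E_def by measurable
  \<comment> \<open>Half of \<open>(1 / r)\<^sup>2\<close>: the squares of \<open>dz\<close> and
    \<open>dzbar\<close> add up to half the squared gradient norms, and the cutoff gradient is at
    most \<open>1 / r\<close>.\<close>
  define m where "m = 1 / (2 * r\<^sup>2)"
  have m0: "0 \<le> m" by (simp add: m_def)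
  have rem: "(norm (dz (w1 x *\<^sub>R q x) (w2 x *\<^sub>R q x)))\<^sup>2 \<le> m * E x"
    "(norm (dzbar (w1 x *\<^sub>R q x) (w2 x *\<^sub>R q x)))\<^sup>2 \<le> m * E x" for x
  proof -
    have "((norm (w1 x *\<^sub>R q x))\<^sup>2 + (norm (w2 x *\<^sub>R q x))\<^sup>2) / 2 = (norm (q x))\<^sup>2 * E x / 2"
      by (simp add: E_def power_mult_distrib algebra_simps)
    also have "\<dots> \<le> (1 / r)\<^sup>2 * E x / 2"
      using q(2)[of x] by (intro divide_right_mono mult_right_mono power_mono) (auto simp: E_def)
    finally have "((norm (w1 x *\<^sub>R q x))\<^sup>2 + (norm (w2 x *\<^sub>R q x))\<^sup>2) / 2 \<le> m * E x"
      by (simp add: m_def power_divide)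
    then show "(norm (dz (w1 x *\<^sub>R q x) (w2 x *\<^sub>R q x)))\<^sup>2 \<le> m * E x"
      "(norm (dzbar (w1 x *\<^sub>R q x) (w2 x *\<^sub>R q x)))\<^sup>2 \<le> m * E x"
      using norm_dz_add_dzbar[of "w1 x *\<^sub>R q x" "w2 x *\<^sub>R q x"]
        zero_le_power2[of "norm (dz (w1 x *\<^sub>R q x) (w2 x *\<^sub>R q x))"]
        zero_le_power2[of "norm (dzbar (w1 x *\<^sub>R q x) (w2 x *\<^sub>R q x))"] by linarith+
  qed
  have p1: "(norm (dz (g x) (h x)))\<^sup>2 * indicator (ball a r) x
    \<le> 2 * (norm (dz (G x) (H x)))\<^sup>2 + 2 * m * E x * indicator ?B x" for x
  proof (cases "x \<in> ball a r")
    case True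
    then have c1: "?c x = 1" using cutoff_eq_1[OF r] by blast
    have "dz (g x) (h x) = dz (G x) (H x) - dz (w1 x *\<^sub>R q x) (w2 x *\<^sub>R q x)"
      by (simp add: G_def H_def c1 dz_add)
    then have "(norm (dz (g x) (h x)))\<^sup>2
      \<le> 2 * (norm (dz (G x) (H x)))\<^sup>2 + 2 * (norm (dz (w1 x *\<^sub>R q x) (w2 x *\<^sub>R q x)))\<^sup>2"
      by (simp only: norm_diff_sq_le)
    moreover have "x \<in> ?B" using True r by auto
    ultimately show ?thesis using rem(1)[of x] True by simp
  qed (simp add: m0 E_def indicator_def)
  have p2: "(norm (dzbar (G x) (H x)))\<^sup>2 \<le> 2 * (norm (dzbar (g x) (h x)))\<^sup>2 * indicator ?B x
    + 2 * m * E x * indicator ?B x" for x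
  proof (cases "x \<in> ?B")
    case True
    have "dzbar (G x) (H x) = ?c x *\<^sub>R dzbar (g x) (h x) + dzbar (w1 x *\<^sub>R q x) (w2 x *\<^sub>R q x)"
      by (simp add: G_def H_def dzbar_add dzbar_scaleR)
    then have "(norm (dzbar (G x) (H x)))\<^sup>2 \<le> 2 * (norm (?c x *\<^sub>R dzbar (g x) (h x)))\<^sup>2
      + 2 * (norm (dzbar (w1 x *\<^sub>R q x) (w2 x *\<^sub>R q x)))\<^sup>2"
      by (simp only: norm_add_sq_le)
    moreover have "(norm (?c x *\<^sub>R dzbar (g x) (h x)))\<^sup>2 \<le> (norm (dzbar (g x) (h x)))\<^sup>2"
      using cutoff_bounds[of a r x] by (intro power_mono) (auto simp: mult_left_le_one_le)
    ultimately have "(norm (dzbar (G x) (H x)))\<^sup>2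
      \<le> 2 * (norm (dzbar (g x) (h x)))\<^sup>2 + 2 * (m * E x)"
      using rem(2)[of x] by linarith
    then show ?thesis using True by simp
  next
    case False
    then show ?thesis using out[OF False] by (simp add: G_def H_def dzbar_def complex_eq_iff)
  qed
  let ?IE = "\<integral>\<^sup>+x\<in>?B. ennreal (E x) \<partial>lborel"
  have E0: "0 \<le> E x" for x by (simp add: E_def)
  have "sq_norm_on (ball a r) (\<lambda>x. dz (g x) (h x))
      \<le> (\<integral>\<^sup>+x. 2 * ennreal ((norm (dz (G x) (H x)))\<^sup>2) + ennreal (2 * m) * (ennreal
        (E x) * indicator ?B x) \<partial>lborel)"
    unfolding sq_norm_on_def
  proof (rule nn_integral_mono)
    fix x
    have "ennreal ((norm (dz (g x) (h x)))\<^sup>2) * indicator (ball a r) x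
      = ennreal ((norm (dz (g x) (h x)))\<^sup>2 * indicator (ball a r) x)"
      by (simp add: indicator_def)
    also have "\<dots> \<le> ennreal (2 * (norm (dz (G x) (H x)))\<^sup>2 + 2 * m * E x * indicator ?B x)"
      by (intro ennreal_leI p1)
    also have "\<dots> = 2 * ennreal ((norm (dz (G x) (H x)))\<^sup>2)
      + ennreal (2 * m) * (ennreal (E x) * indicator ?B x)"
      using m0 E0[of x] by (cases "x \<in> ?B") (simp_all add: ennreal_mult)
    finally show "ennreal ((norm (dz (g x) (h x)))\<^sup>2) * indicator (ball a r) x \<le> \<dots>" .
  qed
  also have "\<dots> = 2 * (\<integral>\<^sup>+x. ennreal ((norm (dz (G x) (H x)))\<^sup>2) \<partial>lborel) + ennreal (2 * m) * ?IE"
    by (rule nn_integral_linear_combination) measurable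
  also have "(\<integral>\<^sup>+x. ennreal ((norm (dz (G x) (H x)))\<^sup>2) \<partial>lborel)
      \<le> (\<integral>\<^sup>+x. 2 * (ennreal ((norm (dzbar (g x) (h x)))\<^sup>2) * indicator ?B x) + ennreal (2 * m) *
        (ennreal (E x) * indicator ?B x) \<partial>lborel)"
    unfolding eq
  proof (rule nn_integral_mono)
    fix x
    have "ennreal ((norm (dzbar (G x) (H x)))\<^sup>2)
      \<le> ennreal (2 * (norm (dzbar (g x) (h x)))\<^sup>2 * indicator ?B x + 2 * m * E x * indicator ?B x)"
      by (intro ennreal_leI p2)
    also have "\<dots> = 2 * (ennreal ((norm (dzbar (g x) (h x)))\<^sup>2) * indicator ?B x)
      + ennreal (2 * m) * (ennreal (E x) * indicator ?B x)"
      using m0 E0[of x] by (cases "x \<in> ?B") (simp_all add: ennreal_mult)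
    finally show "ennreal ((norm (dzbar (G x) (H x)))\<^sup>2) \<le> \<dots>" .
  qed
  also have "\<dots> = 2 * sq_norm_on ?B (\<lambda>x. dzbar (g x) (h x)) + ennreal (2 * m) * ?IE"
    unfolding sq_norm_on_def by (rule nn_integral_linear_combination) measurable
  also have "?IE = sq_norm_on ?B w1 + sq_norm_on ?B w2"
    unfolding sq_norm_on_def E_def
    by (subst nn_integral_add[symmetric]) (auto intro!: nn_integral_cong simp: indicator_def)
  finally have "sq_norm_on (ball a r) (\<lambda>x. dz (g x) (h x)) \<le>
      2 * (2 * sq_norm_on ?B (\<lambda>x. dzbar (g x) (h x)) + ennreal (2 * m) *
        (sq_norm_on ?B w1 + sq_norm_on ?B w2))
      + ennreal (2 * m) * (sq_norm_on ?B w1 + sq_norm_on ?B w2)"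
    by (simp add: mult_left_mono add_right_mono)
  also have "\<dots> = 4 * sq_norm_on ?B (\<lambda>x. dzbar (g x) (h x)) + (2 * ennreal (2 * m)
    + ennreal (2 * m)) * (sq_norm_on ?B w1 + sq_norm_on ?B w2)"
    by (simp add: algebra_simps)
  \<comment> \<open>The error \<open>2 * m\<close> enters once through \<open>dz\<close> and,
    doubled, through the bound for \<open>dzbar\<close>: in total \<open>6 * m\<close>.\<close>
  also have "2 * ennreal (2 * m) + ennreal (2 * m) = ennreal (3 / r\<^sup>2)"
    using r by (simp add: m_def ennreal_mult[symmetric] ennreal_plus[symmetric] del: ennreal_plus
      flip: ennreal_numeral)
  finally show ?thesis .
qed

text \<open>The Caccioppoli inequality is applied to the difference of the map and its average, which the
  Cauchy-Pompeiu formula controls.\<close>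

lemma local_average_estimate:
  assumes e: "0 < e"
  shows "\<exists>C::real. \<forall>(u::real^2 \<Rightarrow> real) v L K g h a. L-lipschitz_on UNIV u \<longrightarrow> K-lipschitz_on UNIV v \<longrightarrow>
    has_gradient_AE u g \<longrightarrow> has_gradient_AE v h \<longrightarrow>
    sq_norm_on (ball a e) (\<lambda>x. dz (g x) (h x) - avg e (\<lambda>y. dz (g y) (h y)) x)
      \<le> ennreal C * sq_norm_on (ball a (3 * e)) (\<lambda>x. dzbar (g x) (h x))"
proof -
  obtain C0 where C0: "\<And>(u::real^2 \<Rightarrow> real) v L K (g::real^2 \<Rightarrow> real^2) (h::real^2 \<Rightarrow> real^2) S S'.
    L-lipschitz_on UNIV u \<Longrightarrow> K-lipschitz_on UNIV v \<Longrightarrow>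
    has_gradient_AE u g \<Longrightarrow> has_gradient_AE v h \<Longrightarrow> S \<in> sets borel \<Longrightarrow> S' \<in> sets borel \<Longrightarrow>
    (\<forall>x\<in>S. \<forall>z\<in>ball 0 e. x + z \<in> S') \<Longrightarrow>
    (\<integral>\<^sup>+x\<in>S. ennreal ((u x - avg e u x)\<^sup>2) \<partial>lborel) \<le>
      ennreal C0 * (\<integral>\<^sup>+x\<in>S'. ennreal ((g x $ 1 - h x $ 2)\<^sup>2 + (g x $ 2 + h x $ 1)\<^sup>2) \<partial>lborel)"
    using cauchy_pompeiu_L2[OF e] by blast
  \<comment> \<open>Truncation at 0 makes the constant nonnegative, so that \<open>ennreal\<close>
    respects the sums and products below.\<close>
  define C1 where "C1 = max C0 0"
  show ?thesis
  \<comment> \<open>16 is the Caccioppoli factor 4 times 4 for the deviation of \<open>dzbar\<close>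
    from its average; \<open>8 * C1\<close> sums the bounds \<open>4 * C1\<close> for the two
    components.\<close>
  proof (intro exI[of _ "16 + 3 / e\<^sup>2 * (8 * C1)"] allI impI)
    fix u v :: "real^2 \<Rightarrow> real" and L K g h and a :: "real^2"
    assume u: "L-lipschitz_on UNIV u" and v: "K-lipschitz_on UNIV v"
      and g: "has_gradient_AE u g" and h: "has_gradient_AE v h"
    have gl: "loc_bdd_borel g" "loc_bdd_borel h" using g h by (auto intro: has_gradient_AE_loc_bdd)
    let ?S = "ball a (2 * e)" and ?S' = "ball a (3 * e)"
    have SS: "x + z \<in> ?S'" if "x \<in> ?S" "z \<in> ball 0 e" for x z
    proof -
      have "dist a (x + z) \<le> dist a x + norm z"
        by (metis add_diff_cancel_left' dist_norm dist_triangle dist_commute)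
      then show ?thesis using that by simp
    qed
    let ?Q = "\<lambda>x. dzbar (g x) (h x)"
    have Ql: "loc_bdd_borel ?Q" by (rule loc_bdd_borel_dz[OF gl])
    have [measurable]: "?Q \<in> borel_measurable borel" using Ql by (rule loc_bdd_borel_measurable)
    have [measurable]: "avg e ?Q \<in> borel_measurable borel" by (rule avg_borel[OF _ e]) measurable
    let ?q = "sq_norm_on ?S' ?Q"
    have four: "(\<integral>\<^sup>+x\<in>?S'. ennreal (4 * (norm (?Q x))\<^sup>2) \<partial>lborel) = 4 * ?q"
      unfolding sq_norm_on_def by (simp add: ennreal_mult mult.assoc nn_integral_cmult)
    have w1: "sq_norm_on ?S (\<lambda>x. u x - avg e u x) \<le> ennreal C1 * (4 * ?q)"
    proof -
      have "sq_norm_on ?S (\<lambda>x. u x - avg e u x) \<le> ennreal C0 * (\<integral>\<^sup>+x\<in>?S'. ennreal ((g x $ 1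
        - h x $ 2)\<^sup>2 + (g x $ 2 + h x $ 1)\<^sup>2) \<partial>lborel)"
        using C0[OF u v g h, of ?S ?S'] SS by (simp add: sq_norm_on_def)
      also have "(\<lambda>x. (g x $ 1 - h x $ 2)\<^sup>2 + (g x $ 2 + h x $ 1)\<^sup>2) = (\<lambda>x. 4 * (norm (?Q x))\<^sup>2)"
        by (simp add: norm_dzbar_sq power_divide fun_eq_iff)
      finally show ?thesis unfolding four
        by (rule order_trans) (intro mult_right_mono ennreal_leI, auto simp: C1_def)
    qed
    have w2: "sq_norm_on ?S (\<lambda>x. v x - avg e v x) \<le> ennreal C1 * (4 * ?q)"
    proof -
      \<comment> \<open>The pair of \<open>v\<close> and \<open>- u\<close> is the map multiplied by
        \<open>- i\<close>: its first component is \<open>v\<close> and the modulus of its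
        \<open>dzbar\<close> is unchanged, so the estimate for first components applies.\<close>
      have "L-lipschitz_on UNIV (\<lambda>x. - u x)" using u by simp
      then have "sq_norm_on ?S (\<lambda>x. v x - avg e v x) \<le> ennreal C0 * (\<integral>\<^sup>+x\<in>?S'. ennreal ((h x $ 1
        - (- g x) $ 2)\<^sup>2 + (h x $ 2 + (- g x) $ 1)\<^sup>2) \<partial>lborel)"
        using C0[OF v _ h has_gradient_AE_uminus[OF g], of L ?S ?S'] SS
          by (simp add: sq_norm_on_def)
      also have "(\<lambda>x. (h x $ 1 - (- g x) $ 2)\<^sup>2 + (h x $ 2 + (- g x) $ 1)\<^sup>2)
        = (\<lambda>x. 4 * (norm (?Q x))\<^sup>2)"
        unfolding norm_dzbar_sq by (rule ext) (simp add: power2_eq_square field_simps)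
      finally show ?thesis unfolding four
        by (rule order_trans) (intro mult_right_mono ennreal_leI, auto simp: C1_def)
    qed
    have dq: "sq_norm_on ?S (\<lambda>x. ?Q x - avg e ?Q x) \<le> 4 * ?q"
    proof -
      have "sq_norm_on ?S (\<lambda>x. ?Q x - avg e ?Q x)
        \<le> 2 * sq_norm_on ?S ?Q + 2 * sq_norm_on ?S (avg e ?Q)"
        by (rule sq_norm_on_diff_le) measurable
      also have "\<dots> \<le> 2 * ?q + 2 * ?q"
      proof (intro add_mono mult_left_mono)
        show "sq_norm_on ?S ?Q \<le> ?q" using e by (intro sq_norm_on_subset subset_ball) simp
        show "sq_norm_on ?S (avg e ?Q) \<le> ?q"
          by (rule order_trans[OF sq_norm_on_avg_le(1)[OF Ql e, of ?S ?S'] sq_norm_on_avg_le(2)[OF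
            Ql e, of ?S ?S']])
            (rule SS | simp)+
      qed auto
      also have "2 * ?q + 2 * ?q = 4 * ?q" by (simp flip: distrib_right)
      finally show ?thesis .
    qed
    have "sq_norm_on (ball a e) (\<lambda>x. dz (g x - avg e g x) (h x - avg e h x))
       \<le> 4 * sq_norm_on ?S (\<lambda>x. dzbar (g x - avg e g x) (h x - avg e h x))
        + ennreal (3 / e\<^sup>2) * (sq_norm_on ?S (\<lambda>x. u x - avg e u x) + sq_norm_on ?S
          (\<lambda>x. v x - avg e v x))"
      by (rule caccioppoli[OF e lipschitz_on_diff[OF u avg_lipschitz[OF u e]] lipschitz_on_diff[OF v
        avg_lipschitz[OF v e]]
            has_gradient_AE_diff[OF g has_gradient_AE_avg[OF u g e]] has_gradient_AE_diff[OF h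
              has_gradient_AE_avg[OF v h e]]])
    also have "\<dots> \<le> 4 * (4 * ?q) + ennreal (3 / e\<^sup>2) * (ennreal C1 * (4 * ?q)
      + ennreal C1 * (4 * ?q))"
      using w1 w2 dq unfolding dzbar_diff avg_dz(2)[OF gl e, symmetric]
      by (intro add_mono mult_left_mono) auto
    also have "\<dots> = ennreal (16 + 3 / e\<^sup>2 * (8 * C1)) * ?q"
    proof -
      define k where "k = 3 / e\<^sup>2"
      have k: "0 \<le> k" "0 \<le> C1" by (simp_all add: k_def C1_def)
      have "16 + k * (8 * C1) = 16 + (k * (C1 * 4) + k * (C1 * 4))" by simp
      then have "ennreal (16 + k * (8 * C1))
        = 16 + (ennreal k * (ennreal C1 * 4) + ennreal k * (ennreal C1 * 4))"
        using k by (simp only: ennreal_plus ennreal_mult ennreal_numeral mult_nonneg_nonneg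
          add_nonneg_nonneg zero_le_numeral)
      moreover have "4 * (4 * ?q) = 16 * ?q" by (simp flip: mult.assoc)
      ultimately show ?thesis unfolding k_def[symmetric]
        by (simp only: distrib_left distrib_right mult.assoc)
    qed
    finally show "sq_norm_on (ball a e) (\<lambda>x. dz (g x) (h x) - avg e (\<lambda>y. dz (g y) (h y)) x)
      \<le> ennreal (16 + 3 / e\<^sup>2 * (8 * C1)) * ?q"
      unfolding dz_diff avg_dz(1)[OF gl e, symmetric] .
  qed
qed

subsection \<open>Functions of almost constant modulus\<close>

text \<open>Packages epsilon arguments with a free parameter: the null sequence may depend on
  \<open>t\<close> while \<open>K\<close> must not, so \<open>t\<close> is fixed first and the index
  afterwards.\<close>

lemma ennreal_tendsto_0I:
  fixes f :: "nat \<Rightarrow> ennreal"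
  assumes K: "0 \<le> K" and H: "\<And>t. 0 < t \<Longrightarrow> t \<le> 1 \<Longrightarrow> \<exists>g. g \<longlonglongrightarrow> 0 \<and> (\<forall>n. f n \<le> ennreal (t * K) + g n)"
  shows "f \<longlonglongrightarrow> 0"
proof (rule order_tendstoI)
  fix a :: ennreal assume a: "0 < a"
  obtain e :: real where e: "0 < e" "ennreal e \<le> a"
  proof (cases a)
    case (real r)
    then show ?thesis using a that[of r] by (auto simp: ennreal_less_zero_iff)
  next
    case top
    then show ?thesis using that[of 1] by simp
  qed
  define t where "t = min 1 (e / (2 * (K + 1)))"
  have t: "0 < t" "t \<le> 1" using e K by (auto simp: t_def)
  have "t * K \<le> e / (2 * (K + 1)) * (K + 1)" using K e by (intro mult_mono) (auto simp: t_def)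
  also have "\<dots> = e / 2" using K by (simp add: field_simps)
  finally have tK: "t * K \<le> e / 2" .
  obtain g where g: "g \<longlonglongrightarrow> 0" "\<And>n. f n \<le> ennreal (t * K) + g n" using H[OF t] by blast
  have "eventually (\<lambda>n. g n < ennreal (e / 2)) sequentially"
    using g(1) e by (intro order_tendstoD(2)) auto
  then show "eventually (\<lambda>n. f n < a) sequentially"
  proof eventually_elim
    case (elim n)
    have "f n \<le> ennreal (e / 2) + g n" using g(2)[of n] tK
      by (meson add_right_mono ennreal_leI order_trans)
    also have "\<dots> < ennreal (e / 2) + ennreal (e / 2)" using elim
      by (simp add: ennreal_add_left_cancel_less)
    also have "\<dots> = ennreal e" using e by (simp flip: ennreal_plus)
    finally show ?case using e(2) by simp
  qed
qed simp

lemma ennreal_squeeze_0: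
  fixes f g :: "nat \<Rightarrow> ennreal"
  assumes "g \<longlonglongrightarrow> 0" "\<And>n. f n \<le> g n"
  shows "f \<longlonglongrightarrow> 0"
  by (rule tendsto_sandwich[OF _ _ tendsto_const assms(1)]) (use assms(2) in auto)

lemma ennreal_cmult_tendsto_0:
  fixes f :: "nat \<Rightarrow> ennreal"
  assumes "f \<longlonglongrightarrow> 0" "c < top"
  shows "(\<lambda>n. c * f n) \<longlonglongrightarrow> 0"
  using ennreal_tendsto_cmult[OF assms(2,1)] by simp

lemma ennreal_add_tendsto_0:
  fixes f g :: "nat \<Rightarrow> ennreal"
  assumes "f \<longlonglongrightarrow> 0" "g \<longlonglongrightarrow> 0"
  shows "(\<lambda>n. f n + g n) \<longlonglongrightarrow> 0"
  using tendsto_add[OF assms] by simp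

lemma avg_mono:
  fixes f g :: "'a::euclidean_space \<Rightarrow> real"
  assumes "loc_bdd_borel f" "loc_bdd_borel g" "0 < e" "\<And>x. f x \<le> g x"
  shows "avg e f x \<le> avg e g x"
  unfolding avg_def using assms by (intro integral_mono loc_bdd_borel_integrable_disc) auto

lemma nn_integral_linear_combination4:
  assumes "f1 \<in> borel_measurable M" "f2 \<in> borel_measurable M" "f3 \<in> borel_measurable M"
    "f4 \<in> borel_measurable M"
  shows "(\<integral>\<^sup>+x. a * f1 x + (b * f2 x + c * f3 x + d * f4 x) \<partial>M) =
    a * (\<integral>\<^sup>+x. f1 x \<partial>M) + (b * (\<integral>\<^sup>+x. f2 x \<partial>M) + c * (\<integral>\<^sup>+x. f3 x \<partial>M) + d * (\<integral>\<^sup>+x. f4 x \<partial>M))"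
  using assms by (simp add: nn_integral_add nn_integral_cmult)

text \<open>Expand \<open>avg \<bar>P - P x\<bar>\<^sup>2 = avg \<bar>P\<bar>\<^sup>2 - 2 (avg P \<bullet> P x) + \<bar>P x\<bar>\<^sup>2\<close>: the modulus of \<open>P\<close> is almost \<open>c\<close> and
  \<open>avg P\<close> is almost \<open>P x\<close>, so the terms are almost \<open>c\<^sup>2\<close>, \<open>2 c\<^sup>2\<close> and \<open>c\<^sup>2\<close>.\<close>

lemma variance_tendsto_0:
  fixes P :: "nat \<Rightarrow> 'a::euclidean_space \<Rightarrow> complex"
  assumes P: "\<And>n. loc_bdd_borel (P n)" and e: "0 < e" and c: "0 \<le> c"
    and A: "(\<lambda>n. sq_norm_on (ball a (2 * e)) (\<lambda>x. norm (P n x) - c)) \<longlonglongrightarrow> 0"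
    and D: "(\<lambda>n. sq_norm_on (ball a e) (\<lambda>x. P n x - avg e (P n) x)) \<longlonglongrightarrow> 0"
  shows "(\<lambda>n. \<integral>\<^sup>+x\<in>ball a e. ennreal (avg e (\<lambda>y. (norm (P n y - P n x))\<^sup>2) x) \<partial>lborel) \<longlonglongrightarrow> 0"
proof (rule ennreal_tendsto_0I[where K="(c\<^sup>2 + 3) * measure lborel (ball a e)"])
  show "0 \<le> (c\<^sup>2 + 3) * measure lborel (ball a e)" by simp
  fix t :: real assume t: "0 < t" "t \<le> 1"
  \<comment> \<open>Young's inequality trades the linear deviation of the modulus from
    \<open>c\<close> for \<open>t\<close> plus \<open>c\<^sup>2 / t\<close> times its square; the
    summand 1 is the square already present in the expansion of
    \<open>(norm (P n y))\<^sup>2\<close>.\<close>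
  define k where "k = 1 + c\<^sup>2 / t"
  have k: "0 \<le> k" using t by (simp add: k_def)
  define q where "q n y = (norm (P n y) - c)\<^sup>2" for n y
  have ql: "loc_bdd_borel (q n)" for n unfolding q_def by (intro loc_bdd_borel_intros P)
  have cb: "\<bar>2 * c * b\<bar> \<le> t + c\<^sup>2 / t * b\<^sup>2" for b :: real
  proof -
    have "2 * c * \<bar>b\<bar> * t \<le> t * t + c\<^sup>2 * b\<^sup>2"
      using sum_squares_bound[of t "c * \<bar>b\<bar>"]
        by (simp add: power_mult_distrib power2_eq_square algebra_simps)
    then have "2 * c * \<bar>b\<bar> \<le> (t * t + c\<^sup>2 * b\<^sup>2) / t" using t by (simp add: pos_le_divide_eq)
    also have "\<dots> = t + c\<^sup>2 / t * b\<^sup>2" using t by (simp add: add_divide_distrib)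
    finally show ?thesis using c by (simp add: abs_mult)
  qed
  have Psq: "(norm (P n y))\<^sup>2 \<le> c\<^sup>2 + t + k * q n y" "c\<^sup>2 - t - k * q n y \<le> (norm (P n y))\<^sup>2"
    for n y
  proof -
    have "(norm (P n y))\<^sup>2 = c\<^sup>2 + q n y + 2 * c * (norm (P n y) - c)"
      by (simp add: q_def power2_eq_square algebra_simps)
    moreover have "k * q n y = q n y + c\<^sup>2 / t * (norm (P n y) - c)\<^sup>2"
      by (simp add: k_def q_def algebra_simps)
    moreover have "0 \<le> q n y" by (simp add: q_def)
    ultimately show "(norm (P n y))\<^sup>2 \<le> c\<^sup>2 + t + k * q n y" "c\<^sup>2 - t - k * q n y
      \<le> (norm (P n y))\<^sup>2"
      using cb[of "norm (P n y) - c"] by (simp_all add: abs_le_iff)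
  qed
  \<comment> \<open>Of the term \<open>t * (c\<^sup>2 + 3)\<close>, one \<open>t\<close> comes from
    the average of the squared moduli, one from the lower bound at \<open>x\<close>, and
    \<open>t * (c\<^sup>2 + 1)\<close> from Young's inequality for the inner product of
    \<open>P n x\<close> with its deviation from the average; the last part uses
    \<open>t \<le> 1\<close>.\<close>
  have pt: "avg e (\<lambda>y. (norm (P n y - P n x))\<^sup>2) x \<le>
     t * (c\<^sup>2 + 3) + (2 * k * avg e (q n) x + 2 * k * q n x + (1 / t) * (norm (P n x - avg e
       (P n) x))\<^sup>2)" for n x
  proof -
    let ?m = "avg e (P n) x"
    have kl: "loc_bdd_borel (\<lambda>y. k * q n y)" by (intro loc_bdd_borel_intros ql)
    have "avg e (\<lambda>y. (norm (P n y))\<^sup>2) x \<le> avg e (\<lambda>y. (c\<^sup>2 + t) + k * q n y) x"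
      by (intro avg_mono loc_bdd_borel_intros P ql e) (use Psq(1) in auto)
    also have "\<dots> = c\<^sup>2 + t + k * avg e (q n) x"
      using avg_linear[OF bounded_linear_mult_right ql e, of k n x]
      by (simp add: avg_add[OF loc_bdd_borel_const kl e] avg_const[OF e])
    finally have 1: "avg e (\<lambda>y. (norm (P n y))\<^sup>2) x \<le> c\<^sup>2 + t + k * avg e (q n) x" .
    have "2 * (P n x \<bullet> (P n x - ?m)) \<le> t * (norm (P n x))\<^sup>2 + (1 / t) * (norm (P n x - ?m))\<^sup>2"
    proof -
      have "2 * (P n x \<bullet> (P n x - ?m)) \<le> 2 * (norm (P n x) * norm (P n x - ?m))"
        using norm_cauchy_schwarz[of "P n x" "P n x - ?m"] by simp
      also have "\<dots> * t \<le> (t * norm (P n x))\<^sup>2 + (norm (P n x - ?m))\<^sup>2"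
        using sum_squares_bound[of "t * norm (P n x)" "norm (P n x - ?m)"] by (simp add: mult_ac)
      finally have "2 * (P n x \<bullet> (P n x - ?m)) * t \<le> (t * norm (P n x))\<^sup>2 + (norm (P n x - ?m))\<^sup>2"
        using t by (simp add: mult_right_mono)
      then have "2 * (P n x \<bullet> (P n x - ?m)) \<le> ((t * norm (P n x))\<^sup>2 + (norm (P n x - ?m))\<^sup>2) / t"
        using t by (simp add: pos_le_divide_eq)
      also have "\<dots> = t * (norm (P n x))\<^sup>2 + (1 / t) * (norm (P n x - ?m))\<^sup>2"
        using t by (simp add: add_divide_distrib power2_eq_square)
      finally show ?thesis .
    qed
    moreover have "t * (norm (P n x))\<^sup>2 \<le> t * (c\<^sup>2 + t + k * q n x)"
      using Psq(1) t by (intro mult_left_mono) auto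
    moreover have "t * (c\<^sup>2 + t + k * q n x) \<le> t * c\<^sup>2 + t + k * q n x"
    proof -
      have "t * t \<le> t" "t * (k * q n x) \<le> k * q n x"
        using t k by (auto simp: q_def mult_left_le mult_left_le_one_le)
      then show ?thesis by (simp add: algebra_simps)
    qed
    moreover have "0 \<le> k * avg e (q n) x"
      using k unfolding avg_def by (intro mult_nonneg_nonneg Bochner_Integration.integral_nonneg)
        (auto simp: q_def)
    moreover have "- 2 * (?m \<bullet> P n x) + (norm (P n x))\<^sup>2 = - (norm (P n x))\<^sup>2 + 2 * (P n x \<bullet> (P n x
      - ?m))"
      by (simp add: inner_diff_right power2_norm_eq_inner inner_commute)
    ultimately show ?thesis
      unfolding avg_norm_diff_sq[OF P e] using 1 Psq(2)[of n x] by (simp add: algebra_simps)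
  qed
  define g where "g n = ennreal (2 * k) * sq_norm_on (ball a (2 * e)) (\<lambda>x. norm (P n x) - c)
     + ennreal (2 * k) * sq_norm_on (ball a (2 * e)) (\<lambda>x. norm (P n x) - c)
     + ennreal (1 / t) * sq_norm_on (ball a e) (\<lambda>x. P n x - avg e (P n) x)" for n
  have "g \<longlonglongrightarrow> 0" unfolding g_def
    by (intro ennreal_add_tendsto_0 ennreal_cmult_tendsto_0 A D) auto
  moreover have "(\<integral>\<^sup>+x\<in>ball a e. ennreal (avg e (\<lambda>y. (norm (P n y - P n x))\<^sup>2) x) \<partial>lborel)
     \<le> ennreal (t * ((c\<^sup>2 + 3) * measure lborel (ball a e))) + g n" for n
  proof -
    have [measurable]: "P n \<in> borel_measurable borel" "q n \<in> borel_measurable borel"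
      using P ql loc_bdd_borel_measurable by blast+
    have [measurable]: "avg e (P n) \<in> borel_measurable borel" "avg e (q n) \<in> borel_measurable borel"
      using e by (auto intro!: avg_borel)
    let ?I = "indicator (ball a e) :: 'a \<Rightarrow> ennreal"
    have q0: "0 \<le> avg e (q n) x" for x
      unfolding avg_def by (intro Bochner_Integration.integral_nonneg) (auto simp: q_def)
    have "(\<integral>\<^sup>+x\<in>ball a e. ennreal (avg e (\<lambda>y. (norm (P n y - P n x))\<^sup>2) x) \<partial>lborel)
      \<le> (\<integral>\<^sup>+x. ennreal (t * (c\<^sup>2 + 3)) * ?I x + (ennreal (2 * k) * (ennreal (avg e (q n) x) * ?I x)
         + ennreal (2 * k) * (ennreal (q n x) * ?I x)
         + ennreal (1 / t) * (ennreal ((norm (P n x - avg e (P n) x))\<^sup>2) * ?I x)) \<partial>lborel)"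
    proof (rule nn_integral_mono)
      fix x
      have "ennreal (avg e (\<lambda>y. (norm (P n y - P n x))\<^sup>2) x)
        \<le> ennreal (t * (c\<^sup>2 + 3) + (2 * k * avg e (q n) x + 2 * k * q n x + (1 / t) * (norm
        (P n x - avg e (P n) x))\<^sup>2))"
        by (intro ennreal_leI pt)
      also have "\<dots> = ennreal (t * (c\<^sup>2 + 3)) + (ennreal (2 * k) * ennreal (avg e (q n) x)
        + ennreal (2 * k) * ennreal (q n x)
         + ennreal (1 / t) * ennreal ((norm (P n x - avg e (P n) x))\<^sup>2))"
      proof -
        have "0 \<le> q n x" by (simp add: q_def)
        then show ?thesis using t k q0[of x]
          by (simp add: ennreal_plus ennreal_mult del: times_divide_eq_left)
      qed
      finally show "ennreal (avg e (\<lambda>y. (norm (P n y - P n x))\<^sup>2) x) * ?I x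
        \<le> ennreal (t * (c\<^sup>2 + 3)) * ?I x + (ennreal (2 * k) * (ennreal (avg e (q n) x) * ?I x)
         + ennreal (2 * k) * (ennreal (q n x) * ?I x)
         + ennreal (1 / t) * (ennreal ((norm (P n x - avg e (P n) x))\<^sup>2) * ?I x))"
        by (auto simp: indicator_def)
    qed
    also have "\<dots> = ennreal (t * (c\<^sup>2 + 3)) * emeasure lborel (ball a e)
      + (ennreal (2 * k) * (\<integral>\<^sup>+x\<in>ball a e. ennreal (avg e (q n) x) \<partial>lborel)
         + ennreal (2 * k) * (\<integral>\<^sup>+x\<in>ball a e. ennreal (q n x) \<partial>lborel)
         + ennreal (1 / t) * sq_norm_on (ball a e) (\<lambda>x. P n x - avg e (P n) x))"
    proof -
      have m: "(\<lambda>x. ennreal (avg e (q n) x) * ?I x) \<in> borel_measurable lborel"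
        "(\<lambda>x. ennreal (q n x) * ?I x) \<in> borel_measurable lborel"
        "(\<lambda>x. ennreal ((norm (P n x - avg e (P n) x))\<^sup>2) * ?I x) \<in> borel_measurable lborel"
        by measurable
      have i: "?I \<in> borel_measurable lborel" by measurable
      show ?thesis
        unfolding sq_norm_on_def by (subst nn_integral_linear_combination4[OF i m]) simp
    qed
    also have "ennreal (t * (c\<^sup>2 + 3)) * emeasure lborel (ball a e)
      = ennreal (t * ((c\<^sup>2 + 3) * measure lborel (ball a e)))"
      using t emeasure_lborel_ball_finite[of a e]
      by (subst emeasure_eq_ennreal_measure) (auto simp: ennreal_mult[symmetric] mult.assoc)
    also have "(\<integral>\<^sup>+x\<in>ball a e. ennreal (avg e (q n) x) \<partial>lborel)
      \<le> sq_norm_on (ball a (2 * e)) (\<lambda>x. norm (P n x) - c)"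
    proof -
      have ST: "x + z \<in> ball a (2 * e)" if "x \<in> ball a e" "z \<in> ball 0 e" for x z
      proof -
        have "dist a (x + z) \<le> dist a x + norm z"
          by (metis add_diff_cancel_left' dist_norm dist_triangle dist_commute)
        then show ?thesis using that by simp
      qed
      have "loc_bdd_borel (\<lambda>x. norm (P n x) - c)" by (intro loc_bdd_borel_intros P)
      then have "(\<integral>\<^sup>+x\<in>ball a e. ennreal (avg e (\<lambda>y. (norm (norm (P n y) - c))\<^sup>2) x) \<partial>lborel)
          \<le> sq_norm_on (ball a (2 * e)) (\<lambda>x. norm (P n x) - c)"
        by (rule sq_norm_on_avg_le(2)[OF _ e]) (rule ST | simp)+
      then show ?thesis by (simp add: q_def[abs_def])
    qed
    also have "(\<integral>\<^sup>+x\<in>ball a e. ennreal (q n x) \<partial>lborel)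
      \<le> sq_norm_on (ball a (2 * e)) (\<lambda>x. norm (P n x) - c)"
    proof -
      have "(\<integral>\<^sup>+x\<in>ball a e. ennreal (q n x) \<partial>lborel) = sq_norm_on (ball a e) (\<lambda>x. norm (P n x) - c)"
        by (simp add: sq_norm_on_def q_def)
      also have "\<dots> \<le> sq_norm_on (ball a (2 * e)) (\<lambda>x. norm (P n x) - c)"
        using e by (intro sq_norm_on_subset subset_ball) simp
      finally show ?thesis .
    qed
    finally show ?thesis by (simp add: g_def add_left_mono mult_left_mono add_mono)
  qed
  ultimately show "\<exists>g. g \<longlonglongrightarrow> 0 \<and> (\<forall>n. (\<integral>\<^sup>+x\<in>ball a e. ennreal (avg e (\<lambda>y. (norm (P n y
    - P n x))\<^sup>2) x) \<partial>lborel)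
     \<le> ennreal (t * ((c\<^sup>2 + 3) * measure lborel (ball a e))) + g n)" by blast
qed

text \<open>Nonnegativity allows the integral over the small ball to be enlarged to the big one;
  only the normalizing volumes differ.\<close>

lemma avg_le_avg:
  fixes F :: "'a::euclidean_space \<Rightarrow> real"
  assumes F: "loc_bdd_borel F" "\<And>x. 0 \<le> F x" and d: "0 < d" "0 < e" and sub: "ball a d \<subseteq> ball x e"
  shows "avg d F a \<le> measure lborel (ball (0::'a) e) / measure lborel (ball (0::'a) d) * avg e F x"
proof -
  have [measurable]: "F \<in> borel_measurable borel" using F(1) by (rule loc_bdd_borel_measurable)
  have sh: "(LINT z|lborel. indicator (ball 0 s) z * F (b + z))
    = (LINT y|lborel. indicator (ball b s) y * F y)" for s b
  proof -
    have "(LINT z|lborel. indicator (ball b s) (z + b) * F (z + b))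
      = (LINT y|lborel. indicator (ball b s) y * F y)"
      by (rule integral_lborel_shift) measurable
    moreover have "indicator (ball b s) (z + b) = (indicator (ball 0 s) z :: real)" for z
      by (simp add: indicator_def dist_norm)
    ultimately show ?thesis by (simp add: add.commute)
  qed
  have int: "integrable lborel (\<lambda>y. indicator (ball b s) y * F y)" for b s
  proof -
    obtain B where B: "0 \<le> B" "\<And>x. x \<in> ball b s \<Longrightarrow> norm (F x) \<le> B"
      using loc_bdd_borelE[OF F(1) bounded_ball] by metis
    have "integrable lborel (\<lambda>y. indicator (ball b s) y *\<^sub>R F y)"
      by (rule integrableI_bounded_set_indicator[where B=B])
        (use B emeasure_lborel_ball_finite[of b s] in auto)
    then show ?thesis by simp
  qed
  let ?m = "measure lborel (ball (0::'a) e)" and ?k = "measure lborel (ball (0::'a) d)"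
  have "avg d F a = 1 / ?k * (LINT y|lborel. indicator (ball a d) y * F y)"
    by (simp add: avg_eq sh)
  also have "\<dots> \<le> 1 / ?k * (LINT y|lborel. indicator (ball x e) y * F y)"
    by (intro mult_left_mono integral_mono int) (use F sub in \<open>auto simp: indicator_def\<close>)
  also have "\<dots> = ?m / ?k * avg e F x"
    using measure_ball_pos[OF d(2), where 'a='a] by (simp add: avg_eq sh)
  finally show ?thesis .
qed

text \<open>The variance compares values of \<open>P n\<close> with the moving reference
  \<open>P n x\<close>. For \<open>x\<close> in the half-size ball, that ball lies in
  \<open>ball x e\<close>, so by Jensen the same variance bounds the distance of
  \<open>P n x\<close> from one average that does not depend on \<open>x\<close>.\<close>

lemma local_almost_constant:
  fixes P :: "nat \<Rightarrow> 'a::euclidean_space \<Rightarrow> complex"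
  assumes P: "\<And>n. loc_bdd_borel (P n)" and e: "0 < e" and c: "0 \<le> c"
    and A: "(\<lambda>n. sq_norm_on (ball a (2 * e)) (\<lambda>x. norm (P n x) - c)) \<longlonglongrightarrow> 0"
    and D: "(\<lambda>n. sq_norm_on (ball a e) (\<lambda>x. P n x - avg e (P n) x)) \<longlonglongrightarrow> 0"
  shows "(\<lambda>n. sq_norm_on (ball a (e / 2)) (\<lambda>x. P n x - avg (e / 2) (P n) a)) \<longlonglongrightarrow> 0"
proof -
  have e2: "0 < e / 2" using e by simp
  define M where "M = measure lborel (ball (0::'a) e) / measure lborel (ball (0::'a) (e / 2))"
  have M0: "0 \<le> M" by (simp add: M_def)
  let ?V = "\<lambda>n x. avg e (\<lambda>y. (norm (P n y - P n x))\<^sup>2) x"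
  have pt: "(norm (P n x - avg (e / 2) (P n) a))\<^sup>2 \<le> M * ?V n x" if x: "x \<in> ball a (e / 2)" for n x
  proof -
    have l: "loc_bdd_borel (\<lambda>y. P n y - P n x)" by (intro loc_bdd_borel_intros P)
    have "avg (e / 2) (\<lambda>y. P n y - P n x) a = avg (e / 2) (P n) a - P n x"
      by (simp add: avg_diff[OF P loc_bdd_borel_const e2] avg_const[OF e2])
    then have "(norm (P n x - avg (e / 2) (P n) a))\<^sup>2
      = (norm (avg (e / 2) (\<lambda>y. P n y - P n x) a))\<^sup>2"
      by (simp add: norm_minus_commute)
    also have "\<dots> \<le> avg (e / 2) (\<lambda>y. (norm (P n y - P n x))\<^sup>2) a" by (rule avg_jensen[OF l e2])
    also have "\<dots> \<le> M * ?V n x"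
      unfolding M_def
    proof (rule avg_le_avg)
      show "ball a (e / 2) \<subseteq> ball x e"
      proof
        fix y assume "y \<in> ball a (e / 2)"
        then show "y \<in> ball x e" using x dist_triangle[of x y a] by (simp add: dist_commute)
      qed
    qed (use e l in \<open>auto intro!: loc_bdd_borel_intros\<close>)
    finally show ?thesis .
  qed
  have "(\<lambda>n. ennreal M * (\<integral>\<^sup>+x\<in>ball a e. ennreal (?V n x) \<partial>lborel)) \<longlonglongrightarrow> 0"
    by (intro ennreal_cmult_tendsto_0 variance_tendsto_0[OF P e c A D]) auto
  then show ?thesis
  proof (rule ennreal_squeeze_0)
    fix n
    have [measurable]: "P n \<in> borel_measurable borel" using P loc_bdd_borel_measurable by blast
    have [measurable]: "avg e (P n) \<in> borel_measurable borel"
      "avg e (\<lambda>y. (norm (P n y))\<^sup>2) \<in> borel_measurable borel"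
      using e by (auto intro!: avg_borel)
    have [measurable]: "?V n \<in> borel_measurable borel"
      unfolding avg_norm_diff_sq[OF P e] by measurable
    have "sq_norm_on (ball a (e / 2)) (\<lambda>x. P n x - avg (e / 2) (P n) a)
       \<le> (\<integral>\<^sup>+x. ennreal M * (ennreal (?V n x) * indicator (ball a e) x) \<partial>lborel)"
      unfolding sq_norm_on_def
    proof (rule nn_integral_mono)
      fix x
      show "ennreal ((norm (P n x - avg (e / 2) (P n) a))\<^sup>2) * indicator (ball a (e / 2)) x
         \<le> ennreal M * (ennreal (?V n x) * indicator (ball a e) x)"
      proof (cases "x \<in> ball a (e / 2)")
        case True
        then have "x \<in> ball a e" using e by simp
        moreover have "ennreal ((norm (P n x - avg (e / 2) (P n) a))\<^sup>2)
          \<le> ennreal M * ennreal (?V n x)"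
          using pt[OF True, of n] M0 by (subst ennreal_mult'[symmetric]) (auto intro: ennreal_leI)
        ultimately show ?thesis using True by simp
      qed simp
    qed
    also have "\<dots> = ennreal M * (\<integral>\<^sup>+x\<in>ball a e. ennreal (?V n x) \<partial>lborel)"
      by (rule nn_integral_cmult) measurable
    finally show "sq_norm_on (ball a (e / 2)) (\<lambda>x. P n x - avg (e / 2) (P n) a)
       \<le> ennreal M * (\<integral>\<^sup>+x\<in>ball a e. ennreal (?V n x) \<partial>lborel)" .
  qed
qed

section \<open>From local to global convergence\<close>

lemma emeasure_ball_pos_finite:
  fixes x :: "'a::euclidean_space"
  assumes "0 < r"
  shows "0 < emeasure lborel (ball x r)" "emeasure lborel (ball x r) < top"
  using assms emeasure_lborel_ball_finite[of x r]
    by (auto simp: emeasure_ball ennreal_less_zero_iff)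

lemma emeasure_ball_eq_ennreal:
  fixes x :: "'a::euclidean_space"
  assumes "0 < r"
  shows "emeasure lborel (ball x r) = ennreal (measure lborel (ball x r))"
  using emeasure_ball_pos_finite(2)[OF assms, of x] by (intro emeasure_eq_ennreal_measure) auto

lemma const_tendsto_0_from_sq_norm:
  fixes a :: "nat \<Rightarrow> 'b::euclidean_space" and x :: "'a::euclidean_space"
  assumes r: "0 < r" and s: "(\<lambda>n. sq_norm_on (ball x r) (\<lambda>y. a n)) \<longlonglongrightarrow> 0"
  shows "a \<longlonglongrightarrow> 0"
proof -
  define m where "m = measure lborel (ball x r)"
  have m: "0 < m" "emeasure lborel (ball x r) = ennreal m"
    unfolding m_def using emeasure_ball_eq_ennreal[OF r, of x] r by (auto simp: content_ball)
  have "(\<lambda>n. ennreal ((norm (a n))\<^sup>2 * m)) \<longlonglongrightarrow> ennreal 0"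
    using s m by (simp add: sq_norm_on_const ennreal_mult)
  then have "(\<lambda>n. (norm (a n))\<^sup>2 * m) \<longlonglongrightarrow> 0"
    using m by (subst (asm) tendsto_ennreal_iff) auto
  then have "(\<lambda>n. (norm (a n))\<^sup>2 * m * (1 / m)) \<longlonglongrightarrow> 0 * (1 / m)" by (intro tendsto_mult tendsto_const)
  then have "(\<lambda>n. (norm (a n))\<^sup>2) \<longlonglongrightarrow> 0" using m by simp
  then have "(\<lambda>n. sqrt ((norm (a n))\<^sup>2)) \<longlonglongrightarrow> sqrt 0" by (rule tendsto_real_sqrt)
  then show ?thesis by (simp add: tendsto_norm_zero_iff)
qed

text \<open>Bolzano-Weierstrass on one ball selects the subsequence and the limit \<open>A\<close>.
  The approximate constants of overlapping balls are asymptotically equal because the overlap has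
  positive measure, so the set where \<open>A\<close> is the limit is open and relatively closed in
  the connected set \<open>U\<close>.\<close>

lemma locally_almost_constant_imp_convergent_subsequence:
  fixes X :: "nat \<Rightarrow> 'a::euclidean_space \<Rightarrow> 'b::euclidean_space"
  assumes U: "open U" "connected U" "U \<noteq> {}"
    and X [measurable]: "\<And>n. X n \<in> borel_measurable borel"
    and loc: "\<And>x. x \<in> U \<Longrightarrow> \<exists>r>0. ball x r \<subseteq> U \<and> (\<exists>a. (\<lambda>n. sq_norm_on (ball x r) (\<lambda>y. X n y - a n))
      \<longlonglongrightarrow> 0)"
    and bdd: "eventually (\<lambda>n. sq_norm_on U (X n) \<le> ennreal M) sequentially"
  shows "\<exists>s A. strict_mono (s :: nat \<Rightarrow> nat) \<and> (\<forall>x\<in>U. \<exists>r>0. ball x r \<subseteq> U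
    \<and> (\<lambda>n. sq_norm_on (ball x r) (\<lambda>y. X (s n) y - A)) \<longlonglongrightarrow> 0)"
proof -
  obtain x0 where x0: "x0 \<in> U" using U by blast
  obtain r0 a where r0: "r0 > 0" "ball x0 r0 \<subseteq> U" "(\<lambda>n. sq_norm_on (ball x0 r0) (\<lambda>y. X n y - a n))
    \<longlonglongrightarrow> 0"
    using loc[OF x0] by blast
  define m where "m = measure lborel (ball x0 r0)"
  have m: "0 < m" "emeasure lborel (ball x0 r0) = ennreal m"
    unfolding m_def using emeasure_ball_eq_ennreal[OF r0(1), of x0] r0(1)
      by (auto simp: content_ball)
  have "eventually (\<lambda>n. sq_norm_on (ball x0 r0) (\<lambda>y. X n y - a n) < 1) sequentially"
    using r0(3) by (rule order_tendstoD(2)) simp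
  with bdd have "eventually (\<lambda>n. norm (a n) \<le> sqrt ((2 * max M 0 + 2) / m)) sequentially"
  proof eventually_elim
    case (elim n)
    have "sq_norm_on (ball x0 r0) (\<lambda>y. a n) = sq_norm_on (ball x0 r0) (\<lambda>y. X n y - (X n y - a n))"
      by simp
    also have "\<dots> \<le> 2 * sq_norm_on (ball x0 r0) (X n) + 2 * sq_norm_on (ball x0 r0) (\<lambda>y. X n y
      - a n)"
      by (rule sq_norm_on_diff_le) measurable
    also have "\<dots> \<le> 2 * ennreal (max M 0) + 2 * 1"
    proof (intro add_mono mult_left_mono)
      show "sq_norm_on (ball x0 r0) (X n) \<le> ennreal (max M 0)"
        by (rule order_trans[OF sq_norm_on_subset[OF r0(2)] order_trans[OF elim(1) ennreal_leI]])
          simp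
    qed (use elim in auto)
    also have "\<dots> = ennreal (2 * max M 0 + 2)" by (simp add: ennreal_mult flip: ennreal_numeral)
    finally have "ennreal ((norm (a n))\<^sup>2 * m) \<le> ennreal (2 * max M 0 + 2)"
      using m by (simp add: sq_norm_on_const ennreal_mult)
    then have "(norm (a n))\<^sup>2 * m \<le> 2 * max M 0 + 2" by (subst (asm) ennreal_le_iff) auto
    then have "(norm (a n))\<^sup>2 \<le> (2 * max M 0 + 2) / m" using m by (simp add: pos_le_divide_eq)
    then show ?case by (metis real_sqrt_le_iff norm_ge_zero real_sqrt_unique)
  qed
  then have "Bseq a" by (rule BfunI)
  then have "bounded (range a)" by (simp add: Bseq_eq_bounded)
  then obtain A s where s: "strict_mono (s :: nat \<Rightarrow> nat)" "(a \<circ> s) \<longlonglongrightarrow> A"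
    using bounded_imp_convergent_subsequence by blast
  have sub: "(\<lambda>n. f (s n)) \<longlonglongrightarrow> l" if "f \<longlonglongrightarrow> l" for f :: "nat \<Rightarrow> ennreal" and l
    using LIMSEQ_subseq_LIMSEQ[OF that s(1)] by (simp add: o_def)
  define good where "good x r \<longleftrightarrow> (\<lambda>n. sq_norm_on (ball x r) (\<lambda>y. X (s n) y - A)) \<longlonglongrightarrow> 0" for x r
  have goodI: "good x r" if r: "r > 0" and c: "(\<lambda>n. sq_norm_on (ball x r) (\<lambda>y. X n y - b n)) \<longlonglongrightarrow> 0"
    and b: "(\<lambda>n. b (s n)) \<longlonglongrightarrow> A" for x r b
  proof -
    have "(\<lambda>n. ennreal ((norm (b (s n) - A))\<^sup>2)) \<longlonglongrightarrow> ennreal ((norm (A - A))\<^sup>2)"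
      by (intro tendsto_intros b)
    then have z: "(\<lambda>n. ennreal ((norm (b (s n) - A))\<^sup>2)) \<longlonglongrightarrow> 0" by simp
    have "(\<lambda>n. 2 * sq_norm_on (ball x r) (\<lambda>y. X (s n) y - b (s n))
      + 2 * (emeasure lborel (ball x r) * ennreal ((norm (b (s n) - A))\<^sup>2))) \<longlonglongrightarrow> 0"
      using emeasure_ball_pos_finite[OF r, of x]
      by (intro ennreal_add_tendsto_0 ennreal_cmult_tendsto_0 sub[OF c] z) auto
    then show ?thesis unfolding good_def
    proof (rule ennreal_squeeze_0)
      fix n
      have "sq_norm_on (ball x r) (\<lambda>y. X (s n) y - A)
        = sq_norm_on (ball x r) (\<lambda>y. (X (s n) y - b (s n)) + (b (s n) - A))" by simp
      also have "\<dots> \<le> 2 * sq_norm_on (ball x r) (\<lambda>y. X (s n) y - b (s n))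
        + 2 * sq_norm_on (ball x r) (\<lambda>y. b (s n) - A)"
        by (rule sq_norm_on_add_le) measurable
      finally show "sq_norm_on (ball x r) (\<lambda>y. X (s n) y - A)
        \<le> 2 * sq_norm_on (ball x r) (\<lambda>y. X (s n) y - b (s n)) + 2 * (emeasure lborel
        (ball x r) * ennreal ((norm (b (s n) - A))\<^sup>2))"
        by (simp add: sq_norm_on_const mult.commute)
    qed
  qed
  have good_sub: "good y d" if "good x r" "ball y d \<subseteq> ball x r" for x r y d
    using that(1) unfolding good_def
      by (rule ennreal_squeeze_0) (rule sq_norm_on_subset[OF that(2)])
  define T where "T = {x \<in> U. \<exists>r>0. ball x r \<subseteq> U \<and> good x r}"
  have ballin: "\<exists>d>0. ball y d \<subseteq> ball x r" if "y \<in> ball x r" for x y :: 'a and r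
    using open_ball that openE by blast
  have "open T"
  proof (rule openI)
    fix x assume "x \<in> T"
    then obtain r where r: "r > 0" "ball x r \<subseteq> U" "good x r" by (auto simp: T_def)
    have "ball x r \<subseteq> T"
    proof
      fix y assume y: "y \<in> ball x r"
      then obtain d where "d > 0" "ball y d \<subseteq> ball x r" using ballin by blast
      then show "y \<in> T" using r y good_sub unfolding T_def by blast
    qed
    then show "\<exists>e>0. ball x e \<subseteq> T" using r by blast
  qed
  \<comment> \<open>On a small ball around \<open>y\<close> both \<open>b (s n)\<close> and
    \<open>A\<close> approximate \<open>X (s n)\<close>, which forces \<open>b (s n)\<close> to tend
    to \<open>A\<close>. Contrapositively, a point of \<open>U\<close> outside \<open>T\<close> has
    a ball disjoint from \<open>T\<close>.\<close>
  have close: "x \<in> T" if x: "x \<in> U"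
    and r: "r > 0" "ball x r \<subseteq> U" "(\<lambda>n. sq_norm_on (ball x r) (\<lambda>y. X n y - b n)) \<longlonglongrightarrow> 0"
     and y: "y \<in> ball x r" "y \<in> T" for x r b y
  proof -
    obtain r' where r': "r' > 0" "good y r'" using y by (auto simp: T_def)
    obtain d where d: "d > 0" "ball y d \<subseteq> ball x r" using ballin[OF y(1)] by blast
    define d' where "d' = min d r'"
    have d': "d' > 0" "ball y d' \<subseteq> ball x r" "ball y d' \<subseteq> ball y r'" using d r'
      by (auto simp: d'_def)
    have "(\<lambda>n. 2 * sq_norm_on (ball x r) (\<lambda>y. X (s n) y - b (s n))
      + 2 * sq_norm_on (ball y r') (\<lambda>y. X (s n) y - A)) \<longlonglongrightarrow> 0"
      using r' by (intro ennreal_add_tendsto_0 ennreal_cmult_tendsto_0 sub[OF r(3)]) (auto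
        simp: good_def)
    then have "(\<lambda>n. sq_norm_on (ball y d') (\<lambda>y. A - b (s n))) \<longlonglongrightarrow> 0"
    proof (rule ennreal_squeeze_0)
      fix n
      have "sq_norm_on (ball y d') (\<lambda>y. A - b (s n))
        = sq_norm_on (ball y d') (\<lambda>y. (X (s n) y - b (s n)) - (X (s n) y - A))" by simp
      also have "\<dots> \<le> 2 * sq_norm_on (ball y d') (\<lambda>y. X (s n) y - b (s n))
        + 2 * sq_norm_on (ball y d') (\<lambda>y. X (s n) y - A)"
        by (rule sq_norm_on_diff_le) measurable
      also have "\<dots> \<le> 2 * sq_norm_on (ball x r) (\<lambda>y. X (s n) y - b (s n))
        + 2 * sq_norm_on (ball y r') (\<lambda>y. X (s n) y - A)"
        by (intro add_mono mult_left_mono sq_norm_on_subset d') auto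
      finally show "sq_norm_on (ball y d') (\<lambda>y. A - b (s n)) \<le> \<dots>" .
    qed
    then have "(\<lambda>n. A - b (s n)) \<longlonglongrightarrow> 0" by (rule const_tendsto_0_from_sq_norm[OF d'(1)])
    then have "(\<lambda>n. A - (A - b (s n))) \<longlonglongrightarrow> A - 0" by (intro tendsto_diff tendsto_const)
    then have "(\<lambda>n. b (s n)) \<longlonglongrightarrow> A" by simp
    then have "good x r" by (rule goodI[OF r(1,3)])
    then show ?thesis using x r by (auto simp: T_def)
  qed
  have "open (U - T)"
  proof (rule openI)
    fix x assume x: "x \<in> U - T"
    then obtain r b where r: "r > 0" "ball x r \<subseteq> U" "(\<lambda>n. sq_norm_on (ball x r) (\<lambda>y. X n y - b n))
      \<longlonglongrightarrow> 0"
      using loc by blast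
    have "ball x r \<subseteq> U - T" using close[OF _ r] x r(2) by blast
    then show "\<exists>e>0. ball x e \<subseteq> U - T" using r by blast
  qed
  moreover have "x0 \<in> T" using x0 r0 goodI[OF r0(1,3)] s(2) by (auto simp: T_def o_def)
  ultimately have "U - T = {}"
    using connectedD[OF U(2) \<open>open T\<close>, of "U - T"] x0 by (auto simp: T_def)
  then have "\<forall>x\<in>U. \<exists>r>0. ball x r \<subseteq> U \<and> good x r" by (auto simp: T_def)
  then show ?thesis using s(1) unfolding good_def by blast
qed

text \<open>Local convergence says nothing near the boundary of \<open>U\<close>. A compact subset
  is covered by finitely many balls; on the rest, of small area, the domination by
  \<open>C + b n x\<close> bounds the integral by \<open>C\<close> times the area plus a null
  sequence.\<close>

lemma local_convergence_imp_global:
  fixes X :: "nat \<Rightarrow> 'a::euclidean_space \<Rightarrow> 'b::euclidean_space"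
  assumes U: "open U" "bounded U"
    and X [measurable]: "\<And>n. X n \<in> borel_measurable borel"
    and loc: "\<And>x. x \<in> U \<Longrightarrow> \<exists>r>0. ball x r \<subseteq> U \<and> (\<lambda>n. sq_norm_on (ball x r) (X n)) \<longlonglongrightarrow> 0"
    and dom: "\<And>n x. x \<in> U \<Longrightarrow> (norm (X n x))\<^sup>2 \<le> C + b n x" "0 \<le> C" "\<And>n x. 0 \<le> b n x"
    and b [measurable]: "\<And>n. b n \<in> borel_measurable borel"
    and b0: "(\<lambda>n. \<integral>\<^sup>+x\<in>U. ennreal (b n x) \<partial>lborel) \<longlonglongrightarrow> 0"
  shows "(\<lambda>n. sq_norm_on U (X n)) \<longlonglongrightarrow> 0"
proof (rule ennreal_tendsto_0I[OF dom(2)])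
  fix t :: real assume t: "0 < t" "t \<le> 1"
  have Um [measurable]: "U \<in> sets borel" using U by simp
  then have "U \<in> sets lebesgue" by simp
  then obtain K where K: "closed K" "K \<subseteq> U" "emeasure lebesgue (U - K) < ennreal t"
    using sets_lebesgue_inner_closed[of U t] t by metis
  have Km [measurable]: "K \<in> sets borel" using K by simp
  have "compact K" using K U bounded_subset compact_eq_bounded_closed by blast
  obtain R where R: "\<And>x. x \<in> U \<Longrightarrow> R x > 0 \<and> ball x (R x) \<subseteq> U \<and> (\<lambda>n. sq_norm_on (ball x (R x)) (X n))
    \<longlonglongrightarrow> 0"
    using loc by metis
  have "K \<subseteq> (\<Union>x\<in>K. ball x (R x))" using R K by force
  then obtain F where F: "F \<subseteq> K" "finite F" "K \<subseteq> (\<Union>x\<in>F. ball x (R x))"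
    using compactE_image[OF \<open>compact K\<close>, of K "\<lambda>x. ball x (R x)"] by auto
  have fin: "(\<lambda>n. sq_norm_on (\<Union>x\<in>G. ball x (R x)) (X n)) \<longlonglongrightarrow> 0" if "finite G" "G \<subseteq> U" for G
    using that
  proof (induction G rule: finite_induct)
    case empty
    then show ?case by (simp add: sq_norm_on_def)
  next
    case (insert x G)
    have "(\<lambda>n. sq_norm_on (ball x (R x)) (X n) + sq_norm_on (\<Union>x\<in>G. ball x (R x)) (X n)) \<longlonglongrightarrow> 0"
      using insert R by (intro ennreal_add_tendsto_0) auto
    then show ?case
      by (rule ennreal_squeeze_0) (use insert in \<open>auto intro!: sq_norm_on_Un_le X\<close>)
  qed
  have KX: "(\<lambda>n. sq_norm_on K (X n)) \<longlonglongrightarrow> 0"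
    by (rule ennreal_squeeze_0[OF fin[OF F(2)]]) (use F K in \<open>auto intro!: sq_norm_on_subset\<close>)
  have "(\<lambda>n. sq_norm_on K (X n) + (\<integral>\<^sup>+x\<in>U. ennreal (b n x) \<partial>lborel)) \<longlonglongrightarrow> 0"
    by (intro ennreal_add_tendsto_0 KX b0)
  moreover have "sq_norm_on U (X n)
    \<le> ennreal (t * C) + (sq_norm_on K (X n) + (\<integral>\<^sup>+x\<in>U. ennreal (b n x) \<partial>lborel))" for n
  proof -
    have "sq_norm_on U (X n) = sq_norm_on (K \<union> (U - K)) (X n)" using K by (simp add: Un_absorb1)
    also have "\<dots> \<le> sq_norm_on K (X n) + sq_norm_on (U - K) (X n)"
      by (intro sq_norm_on_Un_le) measurable
    also have "sq_norm_on (U - K) (X n)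
      \<le> (\<integral>\<^sup>+x. ennreal C * indicator (U - K) x + ennreal (b n x) * indicator U x \<partial>lborel)"
      unfolding sq_norm_on_def
    proof (rule nn_integral_mono)
      fix x
      show "ennreal ((norm (X n x))\<^sup>2) * indicator (U - K) x
        \<le> ennreal C * indicator (U - K) x + ennreal (b n x) * indicator U x"
      proof (cases "x \<in> U - K")
        case True
        then have "ennreal ((norm (X n x))\<^sup>2) \<le> ennreal (C + b n x)" using dom
          by (intro ennreal_leI) auto
        then show ?thesis using True dom(2) dom(3)[of n x] by (simp add: ennreal_plus)
      qed simp
    qed
    also have "\<dots> = ennreal C * emeasure lborel (U - K) + (\<integral>\<^sup>+x\<in>U. ennreal (b n x) \<partial>lborel)"
      by (subst nn_integral_add) (auto simp: nn_integral_cmult_indicator)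
    also have "ennreal C * emeasure lborel (U - K) \<le> ennreal C * ennreal t"
      using K(3) by (intro mult_left_mono) auto
    also have "\<dots> = ennreal (t * C)" using t dom(2) by (simp add: ennreal_mult mult.commute)
    finally show ?thesis by (simp add: add.left_commute add_left_mono add_right_mono)
  qed
  ultimately show "\<exists>g. g \<longlonglongrightarrow> 0 \<and> (\<forall>n. sq_norm_on U (X n) \<le> ennreal (t * C) + g n)" by blast
qed

subsection \<open>Asymptotically conformal sequences\<close>

lemma ennreal_avg_sq:
  fixes f :: "'a::euclidean_space \<Rightarrow> 'b::euclidean_space"
  assumes f: "loc_bdd_borel f" and e: "0 < e"
  shows "ennreal (avg e (\<lambda>y. (norm (f y))\<^sup>2) a)
    = ennreal (1 / measure lborel (ball (0::'a) e)) * sq_norm_on (ball a e) f"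
proof -
  have [measurable]: "f \<in> borel_measurable borel" using f by (rule loc_bdd_borel_measurable)
  let ?m = "measure lborel (ball (0::'a) e)"
  have "ennreal (avg e (\<lambda>y. (norm (f y))\<^sup>2) a)
    = (\<integral>\<^sup>+z. ennreal ((norm (f (a + z)))\<^sup>2) \<partial>disc_measure e)"
    by (intro ennreal_avg loc_bdd_borel_intros f e) auto
  also have "\<dots> = (\<integral>\<^sup>+z. ennreal (indicator (ball 0 e) z / ?m) * ennreal ((norm (f (a
    + z)))\<^sup>2) \<partial>lborel)"
    unfolding disc_measure_def by (subst nn_integral_density) auto
  also have "\<dots> = (\<integral>\<^sup>+z. ennreal (1 / ?m) * (ennreal ((norm (f (z + a)))\<^sup>2) * indicator (ball a e) (z
    + a)) \<partial>lborel)"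
    by (intro nn_integral_cong) (auto simp: indicator_def dist_norm add.commute)
  also have "\<dots> = ennreal (1 / ?m) * (\<integral>\<^sup>+z. ennreal ((norm (f (z + a)))\<^sup>2) * indicator (ball a e) (z
    + a) \<partial>lborel)"
    by (rule nn_integral_cmult) measurable
  also have "(\<integral>\<^sup>+z. ennreal ((norm (f (z + a)))\<^sup>2) * indicator (ball a e) (z + a) \<partial>lborel)
    = sq_norm_on (ball a e) f"
    unfolding sq_norm_on_def
    by (rule nn_integral_lborel_shift[of
      "\<lambda>y. ennreal ((norm (f y))\<^sup>2) * indicator (ball a e) y"]) measurable
  finally show ?thesis .
qed

text \<open>Takes the place of a Poincare inequality. The Cauchy-Pompeiu bound compares the function
  with its moving averages; their gradient is itself an average, hence bounded pointwise by the
  \<open>L^2\<close> norm of the gradient, so they vary little across the ball.\<close>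

lemma small_gradient_imp_almost_constant:
  fixes w :: "nat \<Rightarrow> real^2 \<Rightarrow> real"
  assumes w: "\<And>n. (L n)-lipschitz_on UNIV (w n)" and G: "\<And>n. has_gradient_AE (w n) (G n)"
    and e: "0 < e"
    and z: "(\<lambda>n. sq_norm_on (ball a (2 * e)) (G n)) \<longlonglongrightarrow> 0"
  shows "(\<lambda>n. sq_norm_on (ball a e) (\<lambda>x. w n x - avg e (w n) a)) \<longlonglongrightarrow> 0"
proof -
  let ?S = "ball a e" and ?T = "ball a (2 * e)"
  obtain C where C: "\<And>(u::real^2 \<Rightarrow> real) v L K (g::real^2 \<Rightarrow> real^2) (h::real^2 \<Rightarrow> real^2) S S'.
    L-lipschitz_on UNIV u \<Longrightarrow> K-lipschitz_on UNIV v \<Longrightarrow>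
    has_gradient_AE u g \<Longrightarrow> has_gradient_AE v h \<Longrightarrow> S \<in> sets borel \<Longrightarrow> S' \<in> sets borel \<Longrightarrow>
    (\<forall>x\<in>S. \<forall>z\<in>ball 0 e. x + z \<in> S') \<Longrightarrow>
    (\<integral>\<^sup>+x\<in>S. ennreal ((u x - avg e u x)\<^sup>2) \<partial>lborel) \<le>
      ennreal C * (\<integral>\<^sup>+x\<in>S'. ennreal ((g x $ 1 - h x $ 2)\<^sup>2 + (g x $ 2 + h x $ 1)\<^sup>2) \<partial>lborel)"
    using cauchy_pompeiu_L2[OF e] by blast
  have ST: "x + z \<in> ?T" if "x \<in> ?S" "z \<in> ball 0 e" for x z
  proof -
    have "dist a (x + z) \<le> dist a x + norm z"
      by (metis add_diff_cancel_left' dist_norm dist_triangle dist_commute)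
    then show ?thesis using that by simp
  qed
  \<comment> \<open>With zero as second component the right-hand side of the Cauchy-Pompeiu bound
    reduces to the full squared gradient.\<close>
  have z0: "0-lipschitz_on UNIV (\<lambda>x::real^2. 0::real)" "has_gradient_AE (\<lambda>x::real^2. 0) (\<lambda>x. 0)"
    by (auto simp: has_gradient_AE_def intro: exI[of _ 0] lipschitz_on_constant)
  have c1: "sq_norm_on ?S (\<lambda>x. w n x - avg e (w n) x) \<le> ennreal C * sq_norm_on ?T (G n)" for n
    using C[OF w z0(1) G z0(2), of ?S ?T] ST by (simp add: sq_norm_on_def norm_vec2_sq)
  have Gl: "loc_bdd_borel (G n)" for n using G by (rule has_gradient_AE_loc_bdd)
  have e2: "0 < 2 * e" using e by simp
  define k where "k = measure lborel (ball (0::real^2) (2 * e)) / measure lborel (ball (0::real^2)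
    e)"
  have k0: "0 \<le> k" by (simp add: k_def)
  define s where "s n = avg (2 * e) (\<lambda>y. (norm (G n y))\<^sup>2) a" for n
  have s0: "0 \<le> s n" for n unfolding s_def avg_def
    by (rule Bochner_Integration.integral_nonneg) simp
  have bnd: "norm (avg e (G n) y) \<le> sqrt (k * s n)" if y: "y \<in> ?S" for n y
  proof -
    have "(norm (avg e (G n) y))\<^sup>2 \<le> avg e (\<lambda>y. (norm (G n y))\<^sup>2) y" by (rule avg_jensen[OF Gl e])
    also have "\<dots> \<le> k * s n" unfolding k_def s_def
    proof (rule avg_le_avg)
      show "ball y e \<subseteq> ?T"
      proof
        fix x assume "x \<in> ball y e"
        then show "x \<in> ?T" using y dist_triangle[of a x y] by simp
      qed
    qed (use e Gl in \<open>auto intro!: loc_bdd_borel_intros\<close>)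
    finally show ?thesis by (rule real_le_rsqrt)
  qed
  have c2: "sq_norm_on ?S (\<lambda>x. avg e (w n) x - avg e (w n) a)
    \<le> ennreal (e\<^sup>2 * k) * ennreal (s n) * emeasure lborel ?S" for n
  proof -
    have "norm (avg e (w n) x - avg e (w n) a) \<le> e * sqrt (k * s n)" if x: "x \<in> ?S" for x
    proof -
      have "norm (avg e (w n) x - avg e (w n) a) \<le> sqrt (k * s n) * norm (x - a)"
      proof (rule differentiable_bound[of ?S])
        fix y assume y: "y \<in> ?S"
        show "(avg e (w n) has_derivative (\<lambda>h. avg e (G n) y \<bullet> h)) (at y within ?S)"
          using avg_has_derivative[OF w G e] has_derivative_at_withinI by blast
        show "onorm (\<lambda>h. avg e (G n) y \<bullet> h) \<le> sqrt (k * s n)"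
        proof (rule onorm_le)
          fix h
          show "norm (avg e (G n) y \<bullet> h) \<le> sqrt (k * s n) * norm h"
            using Cauchy_Schwarz_ineq2[of "avg e (G n) y" h] mult_right_mono[OF bnd[OF y, of n], of
              "norm h"]
            by simp
        qed
      qed (use x e in auto)
      also have "\<dots> \<le> sqrt (k * s n) * e"
        using x k0 s0[of n] by (intro mult_left_mono) (auto simp: dist_norm norm_minus_commute)
      finally show ?thesis by (simp add: mult.commute)
    qed
    then have "sq_norm_on ?S (\<lambda>x. avg e (w n) x - avg e (w n) a)
      \<le> sq_norm_on ?S (\<lambda>x. e * sqrt (k * s n))"
      using abs_ge_self order_trans by (intro sq_norm_on_mono) fastforce
    also have "\<dots> = ennreal ((e * sqrt (k * s n))\<^sup>2) * emeasure lborel ?S"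
      by (subst sq_norm_on_const) auto
    also have "(e * sqrt (k * s n))\<^sup>2 = e\<^sup>2 * k * s n" using k0 s0[of n]
      by (simp add: power_mult_distrib)
    finally show ?thesis using k0 s0[of n] by (simp add: ennreal_mult)
  qed
  have "(\<lambda>n. ennreal (s n)) \<longlonglongrightarrow> 0"
    unfolding s_def ennreal_avg_sq[OF Gl e2] by (intro ennreal_cmult_tendsto_0 z) auto
  then have "(\<lambda>n. 2 * (ennreal C * sq_norm_on ?T (G n))
    + 2 * (emeasure lborel ?S * (ennreal (e\<^sup>2 * k) * ennreal (s n)))) \<longlonglongrightarrow> 0"
    using emeasure_ball_pos_finite(2)[OF e, of a]
    by (intro ennreal_add_tendsto_0 ennreal_cmult_tendsto_0 z) auto
  then show ?thesis
  proof (rule ennreal_squeeze_0)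
    fix n
    have [measurable]: "w n \<in> borel_measurable borel"
      using w loc_bdd_borel_lipschitz loc_bdd_borel_measurable by blast
    have [measurable]: "avg e (w n) \<in> borel_measurable borel" using e by (intro avg_borel) auto
    have "sq_norm_on ?S (\<lambda>x. w n x - avg e (w n) a) = sq_norm_on ?S (\<lambda>x. (w n x - avg e (w n) x)
      + (avg e (w n) x - avg e (w n) a))"
      by simp
    also have "\<dots> \<le> 2 * sq_norm_on ?S (\<lambda>x. w n x - avg e (w n) x)
      + 2 * sq_norm_on ?S (\<lambda>x. avg e (w n) x - avg e (w n) a)"
      by (rule sq_norm_on_add_le) measurable
    also have "\<dots> \<le> 2 * (ennreal C * sq_norm_on ?T (G n))
      + 2 * (ennreal (e\<^sup>2 * k) * ennreal (s n) * emeasure lborel ?S)"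
      by (intro add_mono mult_left_mono c1 c2) auto
    finally show "sq_norm_on ?S (\<lambda>x. w n x - avg e (w n) a)
      \<le> 2 * (ennreal C * sq_norm_on ?T (G n)) + 2 * (emeasure lborel ?S * (ennreal
      (e\<^sup>2 * k) * ennreal (s n)))"
      by (simp add: mult.commute)
  qed
qed

lemma sq_norm_on_gradient_le:
  fixes g h :: "'a::euclidean_space \<Rightarrow> real^2"
  assumes [measurable]: "g \<in> borel_measurable borel" "h \<in> borel_measurable borel" "S \<in> sets borel"
  shows "sq_norm_on S g \<le> 2 * sq_norm_on S (\<lambda>x. dz (g x) (h x))
    + 2 * sq_norm_on S (\<lambda>x. dzbar (g x) (h x))"
    and "sq_norm_on S h \<le> 2 * sq_norm_on S (\<lambda>x. dz (g x) (h x))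
      + 2 * sq_norm_on S (\<lambda>x. dzbar (g x) (h x))"
proof -
  have [measurable]: "(\<lambda>x. dz (g x) (h x)) \<in> borel_measurable borel"
    "(\<lambda>x. dzbar (g x) (h x)) \<in> borel_measurable borel"
    unfolding dz_def dzbar_def by measurable
  have b: "sq_norm_on S f \<le> 2 * sq_norm_on S (\<lambda>x. dz (g x) (h x))
    + 2 * sq_norm_on S (\<lambda>x. dzbar (g x) (h x))"
    if f: "\<And>x. (norm (f x))\<^sup>2 \<le> (norm (g x))\<^sup>2 + (norm (h x))\<^sup>2" for f :: "'a \<Rightarrow> real^2"
  proof -
    have "sq_norm_on S f \<le> (\<integral>\<^sup>+x. 2 * (ennreal ((norm (dz (g x) (h x)))\<^sup>2) * indicator S x)
      + 2 * (ennreal ((norm (dzbar (g x) (h x)))\<^sup>2) * indicator S x) \<partial>lborel)"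
      unfolding sq_norm_on_def
    proof (rule nn_integral_mono)
      fix x
      have "(norm (f x))\<^sup>2 \<le> 2 * (norm (dz (g x) (h x)))\<^sup>2 + 2 * (norm (dzbar (g x) (h x)))\<^sup>2"
        using f[of x] norm_dz_add_dzbar[of "g x" "h x"] by simp
      then have "ennreal ((norm (f x))\<^sup>2)
        \<le> ennreal (2 * (norm (dz (g x) (h x)))\<^sup>2 + 2 * (norm (dzbar (g x) (h x)))\<^sup>2)"
        by (rule ennreal_leI)
      also have "\<dots> = 2 * ennreal ((norm (dz (g x) (h x)))\<^sup>2)
        + 2 * ennreal ((norm (dzbar (g x) (h x)))\<^sup>2)"
        by (simp add: ennreal_mult)
      finally show "ennreal ((norm (f x))\<^sup>2) * indicator S x
        \<le> 2 * (ennreal ((norm (dz (g x) (h x)))\<^sup>2) * indicator S x) + 2 * (ennreal ((norm (dzbar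
        (g x) (h x)))\<^sup>2) * indicator S x)"
        by (auto simp: indicator_def)
    qed
    also have "\<dots> = 2 * sq_norm_on S (\<lambda>x. dz (g x) (h x)) + 2 * sq_norm_on S (\<lambda>x. dzbar (g x) (h x))"
      unfolding sq_norm_on_def by (rule nn_integral_linear_combination) measurable
    finally show ?thesis .
  qed
  show "sq_norm_on S g \<le> 2 * sq_norm_on S (\<lambda>x. dz (g x) (h x))
    + 2 * sq_norm_on S (\<lambda>x. dzbar (g x) (h x))" by (rule b) simp
  show "sq_norm_on S h \<le> 2 * sq_norm_on S (\<lambda>x. dz (g x) (h x))
    + 2 * sq_norm_on S (\<lambda>x. dzbar (g x) (h x))" by (rule b) simp
qed

lemma inner_lipschitz: "(norm p)-lipschitz_on UNIV (\<lambda>x::'a::euclidean_space. p \<bullet> x)"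
proof (rule lipschitz_onI)
  fix x y :: 'a
  show "dist (p \<bullet> x) (p \<bullet> y) \<le> norm p * dist x y"
    using Cauchy_Schwarz_ineq2[of p "x - y"] by (simp add: dist_norm inner_diff_right)
qed simp

lemma inner_has_gradient_AE: "has_gradient_AE (\<lambda>x::'a::euclidean_space. p \<bullet> x) (\<lambda>x. p)"
  unfolding has_gradient_AE_def by (auto intro!: derivative_eq_intros)

text \<open>The values are bounded uniformly in \<open>n\<close>; the Lipschitz constants may grow.
  The local-to-global argument runs twice: on \<open>dz\<close>, giving the linear part, and on the
  map minus that linear part, whose gradient tends to 0, giving the translation.\<close>

theorem asymptotic_conformal_rigidity:
  fixes U :: "(real^2) set" and u v :: "nat \<Rightarrow> real^2 \<Rightarrow> real" and g h :: "nat \<Rightarrow> real^2 \<Rightarrow> real^2"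
  assumes U: "open U" "connected U" "bounded U" "U \<noteq> {}" and c: "0 \<le> c"
    and lip: "\<And>n. (L n)-lipschitz_on UNIV (u n)" "\<And>n. (K n)-lipschitz_on UNIV (v n)"
    and grad: "\<And>n. has_gradient_AE (u n) (g n)" "\<And>n. has_gradient_AE (v n) (h n)"
    and bdd: "\<And>n x. x \<in> U \<Longrightarrow> \<bar>u n x\<bar> \<le> B" "\<And>n x. x \<in> U \<Longrightarrow> \<bar>v n x\<bar> \<le> B"
    and Q: "(\<lambda>n. sq_norm_on U (\<lambda>x. dzbar (g n x) (h n x))) \<longlonglongrightarrow> 0"
    and Pc: "(\<lambda>n. sq_norm_on U (\<lambda>x. norm (dz (g n x) (h n x)) - c)) \<longlonglongrightarrow> 0"
  shows "\<exists>s p q b1 b2. strict_mono (s :: nat \<Rightarrow> nat) \<and> norm (dz p q) = c \<and> dzbar p q = 0 \<and>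
    (\<lambda>n. sq_norm_on U (\<lambda>x. g (s n) x - p)) \<longlonglongrightarrow> 0 \<and>
    (\<lambda>n. sq_norm_on U (\<lambda>x. h (s n) x - q)) \<longlonglongrightarrow> 0 \<and>
    (\<lambda>n. sq_norm_on U (\<lambda>x. u (s n) x - (p \<bullet> x + b1))) \<longlonglongrightarrow> 0 \<and>
    (\<lambda>n. sq_norm_on U (\<lambda>x. v (s n) x - (q \<bullet> x + b2))) \<longlonglongrightarrow> 0"
proof -
  define P where "P n x = dz (g n x) (h n x)" for n x
  have gl: "loc_bdd_borel (g n)" "loc_bdd_borel (h n)" for n using grad
    by (auto intro: has_gradient_AE_loc_bdd)
  have Pl: "loc_bdd_borel (P n)" for n unfolding P_def by (rule loc_bdd_borel_dz[OF gl])
  have [measurable]: "P n \<in> borel_measurable borel" "g n \<in> borel_measurable borel"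
    "h n \<in> borel_measurable borel" for n
    using Pl gl loc_bdd_borel_measurable by blast+
  have Um [measurable]: "U \<in> sets borel" using U by simp
  have finU: "emeasure lborel U < top" using emeasure_bounded_finite[OF U(3)] by simp
  define mU where "mU = measure lborel U"
  have mU: "emeasure lborel U = ennreal mU" using finU
    by (simp add: mU_def emeasure_eq_ennreal_measure)
  \<comment> \<open>Room for the local estimate, which bounds a quantity on the ball of radius
    \<open>e\<close> by \<open>dzbar\<close> on the concentric ball of radius
    \<open>3 * e\<close>.\<close>
  have nb: "\<exists>e>0. ball x (3 * e) \<subseteq> U" if x: "x \<in> U" for x
  proof -
    obtain r where "r > 0" "ball x r \<subseteq> U" using U(1) x openE by blast
    then show ?thesis by (intro exI[of _ "r / 3"]) auto
  qed
  have Pc': "(\<lambda>n. sq_norm_on U (\<lambda>x. norm (P n x) - c)) \<longlonglongrightarrow> 0" using Pc by (simp add: P_def)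
  have loc1: "\<exists>r>0. ball x r \<subseteq> U \<and> (\<exists>a. (\<lambda>n. sq_norm_on (ball x r) (\<lambda>y. P n y - a n)) \<longlonglongrightarrow> 0)"
    if x: "x \<in> U" for x
  proof -
    obtain e where e: "e > 0" "ball x (3 * e) \<subseteq> U" using nb[OF x] by blast
    obtain C where C: "\<And>u v L K g h a. L-lipschitz_on UNIV u \<Longrightarrow> K-lipschitz_on UNIV v \<Longrightarrow>
      has_gradient_AE u g \<Longrightarrow> has_gradient_AE v h \<Longrightarrow>
      sq_norm_on (ball a e) (\<lambda>x. dz (g x) (h x) - avg e (\<lambda>y. dz (g y) (h y)) x)
        \<le> ennreal C * sq_norm_on (ball a (3 * e)) (\<lambda>x. dzbar (g x) (h x))"
      using local_average_estimate[OF e(1)] by blast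
    have A: "(\<lambda>n. sq_norm_on (ball x (2 * e)) (\<lambda>x. norm (P n x) - c)) \<longlonglongrightarrow> 0"
    proof (rule ennreal_squeeze_0[OF Pc'])
      have "ball x (2 * e) \<subseteq> U" using e subset_ball[of "2 * e" "3 * e" x] by auto
      then show "sq_norm_on (ball x (2 * e)) (\<lambda>x. norm (P n x) - c)
        \<le> sq_norm_on U (\<lambda>x. norm (P n x) - c)" for n
        by (rule sq_norm_on_subset)
    qed
    have D: "(\<lambda>n. sq_norm_on (ball x e) (\<lambda>x. P n x - avg e (P n) x)) \<longlonglongrightarrow> 0"
    proof (rule ennreal_squeeze_0[OF ennreal_cmult_tendsto_0[OF Q, of "ennreal C"]])
      fix n
      have "sq_norm_on (ball x e) (\<lambda>x. P n x - avg e (P n) x)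
        \<le> ennreal C * sq_norm_on (ball x (3 * e)) (\<lambda>x. dzbar (g n x) (h n x))"
        using C[OF lip grad] unfolding P_def[abs_def] .
      also have "\<dots> \<le> ennreal C * sq_norm_on U (\<lambda>x. dzbar (g n x) (h n x))"
        by (intro mult_left_mono sq_norm_on_subset e) auto
      finally show "sq_norm_on (ball x e) (\<lambda>x. P n x - avg e (P n) x) \<le> \<dots>" .
    qed simp
    have "ball x (e / 2) \<subseteq> U" using e subset_ball[of "e / 2" "3 * e" x] by auto
    then show ?thesis using local_almost_constant[OF Pl e(1) c A D] e(1)
      by (intro exI[of _ "e / 2"]) (auto intro!: exI[of _ "\<lambda>n. avg (e / 2) (P n) x"])
  qed
  have bdd1: "eventually (\<lambda>n. sq_norm_on U (P n) \<le> ennreal (2 + 2 * (c\<^sup>2 * mU))) sequentially"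
  proof -
    have "eventually (\<lambda>n. sq_norm_on U (\<lambda>x. norm (P n x) - c) < 1) sequentially"
      using Pc' by (rule order_tendstoD(2)) simp
    then show ?thesis
    proof eventually_elim
      case (elim n)
      have "sq_norm_on U (P n) = sq_norm_on U (\<lambda>x. (norm (P n x) - c) + c)"
        by (simp add: sq_norm_on_def)
      also have "\<dots> \<le> 2 * sq_norm_on U (\<lambda>x. norm (P n x) - c) + 2 * sq_norm_on U (\<lambda>x. c)"
        by (rule sq_norm_on_add_le) measurable
      also have "\<dots> \<le> 2 * 1 + 2 * ennreal (c\<^sup>2 * mU)"
        using elim by (intro add_mono mult_left_mono) (auto
          simp: sq_norm_on_const[OF Um] mU ennreal_mult mU_def)
      also have "\<dots> = ennreal (2 + 2 * (c\<^sup>2 * mU))"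
        by (simp add: mU_def ennreal_mult flip: ennreal_numeral)
      finally show ?case .
    qed
  qed
  obtain s A where s: "strict_mono (s :: nat \<Rightarrow> nat)"
    and sA: "\<And>x. x \<in> U \<Longrightarrow> \<exists>r>0. ball x r \<subseteq> U \<and> (\<lambda>n. sq_norm_on (ball x r) (\<lambda>y. P (s n) y - A)) \<longlonglongrightarrow> 0"
    using locally_almost_constant_imp_convergent_subsequence[OF U(1,2,4) _ loc1 bdd1]
      by (auto simp del: ennreal_plus)
  have sub: "(\<lambda>n. f (s n)) \<longlonglongrightarrow> l" if "f \<longlonglongrightarrow> l" for f :: "nat \<Rightarrow> ennreal" and l
    using LIMSEQ_subseq_LIMSEQ[OF that s] by (simp add: o_def)
  \<comment> \<open>Domination for the passage to all of \<open>U\<close>: the modulus of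
    \<open>P (s n) x\<close> is at most \<open>c\<close> plus its deviation from \<open>c\<close>,
    and the squared deviation tends to 0 in \<open>L^1\<close>.\<close>
  have PA: "(\<lambda>n. sq_norm_on U (\<lambda>x. P (s n) x - A)) \<longlonglongrightarrow> 0"
  proof (rule local_convergence_imp_global[OF U(1,3) _ sA, where C="4 * c\<^sup>2 + 2 * (norm A)\<^sup>2"
    and b="\<lambda>n x. 4 * (norm (P (s n) x) - c)\<^sup>2"])
    show "(norm (P (s n) x - A))\<^sup>2 \<le> 4 * c\<^sup>2 + 2 * (norm A)\<^sup>2 + 4 * (norm (P (s n) x) - c)\<^sup>2"
      for n x
      using norm_diff_sq_le[of "P (s n) x" A] norm_add_sq_le[of "norm (P (s n) x) - c" c] by simp
    have "(\<lambda>n. 4 * sq_norm_on U (\<lambda>x. norm (P (s n) x) - c)) \<longlonglongrightarrow> 0"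
      by (intro ennreal_cmult_tendsto_0 sub[OF Pc']) auto
    moreover have "(\<integral>\<^sup>+x\<in>U. ennreal (4 * (norm (P (s n) x) - c)\<^sup>2) \<partial>lborel)
      = 4 * sq_norm_on U (\<lambda>x. norm (P (s n) x) - c)" for n
      unfolding sq_norm_on_def by (simp add: ennreal_mult mult.assoc nn_integral_cmult)
    ultimately show "(\<lambda>n. \<integral>\<^sup>+x\<in>U. ennreal (4 * (norm (P (s n) x) - c)\<^sup>2) \<partial>lborel) \<longlonglongrightarrow> 0" by simp
  qed auto
  have nA: "norm A = c"
  proof -
    obtain x0 e where e: "e > 0" "ball x0 e \<subseteq> U" using U by (metis ex_in_conv openE)
    have "(\<lambda>n. 2 * sq_norm_on U (\<lambda>x. norm (P (s n) x) - c) + 2 * sq_norm_on U (\<lambda>x. P (s n) x - A))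
      \<longlonglongrightarrow> 0"
      by (intro ennreal_add_tendsto_0 ennreal_cmult_tendsto_0 PA sub[OF Pc']) auto
    then have "(\<lambda>n::nat. sq_norm_on (ball x0 e) (\<lambda>x. norm A - c)) \<longlonglongrightarrow> 0"
    proof (rule ennreal_squeeze_0)
      fix n
      have "sq_norm_on (ball x0 e) (\<lambda>x. norm A - c) \<le> sq_norm_on U (\<lambda>x. norm A - c)"
        by (rule sq_norm_on_subset[OF e(2)])
      also have "\<dots> = sq_norm_on U (\<lambda>x. (norm (P (s n) x) - c) - (norm (P (s n) x) - norm A))"
        by simp
      also have "\<dots> \<le> 2 * sq_norm_on U (\<lambda>x. norm (P (s n) x) - c)
        + 2 * sq_norm_on U (\<lambda>x. norm (P (s n) x) - norm A)"
        by (rule sq_norm_on_diff_le) measurable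
      also have "\<dots> \<le> 2 * sq_norm_on U (\<lambda>x. norm (P (s n) x) - c) + 2 * sq_norm_on U (\<lambda>x. P (s n) x
        - A)"
        by (intro add_left_mono mult_left_mono sq_norm_on_mono) (auto simp: norm_triangle_ineq3)
      finally show "sq_norm_on (ball x0 e) (\<lambda>x. norm A - c) \<le> \<dots>" .
    qed
    then have "(\<lambda>n::nat. norm A - c) \<longlonglongrightarrow> 0" by (rule const_tendsto_0_from_sq_norm[OF e(1)])
    then show ?thesis by (simp add: LIMSEQ_const_iff)
  qed
  \<comment> \<open>The rows \<open>p\<close> and \<open>q\<close> form the matrix of multiplication
    by the complex number \<open>A\<close>.\<close>
  define p :: "real^2" where "p = (\<chi> i. if i = 1 then Re A else - Im A)"
  define q :: "real^2" where "q = (\<chi> i. if i = 1 then Im A else Re A)"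
  have pq: "dz p q = A" "dzbar p q = 0"
    by (simp_all add: p_def q_def dz_def dzbar_def complex_eq_iff)
  have lim0: "(\<lambda>n. 2 * sq_norm_on U (\<lambda>x. P (s n) x - A)
    + 2 * sq_norm_on U (\<lambda>x. dzbar (g (s n) x) (h (s n) x))) \<longlonglongrightarrow> 0"
    by (intro ennreal_add_tendsto_0 ennreal_cmult_tendsto_0 PA sub[OF Q]) auto
  have G0: "(\<lambda>n. sq_norm_on U (\<lambda>x. g (s n) x - p)) \<longlonglongrightarrow> 0" "(\<lambda>n. sq_norm_on U (\<lambda>x. h (s n) x - q)) \<longlonglongrightarrow> 0"
    using sq_norm_on_gradient_le[of "\<lambda>x. g (s n) x - p" "\<lambda>x. h (s n) x - q" U for n]
    by (auto intro!: ennreal_squeeze_0[OF lim0] simp: dz_diff dzbar_diff pq P_def)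
  define u' where "u' n x = u (s n) x - p \<bullet> x" for n x
  define v' where "v' n x = v (s n) x - q \<bullet> x" for n x
  have ul: "(L (s n) + norm p)-lipschitz_on UNIV (u' n)" "(K (s n)
    + norm q)-lipschitz_on UNIV (v' n)" for n
    unfolding u'_def v'_def by (intro lipschitz_on_diff lip inner_lipschitz)+
  have ug: "has_gradient_AE (u' n) (\<lambda>x. g (s n) x - p)" "has_gradient_AE (v' n) (\<lambda>x. h (s n) x - q)"
    for n
    unfolding u'_def v'_def by (intro has_gradient_AE_diff grad inner_has_gradient_AE)+
  \<comment> \<open>Both components are packed into one complex function so that a single further
    subsequence serves both translations.\<close>
  define X where "X n x = Complex (u' n x) (v' n x)" for n x
  have [measurable]: "u' n \<in> borel_measurable borel" "v' n \<in> borel_measurable borel" for n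
    using ul loc_bdd_borel_lipschitz loc_bdd_borel_measurable by blast+
  have [measurable]: "X n \<in> borel_measurable borel" for n unfolding X_def by measurable
  have loc2: "\<exists>r>0. ball x r \<subseteq> U \<and> (\<exists>a. (\<lambda>n. sq_norm_on (ball x r) (\<lambda>y. X n y - a n)) \<longlonglongrightarrow> 0)"
    if x: "x \<in> U" for x
  proof -
    obtain e where e: "e > 0" "ball x (3 * e) \<subseteq> U" using nb[OF x] by blast
    have sb: "ball x (2 * e) \<subseteq> U" "ball x e \<subseteq> U"
      using e subset_ball[of "2 * e" "3 * e" x] subset_ball[of e "3 * e" x] by auto
    have 1: "(\<lambda>n. sq_norm_on (ball x (2 * e)) (\<lambda>x. g (s n) x - p)) \<longlonglongrightarrow> 0"
      by (rule ennreal_squeeze_0[OF G0(1)]) (rule sq_norm_on_subset[OF sb(1)])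
    have 2: "(\<lambda>n. sq_norm_on (ball x (2 * e)) (\<lambda>x. h (s n) x - q)) \<longlonglongrightarrow> 0"
      by (rule ennreal_squeeze_0[OF G0(2)]) (rule sq_norm_on_subset[OF sb(1)])
    have "(\<lambda>n. sq_norm_on (ball x e) (\<lambda>y. u' n y - avg e (u' n) x)
      + sq_norm_on (ball x e) (\<lambda>y. v' n y - avg e (v' n) x)) \<longlonglongrightarrow> 0"
      by (intro ennreal_add_tendsto_0 small_gradient_imp_almost_constant[OF ul(1) ug(1) e(1) 1]
          small_gradient_imp_almost_constant[OF ul(2) ug(2) e(1) 2])
    moreover have "sq_norm_on (ball x e) (\<lambda>y. X n y - Complex (avg e (u' n) x) (avg e (v' n) x))
       = sq_norm_on (ball x e) (\<lambda>y. u' n y - avg e (u' n) x) + sq_norm_on (ball x e)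
         (\<lambda>y. v' n y - avg e (v' n) x)" for n
      unfolding sq_norm_on_def X_def
      by (subst nn_integral_add[symmetric]) (auto intro!: nn_integral_cong
        simp: cmod_power2 indicator_def)
    ultimately have "(\<lambda>n. sq_norm_on (ball x e) (\<lambda>y. X n y
      - Complex (avg e (u' n) x) (avg e (v' n) x))) \<longlonglongrightarrow> 0" by simp
    then show ?thesis using e(1) sb(2)
      by (intro exI[of _ e]) (auto intro!: exI[of _
        "\<lambda>n. Complex (avg e (u' n) x) (avg e (v' n) x)"])
  qed
  obtain R where R: "\<And>x. x \<in> U \<Longrightarrow> norm x \<le> R" using U(3) by (auto simp: bounded_iff)
  define M where "M = (B + norm p * R) + (B + norm q * R)"
  have XM: "norm (X n x) \<le> M" if x: "x \<in> U" for n x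
  proof -
    have "\<bar>p \<bullet> x\<bar> \<le> norm p * R" "\<bar>q \<bullet> x\<bar> \<le> norm q * R"
      using Cauchy_Schwarz_ineq2[of p x] Cauchy_Schwarz_ineq2[of q x] R[OF x]
      by (meson mult_left_mono norm_ge_zero order_trans)+
    then have "\<bar>u' n x\<bar> \<le> B + norm p * R" "\<bar>v' n x\<bar> \<le> B + norm q * R"
      using bdd(1)[OF x, of "s n"] bdd(2)[OF x, of "s n"] by (auto simp: u'_def v'_def)
    then show ?thesis using cmod_le[of "X n x"] by (simp add: X_def M_def)
  qed
  have M0: "0 \<le> M" using U(4) XM norm_ge_zero order_trans by blast
  have bdd2: "eventually (\<lambda>n. sq_norm_on U (X n) \<le> ennreal (M\<^sup>2 * mU)) sequentially"
  proof (rule always_eventually, rule allI)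
    fix n
    have "sq_norm_on U (X n) \<le> sq_norm_on U (\<lambda>x. M)" using XM M0 by (intro sq_norm_on_mono) auto
    then show "sq_norm_on U (X n) \<le> ennreal (M\<^sup>2 * mU)"
      using M0 by (simp add: sq_norm_on_const mU ennreal_mult mU_def)
  qed
  obtain t b where t: "strict_mono (t :: nat \<Rightarrow> nat)"
    and tb: "\<And>x. x \<in> U \<Longrightarrow> \<exists>r>0. ball x r \<subseteq> U \<and> (\<lambda>n. sq_norm_on (ball x r) (\<lambda>y. X (t n) y - b)) \<longlonglongrightarrow> 0"
    using locally_almost_constant_imp_convergent_subsequence[OF U(1,2,4) _ loc2 bdd2] by auto
  have Xb: "(\<lambda>n. sq_norm_on U (\<lambda>x. X (t n) x - b)) \<longlonglongrightarrow> 0"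
  proof (rule local_convergence_imp_global[OF U(1,3) _ tb, where C="(M + norm b)\<^sup>2"
    and b="\<lambda>n x. 0"])
    show "(norm (X (t n) x - b))\<^sup>2 \<le> (M + norm b)\<^sup>2 + 0" if "x \<in> U" for n x
      using XM[OF that, of "t n"] norm_triangle_ineq4[of "X (t n) x" b] by (auto intro!: power_mono)
  qed auto
  have fin: "(\<lambda>n. sq_norm_on U (\<lambda>x. u (s (t n)) x - (p \<bullet> x + Re b))) \<longlonglongrightarrow> 0"
    "(\<lambda>n. sq_norm_on U (\<lambda>x. v (s (t n)) x - (q \<bullet> x + Im b))) \<longlonglongrightarrow> 0"
  proof -
    have "u (s (t n)) x - (p \<bullet> x + Re b) = Re (X (t n) x - b)" "v (s (t n)) x - (q \<bullet> x + Im b)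
      = Im (X (t n) x - b)" for n x
      by (simp_all add: X_def u'_def v'_def)
    then show "(\<lambda>n. sq_norm_on U (\<lambda>x. u (s (t n)) x - (p \<bullet> x + Re b))) \<longlonglongrightarrow> 0"
      "(\<lambda>n. sq_norm_on U (\<lambda>x. v (s (t n)) x - (q \<bullet> x + Im b))) \<longlonglongrightarrow> 0"
      by (auto intro!: ennreal_squeeze_0[OF Xb] sq_norm_on_mono
        simp: abs_Re_le_cmod abs_Im_le_cmod simp del: minus_complex.sel)
  qed
  have subt: "(\<lambda>n. f (t n)) \<longlonglongrightarrow> l" if "f \<longlonglongrightarrow> l" for f :: "nat \<Rightarrow> ennreal" and l
    using LIMSEQ_subseq_LIMSEQ[OF that t] by (simp add: o_def)
  show ?thesis
  proof (intro exI conjI)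
    show "strict_mono (\<lambda>n. s (t n))" using strict_mono_o[OF s t] by (simp add: o_def)
    show "norm (dz p q) = c" "dzbar p q = 0" using pq nA by auto
    show "(\<lambda>n. sq_norm_on U (\<lambda>x. g (s (t n)) x - p)) \<longlonglongrightarrow> 0" by (rule subt[OF G0(1)])
    show "(\<lambda>n. sq_norm_on U (\<lambda>x. h (s (t n)) x - q)) \<longlonglongrightarrow> 0" by (rule subt[OF G0(2)])
  qed (rule fin)+
qed

subsection \<open>Lipschitz domains\<close>

text \<open>Dividing both first-order expansions at \<open>x + d *\<^sub>R v\<close> by
  \<open>d\<close> leaves only the values at \<open>v\<close>. Points of \<open>S\<close> in this
  one direction suffice, so the argument works at boundary points.\<close>

lemma has_derivative_within_unique_direction:
  assumes 1: "(f has_derivative f') (at x within S)" and 2: "(f has_derivative f'') (at x within S)"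
    and v: "\<And>e. e > 0 \<Longrightarrow> \<exists>d. 0 < d \<and> d < e \<and> x + d *\<^sub>R v \<in> S"
  shows "f' v = f'' v"
proof (cases "v = 0")
  case True
  then show ?thesis using 1 2 by (metis has_derivative_linear linear_0)
next
  case False
  have b: "norm (f' v - f'' v) \<le> 2 * e * norm v" if e: "e > 0" for e
  proof -
    obtain d1 where d1: "d1 > 0" "\<And>y. y \<in> S \<Longrightarrow> norm (y - x) < d1 \<Longrightarrow> norm (f y - f x - f' (y - x))
      \<le> e * norm (y - x)"
      using 1 e unfolding has_derivative_within_alt by blast
    obtain d2 where d2: "d2 > 0" "\<And>y. y \<in> S \<Longrightarrow> norm (y - x) < d2 \<Longrightarrow> norm (f y - f x - f'' (y - x))
      \<le> e * norm (y - x)"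
      using 2 e unfolding has_derivative_within_alt by blast
    obtain d where d: "0 < d" "d < min d1 d2 / norm v" "x + d *\<^sub>R v \<in> S"
      using v[of "min d1 d2 / norm v"] d1 d2 False by auto
    have n: "norm (d *\<^sub>R v) < d1" "norm (d *\<^sub>R v) < d2" using d False
      by (auto simp: pos_less_divide_eq)
    let ?a = "f (x + d *\<^sub>R v) - f x"
    have A: "norm (?a - f' (d *\<^sub>R v)) \<le> e * norm (d *\<^sub>R v)" "norm (?a - f'' (d *\<^sub>R v))
      \<le> e * norm (d *\<^sub>R v)"
      using d1(2)[OF d(3)] d2(2)[OF d(3)] n by auto
    have "norm (f' (d *\<^sub>R v) - f'' (d *\<^sub>R v))
      \<le> norm (?a - f'' (d *\<^sub>R v)) + norm (?a - f' (d *\<^sub>R v))"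
      using norm_triangle_ineq4[of "?a - f'' (d *\<^sub>R v)" "?a - f' (d *\<^sub>R v)"] by simp
    then have "norm (f' (d *\<^sub>R v) - f'' (d *\<^sub>R v)) \<le> e * norm (d *\<^sub>R v) + e * norm (d *\<^sub>R v)"
      using A by linarith
    moreover have "f' (d *\<^sub>R v) = d *\<^sub>R f' v" "f'' (d *\<^sub>R v) = d *\<^sub>R f'' v"
      using 1 2 by (auto simp: linear_scale dest: has_derivative_linear)
    ultimately have "d * norm (f' v - f'' v) \<le> d * (2 * e * norm v)"
      using d(1) by (simp add: algebra_simps flip: scaleR_diff_right)
    then show ?thesis using d(1) by simp
  qed
  have "norm (f' v - f'' v) \<le> 0"
  proof (rule field_le_epsilon)
    fix r :: real assume r: "0 < r"
    have "norm (f' v - f'' v) \<le> 2 * (r / (2 * norm v)) * norm v" using r False by (intro b) auto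
    then show "norm (f' v - f'' v) \<le> 0 + r" using False by simp
  qed
  then show ?thesis by simp
qed

text \<open>The definition of the boundary class describes only \<open>U\<close>. The frontier is
  located here: its points are outside the open set \<open>U\<close>, hence not above the graph, and
  a point strictly below the graph has a neighbourhood missing \<open>U\<close>.\<close>

lemma lipschitz_boundary_local_graph:
  assumes U: "lipschitz_domain U" and x: "x \<in> frontier U"
  obtains T :: "real^2 \<Rightarrow> real^2" and g L W
    where "orthogonal_transformation T" "L-lipschitz_on UNIV g" "open W" "x \<in> W"
    "U \<inter> W = {x \<in> W. g (T x $ 1) < T x $ 2}"
    "\<And>y. y \<in> frontier U \<inter> W \<Longrightarrow> g (T y $ 1) = T y $ 2"
proof -
  obtain T :: "real^2 \<Rightarrow> real^2" and g L W where T: "orthogonal_transformation T"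
    and g: "L-lipschitz_on UNIV g"
    and W: "open W" "x \<in> W" and eq: "U \<inter> W = {x \<in> W. g (T x $ 1) < T x $ 2}"
    using U x unfolding lipschitz_domain_def lipschitz_boundary_def boundary_of_class_def by blast
  have "open U" using U by (simp add: lipschitz_domain_def)
  have cT: "continuous_on UNIV T" using T
    by (simp add: linear_continuous_on linear_conv_bounded_linear[symmetric]
      orthogonal_transformation_linear)
  have cg: "continuous_on UNIV (\<lambda>y. g (T y $ 1))"
    by (rule continuous_on_compose2[OF lipschitz_on_continuous_on[OF g]])
      (auto intro!: continuous_intros cT)
  have "g (T y $ 1) = T y $ 2" if y: "y \<in> frontier U \<inter> W" for y
  proof (rule antisym)
    have yU: "y \<notin> U" "y \<in> closure U" using y \<open>open U\<close> by (auto simp: frontier_def interior_open)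
    show "T y $ 2 \<le> g (T y $ 1)" using yU eq y
      by (metis (no_types, lifting) IntD2 IntI Int_iff linorder_not_less mem_Collect_eq)
    show "g (T y $ 1) \<le> T y $ 2"
    proof (rule ccontr)
      assume a: "\<not> g (T y $ 1) \<le> T y $ 2"
      let ?O = "W \<inter> {z. T z $ 2 < g (T z $ 1)}"
      have "open ?O" using W by (intro open_Int open_Collect_less cg continuous_intros cT) auto
      moreover have "y \<in> ?O" using a y by auto
      moreover have "?O \<inter> U = {}"
      proof -
        have False if "z \<in> ?O" "z \<in> U" for z
        proof -
          have "z \<in> U \<inter> W" using that by blast
          then have "g (T z $ 1) < T z $ 2" unfolding eq by blast
          then show False using that(1) by simp
        qed
        then show ?thesis by blast
      qed
      ultimately show False using yU(2) open_Int_closure_eq_empty by blast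
    qed
  qed
  with T g W eq show ?thesis using that by blast
qed

text \<open>Locally the frontier lies on a Lipschitz graph, the image of a coordinate axis.
  Extending the graph map to a Lipschitz map \<open>F\<close> of the whole plane makes the axis a
  null set of its domain, and such maps preserve null sets.\<close>

lemma lipschitz_domain_negligible_frontier:
  assumes U: "lipschitz_domain U"
  shows "negligible (frontier U)"
  unfolding locally_negligible_alt[of "frontier U"]
proof
  fix x assume x: "x \<in> frontier U"
  obtain T :: "real^2 \<Rightarrow> real^2" and g L W where T: "orthogonal_transformation T"
    and g: "L-lipschitz_on UNIV g"
    and W: "open W" "x \<in> W" and eqU: "U \<inter> W = {x \<in> W. g (T x $ 1) < T x $ 2}"
    and eq: "\<And>y. y \<in> frontier U \<inter> W \<Longrightarrow> g (T y $ 1) = T y $ 2"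
    by (rule lipschitz_boundary_local_graph[OF U x]) (rule that)
  have L0: "0 \<le> L" by (rule lipschitz_on_nonneg[OF g])
  define F where "F y = inv T (y + g (y $ 1) *\<^sub>R axis 2 1)" for y :: "real^2"
  have iT: "orthogonal_transformation (inv T)" using T by (rule orthogonal_transformation_inv)
  have bT: "bij T" using T orthogonal_transformation_bij by blast
  let ?H = "{y :: real^2. y \<bullet> axis 2 1 = 0}"
  have "negligible (F ` ?H)"
  proof (rule negligible_locally_Lipschitz_image)
    show "negligible ?H" by (rule negligible_standard_hyperplane) (simp add: axis_in_Basis_iff)
    fix y assume "y \<in> ?H"
    have "norm (F z - F y) \<le> (1 + L) * norm (z - y)" for z
    proof -
      have "F z - F y = inv T ((z - y) + (g (z $ 1) - g (y $ 1)) *\<^sub>R axis 2 1)"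
        unfolding F_def using orthogonal_transformation_linear[OF iT]
        by (simp add: linear_diff[symmetric] algebra_simps)
      then have "norm (F z - F y) = norm ((z - y) + (g (z $ 1) - g (y $ 1)) *\<^sub>R axis 2 1)"
        using orthogonal_transformation_norm[OF iT] by simp
      also have "\<dots> \<le> norm (z - y) + \<bar>g (z $ 1) - g (y $ 1)\<bar>"
        using norm_triangle_ineq[of "z - y" "(g (z $ 1) - g (y $ 1)) *\<^sub>R axis 2 1"] by simp
      also have "\<bar>g (z $ 1) - g (y $ 1)\<bar> \<le> L * \<bar>z $ 1 - y $ 1\<bar>"
        using lipschitz_onD[OF g, of "z $ 1" "y $ 1"] by (simp add: dist_real_def)
      also have "\<dots> \<le> L * norm (z - y)"
        using component_le_norm_cart[of "z - y" 1] L0 by (intro mult_left_mono) auto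
      finally show ?thesis by (simp add: algebra_simps)
    qed
    then show "\<exists>T B. open T \<and> y \<in> T \<and> (\<forall>z\<in>?H \<inter> T. norm (F z - F y) \<le> B * norm (z - y))"
      by (intro exI[of _ UNIV] exI[of _ "1 + L"]) auto
  qed simp
  moreover have "frontier U \<inter> W \<subseteq> F ` ?H"
  proof
    fix y assume y: "y \<in> frontier U \<inter> W"
    let ?z = "T y - T y $ 2 *\<^sub>R axis 2 1"
    have "?z \<in> ?H" by (simp add: inner_diff_left inner_axis)
    moreover have "F ?z = y"
    proof -
      have z1: "?z $ 1 = T y $ 1" by (simp add: axis_def)
      have "F ?z = inv T (T y)" unfolding F_def z1 eq[OF y] by simp
      then show ?thesis using bT by (simp add: bij_is_inj)
    qed
    ultimately show "y \<in> F ` ?H" by (metis imageI)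
  qed
  ultimately have "negligible (frontier U \<inter> W)" by (rule negligible_subset)
  then show "\<exists>Q. openin (top_of_set (frontier U)) Q \<and> x \<in> Q \<and> negligible Q"
    using x W by (intro exI[of _ "frontier U \<inter> W"]) (auto simp: openin_open)
qed

text \<open>\<open>differential\<close> is taken within the closed domain, where
  \<open>frechet_derivative\<close> is a choice among possible derivatives. At a frontier point two
  linearly independent directions steeper than the local graph lead into \<open>U\<close>, and their
  images determine a linear map of the plane.\<close>

lemma lipschitz_domain_derivative_unique:
  assumes U: "lipschitz_domain U" and x: "x \<in> closure U"
    and 1: "(f has_derivative f') (at x within closure U)"
      and 2: "(f has_derivative f'') (at x within closure U)"
  shows "f' = f''"
proof (cases "x \<in> U")
  case True
  then have "x \<in> interior (closure U)"
    using U by (metis closure_subset interior_maximal lipschitz_domain_def subsetD)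
  then show ?thesis using 1 2 has_derivative_unique by (metis at_within_interior)
next
  case False
  then have x: "x \<in> frontier U" using x U
    by (simp add: frontier_def lipschitz_domain_def interior_open)
  obtain T :: "real^2 \<Rightarrow> real^2" and g L W where T: "orthogonal_transformation T"
    and g: "L-lipschitz_on UNIV g"
    and W: "open W" "x \<in> W" and eqU: "U \<inter> W = {x \<in> W. g (T x $ 1) < T x $ 2}"
    and eq: "\<And>y. y \<in> frontier U \<inter> W \<Longrightarrow> g (T y $ 1) = T y $ 2"
    by (rule lipschitz_boundary_local_graph[OF U x]) (rule that)
  have L0: "0 \<le> L" by (rule lipschitz_on_nonneg[OF g])
  have lT: "linear T" "linear (inv T)" and bT: "bij T"
    using T orthogonal_transformation_inv orthogonal_transformation_linear
      orthogonal_transformation_bij by blast+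
  have l': "linear f'" "linear f''" using 1 2 has_derivative_linear by blast+
  \<comment> \<open>Slope \<open>L + 1\<close> exceeds the Lipschitz constant of the graph, so a
    small step from a frontier point along \<open>w 1\<close> or \<open>w (-1)\<close>, rotated back
    by \<open>inv T\<close>, ends strictly above it.\<close>
  define w :: "real \<Rightarrow> real^2" where "w s = s *\<^sub>R axis 1 1 + (L + 1) *\<^sub>R axis 2 1" for s
  have dir: "f' (inv T (w s)) = f'' (inv T (w s))" if s: "\<bar>s\<bar> = 1" for s
  proof (rule has_derivative_within_unique_direction[OF 1 2])
    fix e :: real assume e: "e > 0"
    let ?v = "inv T (w s)"
    have "((\<lambda>d. x + d *\<^sub>R ?v) \<longlongrightarrow> x + 0 *\<^sub>R ?v) (at_right 0)" by (intro tendsto_intros)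
    then have "eventually (\<lambda>d. x + d *\<^sub>R ?v \<in> W) (at_right 0)"
      using W by (intro topological_tendstoD[of _ x]) auto
    moreover have "eventually (\<lambda>d. d < e) (at_right (0::real))" using eventually_at_right_real[OF e]
      by eventually_elim auto
    moreover have "eventually (\<lambda>d. 0 < d) (at_right (0::real))" by (rule eventually_at_right_less)
    ultimately have "eventually (\<lambda>d. 0 < d \<and> d < e \<and> x + d *\<^sub>R ?v \<in> W) (at_right 0)"
      by eventually_elim auto
    then obtain d where d: "0 < d" "d < e" "x + d *\<^sub>R ?v \<in> W"
      using eventually_happens'[OF trivial_limit_at_right_real] by blast
    have Tv: "T (x + d *\<^sub>R ?v) = T x + d *\<^sub>R w s"
      using bT by (simp add: linear_add[OF lT(1)] linear_scale[OF lT(1)] surj_f_inv_f bij_is_surj)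
    have c: "T (x + d *\<^sub>R ?v) $ 1 = T x $ 1 + d * s" "T (x + d *\<^sub>R ?v) $ 2 = T x $ 2 + d * (L + 1)"
      unfolding Tv by (simp_all add: w_def axis_def)
    have "g (T x $ 1 + d * s) \<le> g (T x $ 1) + L * d"
      using lipschitz_onD[OF g, of "T x $ 1 + d * s" "T x $ 1"] s d
        by (auto simp: dist_real_def abs_mult)
    also have "\<dots> < T x $ 2 + d * (L + 1)" using eq[of x] x W d by (simp add: algebra_simps)
    finally have "x + d *\<^sub>R ?v \<in> {x \<in> W. g (T x $ 1) < T x $ 2}"
      using d(3) by (simp only: mem_Collect_eq c)
    then have "x + d *\<^sub>R ?v \<in> U" unfolding eqU[symmetric] by blast
    then show "\<exists>d. 0 < d \<and> d < e \<and> x + d *\<^sub>R ?v \<in> closure U" using d closure_subset by blast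
  qed
  define D where "D y = f' (inv T y) - f'' (inv T y)" for y
  have lD: "linear D" unfolding D_def
    using linear_compose[OF lT(2) l'(1)] linear_compose[OF lT(2) l'(2)]
      by (auto simp: o_def intro: linear_compose_sub)
  have D0: "D (w 1) = 0" "D (w (-1)) = 0" using dir[of 1] dir[of "-1"] by (auto simp: D_def)
  have "w 1 - w (-1) = 2 *\<^sub>R axis 1 1" "w 1 + w (-1) = (2 * (L + 1)) *\<^sub>R axis 2 1"
    by (simp_all add: vec_eq_iff w_def)
  then have "2 *\<^sub>R D (axis 1 1) = 0" "(2 * (L + 1)) *\<^sub>R D (axis 2 1) = 0"
    using D0 lD by (metis linear_scale linear_diff diff_self, metis linear_scale linear_add add_0)
  then have D1: "D (axis 1 1) = 0" "D (axis 2 1) = 0" using L0 by auto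
  have "D y = 0" for y
  proof -
    have "D (y $ 1 *\<^sub>R axis 1 1 + y $ 2 *\<^sub>R axis 2 1) = 0"
      by (simp add: linear_add[OF lD] linear_scale[OF lD] D1)
    moreover have "y $ 1 *\<^sub>R axis 1 1 + y $ 2 *\<^sub>R axis 2 1 = y"
      by (simp add: vec_eq_iff forall_2 axis_def)
    ultimately show ?thesis by simp
  qed
  then have "f' (inv T (T z)) = f'' (inv T (T z))" for z by (simp add: D_def)
  then show ?thesis using bT by (simp add: fun_eq_iff bij_is_inj)
qed

subsection \<open>Area and energy density\<close>

text \<open>McShane's extension, the infimum of the cones \<open>f y + L * dist x y\<close> with
  vertices over \<open>S\<close>; it preserves the Lipschitz constant.\<close>

lemma lipschitz_real_extension:
  fixes f :: "'a::metric_space \<Rightarrow> real"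
  assumes L: "L-lipschitz_on S f"
  shows "\<exists>F. L-lipschitz_on UNIV F \<and> (\<forall>x\<in>S. F x = f x)"
proof (cases "S = {}")
  case True
  then show ?thesis using lipschitz_on_nonneg[OF L]
    by (intro exI[of _ "\<lambda>x. 0"]) (auto intro!: lipschitz_onI)
next
  case False
  have L0: "0 \<le> L" by (rule lipschitz_on_nonneg[OF L])
  have fl: "f y \<le> f z + L * dist y z" if "y \<in> S" "z \<in> S" for y z
    using lipschitz_onD[OF L that] by (auto simp: dist_real_def)
  define F where "F x = (INF y\<in>S. f y + L * dist x y)" for x
  obtain s where s: "s \<in> S" using False by blast
  have bd: "bdd_below ((\<lambda>y. f y + L * dist x y) ` S)" for x
  proof (rule bdd_belowI2)
    fix y assume y: "y \<in> S"
    have "f s \<le> f y + L * dist s y" using fl s y by blast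
    also have "L * dist s y \<le> L * (dist x y + dist x s)" using L0 dist_triangle[of s y x]
      by (intro mult_left_mono) (auto simp: dist_commute)
    finally show "f s - L * dist x s \<le> f y + L * dist x y" by (simp add: algebra_simps)
  qed
  have "F x = f x" if x: "x \<in> S" for x
  proof (rule antisym)
    show "F x \<le> f x" unfolding F_def using cINF_lower[OF bd x, of x] by simp
    show "f x \<le> F x" unfolding F_def using False fl[OF x] by (intro cINF_greatest) auto
  qed
  moreover have "L-lipschitz_on UNIV F"
  proof (rule lipschitz_onI[OF _ L0])
    have half: "F x - L * dist x y \<le> F y" for x y
      unfolding F_def[of y]
    proof (rule cINF_greatest[OF False])
      fix z assume z: "z \<in> S"
      have "F x \<le> f z + L * dist x z" unfolding F_def by (rule cINF_lower[OF bd z])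
      also have "L * dist x z \<le> L * (dist x y + dist y z)" using L0
        by (intro mult_left_mono dist_triangle)
      finally show "F x - L * dist x y \<le> f z + L * dist y z" by (simp add: algebra_simps)
    qed
    show "dist (F x) (F y) \<le> L * dist x y" for x y
      using half[of x y] half[of y x] by (auto simp: dist_real_def dist_commute abs_le_iff)
  qed
  ultimately show ?thesis by blast
qed

lemma inj_matrix_vector_mult_det:
  fixes A :: "real^'n^'n"
  assumes "det A \<noteq> 0"
  shows "inj ((*v) A)"
  using assms by (simp add: invertible_det_nz inj_matrix_vector_mult)

text \<open>The area formula requires an injective map differentiable at each point of the set.
  Points without derivative are null, points of zero Jacobian contribute nothing, and among points
  of nonzero Jacobian those sent into the null set of multiply covered values are null; on the rest
  the map is injective.\<close>

lemma integral_jacobian_le_area: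
  fixes f :: "real^2 \<Rightarrow> real^2" and G :: "real^2 \<Rightarrow> real^2^2"
  assumes U: "open U" "bounded U" "U \<subseteq> M" and N: "N \<in> lmeasurable" and fN: "f ` U \<subseteq> N"
    and inj: "AE q in lebesgue_on N. \<exists>\<^sub>\<le>\<^sub>1x. x \<in> M \<and> f x = q"
    and G: "G \<in> borel_measurable borel" "\<And>x. \<bar>det (G x)\<bar> \<le> B"
    and dm: "(\<lambda>x. det (G x)) \<in> borel_measurable borel"
    and der: "AE x in lborel. x \<in> U \<longrightarrow> (f has_derivative (\<lambda>h. G x *v h)) (at x)"
  shows "(LINT x|lborel. indicator U x * \<bar>det (G x)\<bar>) \<le> measure lebesgue N"
proof -
  have Um [measurable]: "U \<in> sets borel" using U by simp
  have Nm: "N \<in> sets lebesgue" using N by (rule fmeasurableD)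
  define A where "A = {x \<in> U. \<not> (f has_derivative (\<lambda>h. G x *v h)) (at x)}"
  have A: "A \<in> null_sets lebesgue"
  proof -
    have "AE x in lebesgue. x \<notin> A"
      using der by (simp add: AE_completion_iff A_def)
    then show ?thesis by (simp add: completion.AE_iff_null_sets)
  qed
  define Z where "Z = {q \<in> N. \<not> (\<exists>\<^sub>\<le>\<^sub>1x. x \<in> M \<and> f x = q)}"
  have Z: "negligible Z"
  proof -
    have "AE q in lebesgue. q \<notin> Z" using inj Nm by (simp add: AE_restrict_space_iff Z_def)
    then show ?thesis by (simp add: completion.AE_iff_null_sets negligible_iff_null_sets)
  qed
  have P: "{x \<in> U. det (G x) \<noteq> 0} \<in> sets borel" using dm by measurable
  define D where "D = {x \<in> U. det (G x) \<noteq> 0} - A"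
  have D: "D \<in> sets lebesgue" unfolding D_def using P A by (intro sets.Diff) auto
  have dD: "(f has_derivative (\<lambda>h. G x *v h)) (at x within T)" if "x \<in> D" for x T
    using that by (auto simp: D_def A_def intro: has_derivative_at_withinI)
  define D0 where "D0 = {x \<in> D. f x \<in> Z}"
  have D0: "negligible D0" unfolding D0_def
    by (rule negligible_differentiable_vimage[where f'="\<lambda>x h. G x *v h"])
      (use Z dD inj_matrix_vector_mult_det in \<open>auto simp: D_def\<close>)
  define E where "E = D - D0"
  have E: "E \<in> sets lebesgue" unfolding E_def using D D0
    by (intro sets.Diff) (auto simp: negligible_iff_null_sets)
  have injE: "inj_on f E"
  proof (rule inj_onI)
    fix x y assume xy: "x \<in> E" "y \<in> E" "f x = f y"
    then have "x \<in> U" "y \<in> U" "f x \<notin> Z" by (auto simp: E_def D0_def D_def)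
    moreover from this have "f x \<in> N" using fN by blast
    ultimately have "\<exists>\<^sub>\<le>\<^sub>1z. z \<in> M \<and> f z = f x" by (simp add: Z_def)
    then show "x = y" using \<open>x \<in> U\<close> \<open>y \<in> U\<close> xy(3) U(3) by (auto dest: Uniq_D)
  qed
  have dE: "(f has_derivative (*v) (G x)) (at x within E)" if "x \<in> E" for x
    using dD[of x E] that by (auto simp: E_def)
  let ?d = "\<lambda>x. \<bar>det (G x)\<bar>"
  have fin: "emeasure lborel U < \<infinity>" using emeasure_bounded_finite[OF U(2)] .
  have [measurable]: "(\<lambda>x. det (G x)) \<in> borel_measurable borel" by (rule dm)
  have iU: "integrable lborel (\<lambda>x. indicator U x *\<^sub>R ?d x)"
    by (rule integrableI_bounded_set_indicator[where B=B]) (use fin G in auto)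
  have iUl: "integrable lebesgue (\<lambda>x. indicator U x *\<^sub>R ?d x)"
    using iU by (subst integrable_completion) auto
  have ae: "AE x in lebesgue. indicator U x *\<^sub>R ?d x = indicator E x *\<^sub>R ?d x"
  proof -
    have "AE x in lebesgue. x \<notin> A" "AE x in lebesgue. x \<notin> D0"
      using A D0 by (auto simp: negligible_iff_null_sets intro: AE_not_in)
    then show ?thesis by eventually_elim (auto simp: indicator_def E_def D_def)
  qed
  have EU: "E \<subseteq> U" by (auto simp: E_def D_def)
  have sE: "set_integrable lebesgue E ?d"
  proof -
    have "set_integrable lebesgue U ?d" using iUl by (simp add: set_integrable_def)
    then show ?thesis by (rule set_integrable_subset[OF _ E EU])
  qed
  have "(LINT x|lborel. indicator U x * ?d x) = (LINT x|lebesgue. indicator U x *\<^sub>R ?d x)"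
    by (subst integral_completion) auto
  also have "\<dots> = (LINT x|lebesgue. indicator E x *\<^sub>R ?d x)"
    by (rule integral_cong_AE[OF _ _ ae]) (use iUl sE in \<open>auto simp: set_integrable_def
      dest: borel_measurable_integrable\<close>)
  also have "\<dots> = integral E ?d"
    using set_lebesgue_integral_eq_integral(2)[OF sE] by (simp add: set_lebesgue_integral_def)
  also have "\<dots> = measure lebesgue (f ` E)"
    using measure_differentiable_image_eq[OF E dE injE] set_lebesgue_integral_eq_integral(1)[OF sE]
      by simp
  also have "\<dots> \<le> measure lebesgue N"
  proof (rule measure_mono_fmeasurable[OF _ _ N])
    show "f ` E \<subseteq> N" using fN EU by blast
    have "f ` E \<in> lmeasurable"
      using measurable_differentiable_image_eq[OF E dE injE] set_lebesgue_integral_eq_integral(1)[OF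
        sE] by simp
    then show "f ` E \<in> sets lebesgue" by (rule fmeasurableD)
  qed
  finally show ?thesis .
qed

text \<open>Rotations are the multiplications by unit complex numbers.\<close>

lemma rotation_matrix_dz:
  fixes R :: "real^2^2"
  assumes "rotation_matrix R"
  shows "norm (dz (R $ 1) (R $ 2)) = 1" "dzbar (R $ 1) (R $ 2) = 0"
proof -
  have o: "transpose R ** R = mat 1" and d: "det R = 1"
    using assms by (auto simp: rotation_matrix_def orthogonal_matrix)
  have e: "(\<Sum>k\<in>UNIV. R $ k $ i * R $ k $ j) = (if i = j then 1 else 0)" for i j
    using arg_cong[OF o, of "\<lambda>A. A $ i $ j"]
      by (simp add: matrix_matrix_mult_def transpose_def mat_def)
  have 1: "R $ 1 $ 1 * R $ 1 $ 1 + R $ 2 $ 1 * R $ 2 $ 1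
    = 1" "R $ 1 $ 2 * R $ 1 $ 2 + R $ 2 $ 2 * R $ 2 $ 2 = 1"
    using e[of 1 1] e[of 2 2] by (simp_all add: sum_2)
  have 2: "R $ 1 $ 1 * R $ 2 $ 2 - R $ 1 $ 2 * R $ 2 $ 1 = 1" using d by (simp add: det_2)
  have "(norm (dz (R $ 1) (R $ 2)))\<^sup>2 = 1" "(norm (dzbar (R $ 1) (R $ 2)))\<^sup>2 = 0"
    unfolding norm_dz_sq norm_dzbar_sq using 1 2 by (simp_all add: power2_eq_square field_simps)
  then show "norm (dz (R $ 1) (R $ 2)) = 1" "dzbar (R $ 1) (R $ 2) = 0"
    by (auto simp: power2_eq_1_iff) (smt (verit) norm_ge_zero)
qed

lemma norm_matrix2_sq:
  fixes A :: "real^2^2"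
  shows "(norm A)\<^sup>2 = (norm (A $ 1))\<^sup>2 + (norm (A $ 2))\<^sup>2"
  by (simp only: power2_norm_eq_inner inner_vec_def[of A] sum_2)

text \<open>The squared Frobenius norm is twice the sum of the squares of \<open>dz\<close> and
  \<open>dzbar\<close>, and rotations lie on the unit circle of the \<open>dz\<close> coordinate. So
  the \<open>dzbar\<close> part of the distance is fixed, and the reverse triangle inequality bounds
  the \<open>dz\<close> part.\<close>

lemma infdist_rotation_sq_ge:
  fixes A :: "real^2^2"
  shows "2 * (norm (dz (A $ 1) (A $ 2)) - 1)\<^sup>2 + 2 * (norm (dzbar (A $ 1) (A $ 2)))\<^sup>2
    \<le> (infdist A {A. rotation_matrix A})\<^sup>2"
proof -
  let ?m = "norm (dz (A $ 1) (A $ 2))" and ?l = "norm (dzbar (A $ 1) (A $ 2))"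
  let ?q = "2 * (?m - 1)\<^sup>2 + 2 * ?l\<^sup>2"
  have ne: "{A :: real^2^2. rotation_matrix A} \<noteq> {}"
    by (auto simp: rotation_matrix_def orthogonal_matrix_id intro!: exI[of _ "mat 1"])
  have b: "sqrt ?q \<le> dist A R" if R: "rotation_matrix R" for R
  proof -
    note r = rotation_matrix_dz[OF R]
    have "(norm (A - R))\<^sup>2 = 2 * ((norm (dz (A $ 1 - R $ 1) (A $ 2 - R $ 2)))\<^sup>2
      + (norm (dzbar (A $ 1 - R $ 1) (A $ 2 - R $ 2)))\<^sup>2)"
      unfolding norm_dz_add_dzbar by (simp add: norm_matrix2_sq)
    also have "\<dots> = 2 * (norm (dz (A $ 1) (A $ 2) - dz (R $ 1) (R $ 2)))\<^sup>2 + 2 * ?l\<^sup>2"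
      by (simp add: dz_diff dzbar_diff r)
    also have "\<dots> \<ge> ?q"
    proof -
      have "\<bar>?m - 1\<bar> \<le> norm (dz (A $ 1) (A $ 2) - dz (R $ 1) (R $ 2))"
        using norm_triangle_ineq3[of "dz (A $ 1) (A $ 2)" "dz (R $ 1) (R $ 2)"] r by simp
      then have "(?m - 1)\<^sup>2 \<le> (norm (dz (A $ 1) (A $ 2) - dz (R $ 1) (R $ 2)))\<^sup>2"
        by (metis abs_norm_cancel abs_le_square_iff)
      then show ?thesis by simp
    qed
    finally show ?thesis by (simp add: dist_norm real_le_lsqrt)
  qed
  have "sqrt ?q \<le> infdist A {A. rotation_matrix A}"
    unfolding infdist_def using ne b by (auto intro!: cINF_greatest)
  then have "(sqrt ?q)\<^sup>2 \<le> (infdist A {A. rotation_matrix A})\<^sup>2" by (intro power_mono) auto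
  then show ?thesis by simp
qed

text \<open>The tangent line at \<open>c\<^sup>2\<close> of \<open>s \<mapsto> 2 (\<surd>s - 1)\<^sup>2\<close>, evaluated at the Jacobian, plus an excess that for
  \<open>c > 1 / 2\<close> vanishes only at the conformal matrices of ratio \<open>c\<close>.\<close>

lemma energy_density_lower_bound:
  fixes A :: "real^2^2"
  assumes c: "0 < c"
  shows "2 * (c - 1)\<^sup>2 + (2 - 2 / c) * (det A - c\<^sup>2) + (4
    - 2 / c) * (norm (dzbar (A $ 1) (A $ 2)))\<^sup>2
      + 2 / c * (norm (dz (A $ 1) (A $ 2)) - c)\<^sup>2 \<le> (infdist A {A. rotation_matrix A})\<^sup>2"
proof -
  let ?m = "norm (dz (A $ 1) (A $ 2))" and ?l = "norm (dzbar (A $ 1) (A $ 2))"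
  have d: "det A = ?m\<^sup>2 - ?l\<^sup>2" by (simp add: norm_dz_diff_dzbar det_2)
  \<comment> \<open>The slope \<open>2 - 2 / c\<close> is the derivative of
    \<open>2 (sqrt s - 1)^2\<close> at \<open>s = c\<^sup>2\<close>; completing the square around
    \<open>c\<close> makes both sides agree identically.\<close>
  have "2 * (c - 1)\<^sup>2 + (2 - 2 / c) * (det A - c\<^sup>2) + (4 - 2 / c) * ?l\<^sup>2 + 2 / c * (?m - c)\<^sup>2
      = 2 * (?m - 1)\<^sup>2 + 2 * ?l\<^sup>2"
    unfolding d using c by (simp add: field_simps power2_eq_square)
  then show ?thesis using infdist_rotation_sq_ge[of A] by simp
qed

subsection \<open>Weak derivatives of Lipschitz maps\<close>

text \<open>Lebesgue measure is complete: preimages change only by subsets of a null set, which are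
  measurable.\<close>

lemma borel_measurable_lebesgue_AE:
  fixes f g :: "'a::euclidean_space \<Rightarrow> 'b::topological_space"
  assumes g: "g \<in> borel_measurable lebesgue" and ae: "AE x in lebesgue. f x = g x"
  shows "f \<in> borel_measurable lebesgue"
proof (rule measurableI)
  fix A :: "'b set" assume A: "A \<in> sets borel"
  define N where "N = {x. f x \<noteq> g x}"
  have N: "N \<in> null_sets lebesgue" using ae by (simp add: completion.AE_iff_null_sets N_def)
  have "N \<inter> f -` A \<in> null_sets lebesgue"
    using N by (rule null_sets_completion_subset[rotated]) auto
  moreover have "g -` A \<in> sets lebesgue" using measurable_sets[OF g A] by simp
  ultimately have "(g -` A - N) \<union> (N \<inter> f -` A) \<in> sets lebesgue" using N by auto
  also have "(g -` A - N) \<union> (N \<inter> f -` A) = f -` A \<inter> space lebesgue" by (auto simp: N_def)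
  finally show "f -` A \<inter> space lebesgue \<in> sets lebesgue" .
qed simp

text \<open>Bridge between two settings: energy and Sobolev norms use \<open>lebesgue_on\<close>,
  whereas the estimates use \<open>lborel\<close> and Borel representatives on an open set. The null
  set \<open>M - U\<close> and the null set where function and representative differ are both
  invisible to the integral.\<close>

lemma lebesgue_on_AE_eq_borel:
  fixes f g :: "'a::euclidean_space \<Rightarrow> 'b::euclidean_space"
  assumes M: "M \<in> sets lebesgue" and U: "U \<in> sets borel" "U \<subseteq> M" "negligible (M - U)"
    and g: "g \<in> borel_measurable borel" and ae: "AE x in lborel. x \<in> U \<longrightarrow> f x = g x"
  shows "f \<in> borel_measurable (lebesgue_on M)"
    "integrable (lebesgue_on M) f \<longleftrightarrow> integrable lborel (\<lambda>x. indicator U x *\<^sub>R g x)"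
    "integral\<^sup>L (lebesgue_on M) f = (LINT x|lborel. indicator U x *\<^sub>R g x)"
proof -
  have [measurable]: "g \<in> borel_measurable borel" "U \<in> sets borel" using g U by auto
  have gm: "(\<lambda>x. indicator U x *\<^sub>R g x) \<in> borel_measurable lborel" by measurable
  have gml: "(\<lambda>x. indicator U x *\<^sub>R g x) \<in> borel_measurable lebesgue" using gm
    by (rule measurable_completion)
  have "AE x in lebesgue. x \<notin> M - U"
    by (rule AE_not_in) (use U(3) in \<open>simp add: negligible_iff_null_sets\<close>)
  moreover have "AE x in lebesgue. x \<in> U \<longrightarrow> f x = g x" using ae by (rule AE_completion)
  ultimately have eq: "AE x in lebesgue. indicator M x *\<^sub>R f x = indicator U x *\<^sub>R g x"
    by eventually_elim (use U(2) in \<open>auto simp: indicator_def\<close>)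
  have fm: "(\<lambda>x. indicator M x *\<^sub>R f x) \<in> borel_measurable lebesgue"
    by (rule borel_measurable_lebesgue_AE[OF gml eq])
  have Ms: "M \<inter> space lebesgue \<in> sets lebesgue" using M by simp
  show "f \<in> borel_measurable (lebesgue_on M)"
    using fm by (subst borel_measurable_restrict_space_iff[OF Ms]) auto
  have "integrable (lebesgue_on M) f \<longleftrightarrow> integrable lebesgue (\<lambda>x. indicator M x *\<^sub>R f x)"
    by (rule integrable_restrict_space[OF Ms])
  also have "\<dots> \<longleftrightarrow> integrable lebesgue (\<lambda>x. indicator U x *\<^sub>R g x)"
    by (rule integrable_cong_AE[OF fm gml eq])
  also have "\<dots> \<longleftrightarrow> integrable lborel (\<lambda>x. indicator U x *\<^sub>R g x)"
    by (rule integrable_completion[OF gm])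
  finally show "integrable (lebesgue_on M) f \<longleftrightarrow> integrable lborel (\<lambda>x. indicator U x *\<^sub>R g x)" .
  have "integral\<^sup>L (lebesgue_on M) f = (LINT x|lebesgue. indicator M x *\<^sub>R f x)"
    by (rule integral_restrict_space[OF Ms])
  also have "\<dots> = (LINT x|lebesgue. indicator U x *\<^sub>R g x)" by (rule integral_cong_AE[OF fm gml eq])
  also have "\<dots> = (LINT x|lborel. indicator U x *\<^sub>R g x)" by (rule integral_completion[OF gm])
  finally show "integral\<^sup>L (lebesgue_on M) f = (LINT x|lborel. indicator U x *\<^sub>R g x)" .
qed

lemma loc_bdd_borel_integrable_on_bounded:
  assumes f: "loc_bdd_borel f" and S: "S \<in> sets borel" "bounded S"
  shows "integrable lborel (\<lambda>x. indicator S x *\<^sub>R f x)"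
proof -
  obtain B where "0 \<le> B" "\<And>x. x \<in> S \<Longrightarrow> norm (f x) \<le> B" using loc_bdd_borelE[OF f S(2)] by metis
  then show ?thesis using S emeasure_bounded_finite[OF S(2)] loc_bdd_borel_measurable[OF f]
    by (intro integrableI_bounded_set_indicator[where B=B]) auto
qed

lemma sq_norm_on_eq_integral:
  fixes f :: "'a::euclidean_space \<Rightarrow> 'b::euclidean_space"
  assumes f: "loc_bdd_borel f" and S: "S \<in> sets borel" "bounded S"
  shows "sq_norm_on S f = ennreal (LINT x|lborel. indicator S x *\<^sub>R (norm (f x))\<^sup>2)"
proof -
  have "integrable lborel (\<lambda>x. indicator S x *\<^sub>R (norm (f x))\<^sup>2)"
    by (rule loc_bdd_borel_integrable_on_bounded[OF _ S]) (intro loc_bdd_borel_intros f)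
  then have "ennreal (LINT x|lborel. indicator S x *\<^sub>R (norm (f x))\<^sup>2)
    = (\<integral>\<^sup>+x. ennreal (indicator S x *\<^sub>R (norm (f x))\<^sup>2) \<partial>lborel)"
    by (intro nn_integral_eq_integral[symmetric]) auto
  also have "\<dots> = sq_norm_on S f" unfolding sq_norm_on_def
    by (intro nn_integral_cong) (auto simp: indicator_def)
  finally show ?thesis ..
qed

lemma borel_measurable_vector_2:
  fixes a b :: "real^2 \<Rightarrow> 'c::euclidean_space"
  assumes "a \<in> borel_measurable borel" "b \<in> borel_measurable borel"
  shows "(\<lambda>x. vector [a x, b x] :: 'c^2) \<in> borel_measurable borel"
proof -
  have eq: "(vector [a x, b x] :: 'c^2) = axis 1 (a x) + axis 2 (b x)" for x
    by (simp add: vec_eq_iff forall_2 axis_def)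
  have "continuous_on UNIV (\<lambda>y::'c. axis i y :: 'c^2)" for i
    by (intro linear_continuous_on) (auto
      simp: linear_conv_bounded_linear[symmetric] axis_def vec_eq_iff intro!: linearI)
  then have "(\<lambda>y::'c. axis i y :: 'c^2) \<in> borel_measurable borel" for i
    by (rule borel_measurable_continuous_onI)
  then have "(\<lambda>x. axis i (c x) :: 'c^2) \<in> borel_measurable borel" if "c \<in> borel_measurable borel"
    for i and c :: "real^2 \<Rightarrow> 'c"
    using that measurable_compose by blast
  then show ?thesis unfolding eq using assms by (intro borel_measurable_add)
qed

section \<open>Test functions and weak derivatives\<close>

lemma frechet_derivative_cong_open:
  assumes "open W" "y \<in> W" "\<And>z. z \<in> W \<Longrightarrow> g z = f z"
  shows "frechet_derivative g (at y) = frechet_derivative f (at y)"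
proof -
  have "(g has_derivative D) (at y) \<longleftrightarrow> (f has_derivative D) (at y)" for D
    using assms by (metis has_derivative_transform_within_open)
  then show ?thesis by (simp add: frechet_derivative_def)
qed

text \<open>Differentiability and continuity of the derivative are local, so they pass from the
  local extensions to the function itself.\<close>

lemma smooth_on_UNIV_C1:
  assumes f: "smooth_on UNIV f"
  shows "Ck_on_open 1 UNIV f"
proof -
  have "\<exists>W g. open W \<and> x \<in> W \<and> Ck_on_open 1 W g \<and> (\<forall>y\<in>W. g y = f y)" for x
    using f unfolding smooth_on_def by (metis Int_UNIV_right UNIV_I)
  then obtain W g where W: "\<And>x. open (W x)" "\<And>x. x \<in> W x" and g: "\<And>x. Ck_on_open 1 (W x) (g x)"
    and eq: "\<And>x y. y \<in> W x \<Longrightarrow> g x y = f y" by metis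
  have "f differentiable (at x)" for x
  proof -
    have "g x differentiable (at x)" using g[of x] W(2)[of x] by simp
    then show ?thesis using W eq by (meson differentiable_def has_derivative_transform_within_open)
  qed
  moreover have "isCont (\<lambda>x. frechet_derivative f (at x) v) x" for v x
  proof -
    have "continuous_on (W x) (\<lambda>y. frechet_derivative (g x) (at y) v)" using g[of x] by simp
    then have "continuous_on (W x) (\<lambda>y. frechet_derivative f (at y) v)"
    proof (rule continuous_on_eq)
      fix y assume "y \<in> W x"
      then show "frechet_derivative (g x) (at y) v = frechet_derivative f (at y) v"
        using frechet_derivative_cong_open[OF W(1)[of x], of y "g x" f] eq by simp
    qed
    then show ?thesis using W continuous_on_eq_continuous_at by blast
  qed
  ultimately show ?thesis by (simp add: continuous_on_eq_continuous_at)
qed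

lemma Ck_on_open_imp_smooth_on_UNIV:
  assumes "\<And>k. Ck_on_open k UNIV f"
  shows "smooth_on S f"
  unfolding smooth_on_def using assms by (intro ballI exI[of _ UNIV] exI[of _ f]) auto

lemma test_function_box_bump:
  assumes "cbox a b \<subseteq> W" "0 < r"
  shows "test_function W (box_bump a b r)"
proof -
  have eq: "{x. box_bump a b r x \<noteq> 0} = box a b" using box_bump_nonzero[OF assms(2)] by blast
  have "closure (box a b) \<subseteq> cbox a b" by (rule closure_minimal) (auto simp: box_subset_cbox)
  then show ?thesis unfolding test_function_def eq
    using assms(1) by (auto intro!: Ck_on_open_imp_smooth_on_UNIV box_bump_Ck bounded_box)
qed

text \<open>\<open>W12_norm\<close> selects a weak derivative by \<open>SOME\<close>; uniqueness is
  what makes the norm computable. Box bumps serve as test functions, and in their limit the box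
  integrals of the difference of two derivatives vanish.\<close>

lemma L2_weak_derivative_unique:
  assumes W: "open W" "bounded W" and G: "L2_weak_derivative W f G"
    and H: "L2_weak_derivative W f H"
  shows "AE x in lebesgue_on W. G x = H x"
proof -
  have Wl: "W \<in> sets lebesgue" and Wb: "W \<in> sets borel" using W by auto
  have Ws: "W \<inter> space lebesgue \<in> sets lebesgue" using Wl by simp
  have fin: "finite_measure (lebesgue_on W)"
  proof (rule finite_measureI)
    have "emeasure (lebesgue_on W) (space (lebesgue_on W)) = emeasure lborel W"
      using Wb Wl by (simp add: emeasure_restrict_space)
    then show "emeasure (lebesgue_on W) (space (lebesgue_on W)) \<noteq> \<infinity>"
      using emeasure_bounded_finite[OF W(2)] by simp
  qed
  interpret finite_measure "lebesgue_on W" by (rule fin)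
  have comp: "AE x in lebesgue_on W. G x $ i $ j = H x $ i $ j" for i j
  proof -
    have sq: "integrable (lebesgue_on W) (\<lambda>x. K x $ i $ j)" if "L2_weak_derivative W f K" for K
    proof (rule Bochner_Integration.integrable_bound)
      have K: "K \<in> borel_measurable (lebesgue_on W)"
        "integrable (lebesgue_on W) (\<lambda>x. (norm (K x))\<^sup>2)"
        using that by (auto simp: L2_weak_derivative_def square_integrable_on_def)
      show "integrable (lebesgue_on W) (\<lambda>x. 1 + (norm (K x))\<^sup>2)" using K by auto
      show "(\<lambda>x. K x $ i $ j) \<in> borel_measurable (lebesgue_on W)"
      proof -
        have "(\<lambda>A::real^2^2. A $ i $ j) \<in> borel_measurable borel"
          by (intro borel_measurable_continuous_onI continuous_intros)
        then show ?thesis using K(1) by (rule measurable_compose[rotated])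
      qed
      show "AE x in lebesgue_on W. norm (K x $ i $ j) \<le> norm (1 + (norm (K x))\<^sup>2)"
      proof (rule AE_I2)
        fix x
        have "norm (K x $ i $ j) \<le> norm (K x)"
          by (rule order_trans[OF Finite_Cartesian_Product.norm_nth_le
          Finite_Cartesian_Product.norm_nth_le])
        also have "\<dots> \<le> 1 + (norm (K x))\<^sup>2"
          using sum_squares_bound[of 1 "norm (K x)"] norm_ge_zero[of "K x"]
          by (simp del: norm_ge_zero)
        finally show "norm (K x $ i $ j) \<le> norm (1 + (norm (K x))\<^sup>2)" by simp
      qed
    qed
    define D where "D x = G x $ i $ j - H x $ i $ j" for x
    have Di: "integrable (lebesgue_on W) D" unfolding D_def
      by (intro Bochner_Integration.integrable_diff sq G H)
    then have DiU: "integrable lebesgue (\<lambda>x. indicator W x *\<^sub>R D x)"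
      by (simp add: integrable_restrict_space[OF Ws])
    then have "(\<lambda>x. indicator W x *\<^sub>R D x) \<in> borel_measurable lebesgue"
      by (rule borel_measurable_integrable)
    \<comment> \<open>The difference is only Lebesgue measurable, whereas the criterion on box
      integrals is stated for \<open>lborel\<close>; hence a Borel representative
      \<open>d\<close>.\<close>
    from completion_ex_borel_measurable_real[OF this]
    obtain d where d [measurable]: "d \<in> borel_measurable lborel"
      and dD: "AE x in lborel. indicator W x *\<^sub>R D x = d x" by blast
    have dDl: "AE x in lebesgue. indicator W x *\<^sub>R D x = d x" using dD by (rule AE_completion)
    have dml: "d \<in> borel_measurable lebesgue" using d by (rule measurable_completion)
    have di: "integrable lborel d"
      using DiU integrable_cong_AE[OF borel_measurable_integrable[OF DiU] dml dDl]
        integrable_completion[OF d] by simp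
    have "AE x in lborel. x \<in> W \<longrightarrow> d x = 0"
    proof (rule AE_zero_if_box_integrals_zero[OF W(1)])
      show "integrable lborel (\<lambda>x. indicator (cbox a b) x * (indicator W x * d x))" for a b
        by (rule Bochner_Integration.integrable_bound[OF di]) (use Wb in \<open>auto simp: indicator_def\<close>)
      fix a b assume ab: "cbox a b \<subseteq> W"
      define k where "k n = box_bump a b (real (Suc n))" for n
      have kb: "0 \<le> k n x" "k n x \<le> 1" for n x using box_bump_bounds by (auto simp: k_def)
      have [measurable]: "k n \<in> borel_measurable borel" for n
        using box_bump_Ck[of 0 a b "real (Suc n)"]
          by (simp add: k_def borel_measurable_continuous_onI)
      have z: "(LINT x|lborel. d x * k n x) = 0" for n
      proof -
        have t: "test_function W (k n)" unfolding k_def by (rule test_function_box_bump[OF ab]) simp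
        have ik: "integrable (lebesgue_on W) (\<lambda>x. K x $ i $ j * k n x)"
          if "L2_weak_derivative W f K" for K
        proof (rule Bochner_Integration.integrable_bound[OF sq[OF that]])
          show "(\<lambda>x. K x $ i $ j * k n x) \<in> borel_measurable (lebesgue_on W)"
            by (rule borel_measurable_times[OF borel_measurable_integrable[OF sq[OF that]]
                  measurable_restrict_space1[OF measurable_completion]]) simp
          show "AE x in lebesgue_on W. norm (K x $ i $ j * k n x) \<le> norm (K x $ i $ j)"
            using kb by (intro AE_I2) (simp add: abs_mult mult_left_le)
        qed
        have "(LINT x|lebesgue_on W. G x $ i $ j * k n x)
          = (LINT x|lebesgue_on W. H x $ i $ j * k n x)"
        proof -
          have "(LINT x|lebesgue_on W. f x $ i * frechet_derivative (k n) (at x) (axis j 1))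
            = - (LINT x|lebesgue_on W. K x $ i $ j * k n x)"
            if "L2_weak_derivative W f K" for K using that t unfolding L2_weak_derivative_def
              by blast
          from this[OF G] this[OF H] show ?thesis by linarith
        qed
        then have "(LINT x|lebesgue_on W. D x * k n x) = 0"
          by (simp add: D_def left_diff_distrib Bochner_Integration.integral_diff[OF ik[OF G] ik[OF
            H]])
        moreover have "(LINT x|lebesgue_on W. D x * k n x)
          = (LINT x|lebesgue. (indicator W x *\<^sub>R D x) * k n x)"
          by (subst integral_restrict_space[OF Ws]) (simp add: mult.assoc)
        moreover have "\<dots> = (LINT x|lebesgue. d x * k n x)"
        proof (rule integral_cong_AE)
          show "AE x in lebesgue. indicator W x *\<^sub>R D x * k n x = d x * k n x" using dDl
            by eventually_elim simp
          have km: "k n \<in> borel_measurable lebesgue" by (rule measurable_completion) simp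
          show "(\<lambda>x. indicator W x *\<^sub>R D x * k n x) \<in> borel_measurable lebesgue"
            by (rule borel_measurable_times[OF borel_measurable_integrable[OF DiU] km])
          show "(\<lambda>x. d x * k n x) \<in> borel_measurable lebesgue"
            by (rule borel_measurable_times[OF dml km])
        qed
        moreover have "\<dots> = (LINT x|lborel. d x * k n x)" by (rule integral_completion) measurable
        ultimately show ?thesis by simp
      qed
      have "(\<lambda>n. LINT x|lborel. d x * k n x) \<longlonglongrightarrow> (LINT x|lborel. d x * indicator (box a b) x)"
      proof (rule integral_dominated_convergence[where w="\<lambda>x. \<bar>d x\<bar>"])
        show "AE x in lborel. (\<lambda>n. d x * k n x) \<longlonglongrightarrow> d x * indicator (box a b) x"
          unfolding k_def by (intro AE_I2 tendsto_intros box_bump_tendsto)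
        show "AE x in lborel. norm (d x * k n x) \<le> \<bar>d x\<bar>" for n
          using kb by (intro AE_I2) (simp add: abs_mult mult_left_le)
      qed (use di in auto)
      then show "(LINT x|lborel. indicator (box a b) x * d x) = 0"
        unfolding z LIMSEQ_const_iff by (simp only: mult.commute)
    qed
    with dD have "AE x in lborel. x \<in> W \<longrightarrow> D x = 0" by eventually_elim auto
    then have "AE x in lebesgue. x \<in> W \<longrightarrow> D x = 0" by (rule AE_completion)
    then show ?thesis by (simp add: AE_restrict_space_iff[OF Ws] D_def)
  qed
  have "AE x in lebesgue_on W. \<forall>i\<in>UNIV. \<forall>j\<in>UNIV. G x $ i $ j = H x $ i $ j"
    by (intro AE_finite_allI comp) auto
  then show ?thesis by eventually_elim (simp add: vec_eq_iff)
qed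

text \<open>The map agrees with the global Lipschitz functions on \<open>W\<close>, which is all
  that the Sobolev space sees. Test functions and their derivatives vanish outside \<open>W\<close>,
  so integrals over \<open>W\<close> and over the plane coincide and integration by parts
  applies.\<close>

lemma lipschitz_L2_weak_derivative:
  fixes f :: "real^2 \<Rightarrow> real^2" and u v :: "real^2 \<Rightarrow> real"
  assumes W: "open W" "bounded W" and u: "L-lipschitz_on UNIV u" and v: "K-lipschitz_on UNIV v"
    and g: "has_gradient_AE u g" and h: "has_gradient_AE v h"
    and f: "\<And>x. x \<in> W \<Longrightarrow> f x $ 1 = u x \<and> f x $ 2 = v x"
  shows "L2_weak_derivative W f (\<lambda>x. vector [g x, h x])"
    "square_integrable_on W f" "f \<in> W12 W"
    "W12_norm W f = sqrt ((LINT x|lborel. indicator W x * ((u x)\<^sup>2 + (v x)\<^sup>2))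
      + (LINT x|lborel. indicator W x * ((norm (g x))\<^sup>2 + (norm (h x))\<^sup>2)))"
proof -
  have Wl: "W \<in> sets lebesgue" and Wb [measurable]: "W \<in> sets borel" using W by auto
  have neg: "negligible (W - W)" by simp
  have gl: "loc_bdd_borel g" "loc_bdd_borel h" using g h by (auto intro: has_gradient_AE_loc_bdd)
  have ul: "loc_bdd_borel u" "loc_bdd_borel v" using u v by (auto intro: loc_bdd_borel_lipschitz)
  have [measurable]: "g \<in> borel_measurable borel" "h \<in> borel_measurable borel"
    "u \<in> borel_measurable borel" "v \<in> borel_measurable borel"
    using gl ul loc_bdd_borel_measurable by blast+
  let ?G = "\<lambda>x. vector [g x, h x] :: real^2^2"
  note onW = lebesgue_on_AE_eq_borel[OF Wl Wb order_refl neg]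
  have nG: "(norm (?G x))\<^sup>2 = (norm (g x))\<^sup>2 + (norm (h x))\<^sup>2" for x by (simp add: norm_matrix2_sq)
  have Gm: "?G \<in> borel_measurable borel" by (rule borel_measurable_vector_2) auto
  have sqG: "square_integrable_on W ?G"
    unfolding square_integrable_on_def
  proof
    show "?G \<in> borel_measurable (lebesgue_on W)" by (rule onW(1)[OF Gm]) auto
    have "integrable lborel (\<lambda>x. indicator W x *\<^sub>R ((norm (g x))\<^sup>2 + (norm (h x))\<^sup>2))"
      by (rule loc_bdd_borel_integrable_on_bounded[OF _ Wb W(2)]) (intro loc_bdd_borel_intros gl)
    then show "integrable (lebesgue_on W) (\<lambda>x. (norm (?G x))\<^sup>2)"
      unfolding nG by (subst onW(2)[of "\<lambda>x. (norm (g x))\<^sup>2 + (norm (h x))\<^sup>2"]) auto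
  qed
  have fn: "(norm (f x))\<^sup>2 = (u x)\<^sup>2 + (v x)\<^sup>2" if "x \<in> W" for x using f[OF that]
    by (simp add: norm_vec2_sq)
  have fae: "AE x in lborel. x \<in> W \<longrightarrow> (norm (f x))\<^sup>2 = (u x)\<^sup>2 + (v x)\<^sup>2" using fn by simp
  show sqf: "square_integrable_on W f"
    unfolding square_integrable_on_def
  proof
    have "(\<lambda>x. vector [u x, v x] :: real^2) \<in> borel_measurable borel"
      by (rule borel_measurable_vector_2) auto
    moreover have "f x = vector [u x, v x]" if "x \<in> W" for x using f[OF that]
      by (simp add: vec_eq_iff forall_2)
    ultimately show "f \<in> borel_measurable (lebesgue_on W)" by (intro onW(1)) auto
    have "integrable lborel (\<lambda>x. indicator W x *\<^sub>R ((u x)\<^sup>2 + (v x)\<^sup>2))"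
      by (rule loc_bdd_borel_integrable_on_bounded[OF _ Wb W(2)]) (intro loc_bdd_borel_intros ul)
    then show "integrable (lebesgue_on W) (\<lambda>x. (norm (f x))\<^sup>2)"
      by (subst onW(2)[OF _ fae]) auto
  qed
  show wd: "L2_weak_derivative W f ?G"
    unfolding L2_weak_derivative_def
  proof (intro conjI sqG allI impI)
    fix \<eta> :: "real^2 \<Rightarrow> real" and i j :: 2 assume t: "test_function W \<eta>"
    have C1: "Ck_on_open 1 UNIV \<eta>" using t unfolding test_function_def
      by (blast intro: smooth_on_UNIV_C1)
    define S where "S = closure {x. \<eta> x \<noteq> 0}"
    have S: "compact S" "S \<subseteq> W" using t by (auto simp: test_function_def S_def)
    have bd: "bounded {x. \<eta> x \<noteq> 0}" using S(1)
      by (metis S_def bounded_subset closure_subset compact_imp_bounded)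
    obtain B where B: "B-lipschitz_on UNIV \<eta>" using C1_compact_support_lipschitz[OF C1 bd] by blast
    have d: "(\<eta> has_derivative frechet_derivative \<eta> (at x)) (at x)" for x
      using C1 by (simp add: frechet_derivative_works[symmetric])
    let ?D = "\<lambda>x. frechet_derivative \<eta> (at x) (axis j 1)"
    have Dm [measurable]: "?D \<in> borel_measurable borel" using C1
      by (intro borel_measurable_continuous_onI) simp
    have \<eta>m [measurable]: "\<eta> \<in> borel_measurable borel"
      using B loc_bdd_borel_lipschitz loc_bdd_borel_measurable by blast
    have dd: "has_dir_deriv_AE (axis j 1) \<eta> ?D"
      unfolding has_dir_deriv_AE_def using has_derivative_dir_deriv[OF d] by auto
    have \<eta>0: "\<eta> x = 0" "?D x = 0" if "x \<notin> W" for x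
    proof -
      have xS: "x \<in> - S" "open (- S)" using that S by (auto simp: compact_imp_closed)
      have z: "\<eta> y = 0" if "y \<in> - S" for y using that closure_subset[of "{x. \<eta> x \<noteq> 0}"]
        by (auto simp: S_def)
      show "\<eta> x = 0" using z xS by blast
      have "((\<lambda>x. 0::real) has_derivative (\<lambda>h. 0)) (at x)" by simp
      then have "(\<eta> has_derivative (\<lambda>h. 0)) (at x)"
        by (rule has_derivative_transform_within_open[OF _ xS(2,1)]) (use z in auto)
      then show "?D x = 0" using d has_derivative_unique by metis
    qed
    have ibp: "(LINT x|lebesgue_on W. f x $ i * ?D x)
      = - (LINT x|lebesgue_on W. ?G x $ i $ j * \<eta> x)"
      if c: "M-lipschitz_on UNIV w" "has_gradient_AE w q" "\<And>x. x \<in> W \<Longrightarrow> f x $ i = w x" "\<And>x. ?G x $ i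
        = q x" for M w q
    proof -
      have [measurable]: "w \<in> borel_measurable borel" "q \<in> borel_measurable borel"
        using c(1,2) loc_bdd_borel_lipschitz loc_bdd_borel_measurable has_gradient_AE_loc_bdd
          by blast+
      have "(LINT x|lebesgue_on W. f x $ i * ?D x)
        = (LINT x|lborel. indicator W x *\<^sub>R (w x * ?D x))"
        by (rule onW(3)) (use c(3) in auto)
      also have "\<dots> = (LINT x|lborel. w x * ?D x)"
        by (intro Bochner_Integration.integral_cong) (auto simp: indicator_def \<eta>0)
      also have "\<dots> = - (LINT x|lborel. q x $ j * \<eta> x)"
        using lipschitz_integration_by_parts(3)[OF c(1) B bd has_gradient_AE_dir_deriv[OF c(2)] dd]
        by (simp add: inner_axis)
      also have "(LINT x|lborel. q x $ j * \<eta> x)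
        = (LINT x|lborel. indicator W x *\<^sub>R (q x $ j * \<eta> x))"
        by (intro Bochner_Integration.integral_cong) (auto simp: indicator_def \<eta>0)
      also have "\<dots> = (LINT x|lebesgue_on W. ?G x $ i $ j * \<eta> x)"
        by (rule onW(3)[symmetric]) (use c(4) in auto)
      finally show ?thesis .
    qed
    have "i = 1 \<or> i = 2" using exhaust_2 by blast
    then show "(LINT x|lebesgue_on W. f x $ i * ?D x)
      = - (LINT x|lebesgue_on W. ?G x $ i $ j * \<eta> x)"
      using ibp[OF u g] ibp[OF v h] f by auto
  qed
  then show "f \<in> W12 W" using sqf by (auto simp: W12_def)
  \<comment> \<open>By uniqueness almost everywhere the derivative chosen inside
    \<open>W12_norm\<close> may be replaced by the classical gradient matrix.\<close>
  have some: "L2_weak_derivative W f (SOME G. L2_weak_derivative W f G)"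
    by (rule someI[of "L2_weak_derivative W f", OF wd])
  have "(LINT x|lebesgue_on W. (norm ((SOME G. L2_weak_derivative W f G) x))\<^sup>2)
    = (LINT x|lebesgue_on W. (norm (?G x))\<^sup>2)"
  proof (rule integral_cong_AE)
    show "AE x in lebesgue_on W. (norm ((SOME G. L2_weak_derivative W f G) x))\<^sup>2 = (norm (?G x))\<^sup>2"
      using L2_weak_derivative_unique[OF W some wd] by eventually_elim simp
  qed (use some wd in \<open>auto simp: L2_weak_derivative_def square_integrable_on_def\<close>)
  also have "\<dots> = (LINT x|lborel. indicator W x * ((norm (g x))\<^sup>2 + (norm (h x))\<^sup>2))"
    unfolding nG by (subst onW(3)[of "\<lambda>x. (norm (g x))\<^sup>2 + (norm (h x))\<^sup>2"]) auto
  finally have 1: "(LINT x|lebesgue_on W. (norm ((SOME G. L2_weak_derivative W f G) x))\<^sup>2)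
     = (LINT x|lborel. indicator W x * ((norm (g x))\<^sup>2 + (norm (h x))\<^sup>2))" .
  have 2: "(LINT x|lebesgue_on W. (norm (f x))\<^sup>2) = (LINT x|lborel. indicator W x * ((u x)\<^sup>2
    + (v x)\<^sup>2))"
    by (subst onW(3)[OF _ fae]) auto
  show "W12_norm W f = sqrt ((LINT x|lborel. indicator W x * ((u x)\<^sup>2 + (v x)\<^sup>2))
    + (LINT x|lborel. indicator W x * ((norm (g x))\<^sup>2 + (norm (h x))\<^sup>2)))"
    unfolding W12_norm_def Let_def 1 2 ..
qed

subsection \<open>Limits of minimizing sequences\<close>

lemma has_derivative_vector_2:
  fixes u v :: "real^2 \<Rightarrow> real"
  assumes "(u has_derivative (\<lambda>h. g \<bullet> h)) (at x)" "(v has_derivative (\<lambda>h. k \<bullet> h)) (at x)"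
  shows "((\<lambda>y. vector [u y, v y] :: real^2) has_derivative (*v) (vector [g, k])) (at x)"
proof -
  have eq: "(vector [a, b] :: real^2) = a *\<^sub>R axis 1 1 + b *\<^sub>R axis 2 1" for a b
    by (simp add: vec_eq_iff forall_2 axis_def)
  have mv: "(vector [g, k] :: real^2^2) *v h = (g \<bullet> h) *\<^sub>R axis 1 1 + (k \<bullet> h) *\<^sub>R axis 2 1" for h
    by (simp add: vec_eq_iff forall_2 axis_def matrix_vector_mult_def inner_vec_def)
  show ?thesis unfolding eq mv[abs_def] by (intro derivative_intros assms)
qed

lemma differential_at_interior:
  assumes "x \<in> interior M" "(f has_derivative f') (at x)"
  shows "differential M f x = matrix f'"
proof -
  have "frechet_derivative f (at x) = f'" by (rule frechet_derivative_at[OF assms(2), symmetric])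
  then show ?thesis unfolding differential_def at_within_interior[OF assms(1)] by (rule arg_cong)
qed

text \<open>The estimates concern functions that are Lipschitz on the whole plane, hence the
  componentwise extension. On the open set \<open>U\<close> extension and map agree near each point,
  so they share derivatives there, and \<open>differential\<close> within \<open>M\<close> is the
  full one.\<close>

lemma lipschitz_representation:
  assumes U: "open U" and UM: "U \<subseteq> M" and f: "L-lipschitz_on M f"
  shows "\<exists>u v g h. L-lipschitz_on UNIV u \<and> L-lipschitz_on UNIV v \<and> has_gradient_AE u g
    \<and> has_gradient_AE v h \<and>
    (\<forall>x\<in>M. f x $ 1 = u x \<and> f x $ 2 = v x) \<and>
    (AE x in lborel. x \<in> U \<longrightarrow> (f has_derivative (*v) (vector [g x, h x])) (at x)) \<and>
    (AE x in lborel. x \<in> U \<longrightarrow> differential M f x = vector [g x, h x])"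
proof -
  have "L-lipschitz_on M (\<lambda>x. f x $ i)" for i
  proof (rule lipschitz_onI[OF _ lipschitz_on_nonneg[OF f]])
    fix x y assume "x \<in> M" "y \<in> M"
    then show "dist (f x $ i) (f y $ i) \<le> L * dist x y"
      using dist_vec_nth_le[of "f x" i "f y"] lipschitz_onD[OF f, of x y] by linarith
  qed
  note ext = lipschitz_real_extension[OF this]
  obtain u where u: "L-lipschitz_on UNIV u" "\<forall>x\<in>M. u x = f x $ 1" using ext[of 1] by blast
  obtain v where v: "L-lipschitz_on UNIV v" "\<forall>x\<in>M. v x = f x $ 2" using ext[of 2] by blast
  obtain g h where g: "has_gradient_AE u g" and h: "has_gradient_AE v h"
    using lipschitz_has_gradient_AE u(1) v(1) by blast
  have fe: "vector [u x, v x] = f x" if "x \<in> U" for x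
    using u(2) v(2) UM that by (simp add: vec_eq_iff forall_2 subset_iff)
  have der: "AE x in lborel. x \<in> U \<longrightarrow> (f has_derivative (*v) (vector [g x, h x])) (at x)"
    using g[unfolded has_gradient_AE_def, THEN conjunct2, THEN conjunct2]
      h[unfolded has_gradient_AE_def, THEN conjunct2, THEN conjunct2]
  proof eventually_elim
    case (elim x)
    show ?case
    proof
      assume "x \<in> U"
      then show "(f has_derivative (*v) (vector [g x, h x])) (at x)"
        by (intro has_derivative_transform_within_open[OF has_derivative_vector_2[OF elim] U])
          (use fe in auto)
    qed
  qed
  moreover have "AE x in lborel. x \<in> U \<longrightarrow> differential M f x = vector [g x, h x]"
    using der
  proof eventually_elim
    case (elim x)
    have "U \<subseteq> interior M" using U UM by (rule interior_maximal[rotated])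
    then show ?case using elim differential_at_interior[of x M f]
      by (auto simp: matrix_of_matrix_vector_mul)
  qed
  ultimately show ?thesis using u v g h
    by (intro exI[of _ u] exI[of _ v] exI[of _ g] exI[of _ h]) auto
qed

lemma sq_norm_tendsto_0_iff:
  fixes f :: "nat \<Rightarrow> 'a::euclidean_space \<Rightarrow> 'b::euclidean_space"
  assumes f: "\<And>n. loc_bdd_borel (f n)" and S: "S \<in> sets borel" "bounded S"
  shows "(\<lambda>n. sq_norm_on S (f n)) \<longlonglongrightarrow> 0 \<longleftrightarrow> (\<lambda>n. LINT x|lborel. indicator S x *\<^sub>R (norm (f n x))\<^sup>2) \<longlonglongrightarrow> 0"
proof -
  have "0 \<le> (LINT x|lborel. indicator S x *\<^sub>R (norm (f n x))\<^sup>2)" for n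
    by (rule Bochner_Integration.integral_nonneg) auto
  then show ?thesis unfolding sq_norm_on_eq_integral[OF f S] ennreal_0[symmetric]
    by (intro tendsto_ennreal_iff) auto
qed

text \<open>Integrate the pointwise lower bound. The slope \<open>2 - 2 / c\<close> is nonpositive
  for \<open>c \<le> 1\<close>, so the bound of the Jacobian integral by \<open>area N\<close> makes
  the tangent-line part at least \<open>2 * (c - 1)\<^sup>2 * area M\<close>, and only the excess is
  left.\<close>

lemma energy_deficit_bound:
  fixes f :: "real^2 \<Rightarrow> real^2" and u v :: "real^2 \<Rightarrow> real"
  assumes U: "open U" "bounded U" "U \<subseteq> M" and M: "M \<in> sets lebesgue" and neg: "negligible (M - U)"
    and N: "N \<in> lmeasurable" and fN: "f ` M \<subseteq> N"
    and inj: "AE q in lebesgue_on N. \<exists>\<^sub>\<le>\<^sub>1x. x \<in> M \<and> f x = q"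
    and gh: "has_gradient_AE u g" "has_gradient_AE v h"
    and der: "AE x in lborel. x \<in> U \<longrightarrow> (f has_derivative (*v) (vector [g x, h x])) (at x)"
    and dif: "AE x in lborel. x \<in> U \<longrightarrow> differential M f x = vector [g x, h x]"
    and c: "0 < c" "c \<le> 1" and aM: "0 < area M" and area: "area N = c\<^sup>2 * area M"
  shows "(4 - 2 / c) * (LINT x|lborel. indicator U x *\<^sub>R (norm (dzbar (g x) (h x)))\<^sup>2)
    + 2 / c * (LINT x|lborel. indicator U x *\<^sub>R (norm (norm (dz (g x) (h x)) - c))\<^sup>2)
    \<le> area M * (E2 M f - 2 * (c - 1)\<^sup>2)"
proof -
  have Ub [measurable]: "U \<in> sets borel" using U by simp
  have gl: "loc_bdd_borel g" "loc_bdd_borel h" using gh by (auto intro: has_gradient_AE_loc_bdd)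
  have [measurable]: "g \<in> borel_measurable borel" "h \<in> borel_measurable borel"
    using gl loc_bdd_borel_measurable by blast+
  let ?G = "\<lambda>x. vector [g x, h x] :: real^2^2"
  let ?I = "\<lambda>x. (infdist (?G x) {A. rotation_matrix A})\<^sup>2"
  have Gm: "?G \<in> borel_measurable borel" by (rule borel_measurable_vector_2) auto
  have Im: "?I \<in> borel_measurable borel"
  proof -
    have "continuous_on UNIV (\<lambda>A::real^2^2. (infdist A {A. rotation_matrix A})\<^sup>2)"
      by (intro continuous_intros)
    then show ?thesis using Gm by (rule measurable_compose[OF _ borel_measurable_continuous_onI,
      rotated])
  qed
  have det: "det (?G x) = g x $ 1 * h x $ 2 - g x $ 2 * h x $ 1" for x by (simp add: det_2)
  have lm: "loc_bdd_borel (\<lambda>x. det (?G x))" unfolding det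
    by (intro loc_bdd_borel_intros loc_bdd_borel_vec_nth gl)
  have mU: "measure lborel U = area M"
  proof -
    have "U \<in> lmeasurable" using U by (intro lmeasurable_open) auto
    moreover have "U - M = {}" using U by auto
    ultimately have "area M = measure lebesgue U" using neg
      by (intro measure_negligible_symdiff) auto
    then show ?thesis by simp
  qed
  have IB: "\<exists>B. \<forall>x. norm (?I x) \<le> B"
  proof -
    obtain A B where AB: "\<And>x. norm (g x) \<le> A" "\<And>x. norm (h x) \<le> B" using gh
      unfolding has_gradient_AE_def by metis
    have "infdist (?G x) {A. rotation_matrix A} \<le> A + B + norm (mat 1 :: real^2^2)" for x
    proof -
      have "rotation_matrix (mat 1 :: real^2^2)"
        by (simp add: rotation_matrix_def orthogonal_matrix_id)
      then have "infdist (?G x) {A. rotation_matrix A} \<le> dist (?G x) (mat 1)"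
        by (intro infdist_le) auto
      also have "\<dots> \<le> norm (?G x) + norm (mat 1 :: real^2^2)"
        by (simp add: dist_norm norm_triangle_ineq4)
      also have "norm (?G x) \<le> norm (g x) + norm (h x)"
        by (rule power2_le_imp_le) (auto simp: norm_matrix2_sq power2_sum)
      finally show ?thesis using AB[of x] by linarith
    qed
    then have "norm (?I x) \<le> (A + B + norm (mat 1 :: real^2^2))\<^sup>2" for x
      using infdist_nonneg by (auto intro!: power_mono)
    then show ?thesis by blast
  qed
  have Ii: "integrable lborel (\<lambda>x. indicator U x *\<^sub>R ?I x)"
  proof -
    obtain B where "\<And>x. norm (?I x) \<le> B" using IB by blast
    from loc_bdd_borel_integrable_on_bounded[OF loc_bdd_borel_bounded[OF Im this] Ub U(2)] show
      ?thesis .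
  qed
  have E: "area M * E2 M f = (LINT x|lborel. indicator U x *\<^sub>R ?I x)"
  proof -
    have "(LINT x|lebesgue_on M. (infdist (differential M f x) {A. rotation_matrix A})\<^sup>2)
      = (LINT x|lborel. indicator U x *\<^sub>R ?I x)"
      by (rule lebesgue_on_AE_eq_borel(3)[OF M Ub U(3) neg Im]) (use dif in \<open>eventually_elim, auto\<close>)
    then show ?thesis using aM by (simp add: E2_def)
  qed
  have dzl: "loc_bdd_borel (\<lambda>x. dz (g x) (h x))" "loc_bdd_borel (\<lambda>x. dzbar (g x) (h x))"
    by (rule loc_bdd_borel_dz[OF gl])+
  have i1: "integrable lborel (\<lambda>x. indicator U x *\<^sub>R det (?G x))"
    by (rule loc_bdd_borel_integrable_on_bounded[OF lm Ub U(2)])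
  have i2: "integrable lborel (\<lambda>x. indicator U x *\<^sub>R (norm (dzbar (g x) (h x)))\<^sup>2)"
    by (rule loc_bdd_borel_integrable_on_bounded[OF _ Ub U(2)]) (intro loc_bdd_borel_intros dzl)
  have i3: "integrable lborel (\<lambda>x. indicator U x *\<^sub>R (norm (norm (dz (g x) (h x)) - c))\<^sup>2)"
    by (rule loc_bdd_borel_integrable_on_bounded[OF _ Ub U(2)]) (intro loc_bdd_borel_intros dzl)
  have i0: "integrable lborel (\<lambda>x. indicator U x *\<^sub>R (1::real))"
    by (rule loc_bdd_borel_integrable_on_bounded[OF loc_bdd_borel_const Ub U(2)])
  let ?J = "LINT x|lborel. indicator U x *\<^sub>R det (?G x)"
  let ?l = "LINT x|lborel. indicator U x *\<^sub>R (norm (dzbar (g x) (h x)))\<^sup>2"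
  let ?r = "LINT x|lborel. indicator U x *\<^sub>R (norm (norm (dz (g x) (h x)) - c))\<^sup>2"
  \<comment> \<open>The value of the tangent line at Jacobian 0.\<close>
  define k where "k = 2 * (c - 1)\<^sup>2 - (2 - 2 / c) * c\<^sup>2"
  have one: "(LINT x|lborel. indicator U x *\<^sub>R (1::real)) = area M" using mU by simp
  have "k * area M + (2 - 2 / c) * ?J + (4 - 2 / c) * ?l + 2 / c * ?r
     = (LINT x|lborel. k * (indicator U x *\<^sub>R 1) + (2 - 2 / c) * (indicator U x *\<^sub>R det (?G x))
       + (4 - 2 / c) * (indicator U x *\<^sub>R (norm (dzbar (g x) (h x)))\<^sup>2) + 2 / c * (indicator U x *\<^sub>R
         (norm (norm (dz (g x) (h x)) - c))\<^sup>2))"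
    using i0 i1 i2 i3 one
    by (simp only: Bochner_Integration.integral_add Bochner_Integration.integrable_add
      integrable_mult_right integral_mult_right_zero)
  also have "\<dots> \<le> (LINT x|lborel. indicator U x *\<^sub>R ?I x)"
  proof (rule integral_mono)
    show "integrable lborel (\<lambda>x. k * (indicator U x *\<^sub>R 1) + (2
      - 2 / c) * (indicator U x *\<^sub>R det (?G x))
       + (4 - 2 / c) * (indicator U x *\<^sub>R (norm (dzbar (g x) (h x)))\<^sup>2) + 2 / c * (indicator U x *\<^sub>R
         (norm (norm (dz (g x) (h x)) - c))\<^sup>2))"
      by (intro Bochner_Integration.integrable_add integrable_mult_right i0 i1 i2 i3)
    fix x
    have "k + (2 - 2 / c) * det (?G x) + (4 - 2 / c) * (norm (dzbar (g x) (h x)))\<^sup>2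
      + 2 / c * (norm (norm (dz (g x) (h x)) - c))\<^sup>2 \<le> ?I x"
      using energy_density_lower_bound[OF c(1), of "?G x"] by (simp add: k_def algebra_simps)
    then show "k * (indicator U x *\<^sub>R 1) + (2 - 2 / c) * (indicator U x *\<^sub>R det (?G x))
       + (4 - 2 / c) * (indicator U x *\<^sub>R (norm (dzbar (g x) (h x)))\<^sup>2) + 2 / c * (indicator U x *\<^sub>R
         (norm (norm (dz (g x) (h x)) - c))\<^sup>2)
       \<le> indicator U x *\<^sub>R ?I x"
      by (cases "x \<in> U") auto
  qed (rule Ii)
  finally have main: "k * area M + (2 - 2 / c) * ?J + (4 - 2 / c) * ?l + 2 / c * ?r
    \<le> area M * E2 M f" using E by simp
  have J: "?J \<le> area N"
  proof -
    obtain B where B: "\<And>x. \<bar>det (?G x)\<bar> \<le> B"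
    proof -
      obtain A B where AB: "\<And>x. norm (g x) \<le> A" "\<And>x. norm (h x) \<le> B" using gh
        unfolding has_gradient_AE_def by metis
      have "\<bar>det (?G x)\<bar> \<le> A * B + A * B" for x
      proof -
        have c: "\<bar>g x $ i\<bar> \<le> A" "\<bar>h x $ i\<bar> \<le> B" for i
          using component_le_norm_cart[of "g x" i] component_le_norm_cart[of "h x" i] AB[of x]
            by linarith+
        have "\<bar>g x $ i * h x $ j\<bar> \<le> A * B" for i j
          unfolding abs_mult using c[of i] c[of j]
            by (intro mult_mono) (auto intro: order_trans[OF abs_ge_zero])
        then show ?thesis unfolding det using abs_triangle_ineq4 order_trans add_mono by meson
      qed
      then show ?thesis using that by blast
    qed
    have "?J \<le> (LINT x|lborel. indicator U x * \<bar>det (?G x)\<bar>)"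
      using loc_bdd_borel_integrable_on_bounded[OF loc_bdd_borel_norm[OF lm] Ub U(2)]
      by (intro integral_mono i1) (auto simp: indicator_def)
    also have "\<dots> \<le> area N"
      by (rule integral_jacobian_le_area[OF U N _ inj Gm B loc_bdd_borel_measurable[OF lm] der])
        (use fN U in auto)
    finally show ?thesis .
  qed
  have "2 - 2 / c \<le> 0" using c by (simp add: field_simps)
  then have "(2 - 2 / c) * ?J \<ge> (2 - 2 / c) * area N" using J by (rule mult_left_mono_neg[rotated])
  then have "(2 - 2 / c) * c\<^sup>2 * area M \<le> (2 - 2 / c) * ?J" unfolding area by (simp add: mult.assoc)
  then have "2 * (c - 1)\<^sup>2 * area M \<le> k * area M + (2 - 2 / c) * ?J"
    by (simp add: k_def left_diff_distrib)
  with main show ?thesis by (simp add: algebra_simps)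
qed

section \<open>Affine similarities of the plane\<close>

lemma Ck_on_open_affine:
  fixes A :: "real^2^2"
  shows "Ck_on_open k UNIV (\<lambda>x. A *v x + b)"
proof (cases k)
  case 0
  then show ?thesis by (auto intro!: continuous_intros)
next
  case (Suc j)
  have d: "((\<lambda>x. A *v x + b) has_derivative (*v) A) (at x)" for x
    by (intro has_derivative_add_const bounded_linear_imp_has_derivative
      matrix_vector_mul_bounded_linear)
  have "frechet_derivative (\<lambda>x. A *v x + b) (at x) = (*v) A" for x
    using frechet_derivative_at[OF d] by simp
  then show ?thesis using Suc d by (auto simp: differentiable_def Ck_on_open_const)
qed

text \<open>\<open>dzbar p q = 0\<close> is the pair of Cauchy-Riemann equations and
  \<open>norm (dz p q) = c\<close> fixes the ratio: the matrix with rows \<open>p\<close> and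
  \<open>q\<close> is \<open>c\<close> times a rotation.\<close>

locale conformal_affine =
  fixes p q :: "real^2" and c :: real
  assumes c: "0 < c" and nc: "norm (dz p q) = c" and ac: "dzbar p q = 0"
begin

definition A :: "real^2^2" where "A = vector [p, q]"

lemma conformal_entries: "p $ 1 = q $ 2" "p $ 2 = - q $ 1" "(q $ 1)\<^sup>2 + (q $ 2)\<^sup>2 = c\<^sup>2"
proof -
  show 1: "p $ 1 = q $ 2" "p $ 2 = - q $ 1" using ac by (auto simp: dzbar_def complex_eq_iff)
  have "(norm (dz p q))\<^sup>2 = c\<^sup>2" using nc by simp
  then show "(q $ 1)\<^sup>2 + (q $ 2)\<^sup>2 = c\<^sup>2" unfolding norm_dz_sq 1 by (simp add: add.commute)
qed

lemma A_mult: "A *v x = vector [p \<bullet> x, q \<bullet> x]"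
  by (simp add: A_def vec_eq_iff forall_2 matrix_vector_mult_def inner_vec_def)

lemma inner_A: "(A *v v) \<bullet> (A *v w) = c\<^sup>2 * (v \<bullet> w)"
  unfolding A_mult conformal_entries(3)[symmetric]
  by (simp add: inner_vec_def sum_2 conformal_entries(1,2) power2_eq_square algebra_simps)

lemma det_A: "det A = c\<^sup>2"
  using conformal_entries by (simp add: A_def det_2 power2_eq_square)

lemma norm_A: "norm (A *v x) = c * norm x"
proof -
  have "(norm (A *v x))\<^sup>2 = (c * norm x)\<^sup>2"
    by (simp add: power2_norm_eq_inner inner_A power_mult_distrib)
  then show ?thesis using c by (simp add: power2_eq_iff_nonneg)
qed

lemma inj_A: "inj (\<lambda>x. A *v x + b)"
proof (rule injI)
  fix x y assume "A *v x + b = A *v y + b"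
  then have "norm (A *v (x - y)) = 0" by (simp add: matrix_vector_mult_diff_distrib)
  then show "x = y" using c by (simp add: norm_A)
qed

lemma affine_has_derivative: "((\<lambda>x. A *v x + b) has_derivative (*v) A) (at x within S)"
  by (intro has_derivative_add_const bounded_linear_imp_has_derivative
    matrix_vector_mul_bounded_linear)

lemma affine_differential:
  assumes "lipschitz_domain U" "x \<in> closure U"
  shows "differential (closure U) (\<lambda>x. A *v x + b) x = A"
proof -
  let ?f = "\<lambda>x. A *v x + b"
  have "?f differentiable (at x within closure U)" using affine_has_derivative differentiable_def
    by blast
  then have "(?f has_derivative frechet_derivative ?f (at x within closure U)) (at x within closure
    U)"
    by (simp add: frechet_derivative_works)
  from lipschitz_domain_derivative_unique[OF assms this affine_has_derivative]
  show ?thesis by (simp add: differential_def matrix_of_matrix_vector_mul)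
qed

lemma affine_lipschitz: "c-lipschitz_on S (\<lambda>x. A *v x + b)"
proof (rule lipschitz_onI)
  fix x y
  have "A *v x + b - (A *v y + b) = A *v (x - y)" by (simp add: matrix_vector_mult_diff_distrib)
  then show "dist (A *v x + b) (A *v y + b) \<le> c * dist x y" by (simp add: dist_norm norm_A)
qed (use c in simp)

lemma area_affine_image:
  assumes "S \<in> lmeasurable"
  shows "area ((\<lambda>x. A *v x + b) ` S) = c\<^sup>2 * area S"
proof -
  have i: "(\<lambda>x. \<bar>det (matrix ((*v) A))\<bar>) integrable_on S"
    using assms by (simp add: integrable_on_const matrix_of_matrix_vector_mul)
  have "area ((\<lambda>x. A *v x + b) ` S) = integral S (\<lambda>x. \<bar>det (matrix ((*v) A))\<bar>)"
    by (rule measure_differentiable_image_eq[OF fmeasurableD[OF assms] affine_has_derivative _ i])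
      (use inj_A inj_on_subset in blast)
  also have "\<dots> = integral S (\<lambda>x. c\<^sup>2 * 1)" by (simp add: matrix_of_matrix_vector_mul det_A)
  also have "\<dots> = c\<^sup>2 * integral S (\<lambda>x. 1)"
    by (rule Henstock_Kurzweil_Integration.integral_mult_right)
  also have "\<dots> = c\<^sup>2 * area S" using assms by (simp add: lmeasure_integral)
  finally show ?thesis .
qed

lemma open_affine_image: "open S \<Longrightarrow> open ((\<lambda>x. A *v x + b) ` S)"
proof -
  assume S: "open S"
  have "surj ((*v) A)"
  proof -
    have "inj ((*v) A)" using inj_A[of 0] by simp
    then show ?thesis by (simp add: linear_injective_imp_surjective)
  qed
  then have "open ((*v) A ` S)" using S by (intro open_surjective_linear_image) auto
  then have "open ((+) b ` ((*v) A ` S))" by (rule open_translation)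
  then show ?thesis by (simp add: image_image add.commute)
qed

lemma affine_diffeomorphism:
  assumes "(\<lambda>x. A *v x + b) ` S = T"
  shows "diffeomorphism_betw (\<lambda>x. A *v x + b) S T"
proof -
  \<comment> \<open>The transpose divided by \<open>c\<^sup>2\<close> inverts \<open>A\<close>,
    since \<open>A\<close> scales inner products by \<open>c\<^sup>2\<close>; an explicit affine
    inverse is smooth on any set \<open>T\<close>.\<close>
  let ?f = "\<lambda>x. A *v x + b" and ?B = "(1 / c\<^sup>2) *\<^sub>R transpose A"
  have BA: "?B *v (A *v x) = x" for x
  proof -
    have "y \<bullet> (?B *v (A *v x)) = y \<bullet> x" for y
    proof -
      have "y \<bullet> (transpose A *v (A *v x)) = (A *v y) \<bullet> (A *v x)"
        by (simp only: dot_lmul_matrix[symmetric] vector_transpose_matrix)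
      then show ?thesis using c by (simp add: inner_A scaleR_matrix_vector_assoc[symmetric])
    qed
    then show ?thesis by (metis vector_eq_rdot inner_commute)
  qed
  have inj: "inj_on ?f S" using inj_A inj_on_subset by blast
  have "inv_into S ?f y = ?B *v y + ?B *v (- b)" if y: "y \<in> T" for y
  proof -
    obtain x where x: "x \<in> S" "y = ?f x" using y assms by blast
    have "?B *v y + ?B *v (- b) = ?B *v (y + (- b))" by (simp only: matrix_vector_right_distrib)
    then have "?B *v y + ?B *v (- b) = x" using BA x(2) by simp
    then show ?thesis using inv_into_f_f[OF inj x(1)] x(2) by simp
  qed
  then have "smooth_on T (inv_into S ?f)"
    unfolding smooth_on_def
    by (intro ballI exI[of _ UNIV] exI[of _ "\<lambda>y. ?B *v y
      + ?B *v (- b)"]) (auto simp: Ck_on_open_affine)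
  then show ?thesis unfolding diffeomorphism_betw_def bij_betw_def
    using inj assms by (auto intro!: Ck_on_open_imp_smooth_on_UNIV Ck_on_open_affine)
qed

end

lemma affine_lipschitz_UNIV: "(norm p)-lipschitz_on UNIV (\<lambda>x::'a::euclidean_space. p \<bullet> x + b)"
  using inner_lipschitz[of p] by (simp add: lipschitz_on_def)

lemma affine_has_gradient_AE: "has_gradient_AE (\<lambda>x::'a::euclidean_space. p \<bullet> x + b) (\<lambda>x. p)"
  unfolding has_gradient_AE_def by (auto intro!: derivative_eq_intros)

text \<open>Sobolev norms are taken over the interior of \<open>M\<close>, while convergence is
  proved on \<open>U\<close>; the former set contains the latter and the difference is null.\<close>

lemma sq_norm_on_cong_negligible:
  assumes U: "U \<subseteq> W" "negligible (W - U)"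
  shows "sq_norm_on W f = sq_norm_on U f"
proof -
  have "AE x in lebesgue. x \<notin> W - U"
    by (rule AE_not_in) (use U(2) in \<open>simp add: negligible_iff_null_sets\<close>)
  then have "AE x in lborel. x \<notin> W - U" by (simp only: AE_completion_iff)
  then have "AE x in lborel. ennreal ((norm (f x))\<^sup>2) * indicator W x
    = ennreal ((norm (f x))\<^sup>2) * indicator U x"
    by eventually_elim (use U(1) in \<open>auto simp: indicator_def\<close>)
  then show ?thesis unfolding sq_norm_on_def by (rule nn_integral_cong_AE)
qed

lemma integral_sum_sq_tendsto_0:
  fixes f :: "nat \<Rightarrow> 'a::euclidean_space \<Rightarrow> 'b::euclidean_space" and g :: "nat \<Rightarrow> 'a \<Rightarrow> 'b"
  assumes f: "\<And>n. loc_bdd_borel (f n)" and g: "\<And>n. loc_bdd_borel (g n)"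
    and S: "S \<in> sets borel" "bounded S"
    and lim: "(\<lambda>n. sq_norm_on S (f n)) \<longlonglongrightarrow> 0" "(\<lambda>n. sq_norm_on S (g n)) \<longlonglongrightarrow> 0"
  shows "(\<lambda>n. LINT x|lborel. indicator S x * ((norm (f n x))\<^sup>2 + (norm (g n x))\<^sup>2)) \<longlonglongrightarrow> 0"
proof -
  have i: "integrable lborel (\<lambda>x. indicator S x *\<^sub>R (norm (k x))\<^sup>2)" if "loc_bdd_borel k"
    for k :: "'a \<Rightarrow> 'b"
    by (rule loc_bdd_borel_integrable_on_bounded[OF _ S]) (intro loc_bdd_borel_intros that)
  have eq: "(LINT x|lborel. indicator S x * ((norm (f n x))\<^sup>2 + (norm (g n x))\<^sup>2))
    = (LINT x|lborel. indicator S x *\<^sub>R (norm (f n x))\<^sup>2) + (LINT x|lborel. indicator S x *\<^sub>R (norm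
      (g n x))\<^sup>2)" for n
    by (subst Bochner_Integration.integral_add[OF i[OF f] i[OF g], symmetric]) (simp
      add: distrib_left)
  show ?thesis unfolding eq
    using tendsto_add[OF lim(1)[unfolded sq_norm_tendsto_0_iff[of f, OF f S]] lim(2)[unfolded
      sq_norm_tendsto_0_iff[of g, OF g S]]] by simp
qed

text \<open>Joins the energy estimate to the rigidity theorem. That all values lie in the bounded
  set \<open>N\<close> supplies the uniform bound which keeps the translations from
  escaping.\<close>

lemma energy_minimizing_sequence_limit:
  fixes \<phi> :: "nat \<Rightarrow> real^2 \<Rightarrow> real^2"
  assumes U: "open U" "bounded U" "connected U" "U \<noteq> {}" and UM: "U \<subseteq> M" and M: "M \<in> sets lebesgue"
    and neg: "negligible (M - U)" and N: "N \<in> lmeasurable" "bounded N"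
    and c: "1 / 2 < c" "c \<le> 1" and aM: "0 < area M" and area: "area N = c\<^sup>2 * area M"
    and \<phi>: "\<And>n. \<phi> n \<in> Lip_plus_inj M N" and E: "(\<lambda>n. E2 M (\<phi> n)) \<longlonglongrightarrow> 2 * (c - 1)\<^sup>2"
  obtains s p q b1 b2 L u v g h where "strict_mono (s :: nat \<Rightarrow> nat)" "norm (dz p q) = c" "dzbar p q
    = 0"
    "\<And>n. (L n)-lipschitz_on UNIV (u n)" "\<And>n. (L n)-lipschitz_on UNIV (v n)"
    "\<And>n. has_gradient_AE (u n) (g n)" "\<And>n. has_gradient_AE (v n) (h n)"
    "\<And>n x. x \<in> M \<Longrightarrow> \<phi> n x $ 1 = u n x \<and> \<phi> n x $ 2 = v n x"
    "(\<lambda>n. sq_norm_on U (\<lambda>x. g (s n) x - p)) \<longlonglongrightarrow> 0" "(\<lambda>n. sq_norm_on U (\<lambda>x. h (s n) x - q)) \<longlonglongrightarrow> 0"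
    "(\<lambda>n. sq_norm_on U (\<lambda>x. u (s n) x - (p \<bullet> x + b1))) \<longlonglongrightarrow> 0"
    "(\<lambda>n. sq_norm_on U (\<lambda>x. v (s n) x - (q \<bullet> x + b2))) \<longlonglongrightarrow> 0"
proof -
  have Ub: "U \<in> sets borel" using U by simp
  have "\<forall>n. \<exists>L. L-lipschitz_on M (\<phi> n)" using \<phi> by (auto simp: Lip_plus_inj_def)
  then obtain L where L: "\<And>n. (L n)-lipschitz_on M (\<phi> n)" by metis
  have \<phi>N: "\<phi> n ` M \<subseteq> N" and inj: "AE q in lebesgue_on N. \<exists>\<^sub>\<le>\<^sub>1x. x \<in> M \<and> \<phi> n x = q" for n
    using \<phi>[of n] by (auto simp: Lip_plus_inj_def)
  define P where "P n u v g h \<longleftrightarrow> (L n)-lipschitz_on UNIV u \<and> (L n)-lipschitz_on UNIV v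
    \<and> has_gradient_AE u g \<and> has_gradient_AE v h \<and>
    (\<forall>x\<in>M. \<phi> n x $ 1 = u x \<and> \<phi> n x $ 2 = v x) \<and>
    (AE x in lborel. x \<in> U \<longrightarrow> (\<phi> n has_derivative (*v) (vector [g x, h x])) (at x)) \<and>
    (AE x in lborel. x \<in> U \<longrightarrow> differential M (\<phi> n) x = vector [g x, h x])" for n u v g h
  have "\<exists>u v g h. P n u v g h" for n unfolding P_def
    by (rule lipschitz_representation[OF U(1) UM L])
  then obtain u v g h where "P n (u n) (v n) (g n) (h n)" for n by metis
  then have uv: "\<And>n. (L n)-lipschitz_on UNIV (u n)" "\<And>n. (L n)-lipschitz_on UNIV (v n)"
    and gh: "\<And>n. has_gradient_AE (u n) (g n)" "\<And>n. has_gradient_AE (v n) (h n)"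
    and comp: "\<And>n x. x \<in> M \<Longrightarrow> \<phi> n x $ 1 = u n x \<and> \<phi> n x $ 2 = v n x"
    and der: "\<And>n. AE x in lborel. x \<in> U \<longrightarrow> (\<phi> n has_derivative (*v) (vector [g n x, h n x])) (at x)"
    and dif: "\<And>n. AE x in lborel. x \<in> U \<longrightarrow> differential M (\<phi> n) x = vector [g n x, h n x]"
    unfolding P_def by simp_all
  have c0: "0 < c" using c by simp
  define I where "I n = (LINT x|lborel. indicator U x *\<^sub>R (norm (dzbar (g n x) (h n x)))\<^sup>2)" for n
  define J where "J n = (LINT x|lborel. indicator U x *\<^sub>R (norm (norm (dz (g n x) (h n x)) - c))\<^sup>2)"
    for n
  define e where "e n = area M * (E2 M (\<phi> n) - 2 * (c - 1)\<^sup>2)" for n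
  have bound: "(4 - 2 / c) * I n + 2 / c * J n \<le> e n" for n
    unfolding I_def J_def e_def
    by (rule energy_deficit_bound[OF U(1,2) UM M neg N(1) \<phi>N inj gh der dif c0 c(2) aM area])
  have "e \<longlonglongrightarrow> area M * (2 * (c - 1)\<^sup>2 - 2 * (c - 1)\<^sup>2)" unfolding e_def by (intro tendsto_intros E)
  then have e0: "e \<longlonglongrightarrow> 0" by simp
  have nn: "0 \<le> I n" "0 \<le> J n" for n unfolding I_def J_def
    by (auto intro!: Bochner_Integration.integral_nonneg)
  \<comment> \<open>Here \<open>1 / 2 < c\<close> enters, as positivity of the coefficient of
    \<open>dzbar\<close>; then each of the two nonnegative excess integrals is controlled by the
    deficit.\<close>
  have k: "0 < 4 - 2 / c" "0 < 2 / c" using c by (auto simp: field_simps)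
  have Ie: "I n \<le> e n / (4 - 2 / c)" and Je: "J n \<le> e n / (2 / c)" for n
  proof -
    have "0 \<le> (4 - 2 / c) * I n" "0 \<le> 2 / c * J n" using k nn[of n]
      by (auto intro: mult_nonneg_nonneg)
    then have "I n * (4 - 2 / c) \<le> e n" "J n * (2 / c) \<le> e n" using bound[of n]
      by (auto simp: mult.commute)
    then show "I n \<le> e n / (4 - 2 / c)" "J n \<le> e n / (2 / c)" using k
      by (auto simp only: pos_le_divide_eq)
  qed
  have I0: "I \<longlonglongrightarrow> 0"
    by (rule tendsto_sandwich[OF always_eventually[OF allI[OF nn(1)]] always_eventually[OF allI[OF
      Ie]]
          tendsto_const tendsto_divide_zero[OF e0]])
  have J0: "J \<longlonglongrightarrow> 0"
    by (rule tendsto_sandwich[OF always_eventually[OF allI[OF nn(2)]] always_eventually[OF allI[OF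
      Je]]
          tendsto_const tendsto_divide_zero[OF e0]])
  have gl: "loc_bdd_borel (g n)" "loc_bdd_borel (h n)" for n using gh
    by (auto intro: has_gradient_AE_loc_bdd)
  have bl: "loc_bdd_borel (\<lambda>x. dzbar (g n x) (h n x))"
    and zl: "loc_bdd_borel (\<lambda>x. dz (g n x) (h n x))" for n
    by (rule loc_bdd_borel_dz[OF gl])+
  have zcl: "loc_bdd_borel (\<lambda>x. norm (dz (g n x) (h n x)) - c)" for n
    by (intro loc_bdd_borel_intros zl)
  have Q: "(\<lambda>n. sq_norm_on U (\<lambda>x. dzbar (g n x) (h n x))) \<longlonglongrightarrow> 0"
    using I0 unfolding I_def[abs_def] sq_norm_tendsto_0_iff[of
      "\<lambda>n x. dzbar (g n x) (h n x)", OF bl Ub U(2)] .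
  have Pc: "(\<lambda>n. sq_norm_on U (\<lambda>x. norm (dz (g n x) (h n x)) - c)) \<longlonglongrightarrow> 0"
    using J0 unfolding J_def[abs_def] sq_norm_tendsto_0_iff[of "\<lambda>n x. norm (dz (g n x) (h n x))
      - c", OF zcl Ub U(2)] .
  obtain B where B: "\<And>y. y \<in> N \<Longrightarrow> norm y \<le> B" using N(2) unfolding bounded_iff by blast
  have bdd: "\<bar>u n x\<bar> \<le> B" "\<bar>v n x\<bar> \<le> B" if x: "x \<in> U" for n x
  proof -
    have xM: "x \<in> M" using x UM by blast
    have "\<phi> n x \<in> N" using \<phi>N[of n] xM by blast
    then have "\<bar>\<phi> n x $ i\<bar> \<le> B" for i using component_le_norm_cart[of "\<phi> n x" i] B by force
    then show "\<bar>u n x\<bar> \<le> B" "\<bar>v n x\<bar> \<le> B" using comp[OF xM] by metis+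
  qed
  from asymptotic_conformal_rigidity[OF U(1,3,2,4) less_imp_le[OF c0] uv gh bdd Q Pc]
  show ?thesis using that[OF _ _ _ uv gh comp] by blast
qed

theorem theorem1p8:
  fixes U V M N :: "(real^2) set" and \<phi> :: "nat \<Rightarrow> real^2 \<Rightarrow> real^2"
  assumes "lipschitz_domain U" and "M = closure U"
    and "lipschitz_domain V" and "N = closure V"
    and "1 / 4 < area N / area M" and "area N / area M \<le> 1"
    and "\<And>n. \<phi> n \<in> Lip_plus_inj M N"
    and "(\<lambda>n. E2 M (\<phi> n)) \<longlonglongrightarrow> F (area N / area M)"
  shows "\<exists>r \<psi>. strict_mono (r :: nat \<Rightarrow> nat) \<and>
    converges_strongly_W12 M N (\<lambda>n. \<phi> (r n)) \<psi> \<and>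
    smooth_on (interior M) \<psi> \<and> \<psi> ` M = N \<and> homothety_on M \<psi> \<and>
    \<psi> \<in> Lip_plus_inj M N \<and>
    (\<forall>x\<in>M. jacobian_det M \<psi> x = area N / area M) \<and>
    inj_on \<psi> (interior M) \<and> \<psi> ` interior M \<subseteq> interior N \<and>
    ((\<forall>n. \<phi> n ` frontier M \<subseteq> frontier N) \<longrightarrow>
       inj_on \<psi> M \<and>
       (smooth_boundary U \<and> smooth_boundary V \<longrightarrow>
          smooth_on M \<psi> \<and> diffeomorphism_betw \<psi> M N \<and> homothety_on M \<psi>))"
proof -
  have U: "open U" "bounded U" "connected U" and V: "open V" "bounded V"
    using assms(1,3) by (auto simp: lipschitz_domain_def)
  have Ub: "U \<in> sets borel" using U by simp
  have Mc: "compact M" and Nc: "compact N" using U(2) V(2) assms(2,4) by auto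
  have Ml: "M \<in> lmeasurable" and Nl: "N \<in> lmeasurable" using Mc Nc
    by (auto intro: lmeasurable_compact)
  have UM: "U \<subseteq> M" and VN: "V \<subseteq> N" using assms(2,4) closure_subset by auto
  have "M - U = frontier U" using U(1) assms(2) by (simp add: frontier_def interior_open)
  then have neg: "negligible (M - U)" using lipschitz_domain_negligible_frontier[OF assms(1)]
    by simp
  have "area M \<noteq> 0" using assms(5) by auto
  then have aM: "0 < area M" using measure_nonneg[of lebesgue M] by linarith
  then have Une: "U \<noteq> {}" using assms(2) by auto
  define c where "c = sqrt (area N / area M)"
  have r: "c\<^sup>2 = area N / area M" using assms(5) by (simp add: c_def)
  have c12: "1 / 2 < c" "c \<le> 1"
  proof -
    show "1 / 2 < c" unfolding c_def
      by (rule real_less_rsqrt) (use assms(5) in \<open>simp add: power2_eq_square\<close>)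
    show "c \<le> 1" using assms(6) by (simp add: c_def)
  qed
  have area: "area N = c\<^sup>2 * area M" using aM by (simp add: r)
  have "F (area N / area M) = 2 * (c - 1)\<^sup>2" using assms(5) by (simp add: F_def c_def)
  then have E: "(\<lambda>n. E2 M (\<phi> n)) \<longlonglongrightarrow> 2 * (c - 1)\<^sup>2" using assms(8) by simp
  show ?thesis
  proof (rule energy_minimizing_sequence_limit[OF U Une UM fmeasurableD[OF Ml] neg Nl
    compact_imp_bounded[OF Nc] c12 aM area assms(7) E])
    fix s :: "nat \<Rightarrow> nat" and p q :: "real^2" and b1 b2 :: real and L :: "nat \<Rightarrow> real"
      and u v :: "nat \<Rightarrow> real^2 \<Rightarrow> real" and g h :: "nat \<Rightarrow> real^2 \<Rightarrow> real^2"
    assume s: "strict_mono s" and pq: "norm (dz p q) = c" "dzbar p q = 0"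
      and uv: "\<And>n. (L n)-lipschitz_on UNIV (u n)" "\<And>n. (L n)-lipschitz_on UNIV (v n)"
      and gh: "\<And>n. has_gradient_AE (u n) (g n)" "\<And>n. has_gradient_AE (v n) (h n)"
      and comp: "\<And>n x. x \<in> M \<Longrightarrow> \<phi> n x $ 1 = u n x \<and> \<phi> n x $ 2 = v n x"
      and lg: "(\<lambda>n. sq_norm_on U (\<lambda>x. g (s n) x - p)) \<longlonglongrightarrow> 0"
        and lh: "(\<lambda>n. sq_norm_on U (\<lambda>x. h (s n) x - q)) \<longlonglongrightarrow> 0"
      and lu: "(\<lambda>n. sq_norm_on U (\<lambda>x. u (s n) x - (p \<bullet> x + b1))) \<longlonglongrightarrow> 0"
      and lv: "(\<lambda>n. sq_norm_on U (\<lambda>x. v (s n) x - (q \<bullet> x + b2))) \<longlonglongrightarrow> 0"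
    interpret conformal_affine p q c using c12 pq by unfold_locales auto
    define b :: "real^2" where "b = vector [b1, b2]"
    define \<psi> where "\<psi> = (\<lambda>x. A *v x + b)"
    have \<psi>c: "\<psi> x $ 1 = p \<bullet> x + b1" "\<psi> x $ 2 = q \<bullet> x + b2" for x
      by (simp_all add: \<psi>_def b_def A_mult)
    have \<psi>L: "c-lipschitz_on S \<psi>" for S unfolding \<psi>_def by (rule affine_lipschitz)
    have \<psi>inj: "inj_on \<psi> S" for S unfolding \<psi>_def using inj_A inj_on_subset by blast
    have ul: "loc_bdd_borel (\<lambda>x. u n x - (p \<bullet> x + b1))"
      and vl: "loc_bdd_borel (\<lambda>x. v n x - (q \<bullet> x + b2))" for n
      using lipschitz_on_diff[OF uv(1) affine_lipschitz_UNIV] lipschitz_on_diff[OF uv(2)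
        affine_lipschitz_UNIV]
      by (blast intro: loc_bdd_borel_lipschitz)+
    have \<phi>N: "\<phi> n x \<in> N" if "x \<in> M" for n x using assms(7)[of n] that
      by (auto simp: Lip_plus_inj_def)
    \<comment> \<open>Convergence in \<open>L^2\<close> gives no pointwise information directly. If
      a ball of radius \<open>d\<close> around \<open>\<psi> x\<close> missed \<open>N\<close>,
      then, as \<open>c \<le> 1\<close>, \<open>\<psi>\<close> would stay within
      \<open>d / 2\<close> of \<open>\<psi> x\<close> on a ball of radius at most
      \<open>d / 2\<close>, and the maps would keep a positive \<open>L^2\<close> distance from
      \<open>\<psi>\<close> there.\<close>
    have UN: "\<psi> x \<in> N" if x: "x \<in> U" for x
    proof (rule ccontr)
      assume "\<psi> x \<notin> N"
      then obtain d where d: "0 < d" "ball (\<psi> x) d \<subseteq> - N"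
        using compact_imp_closed[OF Nc] openE[of "- N" "\<psi> x"] by blast
      obtain r0 where r0: "0 < r0" "ball x r0 \<subseteq> U" using U(1) x openE by blast
      define r where "r = min r0 (d / 2)"
      have r: "0 < r" "ball x r \<subseteq> U" "r \<le> d / 2" using d r0 by (auto simp: r_def)
      let ?u = "\<lambda>n y. u (s n) y - (p \<bullet> y + b1)" and ?v = "\<lambda>n y. v (s n) y - (q \<bullet> y + b2)"
      have low: "norm (d / 2) \<le> norm (\<bar>?u n y\<bar> + \<bar>?v n y\<bar>)" if y: "y \<in> ball x r" for n y
      proof -
        have yM: "y \<in> M" using y r(2) UM by blast
        have "\<phi> (s n) y \<notin> ball (\<psi> x) d" using \<phi>N[OF yM] d(2) by blast
        then have "d \<le> dist (\<psi> x) (\<phi> (s n) y)" by simp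
        also have "\<dots> \<le> dist (\<psi> x) (\<psi> y) + dist (\<psi> y) (\<phi> (s n) y)" by (rule dist_triangle)
        also have "dist (\<psi> x) (\<psi> y) \<le> d / 2"
        proof -
          have "dist (\<psi> x) (\<psi> y) \<le> c * dist x y" using lipschitz_onD[OF \<psi>L[of UNIV]] by blast
          also have "\<dots> \<le> 1 * dist x y" using c12 by (intro mult_right_mono) auto
          finally show ?thesis using y r(3) by simp
        qed
        also have "dist (\<psi> y) (\<phi> (s n) y) \<le> \<bar>?u n y\<bar> + \<bar>?v n y\<bar>"
          using norm_le_l1_cart[of "\<phi> (s n) y - \<psi> y"] comp[OF yM, of "s n"] \<psi>c[of y]
          by (simp add: sum_2 dist_norm norm_minus_commute)
        finally show ?thesis using d(1) by simp
      qed
      have um: "(\<lambda>y. \<bar>?u n y\<bar>) \<in> borel_measurable borel"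
        and vm: "(\<lambda>y. \<bar>?v n y\<bar>) \<in> borel_measurable borel" for n
        using ul[of "s n"] vl[of "s n"] by (auto dest!: loc_bdd_borel_measurable)
      have "(\<lambda>n. sq_norm_on (ball x r) (\<lambda>y. d / 2)) \<longlonglongrightarrow> 0"
      proof (rule ennreal_squeeze_0)
        show "(\<lambda>n. 2 * sq_norm_on U (?u n) + 2 * sq_norm_on U (?v n)) \<longlonglongrightarrow> 0"
          by (intro ennreal_add_tendsto_0 ennreal_cmult_tendsto_0 lu lv) auto
        fix n
        have "sq_norm_on (ball x r) (\<lambda>y. d / 2) \<le> sq_norm_on (ball x r) (\<lambda>y. \<bar>?u n y\<bar> + \<bar>?v n y\<bar>)"
          by (rule sq_norm_on_mono[OF low])
        also have "\<dots> \<le> sq_norm_on U (\<lambda>y. \<bar>?u n y\<bar> + \<bar>?v n y\<bar>)" by (rule sq_norm_on_subset[OF r(2)])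
        also have "\<dots> \<le> 2 * sq_norm_on U (\<lambda>y. \<bar>?u n y\<bar>) + 2 * sq_norm_on U (\<lambda>y. \<bar>?v n y\<bar>)"
          by (rule sq_norm_on_add_le[OF um vm Ub])
        also have "\<dots> = 2 * sq_norm_on U (?u n) + 2 * sq_norm_on U (?v n)"
          by (simp add: sq_norm_on_def)
        finally show "sq_norm_on (ball x r) (\<lambda>y. d / 2)
          \<le> 2 * sq_norm_on U (?u n) + 2 * sq_norm_on U (?v n)" .
      qed
      then have "(\<lambda>n::nat. d / 2) \<longlonglongrightarrow> 0" by (rule const_tendsto_0_from_sq_norm[OF r(1)])
      then show False using d(1) by (simp add: LIMSEQ_const_iff)
    qed
    have \<psi>cont: "continuous_on S \<psi>" for S using \<psi>L by (rule lipschitz_on_continuous_on)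
    have MN: "\<psi> ` M \<subseteq> N" unfolding assms(2)
      by (rule image_closure_subset[OF \<psi>cont compact_imp_closed[OF Nc]]) (use UN in blast)
    have \<psi>Mc: "compact (\<psi> ` M)" by (rule compact_continuous_image[OF \<psi>cont Mc])
    \<comment> \<open>The image has the area of \<open>N\<close>, so what it misses is null. The
      missed part of \<open>V\<close> is open because the image is closed, and an open null set is
      empty; closedness then extends the inclusion from \<open>V\<close> to its closure.\<close>
    have NM: "N \<subseteq> \<psi> ` M"
    proof -
      have "area (\<psi> ` M) = area N" unfolding \<psi>_def area by (rule area_affine_image[OF Ml])
      moreover have \<psi>Ms: "\<psi> ` M \<in> sets lebesgue"
        by (rule fmeasurableD[OF lmeasurable_compact[OF \<psi>Mc]])
      ultimately have "measure lebesgue (N - \<psi> ` M) = 0" using measurable_measure_Diff[OF Nl _ MN]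
        by simp
      moreover have "N - \<psi> ` M \<in> lmeasurable" using Nl \<psi>Ms by (rule fmeasurable_Diff)
      ultimately have "negligible (N - \<psi> ` M)" by (simp add: negligible_iff_measure)
      then have "negligible (V - \<psi> ` M)" by (rule negligible_subset) (use VN in blast)
      moreover have "open (V - \<psi> ` M)" using V(1) compact_imp_closed[OF \<psi>Mc] by (rule open_Diff)
      ultimately have "V - \<psi> ` M = {}" using open_not_negligible by blast
      then show ?thesis unfolding assms(4) using compact_imp_closed[OF \<psi>Mc]
        by (intro closure_minimal) auto
    qed
    have onto: "\<psi> ` M = N" using MN NM by blast
    \<comment> \<open>Uniqueness of derivatives within a Lipschitz domain makes this hold at
      frontier points of the domain as well.\<close>
    have dif: "differential M \<psi> x = A" if "x \<in> M" for x
      using affine_differential[OF assms(1)] that unfolding assms(2) \<psi>_def by blast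
    have jac: "\<forall>x\<in>M. jacobian_det M \<psi> x = area N / area M" using dif
      by (simp add: jacobian_det_def det_A r)
    have hom: "homothety_on M \<psi>"
      unfolding homothety_on_def
    proof (intro exI[of _ c] conjI ballI allI)
      fix x v w assume x: "x \<in> M"
      show "\<psi> differentiable at x within M" unfolding \<psi>_def
        using affine_has_derivative differentiable_def by blast
      show "(differential M \<psi> x *v v) \<bullet> (differential M \<psi> x *v w) = c\<^sup>2 * (v \<bullet> w)" using dif[OF x]
        by (simp add: inner_A)
    qed (use c in simp)
    have lip: "\<psi> \<in> Lip_plus_inj M N"
    proof -
      have "AE x in lebesgue_on M. 0 \<le> jacobian_det M \<psi> x" using jac
        by (intro AE_I2) (simp add: r[symmetric])
      moreover have "AE y in lebesgue_on N. \<exists>\<^sub>\<le>\<^sub>1x. x \<in> M \<and> \<psi> x = y"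
        using \<psi>inj[of M] by (intro AE_I2) (auto intro!: Uniq_I dest: inj_onD)
      ultimately show ?thesis using MN \<psi>L by (auto simp: Lip_plus_inj_def)
    qed
    have int: "\<psi> ` interior M \<subseteq> interior N"
    proof (rule interior_maximal)
      show "\<psi> ` interior M \<subseteq> N" using MN interior_subset[of M] by blast
      show "open (\<psi> ` interior M)" unfolding \<psi>_def by (rule open_affine_image) simp
    qed
    have smooth: "smooth_on S \<psi>" for S unfolding \<psi>_def
      by (intro Ck_on_open_imp_smooth_on_UNIV Ck_on_open_affine)
    have diffeo: "diffeomorphism_betw \<psi> M N" unfolding \<psi>_def
      by (rule affine_diffeomorphism) (use onto in \<open>simp add: \<psi>_def\<close>)
    define W where "W = interior M"
    have W: "open W" "bounded W" "W \<subseteq> M"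
      using bounded_subset[OF compact_imp_bounded[OF Mc]] interior_subset by (auto simp: W_def)
    have UW: "U \<subseteq> W" unfolding W_def using UM U(1) by (rule interior_maximal)
    have Wb: "W \<in> sets borel" using W by simp
    have negW: "negligible (W - U)" using neg by (rule negligible_subset) (use W(3) in blast)
    note WU = sq_norm_on_cong_negligible[OF UW negW]
    have conv: "converges_strongly_W12 M N (\<lambda>n. \<phi> (s n)) \<psi>"
      unfolding converges_strongly_W12_def W_def[symmetric]
    proof (intro conjI allI)
      show "\<phi> (s n) \<in> W12_maps M N" for n
      proof -
        have "\<phi> (s n) \<in> W12 W"
          by (rule lipschitz_L2_weak_derivative(3)[OF W(1,2) uv(1)[of "s n"] uv(2)[of
            "s n"] gh(1)[of "s n"] gh(2)[of "s n"]]) (use comp W(3) in blast)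
        then show ?thesis using \<phi>N by (auto simp: W12_maps_def W_def intro!: AE_I2)
      qed
      have "\<psi> \<in> W12 W"
        by (rule lipschitz_L2_weak_derivative(3)[OF W(1,2) affine_lipschitz_UNIV
          affine_lipschitz_UNIV affine_has_gradient_AE affine_has_gradient_AE])
          (simp add: \<psi>c)
      then show "\<psi> \<in> W12_maps M N" using MN by (auto simp: W12_maps_def W_def intro!: AE_I2)
      have n: "W12_norm W (\<lambda>x. \<phi> (s n) x - \<psi> x) =
          sqrt ((LINT x|lborel. indicator W x * ((u (s n) x - (p \<bullet> x + b1))\<^sup>2 + (v (s n) x -
            (q \<bullet> x + b2))\<^sup>2))
            + (LINT x|lborel. indicator W x * ((norm (g (s n) x - p))\<^sup>2 + (norm (h
              (s n) x - q))\<^sup>2)))" for n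
        by (rule lipschitz_L2_weak_derivative(4)[OF W(1,2) lipschitz_on_diff[OF uv(1)
          affine_lipschitz_UNIV]
              lipschitz_on_diff[OF uv(2) affine_lipschitz_UNIV]
              has_gradient_AE_diff[OF gh(1) affine_has_gradient_AE] has_gradient_AE_diff[OF gh(2)
                affine_has_gradient_AE]])
          (use comp W(3) \<psi>c in auto)
      have gl: "loc_bdd_borel (\<lambda>x. g n x - p)" "loc_bdd_borel (\<lambda>x. h n x - q)" for n
        using gh has_gradient_AE_loc_bdd loc_bdd_borel_diff loc_bdd_borel_const by blast+
      have 1: "(\<lambda>n. LINT x|lborel. indicator W x * ((u (s n) x - (p \<bullet> x + b1))\<^sup>2 + (v (s n) x
        - (q \<bullet> x + b2))\<^sup>2)) \<longlonglongrightarrow> 0"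
        using integral_sum_sq_tendsto_0[of "\<lambda>n x. u (s n) x - (p \<bullet> x + b1)" "\<lambda>n x. v (s n) x
          - (q \<bullet> x + b2)", OF ul vl Wb W(2)] lu lv
        by (simp add: WU)
      have 2: "(\<lambda>n. LINT x|lborel. indicator W x * ((norm (g (s n) x - p))\<^sup>2 + (norm (h (s n) x
        - q))\<^sup>2)) \<longlonglongrightarrow> 0"
        using integral_sum_sq_tendsto_0[of "\<lambda>n x. g (s n) x - p" "\<lambda>n x. h (s n) x
          - q", OF gl Wb W(2)] lg lh
        by (simp add: WU)
      show "(\<lambda>n. W12_norm W (\<lambda>x. \<phi> (s n) x - \<psi> x)) \<longlonglongrightarrow> 0"
        unfolding n using tendsto_real_sqrt[OF tendsto_add[OF 1 2]] by simp
    qed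
    show ?thesis
      using s conv smooth onto hom lip jac \<psi>inj int diffeo by (intro exI[of _ s] exI[of _ \<psi>]) auto
  qed
qed

end
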